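(* Let $A\in\mathbb{R}^{n\times n}$ and $C=\mathrm{col}(C_1,\dots,C_N)$ with $C_i\in\mathbb{R}^{m_i\times n}$. Assume that $(C,A)$ is observable and that $\mathcal{G}$ is a strongly connected directed graph on the node set $\{1,\dots,N\}$ with adjacency matrix $[a_{ij}]$ and Laplacian $\mathcal{L}$. Let $\alpha\ge 0$. Then there exists a distributed observer of the form $$\dot z_i=N_iz_i+L_iy_i+\gamma r_iM_i\sum_{j=1}^N a_{ij}(\hat x_j-\hat x_i),\qquad \hat x_i=P_iz_i+Q_iy_i,\qquad i=1,\dots,N,$$ with $z_i(t)\in\mathbb{R}^{n-p_i}$, for the plant $\dot x=Ax$, $y_i=C_ix$, that achieves omniscience asymptotically while all solutions of the error system converge to zero with convergence rate at least $\alpha$. This distributed observer has state space dimension equal to $Nn-\sum_{i=1}^N p_i$ with $p_i=\mathrm{rank}\,C_i$. Such an observer is obtained as follows: 1. For each $i$, make a full rank factorization $C_i=D_iF_i$, where $D_i\in\mathbb{R}^{m_i\times p_i}$ and $F_i\in\mathbb{R}^{p_i\times n}$ have full column rank and full row rank, respectively. 2. For each $i$, choose an orthogonal matrix $T_i$ such that $$T_i^TAT_i=\begin{bmatrix} A_{i11} & A_{i12} & 0 \\ A_{i21} & A_{i22} & 0 \\ A_{i31} & A_{i32} & A_{iu} \end{bmatrix},\qquad F_iT_i=\begin{bmatrix} E_i & 0 & 0 \end{bmatrix},$$ with diagonal blocks of sizes $p_i$, $v_i-p_i$, $n-v_i$, with the pair $\left(\begin{bmatrix} E_i & 0 \end{bmatrix},\begin{bmatrix}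 A_{i11} & A_{i12} \\ A_{i21} & A_{i22} \end{bmatrix}\right)$ observable and $E_i\in\mathbb{R}^{p_i\times p_i}$ nonsingular. Then $(E_iA_{i12},A_{i22})$ is also observable. 3. Compute the positive row vector $r=[r_1,\dots,r_N]$ such that $r\mathcal{L}=0$ and $r\mathbf{1}_N=N$. 4. Put $g_i=1$ for all $i$ and take $\epsilon>0$ such that $$T^T\big((R\mathcal{L}+\mathcal{L}^TR)\otimes I_n\big)T+G>\epsilon I_{nN},$$ where $R=\mathrm{diag}\{r_1,\dots,r_N\}$, $T=\mathrm{diag}\{T_1,\dots,T_N\}$, $G=\mathrm{diag}\{G_1,\dots,G_N\}$, $G_i=\begin{bmatrix} g_iI_{v_i} & 0 \\ 0 & 0_{n-v_i} \end{bmatrix}$. 5. Take $\gamma>0$ sufficiently large so that for all $i$ $$A_{iu}^T+A_{iu}-(\gamma\epsilon-2\alpha)I_{n-v_i}+\frac{1}{\gamma\epsilon-2\alpha}A_{i32}A_{i32}^T<0.$$ 6. For each $i$, choose $H_i\in\mathbb{R}^{(v_i-p_i)\times p_i}$ such that all eigenvalues of $A_{i22}-H_iE_iA_{i12}$ lie in the region $\{s\in\mathbb{C}\mid\mathrm{Re}(s)<-\alpha\}$. 7. For all $i$, solve the Lyapunov equation $$(A_{i22}-H_iE_iA_{i12}+\alpha I_{v_i-p_i})^T\mathcal{P}_{ie}+\mathcal{P}_{ie}(A_{i22}-H_iE_iA_{i12}+\alpha I_{v_i-p_i})+(\gamma-2\alpha)I_{v_i-p_i}=0$$ to obtain $\mathcal{P}_{ie}>0$.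 8. Define $$K_i:=\begin{bmatrix} E_i^{-1} \\ H_i \\ 0 \end{bmatrix} D_i^\dagger,\quad S_i:=\begin{bmatrix} 0 \\ I_{n-p_i} \end{bmatrix},\quad T_{is}:=T_iS_i,$$ $$L_i:=\begin{bmatrix} A_{i21}-H_iE_iA_{i11} \\ A_{i31} \end{bmatrix} E_i^{-1}D_i^\dagger+N_iS_i^TK_i,$$ $$M_i:=\begin{bmatrix} \mathcal{P}_{ie}^{-1} & 0 \\ 0 & I_{n-v_i} \end{bmatrix} T_{is}^T,\quad N_i:=\begin{bmatrix} A_{i22}-H_iE_iA_{i12} & 0 \\ A_{i32} & A_{iu} \end{bmatrix},$$ $$P_i:=T_{is},\quad Q_i:=T_iK_i.$$
   Context: Graph conventions: $\mathcal{G}$ is a weighted directed graph with node set $\{1,\dots,N\}$ and adjacency matrix $\mathcal{A}=[a_{ij}]\in\mathbb{R}^{N\times N}$, where $a_{ji}\neq 0$ if and only if $(i,j)$ is an edge (information flows from $i$ to $j$), and $a_{ji}=0$ otherwise. $\mathcal{G}$ is strongly connected if for every pair of distinct nodes $i,j$ there is a directed path from $i$ to $j$. The Laplacian is $\mathcal{L}=\mathcal{D}-\mathcal{A}$, with $\mathcal{D}$ diagonal with entries $d_i=\sum_j a_{ij}$. $\mathbf{1}_N$ is the all-ones column vector in $\mathbb{R}^N$. The numbers $r_i$ in the observer are the entries of the unique positive row vector $r$ with $r\mathcal{L}=0$ and $r\mathbf{1}_N=N$. Notation: $\mathrm{col}(\cdot)$ is vertical stacking, $\mathrm{diag}\{\cdot\}$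 is the (block) diagonal matrix, $\otimes$ is the Kronecker product, $D^\dagger=(D^TD)^{-1}D^T$ for $D$ of full column rank, and $>0$, $<0$ for symmetric matrices mean positive/negative definite ($X>Y$ means $X-Y>0$). $(C,A)$ is observable if $\bigcap_{k=0}^{n-1}\ker CA^k=0$. The integer $n-v_i$ is the dimension of the unobservable subspace $\bigcap_{k=0}^{n-1}\ker F_iA^k$ of $(F_i,A)$. Blocks of size zero are void. Observer: $\hat x_i\in\mathbb{R}^n$ is the estimate of the plant state at node $i$, $\gamma\in\mathbb{R}$ is a coupling gain, and $N_i\in\mathbb{R}^{(n-p_i)\times(n-p_i)}$, $L_i\in\mathbb{R}^{(n-p_i)\times m_i}$, $M_i\in\mathbb{R}^{(n-p_i)\times n}$, $P_i\in\mathbb{R}^{n\times(n-p_i)}$, $Q_i\in\mathbb{R}^{n\times m_i}$ are gain matrices. The distributed observer achieves omniscience asymptotically if for every choice of initial states of plant and observer one has $\lim_{t\to\infty}(\hat x_i(t)-x(t))=0$ for all $i$. Error system: with $e_i=\hat x_i-x$ and $e=\mathrm{col}(e_1,\dots,e_N)$, the error system for gains of the form in step 8 is $$\dot e=\big(T_s\bar N T_s^T-\gamma T_s\bar M(R\mathcal{L}\otimes I_n)\big)e,$$ where $T_s=\mathrm{diag}\{T_{1s},\dots,T_{Ns}\}$, $\bar N=\mathrm{diag}\{N_1,\dots,N_N\}$, $\bar M=\mathrm{diag}\{M_1,\dots,M_N\}$. Solutions converge to zero with convergence rate at least $\alpha$ if there is a constant $c>0$ such that $\|e(t)\|\le c\,e^{-\alpha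 t}\|e(0)\|$ for all $t\ge 0$.
   Formalization: Edge weights are taken nonnegative (else a positive r with rL=0 may not exist); error-system solutions start in the range of T_s (other components stay constant, so cannot decay); "γ sufficiently large" explicitly includes γε>2α. *)

theory Defs
  imports
    "Jordan_Normal_Form.DL_Rank"
    "Jordan_Normal_Form.Char_Poly"
    "Jordan_Normal_Form.Gauss_Jordan_Elimination"
begin

(* Nodes are numbered 0, ..., N-1. Matrix dimensions vary with the node, so matrices are
   those of Jordan_Normal_Form; blocks of size zero are matrices with no rows or columns. *)

section \<open>Matrices\<close>

definition append_cols :: "'a :: zero mat \<Rightarrow> 'a mat \<Rightarrow> 'a mat" (infixr \<open>@\<^sub>c\<close> 65) where
  "X @\<^sub>c Y = four_block_mat X Y (0\<^sub>m 0 (dim_col X)) (0\<^sub>m 0 (dim_col Y))"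

definition col_blocks :: "nat \<Rightarrow> nat \<Rightarrow> (nat \<Rightarrow> 'a :: zero mat) \<Rightarrow> 'a mat" where
  "col_blocks n N C = foldr (@\<^sub>r) (map C [0..<N]) (0\<^sub>m 0 n)"

definition stack_vec :: "nat \<Rightarrow> nat \<Rightarrow> (nat \<Rightarrow> 'a vec) \<Rightarrow> 'a vec" where
  "stack_vec n N w = vec (N * n) (\<lambda>k. w (k div n) $ (k mod n))"

definition block_diag :: "nat \<Rightarrow> (nat \<Rightarrow> 'a :: zero mat) \<Rightarrow> 'a mat" where
  "block_diag N X = diag_block_mat (map X [0..<N])"

definition kron :: "'a :: semiring_0 mat \<Rightarrow> 'a mat \<Rightarrow> 'a mat" where
  "kron X Y = mat (dim_row X * dim_row Y) (dim_col X * dim_col Y)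
     (\<lambda>(i, j). X $$ (i div dim_row Y, j div dim_col Y) * Y $$ (i mod dim_row Y, j mod dim_col Y))"

(* only meaningful for invertible arguments *)
definition minv :: "'a :: field mat \<Rightarrow> 'a mat" where
  "minv X = the (mat_inverse X)"

definition pinv :: "'a :: field mat \<Rightarrow> 'a mat" where
  "pinv D = minv (D\<^sup>T * D) * D\<^sup>T"

definition pos_def :: "real mat \<Rightarrow> bool" where
  "pos_def X \<longleftrightarrow> square_mat X \<and> X\<^sup>T = X \<and>
     (\<forall>w \<in> carrier_vec (dim_row X). w \<noteq> 0\<^sub>v (dim_row X) \<longrightarrow> 0 < w \<bullet> (X *\<^sub>v w))"

definition neg_def :: "real mat \<Rightarrow> bool" where
  "neg_def X \<longleftrightarrow> pos_def (- X)"

(* Jordan_Normal_Form's orthogonal_mat only asks for a diagonal Gram matrix. *)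
definition orth_mat :: "nat \<Rightarrow> real mat \<Rightarrow> bool" where
  "orth_mat n T \<longleftrightarrow> T \<in> carrier_mat n n \<and> T\<^sup>T * T = 1\<^sub>m n \<and> T * T\<^sup>T = 1\<^sub>m n"

definition vnorm :: "real vec \<Rightarrow> real" where
  "vnorm w = sqrt (w \<bullet> w)"

section \<open>Observability\<close>

definition unobs_space :: "real mat \<Rightarrow> real mat \<Rightarrow> real vec set" where
  "unobs_space C A = {w \<in> carrier_vec (dim_row A).
     \<forall>k < dim_row A. (C * A ^\<^sub>m k) *\<^sub>v w = 0\<^sub>v (dim_row C)}"

definition observable :: "real mat \<Rightarrow> real mat \<Rightarrow> bool" where
  "observable C A \<longleftrightarrow> unobs_space C A = {0\<^sub>v (dim_row A)}"

definition subspace_dim :: "nat \<Rightarrow> real vec set \<Rightarrow> nat" where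
  "subspace_dim n U = vectorspace.dim class_ring ((module_vec TYPE(real) n) \<lparr>carrier := U\<rparr>)"

section \<open>Graph\<close>

(* Edge weights are nonnegative; a $$ (j, i) is the weight of the edge from i to j. *)
definition weighted_digraph :: "nat \<Rightarrow> real mat \<Rightarrow> bool" where
  "weighted_digraph N a \<longleftrightarrow> a \<in> carrier_mat N N \<and> (\<forall>i < N. \<forall>j < N. 0 \<le> a $$ (i, j))"

definition edges :: "nat \<Rightarrow> real mat \<Rightarrow> (nat \<times> nat) set" where
  "edges N a = {(i, j). i < N \<and> j < N \<and> a $$ (j, i) \<noteq> 0}"

definition strongly_connected :: "nat \<Rightarrow> real mat \<Rightarrow> bool" where
  "strongly_connected N a \<longleftrightarrow> (\<forall>i < N. \<forall>j < N. i \<noteq> j \<longrightarrow> (i, j) \<in> (edges N a)\<^sup>+)"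

definition laplacian :: "nat \<Rightarrow> real mat \<Rightarrow> real mat" where
  "laplacian N a = mat_diag N (\<lambda>i. \<Sum>j < N. a $$ (i, j)) - a"

definition laplacian_weights :: "nat \<Rightarrow> real mat \<Rightarrow> real vec \<Rightarrow> bool" where
  "laplacian_weights N a r \<longleftrightarrow> r \<in> carrier_vec N \<and> (\<forall>i < N. 0 < r $ i) \<and>
     mat_of_row r * laplacian N a = 0\<^sub>m 1 N \<and> (\<Sum>i < N. r $ i) = real N"

definition weight_mat :: "nat \<Rightarrow> real vec \<Rightarrow> real mat" where
  "weight_mat N r = mat_diag N (\<lambda>i. r $ i)"

section \<open>Plant, observer and estimation error\<close>

record gains =
  gN :: "real mat"
  gL :: "real mat"
  gM :: "real mat"
  gP :: "real mat"
  gQ :: "real mat"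

definition observer_form ::
  "nat \<Rightarrow> nat \<Rightarrow> (nat \<Rightarrow> nat) \<Rightarrow> (nat \<Rightarrow> nat) \<Rightarrow> (nat \<Rightarrow> gains) \<Rightarrow> bool" where
  "observer_form n N m p obs \<longleftrightarrow> (\<forall>i < N.
     gN (obs i) \<in> carrier_mat (n - p i) (n - p i) \<and>
     gL (obs i) \<in> carrier_mat (n - p i) (m i) \<and>
     gM (obs i) \<in> carrier_mat (n - p i) n \<and>
     gP (obs i) \<in> carrier_mat n (n - p i) \<and>
     gQ (obs i) \<in> carrier_mat n (m i))"

definition state_dim :: "nat \<Rightarrow> (nat \<Rightarrow> gains) \<Rightarrow> nat" where
  "state_dim N obs = (\<Sum>i < N. dim_row (gN (obs i)))"

definition has_vec_deriv :: "nat \<Rightarrow> (real \<Rightarrow> real vec) \<Rightarrow> (real \<Rightarrow> real vec) \<Rightarrow> bool" where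
  "has_vec_deriv d f f' \<longleftrightarrow> (\<forall>t \<ge> 0. f t \<in> carrier_vec d \<and> f' t \<in> carrier_vec d \<and>
     (\<forall>j < d. ((\<lambda>s. f s $ j) has_real_derivative f' t $ j) (at t within {0..})))"

definition estimate ::
  "(nat \<Rightarrow> real mat) \<Rightarrow> (nat \<Rightarrow> gains) \<Rightarrow> (real \<Rightarrow> real vec) \<Rightarrow> (nat \<Rightarrow> real \<Rightarrow> real vec)
     \<Rightarrow> nat \<Rightarrow> real \<Rightarrow> real vec" where
  "estimate C obs x z i t = gP (obs i) *\<^sub>v z i t + gQ (obs i) *\<^sub>v (C i *\<^sub>v x t)"

definition plant_observer ::
  "nat \<Rightarrow> nat \<Rightarrow> real mat \<Rightarrow> (nat \<Rightarrow> real mat) \<Rightarrow> real mat \<Rightarrow> real vec \<Rightarrow> real \<Rightarrow> (nat \<Rightarrow> gains)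
     \<Rightarrow> (real \<Rightarrow> real vec) \<Rightarrow> (nat \<Rightarrow> real \<Rightarrow> real vec) \<Rightarrow> bool" where
  "plant_observer n N A C a r \<gamma> obs x z \<longleftrightarrow>
     has_vec_deriv n x (\<lambda>t. A *\<^sub>v x t) \<and>
     (\<forall>i < N. has_vec_deriv (dim_row (gN (obs i))) (z i)
        (\<lambda>t. gN (obs i) *\<^sub>v z i t + gL (obs i) *\<^sub>v (C i *\<^sub>v x t)
           + (\<gamma> * r $ i) \<cdot>\<^sub>v (gM (obs i) *\<^sub>v
               vec n (\<lambda>k. \<Sum>j < N. a $$ (i, j) *
                 (estimate C obs x z j t $ k - estimate C obs x z i t $ k)))))"

definition est_error ::
  "nat \<Rightarrow> nat \<Rightarrow> (nat \<Rightarrow> real mat) \<Rightarrow> (nat \<Rightarrow> gains) \<Rightarrow> (real \<Rightarrow> real vec)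
     \<Rightarrow> (nat \<Rightarrow> real \<Rightarrow> real vec) \<Rightarrow> real \<Rightarrow> real vec" where
  "est_error n N C obs x z t = stack_vec n N (\<lambda>i. estimate C obs x z i t - x t)"

definition omniscient ::
  "nat \<Rightarrow> nat \<Rightarrow> real mat \<Rightarrow> (nat \<Rightarrow> real mat) \<Rightarrow> real mat \<Rightarrow> real vec \<Rightarrow> real \<Rightarrow> (nat \<Rightarrow> gains)
     \<Rightarrow> bool" where
  "omniscient n N A C a r \<gamma> obs \<longleftrightarrow> (\<forall>x z. plant_observer n N A C a r \<gamma> obs x z \<longrightarrow>
     (\<forall>i < N. ((\<lambda>t. vnorm (estimate C obs x z i t - x t)) \<longlongrightarrow> 0) at_top))"

definition converge_with_rate :: "real \<Rightarrow> (real \<Rightarrow> real vec) set \<Rightarrow> bool" where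
  "converge_with_rate \<alpha> E \<longleftrightarrow>
     (\<exists>c > 0. \<forall>e \<in> E. \<forall>t \<ge> 0. vnorm (e t) \<le> c * exp (- \<alpha> * t) * vnorm (e 0))"

definition observer_errors ::
  "nat \<Rightarrow> nat \<Rightarrow> real mat \<Rightarrow> (nat \<Rightarrow> real mat) \<Rightarrow> real mat \<Rightarrow> real vec \<Rightarrow> real \<Rightarrow> (nat \<Rightarrow> gains)
     \<Rightarrow> (real \<Rightarrow> real vec) set" where
  "observer_errors n N A C a r \<gamma> obs =
     {est_error n N C obs x z | x z. plant_observer n N A C a r \<gamma> obs x z}"

definition error_mat ::
  "nat \<Rightarrow> nat \<Rightarrow> real mat \<Rightarrow> real vec \<Rightarrow> real \<Rightarrow> (nat \<Rightarrow> real mat) \<Rightarrow> (nat \<Rightarrow> gains) \<Rightarrow> real mat"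
  where
  "error_mat n N a r \<gamma> Ts obs =
     block_diag N Ts * block_diag N (\<lambda>i. gN (obs i)) * (block_diag N Ts)\<^sup>T
     - \<gamma> \<cdot>\<^sub>m (block_diag N Ts * block_diag N (\<lambda>i. gM (obs i))
         * kron (weight_mat N r * laplacian N a) (1\<^sub>m n))"

(* The estimation errors of the observer lie in the range of T_s. Off that range the matrix
   differential equation has non-decaying solutions, which no run of the observer produces:
   its right-hand side takes values in the range of T_s, so the component of the
   solution orthogonal to that range stays constant. *)
definition error_system_solutions ::
  "nat \<Rightarrow> nat \<Rightarrow> real mat \<Rightarrow> real vec \<Rightarrow> real \<Rightarrow> (nat \<Rightarrow> real mat) \<Rightarrow> (nat \<Rightarrow> gains)
     \<Rightarrow> (real \<Rightarrow> real vec) set" where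
  "error_system_solutions n N a r \<gamma> Ts obs =
     {e. has_vec_deriv (N * n) e (\<lambda>t. error_mat n N a r \<gamma> Ts obs *\<^sub>v e t) \<and>
         e 0 \<in> (\<lambda>w. block_diag N Ts *\<^sub>v w) ` carrier_vec (dim_col (block_diag N Ts))}"

section \<open>Design procedure\<close>

definition full_rank_factorization ::
  "nat \<Rightarrow> nat \<Rightarrow> nat \<Rightarrow> real mat \<Rightarrow> real mat \<Rightarrow> real mat \<Rightarrow> bool" where
  "full_rank_factorization m n p C D F \<longleftrightarrow>
     D \<in> carrier_mat m p \<and> F \<in> carrier_mat p n \<and> C = D * F \<and>
     vec_space.rank m D = p \<and> vec_space.rank p F = p"

record obs_form =
  oT :: "real mat"
  oE :: "real mat"
  o11 :: "real mat"
  o12 :: "real mat"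
  o21 :: "real mat"
  o22 :: "real mat"
  o31 :: "real mat"
  o32 :: "real mat"
  ou :: "real mat"

definition obs_decomposition ::
  "nat \<Rightarrow> nat \<Rightarrow> nat \<Rightarrow> real mat \<Rightarrow> real mat \<Rightarrow> obs_form \<Rightarrow> bool" where
  "obs_decomposition n p v A F d \<longleftrightarrow>
     orth_mat n (oT d) \<and> oE d \<in> carrier_mat p p \<and>
     o11 d \<in> carrier_mat p p \<and> o12 d \<in> carrier_mat p (v - p) \<and>
     o21 d \<in> carrier_mat (v - p) p \<and> o22 d \<in> carrier_mat (v - p) (v - p) \<and>
     o31 d \<in> carrier_mat (n - v) p \<and> o32 d \<in> carrier_mat (n - v) (v - p) \<and>
     ou d \<in> carrier_mat (n - v) (n - v) \<and>
     (oT d)\<^sup>T * A * oT d =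
       four_block_mat (four_block_mat (o11 d) (o12 d) (o21 d) (o22 d)) (0\<^sub>m v (n - v))
         (o31 d @\<^sub>c o32 d) (ou d) \<and>
     F * oT d = oE d @\<^sub>c 0\<^sub>m p (v - p) @\<^sub>c 0\<^sub>m p (n - v) \<and>
     observable (oE d @\<^sub>c 0\<^sub>m p (v - p)) (four_block_mat (o11 d) (o12 d) (o21 d) (o22 d)) \<and>
     invertible_mat (oE d)"

definition G_block :: "nat \<Rightarrow> nat \<Rightarrow> real \<Rightarrow> real mat" where
  "G_block n v g = four_block_mat (g \<cdot>\<^sub>m 1\<^sub>m v) (0\<^sub>m v (n - v)) (0\<^sub>m (n - v) v) (0\<^sub>m (n - v) (n - v))"

definition admissible_eps ::
  "nat \<Rightarrow> nat \<Rightarrow> (nat \<Rightarrow> nat) \<Rightarrow> real mat \<Rightarrow> real vec \<Rightarrow> (nat \<Rightarrow> real) \<Rightarrow> (nat \<Rightarrow> obs_form) \<Rightarrow> real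
     \<Rightarrow> bool" where
  "admissible_eps n N v a r g d \<epsilon> \<longleftrightarrow> 0 < \<epsilon> \<and>
     (let T = block_diag N (\<lambda>i. oT (d i)); R = weight_mat N r; L = laplacian N a;
          G = block_diag N (\<lambda>i. G_block n (v i) (g i))
      in pos_def (T\<^sup>T * kron (R * L + L\<^sup>T * R) (1\<^sub>m n) * T + G - \<epsilon> \<cdot>\<^sub>m 1\<^sub>m (n * N)))"

(* The condition 2 * \<alpha> < \<gamma> * \<epsilon> is part of "\<gamma> sufficiently large"; it does not follow from the
   matrix inequalities, e.g. when all of them have size zero. *)
definition admissible_gamma ::
  "nat \<Rightarrow> nat \<Rightarrow> (nat \<Rightarrow> nat) \<Rightarrow> real \<Rightarrow> real \<Rightarrow> (nat \<Rightarrow> obs_form) \<Rightarrow> real \<Rightarrow> bool" where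
  "admissible_gamma n N v \<alpha> \<epsilon> d \<gamma> \<longleftrightarrow> 0 < \<gamma> \<and> 2 * \<alpha> < \<gamma> * \<epsilon> \<and>
     (\<forall>i < N. neg_def ((ou (d i))\<^sup>T + ou (d i) - (\<gamma> * \<epsilon> - 2 * \<alpha>) \<cdot>\<^sub>m 1\<^sub>m (n - v i)
        + (1 / (\<gamma> * \<epsilon> - 2 * \<alpha>)) \<cdot>\<^sub>m (o32 (d i) * (o32 (d i))\<^sup>T)))"

definition closed_loop :: "obs_form \<Rightarrow> real mat \<Rightarrow> real mat" where
  "closed_loop d H = o22 d - H * oE d * o12 d"

definition admissible_H :: "nat \<Rightarrow> nat \<Rightarrow> real \<Rightarrow> obs_form \<Rightarrow> real mat \<Rightarrow> bool" where
  "admissible_H p v \<alpha> d H \<longleftrightarrow> H \<in> carrier_mat (v - p) p \<and>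
     (\<forall>s. eigenvalue (map_mat complex_of_real (closed_loop d H)) s \<longrightarrow> Re s < - \<alpha>)"

definition lyapunov_solution ::
  "nat \<Rightarrow> nat \<Rightarrow> real \<Rightarrow> real \<Rightarrow> obs_form \<Rightarrow> real mat \<Rightarrow> real mat \<Rightarrow> bool" where
  "lyapunov_solution p v \<alpha> \<gamma> d H X \<longleftrightarrow> X \<in> carrier_mat (v - p) (v - p) \<and>
     (closed_loop d H + \<alpha> \<cdot>\<^sub>m 1\<^sub>m (v - p))\<^sup>T * X + X * (closed_loop d H + \<alpha> \<cdot>\<^sub>m 1\<^sub>m (v - p))
       + (\<gamma> - 2 * \<alpha>) \<cdot>\<^sub>m 1\<^sub>m (v - p) = 0\<^sub>m (v - p) (v - p)"

definition S_mat :: "nat \<Rightarrow> nat \<Rightarrow> real mat" where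
  "S_mat n p = 0\<^sub>m p (n - p) @\<^sub>r 1\<^sub>m (n - p)"

definition Ts_mat :: "nat \<Rightarrow> nat \<Rightarrow> obs_form \<Rightarrow> real mat" where
  "Ts_mat n p d = oT d * S_mat n p"

definition K_mat :: "nat \<Rightarrow> nat \<Rightarrow> nat \<Rightarrow> real mat \<Rightarrow> obs_form \<Rightarrow> real mat \<Rightarrow> real mat" where
  "K_mat n p v D d H = (minv (oE d) @\<^sub>r H @\<^sub>r 0\<^sub>m (n - v) p) * pinv D"

definition N_mat :: "nat \<Rightarrow> nat \<Rightarrow> nat \<Rightarrow> obs_form \<Rightarrow> real mat \<Rightarrow> real mat" where
  "N_mat n p v d H = four_block_mat (closed_loop d H) (0\<^sub>m (v - p) (n - v)) (o32 d) (ou d)"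

definition designed_gains ::
  "nat \<Rightarrow> nat \<Rightarrow> nat \<Rightarrow> real mat \<Rightarrow> obs_form \<Rightarrow> real mat \<Rightarrow> real mat \<Rightarrow> gains" where
  "designed_gains n p v D d H X =
     \<lparr> gN = N_mat n p v d H,
       gL = ((o21 d - H * oE d * o11 d) @\<^sub>r o31 d) * minv (oE d) * pinv D
            + N_mat n p v d H * (S_mat n p)\<^sup>T * K_mat n p v D d H,
       gM = four_block_mat (minv X) (0\<^sub>m (v - p) (n - v)) (0\<^sub>m (n - v) (v - p)) (1\<^sub>m (n - v))
            * (Ts_mat n p d)\<^sup>T,
       gP = Ts_mat n p d,
       gQ = oT d * K_mat n p v D d H \<rparr>"

end

(*
  In the coordinates x -> T_i^T x, the estimation error of node i lies in the range of T_is, because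
  the first p_i coordinates of the state are read off the output. Writing e_i = T_is w_i, the error
  system becomes w_i' = N_i w_i - gamma M_i (sum over j of (R L)_ij T_js w_j), and
  V = sum over i of w_i^T diag(P_ie, I) w_i is a Lyapunov function: the factor P_ie^-1 in M_i cancels,
  so the coupling contributes the quadratic form of R L + L^T R. By the choice of epsilon this form
  exceeds epsilon |w|^2 minus the squared norm of the observable parts of the w_i, the latter is absorbed by the
  Lyapunov equation, the unobservable parts by the inequality on gamma, and the strict inequalities leave
  V' <= -2 (alpha + mu) V for some mu > 0.

  An epsilon exists because the form of R L + L^T R is the weighted sum of the |x_i - x_j|^2 over the
  edges: it vanishes on consensus vectors only, and a consensus vector that is unobservable at each node
  is 0 by joint observability. Gains H_i come from Bass' method, and Lyapunov equations are
  solved by the Cayley transform and the Stein series, whose convergence follows from the Jordan form.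
*)
theory Submission
  imports Defs "Jordan_Normal_Form.Spectral_Radius"
begin

section \<open>Orthogonal matrices and subspace dimensions\<close>

text \<open>For \<alpha> = 0 the prescribed rate alone would admit errors that never decay, so a
  positive surplus \<mu> has to be carried through the whole estimate. It comes from the room
  \<delta> that the strict inequality for \<epsilon> leaves; the inequality for \<gamma> only has to
  hold weakly along the way. Positive definiteness of the Lyapunov solutions requires 2 \<alpha> <
  \<gamma>, while the choice of \<gamma> grants 2 \<alpha> < \<gamma> \<epsilon>. The gap is closed
  by \<epsilon> < 1, which is read off from consensus vectors. Since the block sizes differ from
  node to node, identities between block matrices are tested on split vectors, and the Stein and
  Lyapunov equations are used in weak form, as identities between bilinear forms. Positivity and
  symmetry then pass through series and quadratic forms. Bass' method suits the gains because it
  rests on the same Lyapunov theory that the design uses anyway: the right-hand side is only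
  semidefinite, observability makes the solution definite, and the shift in the equation dictates
  the decay rate.\<close>

definition inj_mat :: "'a :: semiring_0 mat \<Rightarrow> bool" where
  "inj_mat X \<longleftrightarrow> (\<forall>w \<in> carrier_vec (dim_col X). X *\<^sub>v w = 0\<^sub>v (dim_row X) \<longrightarrow> w = 0\<^sub>v (dim_col X))"

lemma inj_matD:
  "\<lbrakk>inj_mat X; X \<in> carrier_mat m n; w \<in> carrier_vec n; X *\<^sub>v w = 0\<^sub>v m\<rbrakk> \<Longrightarrow> w = 0\<^sub>v n"
  unfolding inj_mat_def by auto

lemma inj_matI:
  "\<lbrakk>X \<in> carrier_mat m n; \<And>w. w \<in> carrier_vec n \<Longrightarrow> X *\<^sub>v w = 0\<^sub>v m \<Longrightarrow> w = 0\<^sub>v n\<rbrakk> \<Longrightarrow> inj_mat X"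
  unfolding inj_mat_def by auto

text \<open>Products of block matrices with node-dependent block sizes are compared through their
  action on split vectors; unit vectors recover the entries.\<close>

lemma mat_eqI_mult_vec:
  fixes X Y :: "'a :: semiring_1 mat"
  assumes X: "X \<in> carrier_mat m n" and Y: "Y \<in> carrier_mat m n"
    and eq: "\<And>w. w \<in> carrier_vec n \<Longrightarrow> X *\<^sub>v w = Y *\<^sub>v w"
  shows "X = Y"
proof (rule eq_matI)
  fix i j assume i: "i < dim_row Y" and j: "j < dim_col Y"
  have "(X *\<^sub>v unit_vec n j) $ i = (Y *\<^sub>v unit_vec n j) $ i"
    using eq[of "unit_vec n j"] by simp
  then show "X $$ (i, j) = Y $$ (i, j)"
    using i j X Y by (simp add: scalar_prod_right_unit)
qed (use X Y in auto)

lemma mult_unit_vec: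
  fixes X :: "'a :: semiring_1 mat"
  assumes "X \<in> carrier_mat m n" "j < n"
  shows "X *\<^sub>v unit_vec n j = col X j"
  using assms by (intro eq_vecI) (auto simp: scalar_prod_right_unit)

lemma adjoint_scalar_prod:
  fixes X :: "'a :: comm_semiring_0 mat"
  assumes "X \<in> carrier_mat m n" "y \<in> carrier_vec m" "w \<in> carrier_vec n"
  shows "y \<bullet> (X *\<^sub>v w) = (X\<^sup>T *\<^sub>v y) \<bullet> w"
  using transpose_vec_mult_scalar[OF assms(1,3,2)]
  by (metis assms comm_scalar_prod mult_mat_vec_carrier transpose_carrier_mat)

lemma scalar_prod_self_nonneg: "0 \<le> (w :: real vec) \<bullet> w"
  unfolding scalar_prod_def by (auto intro: sum_nonneg)

lemma scalar_prod_self_eq_0: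
  "(w :: real vec) \<in> carrier_vec n \<Longrightarrow> w \<bullet> w = 0 \<longleftrightarrow> w = 0\<^sub>v n"
  using conjugate_square_eq_0_vec[of w n] by simp

lemma scalar_prod_self_pos:
  "(w :: real vec) \<in> carrier_vec n \<Longrightarrow> w \<noteq> 0\<^sub>v n \<Longrightarrow> 0 < w \<bullet> w"
  using scalar_prod_self_eq_0[of w n] scalar_prod_self_nonneg[of w] by force

text \<open>A trivial kernel makes the determinant nonzero, so the matrix is a unit of the matrix
  ring and \<open>mat_inverse\<close> returns a value; only then does the description
  \<open>the\<close> in \<open>minv\<close> denote an inverse.\<close>

lemma minv_right_left:
  fixes X :: "'a :: field mat"
  assumes X: "X \<in> carrier_mat n n" and inj: "inj_mat X"
  shows minv_carrier: "minv X \<in> carrier_mat n n"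
    and minv_mult_left: "minv X * X = 1\<^sub>m n"
    and minv_mult_right: "X * minv X = 1\<^sub>m n"
proof -
  have "det X \<noteq> 0"
    using det_0_iff_vec_prod_zero_field[OF X] inj_matD[OF inj X] by blast
  then have "X \<in> Units (ring_mat TYPE('a) n ())"
    by (rule det_non_zero_imp_unit[OF X])
  then obtain Y where "mat_inverse X = Some Y"
    using mat_inverse(1)[OF X, of "()"] by (cases "mat_inverse X") auto
  then show "minv X \<in> carrier_mat n n" "minv X * X = 1\<^sub>m n" "X * minv X = 1\<^sub>m n"
    using mat_inverse(2)[OF X] unfolding minv_def by auto
qed

lemma inj_mat_left_inverse:
  fixes X :: "'a :: comm_ring_1 mat"
  assumes "X \<in> carrier_mat m n" "Y \<in> carrier_mat n m" "Y * X = 1\<^sub>m n"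
  shows "inj_mat X"
proof (rule inj_matI[OF assms(1)])
  fix w :: "'a vec" assume w: "w \<in> carrier_vec n" "X *\<^sub>v w = 0\<^sub>v m"
  have "w = (Y * X) *\<^sub>v w" using assms w by simp
  also have "\<dots> = Y *\<^sub>v (X *\<^sub>v w)" by (rule assoc_mult_mat_vec[OF assms(2,1) w(1)])
  also have "\<dots> = 0\<^sub>v n" using w assms(2) by (auto simp: mult_mat_vec_def)
  finally show "w = 0\<^sub>v n" .
qed

lemma mult_mat_zero_vec [simp]:
  "(X :: 'a :: semiring_0 mat) \<in> carrier_mat m n \<Longrightarrow> X *\<^sub>v 0\<^sub>v n = 0\<^sub>v m"
  by (auto simp: mult_mat_vec_def)

text \<open>The Gram matrix inherits the trivial kernel of \<open>D\<close>: if it annihilates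
  \<open>w\<close>, pairing with \<open>w\<close> gives the squared length of
  \<open>D *\<^sub>v w\<close>, which is therefore 0.\<close>

lemma pinv_mult_left:
  fixes D :: "real mat"
  assumes D: "D \<in> carrier_mat m p" and inj: "inj_mat D"
  shows pinv_carrier: "pinv D \<in> carrier_mat p m"
    and pinv_left: "pinv D * D = 1\<^sub>m p"
proof -
  have G: "D\<^sup>T * D \<in> carrier_mat p p" using D by simp
  have "inj_mat (D\<^sup>T * D)"
  proof (rule inj_matI[OF G])
    fix w :: "real vec" assume w: "w \<in> carrier_vec p" "(D\<^sup>T * D) *\<^sub>v w = 0\<^sub>v p"
    have DT: "D\<^sup>T \<in> carrier_mat p m" using D by simp
    have Dw: "D *\<^sub>v w \<in> carrier_vec m" using D w by simp
    have "(D *\<^sub>v w) \<bullet> (D *\<^sub>v w) = (D\<^sup>T *\<^sub>v (D *\<^sub>v w)) \<bullet> w"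
      by (rule adjoint_scalar_prod[OF D Dw w(1)])
    also have "D\<^sup>T *\<^sub>v (D *\<^sub>v w) = 0\<^sub>v p"
      using w assoc_mult_mat_vec[OF DT D w(1)] by simp
    finally have "D *\<^sub>v w = 0\<^sub>v m" using Dw w scalar_prod_self_eq_0 by simp
    then show "w = 0\<^sub>v p" using inj_matD[OF inj D] w by simp
  qed
  note inv = minv_right_left[OF G this]
  have DT: "D\<^sup>T \<in> carrier_mat p m" using D by simp
  show "pinv D \<in> carrier_mat p m" unfolding pinv_def using inv(1) DT by simp
  show "pinv D * D = 1\<^sub>m p"
    unfolding pinv_def using inv D by (simp add: assoc_mult_mat[OF inv(1) DT D])
qed

lemma invertible_iff_inj:
  fixes X :: "'a :: field mat"
  assumes X: "X \<in> carrier_mat n n"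
  shows "invertible_mat X \<longleftrightarrow> inj_mat X"
proof
  assume "invertible_mat X"
  then obtain Y where XY: "X * Y = 1\<^sub>m (dim_row X)" and YX: "Y * X = 1\<^sub>m (dim_row Y)"
    unfolding invertible_mat_def inverts_mat_def by auto
  \<comment> \<open>\<open>invertible_mat\<close> leaves the format of the inverse open; the two
    products fix it.\<close>
  have "dim_col Y = n" using arg_cong[OF XY, of dim_col] X by simp
  moreover have "dim_row Y = n" using arg_cong[OF YX, of dim_col] X by simp
  ultimately show "inj_mat X" using inj_mat_left_inverse[OF X, of Y] YX by auto
next
  assume "inj_mat X"
  note inv = minv_right_left[OF X this]
  then show "invertible_mat X"
    unfolding invertible_mat_def inverts_mat_def using X by auto
qed

section \<open>Orthogonal matrices and bases adapted to a subspace\<close>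

lemma orth_mat_inverse:
  assumes "orth_mat n T" "w \<in> carrier_vec n"
  shows "T *\<^sub>v (T\<^sup>T *\<^sub>v w) = w" "T\<^sup>T *\<^sub>v (T *\<^sub>v w) = w"
  using assms assoc_mult_mat_vec[of T n n "T\<^sup>T" n w] assoc_mult_mat_vec[of "T\<^sup>T" n n T n w]
  unfolding orth_mat_def by auto

lemma orth_matD: "orth_mat n T \<Longrightarrow> T \<in> carrier_mat n n" "orth_mat n T \<Longrightarrow> T\<^sup>T \<in> carrier_mat n n"
  unfolding orth_mat_def by auto

lemma orth_mat_mult:
  assumes "orth_mat n S" "orth_mat n T"
  shows "orth_mat n (S * T)"
proof -
  have c: "S \<in> carrier_mat n n" "T \<in> carrier_mat n n" "S\<^sup>T \<in> carrier_mat n n" "T\<^sup>T \<in> carrier_mat n n"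
    using assms unfolding orth_mat_def by auto
  have tr: "(S * T)\<^sup>T = T\<^sup>T * S\<^sup>T" using c transpose_mult by blast
  have PQ: "S * T \<in> carrier_mat n n" "T\<^sup>T * S\<^sup>T \<in> carrier_mat n n"
    by (rule mult_carrier_mat[OF c(1,2)], rule mult_carrier_mat[OF c(4,3)])
  have "(S * T) *\<^sub>v ((T\<^sup>T * S\<^sup>T) *\<^sub>v w) = w" "(T\<^sup>T * S\<^sup>T) *\<^sub>v ((S * T) *\<^sub>v w) = w"
    if w: "w \<in> carrier_vec n" for w
    using w c assms by (simp_all add: orth_mat_inverse[OF assms(1)] orth_mat_inverse[OF assms(2)])
  then have "(S * T) * (T\<^sup>T * S\<^sup>T) = 1\<^sub>m n" "(T\<^sup>T * S\<^sup>T) * (S * T) = 1\<^sub>m n"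
    using PQ assoc_mult_mat_vec[OF PQ(1) PQ(2)] assoc_mult_mat_vec[OF PQ(2) PQ(1)]
      mult_carrier_mat[OF PQ(1) PQ(2)] mult_carrier_mat[OF PQ(2) PQ(1)]
    by (metis mat_eqI_mult_vec one_carrier_mat one_mult_mat_vec)+
  then show ?thesis unfolding orth_mat_def tr using c by simp
qed

lemma orth_mat_one: "orth_mat n (1\<^sub>m n)"
  unfolding orth_mat_def by simp

text \<open>Householder reflection: exchanges the last unit vector and \<open>u\<close>.\<close>
lemma orth_mat_with_last_col:
  assumes u: "u \<in> carrier_vec (Suc n)" "u \<bullet> u = 1"
  shows "\<exists>Q. orth_mat (Suc n) Q \<and> Q *\<^sub>v unit_vec (Suc n) n = u"
proof (cases "u = unit_vec (Suc n) n")
  \<comment> \<open>Here the difference of the two vectors is zero and defines no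
    reflection.\<close>
  case True
  then show ?thesis using orth_mat_one[of "Suc n"] by (intro exI[of _ "1\<^sub>m (Suc n)"]) simp
next
  case False
  define e where "e = (unit_vec (Suc n) n :: real vec)"
  define w where "w = e - u"
  define s where "s = w \<bullet> w"
  have e: "e \<in> carrier_vec (Suc n)" unfolding e_def by simp
  have w: "w \<in> carrier_vec (Suc n)" unfolding w_def using e u by simp
  have ee: "e \<bullet> e = 1" unfolding e_def by simp
  have "w \<noteq> 0\<^sub>v (Suc n)"
  proof
    assume "w = 0\<^sub>v (Suc n)"
    then have "w + u = u" using u by simp
    moreover have "w + u = e" unfolding w_def using e u by auto
    ultimately show False using False e_def by simp
  qed
  then have s: "0 < s" unfolding s_def by (rule scalar_prod_self_pos[OF w])
  have we: "w \<bullet> e = 1 - u \<bullet> e" unfolding w_def using e u ee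
    by (simp add: minus_scalar_prod_distrib)
  \<comment> \<open>Both \<open>e\<close> and \<open>u\<close> have length 1, so |e - u|^2 = 2 - 2
    (u . e). This is what makes the reflection subtract exactly \<open>w\<close> from
    \<open>e\<close>.\<close>
  have "s = 2 * (w \<bullet> e)"
    unfolding s_def we using e u ee
    unfolding w_def by (simp add: minus_scalar_prod_distrib[where n = "Suc n"]
        scalar_prod_minus_distrib[where n = "Suc n"] comm_scalar_prod[OF e u(1)])
  then have we': "w \<bullet> e = s / 2" by simp
  define Q where "Q = mat (Suc n) (Suc n) (\<lambda>(i, j). (if i = j then 1 else 0) - 2 / s * w $ i * w $ j)"
  have Q: "Q \<in> carrier_mat (Suc n) (Suc n)" unfolding Q_def by simp
  have QT: "Q\<^sup>T = Q" unfolding Q_def by (rule eq_matI) auto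
  have Qv: "Q *\<^sub>v x = x - (2 / s * (w \<bullet> x)) \<cdot>\<^sub>v w" if x: "x \<in> carrier_vec (Suc n)" for x
  proof (rule eq_vecI)
    fix i assume i: "i < dim_vec (x - (2 / s * (w \<bullet> x)) \<cdot>\<^sub>v w)"
    then have i: "i < Suc n" using w by simp
    have "(Q *\<^sub>v x) $ i = (\<Sum>j = 0..<Suc n. ((if i = j then 1 else 0) - 2 / s * w $ i * w $ j) * x $ j)"
      using i x unfolding Q_def by (simp add: scalar_prod_def)
    also have "\<dots> = (\<Sum>j = 0..<Suc n. (if i = j then x $ j else 0) - 2 / s * w $ i * (w $ j * x $ j))"
      by (rule sum.cong) (auto simp: algebra_simps)
    also have "\<dots> = x $ i - 2 / s * w $ i * (w \<bullet> x)"
      using i x unfolding sum_subtractf sum_distrib_left[symmetric] scalar_prod_def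
      by (simp add: sum.delta)
    finally show "(Q *\<^sub>v x) $ i = (x - (2 / s * (w \<bullet> x)) \<cdot>\<^sub>v w) $ i"
      using i w x by simp
  qed (use Q w in simp)
  have QQ: "Q *\<^sub>v (Q *\<^sub>v x) = x" if x: "x \<in> carrier_vec (Suc n)" for x
  proof -
    have Qx: "Q *\<^sub>v x \<in> carrier_vec (Suc n)" using Q x by simp
    have "w \<bullet> (Q *\<^sub>v x) = w \<bullet> x - 2 / s * (w \<bullet> x) * s"
      unfolding Qv[OF x] s_def using w x
      by (simp add: scalar_prod_minus_distrib[where n = "Suc n"])
    also have "\<dots> = - (w \<bullet> x)" using s by simp
    finally have *: "w \<bullet> (Q *\<^sub>v x) = - (w \<bullet> x)" .
    show ?thesis unfolding Qv[OF Qx] * unfolding Qv[OF x] using w x by (auto simp: algebra_simps)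
  qed
  have "Q * Q = 1\<^sub>m (Suc n)"
    by (rule mat_eqI_mult_vec[where m = "Suc n" and n = "Suc n"])
      (use Q QQ in \<open>auto simp: assoc_mult_mat_vec[OF Q Q]\<close>)
  then have "orth_mat (Suc n) Q" unfolding orth_mat_def using Q QT by simp
  moreover have "Q *\<^sub>v e = u"
    unfolding Qv[OF e] we' using s e u unfolding w_def by auto
  ultimately show ?thesis unfolding e_def by blast
qed

lemma orth_mat_diag_block:
  assumes "orth_mat m S" "orth_mat n T"
  shows "orth_mat (m + n) (four_block_mat S (0\<^sub>m m n) (0\<^sub>m n m) T)"
proof -
  let ?B = "four_block_mat S (0\<^sub>m m n) (0\<^sub>m n m) T"
  have c: "S \<in> carrier_mat m m" "T \<in> carrier_mat n n" "S\<^sup>T \<in> carrier_mat m m" "T\<^sup>T \<in> carrier_mat n n"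
    and e: "S\<^sup>T * S = 1\<^sub>m m" "S * S\<^sup>T = 1\<^sub>m m" "T\<^sup>T * T = 1\<^sub>m n" "T * T\<^sup>T = 1\<^sub>m n"
    using assms unfolding orth_mat_def by auto
  have z: "0\<^sub>m m n \<in> carrier_mat m n" "0\<^sub>m n m \<in> carrier_mat n m" by auto
  have tr: "?B\<^sup>T = four_block_mat S\<^sup>T (0\<^sub>m m n) (0\<^sub>m n m) T\<^sup>T"
    using transpose_four_block_mat[OF c(1) z c(2)] by simp
  have "?B\<^sup>T * ?B = 1\<^sub>m (m + n)" "?B * ?B\<^sup>T = 1\<^sub>m (m + n)"
    unfolding tr mult_four_block_mat[OF c(1) z c(2) c(3) z c(4)]
      mult_four_block_mat[OF c(3) z c(4) c(1) z c(2)] using c e by simp_all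
  then show ?thesis unfolding orth_mat_def using c by simp
qed

lemma carrier_vec_split:
  assumes "w \<in> carrier_vec (m + n)"
  obtains x y where "x \<in> carrier_vec m" "y \<in> carrier_vec n" "w = x @\<^sub>v y"
  using vec_first_last_append[OF assms] vec_first_carrier vec_last_carrier by metis

lemma append_vec_assoc: "(x @\<^sub>v y) @\<^sub>v w = x @\<^sub>v (y @\<^sub>v w)"
proof (rule eq_vecI)
  fix i assume "i < dim_vec (x @\<^sub>v (y @\<^sub>v w))"
  then show "((x @\<^sub>v y) @\<^sub>v w) $ i = (x @\<^sub>v (y @\<^sub>v w)) $ i"
    by (cases "i < dim_vec x"; cases "i < dim_vec x + dim_vec y") (simp_all add: less_diff_conv2)
qed simp

lemma append_zero_vec: "0\<^sub>v m @\<^sub>v 0\<^sub>v n = 0\<^sub>v (m + n)"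
  by (rule eq_vecI) auto

lemma append_vec_eq_zero:
  assumes "x \<in> carrier_vec m" "y \<in> carrier_vec n"
  shows "x @\<^sub>v y = 0\<^sub>v (m + n) \<longleftrightarrow> x = 0\<^sub>v m \<and> y = 0\<^sub>v n"
  using assms append_vec_eq[OF assms(1), of "0\<^sub>v m" y "0\<^sub>v n"] by (simp add: append_zero_vec)

text \<open>Induction on the dimension: a unit vector of \<open>U\<close> is moved to the last
  coordinate by a reflection, and the other coordinates inherit the problem for a smaller subspace.
  The basis of \<open>U\<close> ends up in the last \<open>n - k\<close> columns because the
  observability decomposition has its unobservable block last. The equivalence also says that
  \<open>k\<close> is the codimension of \<open>U\<close>.\<close>

lemma orth_mat_adapted_to_subspace:
  assumes "U \<subseteq> carrier_vec n" "0\<^sub>v n \<in> U"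
    and "\<And>x y. x \<in> U \<Longrightarrow> y \<in> U \<Longrightarrow> x + y \<in> U" and "\<And>c x. x \<in> U \<Longrightarrow> c \<cdot>\<^sub>v x \<in> U"
  shows "\<exists>T k. orth_mat n T \<and> k \<le> n \<and>
    (\<forall>x \<in> carrier_vec k. \<forall>y \<in> carrier_vec (n - k). T *\<^sub>v (x @\<^sub>v y) \<in> U \<longleftrightarrow> x = 0\<^sub>v k)"
  using assms
proof (induction n arbitrary: U)
  case 0
  have "(x @\<^sub>v y) = 0\<^sub>v 0" if "x \<in> carrier_vec 0" "y \<in> carrier_vec 0" for x y :: "real vec"
    using that by auto
  with 0 show ?case using orth_mat_one[of 0] by (intro exI[of _ "1\<^sub>m 0"] exI[of _ 0]) auto
next
  case (Suc n)
  show ?case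
  proof (cases "U = {0\<^sub>v (Suc n)}")
    case True
    have "x @\<^sub>v y = x" if "x \<in> carrier_vec (Suc n)" "y \<in> carrier_vec 0" for x y :: "real vec"
      using that by (intro eq_vecI) auto
    with True show ?thesis using orth_mat_one[of "Suc n"]
      by (intro exI[of _ "1\<^sub>m (Suc n)"] exI[of _ "Suc n"]) auto
  next
    case False
    then obtain u0 where u0: "u0 \<in> U" "u0 \<noteq> 0\<^sub>v (Suc n)" using Suc.prems(2) by auto
    then have u0c: "u0 \<in> carrier_vec (Suc n)" using Suc.prems(1) by auto
    define u where "u = (1 / sqrt (u0 \<bullet> u0)) \<cdot>\<^sub>v u0"
    have uU: "u \<in> U" unfolding u_def using Suc.prems(4) u0 by simp
    then have u: "u \<in> carrier_vec (Suc n)" using Suc.prems(1) by auto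
    have pos: "0 < u0 \<bullet> u0" using scalar_prod_self_pos u0c u0 by blast
    have "u \<bullet> u = 1" unfolding u_def using u0c pos by simp
    from orth_mat_with_last_col[OF u this] obtain Q
      where Q: "orth_mat (Suc n) Q" and Qu: "Q *\<^sub>v unit_vec (Suc n) n = u" by blast
    note Qc = orth_matD(1)[OF Q]
    \<comment> \<open>The last coordinate axis is mapped to the line through \<open>u\<close>, which
      lies in \<open>U\<close>.\<close>
    have last: "Q *\<^sub>v (0\<^sub>v n @\<^sub>v c) \<in> U" if c: "c \<in> carrier_vec 1" for c
    proof -
      have "0\<^sub>v n @\<^sub>v c = (c $ 0) \<cdot>\<^sub>v unit_vec (Suc n) n" using c by (intro eq_vecI) auto
      then have "Q *\<^sub>v (0\<^sub>v n @\<^sub>v c) = (c $ 0) \<cdot>\<^sub>v u"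
        using Qu Qc by (simp add: mult_mat_vec[where nr = "Suc n" and nc = "Suc n"])
      then show ?thesis using Suc.prems(4) uU by simp
    qed
    \<comment> \<open>Membership in \<open>U\<close> does not depend on the last coordinate, so it
      is decided by this trace on the first \<open>n\<close> coordinates.\<close>
    define V where "V = {w \<in> carrier_vec n. Q *\<^sub>v (w @\<^sub>v 0\<^sub>v 1) \<in> U}"
    have carr: "w @\<^sub>v c \<in> carrier_vec (Suc n)" if "w \<in> carrier_vec n" "c \<in> carrier_vec 1"
      for w c :: "real vec" using append_carrier_vec[OF that] by simp
    have split: "Q *\<^sub>v (w @\<^sub>v c) = Q *\<^sub>v (w @\<^sub>v 0\<^sub>v 1) + Q *\<^sub>v (0\<^sub>v n @\<^sub>v c)"
      if "w \<in> carrier_vec n" "c \<in> carrier_vec 1" for w c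
    proof -
      have "w @\<^sub>v c = (w @\<^sub>v 0\<^sub>v 1) + (0\<^sub>v n @\<^sub>v c)" using that by (intro eq_vecI) auto
      then show ?thesis
        using mult_add_distrib_mat_vec[OF Qc carr carr] that by simp
    qed
    have iff: "Q *\<^sub>v (w @\<^sub>v c) \<in> U \<longleftrightarrow> w \<in> V" if wc: "w \<in> carrier_vec n" "c \<in> carrier_vec 1" for w c
    proof
      assume "w \<in> V"
      then show "Q *\<^sub>v (w @\<^sub>v c) \<in> U"
        unfolding split[OF wc] V_def using Suc.prems(3) last wc by blast
    next
      assume a: "Q *\<^sub>v (w @\<^sub>v c) \<in> U"
      have "Q *\<^sub>v (w @\<^sub>v 0\<^sub>v 1) = Q *\<^sub>v (w @\<^sub>v c) + (- 1) \<cdot>\<^sub>v (Q *\<^sub>v (0\<^sub>v n @\<^sub>v c))"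
        unfolding split[OF wc] using Qc wc by (auto simp del: index_mult_mat_vec)
      then show "w \<in> V" unfolding V_def using a Suc.prems(3,4) last wc by simp
    qed
    have add: "(x + y) @\<^sub>v 0\<^sub>v 1 = (x @\<^sub>v 0\<^sub>v 1) + (y @\<^sub>v 0\<^sub>v 1)" and
      sm: "(s \<cdot>\<^sub>v x) @\<^sub>v 0\<^sub>v 1 = s \<cdot>\<^sub>v (x @\<^sub>v 0\<^sub>v 1)"
      if "x \<in> carrier_vec n" "y \<in> carrier_vec n" for x y and s :: real
      using that by (auto intro!: eq_vecI)
    have "\<exists>T k. orth_mat n T \<and> k \<le> n \<and>
      (\<forall>x \<in> carrier_vec k. \<forall>y \<in> carrier_vec (n - k). T *\<^sub>v (x @\<^sub>v y) \<in> V \<longleftrightarrow> x = 0\<^sub>v k)"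
    proof (rule Suc.IH)
      show "V \<subseteq> carrier_vec n" unfolding V_def by auto
      show "0\<^sub>v n \<in> V" unfolding V_def using last[of "0\<^sub>v 1"] by simp
      show "x + y \<in> V" if "x \<in> V" "y \<in> V" for x y
        using that Suc.prems(3) add[of x y] mult_add_distrib_mat_vec[OF Qc carr carr, of x "0\<^sub>v 1" y "0\<^sub>v 1"]
        unfolding V_def by simp
      show "s \<cdot>\<^sub>v x \<in> V" if "x \<in> V" for s x
        using that Suc.prems(4) sm[of x x s] mult_mat_vec[OF Qc carr, of x "0\<^sub>v 1" s]
        unfolding V_def by simp
    qed
    then obtain T k where T: "orth_mat n T" and k: "k \<le> n" and
      Tk: "\<And>x y. x \<in> carrier_vec k \<Longrightarrow> y \<in> carrier_vec (n - k) \<Longrightarrow> T *\<^sub>v (x @\<^sub>v y) \<in> V \<longleftrightarrow> x = 0\<^sub>v k"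
      by blast
    note Tc = orth_matD(1)[OF T]
    define B where "B = four_block_mat T (0\<^sub>m n 1) (0\<^sub>m 1 n) (1\<^sub>m 1)"
    have B: "orth_mat (Suc n) B"
      unfolding B_def using orth_mat_diag_block[OF T orth_mat_one[of 1]] by simp
    have "(Q * B) *\<^sub>v (x @\<^sub>v y) \<in> U \<longleftrightarrow> x = 0\<^sub>v k"
      if x: "x \<in> carrier_vec k" and y: "y \<in> carrier_vec (Suc n - k)" for x y
    proof -
      have "y \<in> carrier_vec ((n - k) + 1)" using y k by (simp add: Suc_diff_le)
      then obtain b c where b: "b \<in> carrier_vec (n - k)" and c: "c \<in> carrier_vec 1" and ybc: "y = b @\<^sub>v c"
        by (rule carrier_vec_split)
      have xb: "x @\<^sub>v b \<in> carrier_vec n" using append_carrier_vec[OF x b] k by simp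
      have "(Q * B) *\<^sub>v (x @\<^sub>v y) = Q *\<^sub>v (B *\<^sub>v ((x @\<^sub>v b) @\<^sub>v c))"
        unfolding ybc append_vec_assoc[symmetric]
        by (rule assoc_mult_mat_vec[OF Qc orth_matD(1)[OF B] carr[OF xb c]])
      also have "B *\<^sub>v ((x @\<^sub>v b) @\<^sub>v c) = (T *\<^sub>v (x @\<^sub>v b)) @\<^sub>v c"
        unfolding B_def using mult_mat_vec_split[OF Tc one_carrier_mat xb c] c by simp
      finally show ?thesis
        using iff[of "T *\<^sub>v (x @\<^sub>v b)" c] Tk[OF x b] Tc xb c by simp
    qed
    then show ?thesis
      using orth_mat_mult[OF Q B] k by (intro exI[of _ "Q * B"] exI[of _ k]) auto
  qed
qed

text \<open>The column space is the image. Ranks of different matrices can thus be compared by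
  showing that their images are the same set.\<close>

lemma rank_eq_subspace_dim:
  assumes X: "(X :: real mat) \<in> carrier_mat n k"
  shows "vec_space.rank n X = subspace_dim n ((\<lambda>w. X *\<^sub>v w) ` carrier_vec k)"
proof -
  interpret vec_space "TYPE(real)" n .
  have "col_space X = (\<lambda>w. X *\<^sub>v w) ` carrier_vec k"
    unfolding col_space_eq[OF X] using X by auto
  then show ?thesis unfolding rank_def subspace_dim_def col_space_def by simp
qed

text \<open>Linear independence speaks of the set of columns, so repetitions have to be excluded
  separately: two equal columns would put a difference of unit vectors into the kernel.\<close>

lemma rank_inj_mat:
  assumes X: "(X :: real mat) \<in> carrier_mat n k" and inj: "inj_mat X"
  shows "vec_space.rank n X = k"
proof -
  interpret vec_space "TYPE(real)" n .
  have dist: "distinct (cols X)"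
  proof (rule ccontr)
    assume "\<not> distinct (cols X)"
    then obtain i j where ij: "i < k" "j < k" "i \<noteq> j" "col X i = col X j"
      using X unfolding distinct_conv_nth by (auto simp: carrier_matD)
    have "X *\<^sub>v (unit_vec k i - unit_vec k j) = 0\<^sub>v n"
      using X ij by (simp add: mult_minus_distrib_mat_vec[OF X] mult_unit_vec)
    then have "unit_vec k i - unit_vec k j = (0\<^sub>v k :: real vec)"
      using inj_matD[OF inj X] by simp
    then have "(unit_vec k i - unit_vec k j) $ i = (0\<^sub>v k :: real vec) $ i" by simp
    then show False using ij by simp
  qed
  have "lin_indpt (set (cols X))"
    using lin_depE[OF X _ dist] inj_matD[OF inj X] by metis
  then show ?thesis by (rule lin_indpt_full_rank[OF X dist])
qed

lemma subspace_dim_inj_image: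
  assumes "(X :: real mat) \<in> carrier_mat n k" "inj_mat X"
  shows "subspace_dim n ((\<lambda>w. X *\<^sub>v w) ` carrier_vec k) = k"
  using rank_eq_subspace_dim[OF assms(1)] rank_inj_mat[OF assms] by simp

section \<open>Unobservable subspaces\<close>

lemma zero_mult_mat_vec [simp]:
  "w \<in> carrier_vec n \<Longrightarrow> 0\<^sub>m m n *\<^sub>v (w :: 'a :: semiring_0 vec) = 0\<^sub>v m"
  by (auto simp: scalar_prod_def)

lemma pow_mat_Suc_mult_vec:
  assumes "A \<in> carrier_mat n n" "w \<in> carrier_vec n"
  shows "A ^\<^sub>m Suc k *\<^sub>v w = A ^\<^sub>m k *\<^sub>v (A *\<^sub>v w)"
  using assoc_mult_mat_vec[OF pow_carrier_mat[OF assms(1)] assms] by simp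

lemma pow_mat_mult_vec_carrier [simp]:
  "A \<in> carrier_mat n n \<Longrightarrow> w \<in> carrier_vec n \<Longrightarrow> A ^\<^sub>m k *\<^sub>v w \<in> carrier_vec n"
  by (rule mult_mat_vec_carrier[OF pow_carrier_mat])

lemma pow_mat_add_mult_vec:
  assumes A: "A \<in> carrier_mat n n" and w: "w \<in> carrier_vec n"
  shows "A ^\<^sub>m (k + l) *\<^sub>v w = A ^\<^sub>m k *\<^sub>v (A ^\<^sub>m l *\<^sub>v w)"
  using w
proof (induction l arbitrary: w)
  case (Suc l)
  have "A ^\<^sub>m (k + Suc l) *\<^sub>v w = A ^\<^sub>m (k + l) *\<^sub>v (A *\<^sub>v w)"
    using pow_mat_Suc_mult_vec[OF A Suc.prems, of "k + l"] by simp
  also have "\<dots> = A ^\<^sub>m k *\<^sub>v (A ^\<^sub>m l *\<^sub>v (A *\<^sub>v w))" using Suc A by simp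
  finally show ?case using pow_mat_Suc_mult_vec[OF A Suc.prems, of l] by simp
qed (use A in simp)

text \<open>The \<open>n + 1\<close> vectors \<open>w, A w, \<dots>, A\<^sup>n w\<close> are linearly dependent; the last one with a nonzero
  coefficient is a combination of its predecessors, which replaces Cayley--Hamilton.\<close>
lemma krylov_vanish:
  fixes A C :: "real mat"
  assumes A: "A \<in> carrier_mat n n" and C: "C \<in> carrier_mat m n" and w: "w \<in> carrier_vec n"
    and zero: "\<And>k. k < n \<Longrightarrow> C *\<^sub>v (A ^\<^sub>m k *\<^sub>v w) = 0\<^sub>v m"
  shows "C *\<^sub>v (A ^\<^sub>m k *\<^sub>v w) = 0\<^sub>v m"
proof -
  \<comment> \<open>The Krylov vectors are the columns, and a row of zeros is added below to make
    the matrix square. That row makes it singular, which yields the coefficients of the linear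
    dependence.\<close>
  define B where "B = mat (Suc n) (Suc n) (\<lambda>(i, j). if i < n then (A ^\<^sub>m j *\<^sub>v w) $ i else 0)"
  have B: "B \<in> carrier_mat (Suc n) (Suc n)" "B\<^sup>T \<in> carrier_mat (Suc n) (Suc n)"
    unfolding B_def by simp_all
  have "B\<^sup>T *\<^sub>v unit_vec (Suc n) n = 0\<^sub>v (Suc n)"
    by (subst mult_unit_vec[OF B(2)]) (auto simp: B_def)
  then have "det B\<^sup>T = 0"
    using det_0_iff_vec_prod_zero_field[OF B(2)] unit_vec_carrier unit_vec_nonzero
    by (metis lessI)
  then have "det B = 0" using det_transpose[OF B(1)] by simp
  then obtain c where c: "c \<in> carrier_vec (Suc n)" "c \<noteq> 0\<^sub>v (Suc n)" "B *\<^sub>v c = 0\<^sub>v (Suc n)"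
    using det_0_iff_vec_prod_zero_field[OF B(1)] by blast
  have rel: "(\<Sum>j<Suc n. c $ j * (A ^\<^sub>m j *\<^sub>v w) $ i) = 0" if i: "i < n" for i
  proof -
    have "(B *\<^sub>v c) $ i = (\<Sum>j<Suc n. c $ j * (A ^\<^sub>m j *\<^sub>v w) $ i)"
      using i c(1) B unfolding B_def by (simp add: scalar_prod_def atLeast0LessThan mult.commute)
    then show ?thesis using c(3) i by simp
  qed
  define f where "f k l = (C *\<^sub>v (A ^\<^sub>m k *\<^sub>v w)) $ l" for k l
  \<comment> \<open>Applying \<open>C * A ^\<^sub>m s\<close> to the dependence turns it into a
    linear recursion, valid at every index, for each component of the outputs.\<close>
  have shift: "(\<Sum>j<Suc n. c $ j * f (s + j) l) = 0" if l: "l < m" for s l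
  proof -
    have CA: "C * A ^\<^sub>m s \<in> carrier_mat m n" using A C by simp
    have "f (s + j) l = (\<Sum>i<n. (C * A ^\<^sub>m s) $$ (l, i) * (A ^\<^sub>m j *\<^sub>v w) $ i)" for j
    proof -
      have "C *\<^sub>v (A ^\<^sub>m (s + j) *\<^sub>v w) = (C * A ^\<^sub>m s) *\<^sub>v (A ^\<^sub>m j *\<^sub>v w)"
        unfolding pow_mat_add_mult_vec[OF A w]
        by (rule assoc_mult_mat_vec[OF C pow_carrier_mat[OF A] pow_mat_mult_vec_carrier[OF A w], symmetric])
      then have "f (s + j) l = row (C * A ^\<^sub>m s) l \<bullet> (A ^\<^sub>m j *\<^sub>v w)"
        unfolding f_def using CA l C by simp
      then show ?thesis using CA l A by (simp add: scalar_prod_def atLeast0LessThan del: index_mult_mat_vec index_mult_mat)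
    qed
    then have "(\<Sum>j<Suc n. c $ j * f (s + j) l)
      = (\<Sum>j<Suc n. \<Sum>i<n. (C * A ^\<^sub>m s) $$ (l, i) * (c $ j * (A ^\<^sub>m j *\<^sub>v w) $ i))"
      by (simp add: sum_distrib_left mult.left_commute del: sum.lessThan_Suc index_mult_mat_vec index_mult_mat)
    also have "\<dots> = (\<Sum>i<n. (C * A ^\<^sub>m s) $$ (l, i) * (\<Sum>j<Suc n. c $ j * (A ^\<^sub>m j *\<^sub>v w) $ i))"
      by (subst sum.swap) (simp only: sum_distrib_left)
    also have "\<dots> = 0" using rel by (intro sum.neutral) (auto simp del: sum.lessThan_Suc)
    finally show ?thesis .
  qed
  \<comment> \<open>The last nonzero coefficient. Dividing by it expresses each output from index
    \<open>q\<close> on through the preceding ones, and \<open>q \<le> n\<close> makes the vanishing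
    initial values sufficient.\<close>
  define q where "q = Max {j. j < Suc n \<and> c $ j \<noteq> 0}"
  have "\<exists>j<Suc n. c $ j \<noteq> 0" using c(1,2) by (metis carrier_vecD eq_vecI index_zero_vec)
  then have "q \<in> {j. j < Suc n \<and> c $ j \<noteq> 0}" unfolding q_def by (intro Max_in) auto
  then have q: "q < Suc n" "c $ q \<noteq> 0" by auto
  have qmax: "c $ j = 0" if "q < j" "j < Suc n" for j
  proof (rule ccontr)
    assume "c $ j \<noteq> 0"
    then have "j \<le> q" unfolding q_def using that by (intro Max_ge) auto
    then show False using that by simp
  qed
  have f0: "f k l = 0" if l: "l < m" for k l
  proof (induction k rule: less_induct)
    case (less k)
    show ?case
    proof (cases "k < n")
      case True
      then show ?thesis unfolding f_def using zero l by simp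
    next
      case False
      then have kq: "q \<le> k" using q by simp
      have "(\<Sum>j<Suc n. c $ j * f (k - q + j) l) = c $ q * f k l"
      proof (subst sum.remove[of _ q])
        have "c $ j * f (k - q + j) l = 0" if "j \<in> {..<Suc n} - {q}" for j
        proof (cases "j < q")
          case True
          then show ?thesis using less.IH[of "k - q + j"] kq by simp
        next
          case False
          then show ?thesis using qmax[of j] that by auto
        qed
        then have "(\<Sum>j\<in>{..<Suc n} - {q}. c $ j * f (k - q + j) l) = 0" by (rule sum.neutral[rule_format])
        then show "c $ q * f (k - q + q) l + (\<Sum>j\<in>{..<Suc n} - {q}. c $ j * f (k - q + j) l) = c $ q * f k l"
          using kq by simp
      qed (use q in auto)
      then show ?thesis using shift[OF l, of "k - q"] q by simp
    qed
  qed
  show ?thesis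
  proof (rule eq_vecI)
    fix l assume "l < dim_vec (0\<^sub>v m :: real vec)"
    then show "(C *\<^sub>v (A ^\<^sub>m k *\<^sub>v w)) $ l = 0\<^sub>v m $ l" using f0[of l k] by (simp add: f_def)
  qed (use C in simp)
qed

text \<open>\<open>krylov_vanish\<close> lifts the bound on the powers. With all powers allowed,
  invariance under \<open>A\<close> is a mere shift of the index.\<close>

lemma unobs_space_iff:
  assumes A: "A \<in> carrier_mat n n" and C: "C \<in> carrier_mat m n"
  shows "w \<in> unobs_space C A \<longleftrightarrow> w \<in> carrier_vec n \<and> (\<forall>k. C *\<^sub>v (A ^\<^sub>m k *\<^sub>v w) = 0\<^sub>v m)"
proof -
  have "(C * A ^\<^sub>m k) *\<^sub>v w = C *\<^sub>v (A ^\<^sub>m k *\<^sub>v w)" if "w \<in> carrier_vec n" for k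
    by (rule assoc_mult_mat_vec[OF C pow_carrier_mat[OF A] that])
  then show ?thesis
    unfolding unobs_space_def mem_Collect_eq using A C krylov_vanish[OF A C]
    by (metis carrier_matD(1))
qed

lemma observable_iff:
  assumes A: "A \<in> carrier_mat n n" and C: "C \<in> carrier_mat m n"
  shows "observable C A \<longleftrightarrow>
    (\<forall>w \<in> carrier_vec n. (\<forall>k. C *\<^sub>v (A ^\<^sub>m k *\<^sub>v w) = 0\<^sub>v m) \<longrightarrow> w = 0\<^sub>v n)"
proof -
  have "0\<^sub>v n \<in> unobs_space C A"
    unfolding unobs_space_iff[OF A C] using mult_mat_zero_vec[OF pow_carrier_mat[OF A]] C by simp
  then show ?thesis unfolding observable_def using unobs_space_iff[OF A C] A by auto
qed

lemma unobs_space_subspace: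
  assumes A: "A \<in> carrier_mat n n" and C: "C \<in> carrier_mat m n"
  shows "unobs_space C A \<subseteq> carrier_vec n" "0\<^sub>v n \<in> unobs_space C A"
    "\<lbrakk>x \<in> unobs_space C A; y \<in> unobs_space C A\<rbrakk> \<Longrightarrow> x + y \<in> unobs_space C A"
    "x \<in> unobs_space C A \<Longrightarrow> c \<cdot>\<^sub>v x \<in> unobs_space C A"
    "x \<in> unobs_space C A \<Longrightarrow> A *\<^sub>v x \<in> unobs_space C A"
proof -
  note iff = unobs_space_iff[OF A C]
  have P: "A ^\<^sub>m k \<in> carrier_mat n n" for k using A by simp
  show "unobs_space C A \<subseteq> carrier_vec n" using iff by auto
  show "0\<^sub>v n \<in> unobs_space C A" unfolding iff using mult_mat_zero_vec[OF P] C by simp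
  show "x + y \<in> unobs_space C A" if "x \<in> unobs_space C A" "y \<in> unobs_space C A"
    using that unfolding iff
    by (auto simp: mult_add_distrib_mat_vec[OF P] mult_add_distrib_mat_vec[OF C] A)
  show "c \<cdot>\<^sub>v x \<in> unobs_space C A" if "x \<in> unobs_space C A"
    using that unfolding iff by (auto simp: mult_mat_vec[OF P] mult_mat_vec[OF C] A)
  show "A *\<^sub>v x \<in> unobs_space C A" if "x \<in> unobs_space C A"
    using that unfolding iff using A pow_mat_Suc_mult_vec[OF A] by (auto simp del: pow_mat.simps) metis
qed

section \<open>Column blocks, kernels and full rank factorizations\<close>

lemma append_cols_carrier [simp, intro]:
  "X \<in> carrier_mat m a \<Longrightarrow> Y \<in> carrier_mat m b \<Longrightarrow> X @\<^sub>c Y \<in> carrier_mat m (a + b)"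
  unfolding append_cols_def by auto

lemma append_cols_mult_vec:
  fixes X Y :: "'a :: comm_ring_1 mat"
  assumes "X \<in> carrier_mat m a" "Y \<in> carrier_mat m b" "x \<in> carrier_vec a" "y \<in> carrier_vec b"
  shows "(X @\<^sub>c Y) *\<^sub>v (x @\<^sub>v y) = X *\<^sub>v x + Y *\<^sub>v y"
proof -
  have "(X @\<^sub>c Y) *\<^sub>v (x @\<^sub>v y) = (X *\<^sub>v x + Y *\<^sub>v y) @\<^sub>v (0\<^sub>m 0 a *\<^sub>v x + 0\<^sub>m 0 b *\<^sub>v y)"
    unfolding append_cols_def
    using four_block_mat_mult_vec[OF assms(1,2) zero_carrier_mat[of 0 a] zero_carrier_mat[of 0 b] assms(3,4)]
      assms by simp
  also have "\<dots> = X *\<^sub>v x + Y *\<^sub>v y" using assms by (intro eq_vecI) auto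
  finally show ?thesis .
qed

lemma append_cols_split:
  assumes "X \<in> carrier_mat m (a + b)"
  obtains Y Z where "Y \<in> carrier_mat m a" "Z \<in> carrier_mat m b" "X = Y @\<^sub>c Z"
proof -
  obtain Y Z V W where s: "split_block X m a = (Y, Z, V, W)" by (metis prod_cases4)
  note b = split_block[OF s, of 0 b]
  have "V = 0\<^sub>m 0 a" "W = 0\<^sub>m 0 b" using b(3,4) assms by auto
  then show ?thesis using that[of Y Z] b assms unfolding append_cols_def by auto
qed

lemma S_mat_mult_vec:
  assumes "y \<in> carrier_vec (n - p)"
  shows "S_mat n p *\<^sub>v y = 0\<^sub>v p @\<^sub>v y"
  unfolding S_mat_def using mat_mult_append[OF zero_carrier_mat one_carrier_mat assms, of p] assms
  by simp

lemma S_mat_carrier: "p \<le> n \<Longrightarrow> S_mat n p \<in> carrier_mat n (n - p)"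
  unfolding S_mat_def using carrier_append_rows[OF zero_carrier_mat one_carrier_mat, of p "n - p"] by simp

text \<open>The last \<open>n - k\<close> columns of \<open>T\<close>, which form
  \<open>T * S_mat n k\<close>, map injectively onto \<open>U\<close>. This identifies the
  \<open>k\<close> of an adapted basis with the number \<open>v\<close> of the design.\<close>

lemma subspace_dim_adapted:
  assumes T: "orth_mat n T" and k: "k \<le> n" and U: "U \<subseteq> carrier_vec n"
    and iff: "\<And>x y. x \<in> carrier_vec k \<Longrightarrow> y \<in> carrier_vec (n - k) \<Longrightarrow>
      T *\<^sub>v (x @\<^sub>v y) \<in> U \<longleftrightarrow> x = 0\<^sub>v k"
  shows "subspace_dim n U = n - k"
proof -
  note Tc = orth_matD(1)[OF T]
  define X where "X = T * S_mat n k"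
  have X: "X \<in> carrier_mat n (n - k)" unfolding X_def using Tc S_mat_carrier[OF k] by simp
  have Xy: "X *\<^sub>v y = T *\<^sub>v (0\<^sub>v k @\<^sub>v y)" if "y \<in> carrier_vec (n - k)" for y
    unfolding X_def using assoc_mult_mat_vec[OF Tc S_mat_carrier[OF k] that] S_mat_mult_vec[OF that] by simp
  have carr: "x @\<^sub>v y \<in> carrier_vec n" if "x \<in> carrier_vec k" "y \<in> carrier_vec (n - k)" for x y :: "real vec"
    using append_carrier_vec[OF that] k by simp
  have "inj_mat X"
  proof (rule inj_matI[OF X])
    fix y :: "real vec" assume y: "y \<in> carrier_vec (n - k)" "X *\<^sub>v y = 0\<^sub>v n"
    have "0\<^sub>v k @\<^sub>v y = T\<^sup>T *\<^sub>v (X *\<^sub>v y)"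
      unfolding Xy[OF y(1)] using orth_mat_inverse(2)[OF T] carr y(1) by simp
    then have "0\<^sub>v k @\<^sub>v y = 0\<^sub>v (k + (n - k))" using y orth_matD(2)[OF T] k by simp
    then show "y = 0\<^sub>v (n - k)" using append_vec_eq_zero[of "0\<^sub>v k" k y "n - k"] y by simp
  qed
  moreover have "(\<lambda>y. X *\<^sub>v y) ` carrier_vec (n - k) = U"
  proof
    show "(\<lambda>y. X *\<^sub>v y) ` carrier_vec (n - k) \<subseteq> U" using Xy iff by auto
    show "U \<subseteq> (\<lambda>y. X *\<^sub>v y) ` carrier_vec (n - k)"
    proof
      fix u assume u: "u \<in> U"
      then have uc: "u \<in> carrier_vec n" using U by auto
      then have "T\<^sup>T *\<^sub>v u \<in> carrier_vec (k + (n - k))" using orth_matD(2)[OF T] k by simp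
      then obtain x y where xy: "x \<in> carrier_vec k" "y \<in> carrier_vec (n - k)" "T\<^sup>T *\<^sub>v u = x @\<^sub>v y"
        by (rule carrier_vec_split)
      then have "u = T *\<^sub>v (x @\<^sub>v y)" using orth_mat_inverse(1)[OF T uc] by simp
      with u iff xy have "u = X *\<^sub>v y" using Xy by simp
      then show "u \<in> (\<lambda>y. X *\<^sub>v y) ` carrier_vec (n - k)" using xy by auto
    qed
  qed
  ultimately show ?thesis using subspace_dim_inj_image[OF X] by simp
qed

text \<open>A basis adapted to the kernel of \<open>C\<close> collects that kernel in its last
  columns. The remaining columns give an injective block with the same image as \<open>C\<close>, so
  its width is the rank. Both the full rank factorization and the block \<open>E\<close> of the
  decomposition are read off from this form.\<close>

lemma mult_orth_mat_adapted_to_kernel: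
  fixes C :: "real mat"
  assumes C: "C \<in> carrier_mat m n"
  obtains T k D where "orth_mat n T" "k \<le> n" "D \<in> carrier_mat m k" "inj_mat D"
    "C * T = D @\<^sub>c 0\<^sub>m m (n - k)" "vec_space.rank m C = k"
proof -
  define U where "U = {w \<in> carrier_vec n. C *\<^sub>v w = 0\<^sub>v m}"
  have U: "U \<subseteq> carrier_vec n" unfolding U_def by auto
  have "\<exists>T k. orth_mat n T \<and> k \<le> n \<and>
    (\<forall>x \<in> carrier_vec k. \<forall>y \<in> carrier_vec (n - k). T *\<^sub>v (x @\<^sub>v y) \<in> U \<longleftrightarrow> x = 0\<^sub>v k)"
    by (rule orth_mat_adapted_to_subspace)
      (auto simp: U_def mult_add_distrib_mat_vec[OF C] mult_mat_vec[OF C] C)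
  then obtain T k where T: "orth_mat n T" and k: "k \<le> n" and
    iff: "\<And>x y. x \<in> carrier_vec k \<Longrightarrow> y \<in> carrier_vec (n - k) \<Longrightarrow> T *\<^sub>v (x @\<^sub>v y) \<in> U \<longleftrightarrow> x = 0\<^sub>v k"
    by blast
  note Tc = orth_matD(1)[OF T]
  have carr: "x @\<^sub>v y \<in> carrier_vec n" if "x \<in> carrier_vec k" "y \<in> carrier_vec (n - k)" for x y :: "real vec"
    using append_carrier_vec[OF that] k by simp
  have "C * T \<in> carrier_mat m (k + (n - k))" using C Tc k by simp
  then obtain D Z where D: "D \<in> carrier_mat m k" and Z: "Z \<in> carrier_mat m (n - k)"
    and CT: "C * T = D @\<^sub>c Z" by (rule append_cols_split)
  have app: "C *\<^sub>v (T *\<^sub>v (x @\<^sub>v y)) = D *\<^sub>v x + Z *\<^sub>v y"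
    if "x \<in> carrier_vec k" "y \<in> carrier_vec (n - k)" for x y
    using assoc_mult_mat_vec[OF C Tc carr[OF that]] append_cols_mult_vec[OF D Z that] CT by simp
  have "Z = 0\<^sub>m m (n - k)"
  proof (rule mat_eqI_mult_vec[OF Z])
    fix y :: "real vec" assume y: "y \<in> carrier_vec (n - k)"
    have "Z *\<^sub>v y = C *\<^sub>v (T *\<^sub>v (0\<^sub>v k @\<^sub>v y))" using app[of "0\<^sub>v k" y] y D Z by simp
    also have "\<dots> = 0\<^sub>v m" using iff[of "0\<^sub>v k" y] y unfolding U_def by simp
    finally show "Z *\<^sub>v y = 0\<^sub>m m (n - k) *\<^sub>v y" using y by simp
  qed simp
  then have Zy: "Z *\<^sub>v y = 0\<^sub>v m" if "y \<in> carrier_vec (n - k)" for y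
    using that by simp
  have inj: "inj_mat D"
  proof (rule inj_matI[OF D])
    fix x :: "real vec" assume x: "x \<in> carrier_vec k" "D *\<^sub>v x = 0\<^sub>v m"
    have "C *\<^sub>v (T *\<^sub>v (x @\<^sub>v 0\<^sub>v (n - k))) = 0\<^sub>v m" using app[of x "0\<^sub>v (n - k)"] x Z by simp
    then show "x = 0\<^sub>v k" using iff[of x "0\<^sub>v (n - k)"] x carr Tc unfolding U_def by simp
  qed
  have "(\<lambda>w. C *\<^sub>v w) ` carrier_vec n = (\<lambda>w. D *\<^sub>v w) ` carrier_vec k"
  proof (intro equalityI subsetI)
    fix c assume "c \<in> (\<lambda>w. C *\<^sub>v w) ` carrier_vec n"
    then obtain w where w: "w \<in> carrier_vec n" "c = C *\<^sub>v w" by auto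
    have "T\<^sup>T *\<^sub>v w \<in> carrier_vec (k + (n - k))" using orth_matD(2)[OF T] k w by simp
    then obtain x y where xy: "x \<in> carrier_vec k" "y \<in> carrier_vec (n - k)" "T\<^sup>T *\<^sub>v w = x @\<^sub>v y"
      by (rule carrier_vec_split)
    then have "c = C *\<^sub>v (T *\<^sub>v (x @\<^sub>v y))" using orth_mat_inverse(1)[OF T w(1)] w by simp
    then have "c = D *\<^sub>v x" using app xy Zy D by simp
    then show "c \<in> (\<lambda>w. D *\<^sub>v w) ` carrier_vec k" using xy by auto
  next
    fix c assume "c \<in> (\<lambda>w. D *\<^sub>v w) ` carrier_vec k"
    then obtain x where x: "x \<in> carrier_vec k" "c = D *\<^sub>v x" by auto
    then have "c = C *\<^sub>v (T *\<^sub>v (x @\<^sub>v 0\<^sub>v (n - k)))" using app[of x "0\<^sub>v (n - k)"] Z D by simp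
    then show "c \<in> (\<lambda>w. C *\<^sub>v w) ` carrier_vec n" using x carr Tc by auto
  qed
  then have "vec_space.rank m C = k"
    using rank_eq_subspace_dim[OF C] rank_eq_subspace_dim[OF D] rank_inj_mat[OF D inj] by simp
  then show ?thesis using that[OF T k D inj] CT \<open>Z = 0\<^sub>m m (n - k)\<close> by simp
qed

text \<open>In the form adapted to the kernel the zero block has width \<open>p - k\<close>; full
  rank leaves it empty, and \<open>D\<close> is an injective matrix up to a rotation.\<close>

lemma inj_mat_if_full_rank:
  fixes D :: "real mat"
  assumes D: "D \<in> carrier_mat m p" and rank: "vec_space.rank m D = p"
  shows "inj_mat D"
proof -
  obtain T k D' where T: "orth_mat p T" and D': "D' \<in> carrier_mat m k" "inj_mat D'"
    and DT: "D * T = D' @\<^sub>c 0\<^sub>m m (p - k)" and k: "vec_space.rank m D = k"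
    using mult_orth_mat_adapted_to_kernel[OF D] by metis
  have kp: "k = p" using k rank by simp
  note Tc = orth_matD[OF T]
  show ?thesis
  proof (rule inj_matI[OF D])
    fix w :: "real vec" assume w: "w \<in> carrier_vec p" "D *\<^sub>v w = 0\<^sub>v m"
    have Tw: "T\<^sup>T *\<^sub>v w \<in> carrier_vec p" using Tc w by simp
    \<comment> \<open>An empty vector is appended to match the empty zero block.\<close>
    have e: "T\<^sup>T *\<^sub>v w = (T\<^sup>T *\<^sub>v w) @\<^sub>v 0\<^sub>v 0" by (rule eq_vecI) auto
    have "D *\<^sub>v w = (D * T) *\<^sub>v (T\<^sup>T *\<^sub>v w)"
      using assoc_mult_mat_vec[OF D Tc(1) Tw] orth_mat_inverse(1)[OF T w(1)] by simp
    also have "\<dots> = D' *\<^sub>v (T\<^sup>T *\<^sub>v w)"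
      unfolding DT kp using D' kp Tw
      by (subst e, subst append_cols_mult_vec[of _ m p _ 0]) auto
    finally have "D' *\<^sub>v (T\<^sup>T *\<^sub>v w) = 0\<^sub>v m" using w by simp
    then have "T\<^sup>T *\<^sub>v w = 0\<^sub>v p" using inj_matD[OF D'(2,1)] Tw kp by simp
    then show "w = 0\<^sub>v p" using orth_mat_inverse(1)[OF T w(1)] Tc by simp
  qed
qed

lemma full_rank_factorization_exists:
  assumes C: "C \<in> carrier_mat m n" and p: "p = vec_space.rank m C"
  shows "\<exists>D F. full_rank_factorization m n p C D F"
proof -
  obtain T D where T: "orth_mat n T" and pn: "p \<le> n" and D: "D \<in> carrier_mat m p" "inj_mat D"
    and CT: "C * T = D @\<^sub>c 0\<^sub>m m (n - p)"
    using mult_orth_mat_adapted_to_kernel[OF C] p by metis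
  note Tc = orth_matD[OF T]
  \<comment> \<open>\<open>P\<close> selects the first \<open>p\<close> coordinates, so
    \<open>F\<close> consists of the first \<open>p\<close> rows of the transposed rotation, and
    \<open>D\<close> is the injective block of the adapted form.\<close>
  define P where "P = (1\<^sub>m p :: real mat) @\<^sub>c 0\<^sub>m p (n - p)"
  define F where "F = P * T\<^sup>T"
  have P: "P \<in> carrier_mat p n"
    unfolding P_def using append_cols_carrier[of "1\<^sub>m p" p p "0\<^sub>m p (n - p)" "n - p"] pn by simp
  have F: "F \<in> carrier_mat p n" unfolding F_def using P Tc by simp
  have carr: "x @\<^sub>v y \<in> carrier_vec n" if "x \<in> carrier_vec p" "y \<in> carrier_vec (n - p)" for x y :: "real vec"
    using append_carrier_vec[OF that] pn by simp
  have Pxy: "P *\<^sub>v (x @\<^sub>v y) = x" if "x \<in> carrier_vec p" "y \<in> carrier_vec (n - p)" for x y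
    unfolding P_def using append_cols_mult_vec[OF one_carrier_mat zero_carrier_mat that] that
    by simp
  have Fw: "F *\<^sub>v w = P *\<^sub>v (T\<^sup>T *\<^sub>v w)" if "w \<in> carrier_vec n" for w
    unfolding F_def by (rule assoc_mult_mat_vec[OF P Tc(2) that])
  have "C = D * F"
  proof (rule mat_eqI_mult_vec[OF C])
    fix w :: "real vec" assume w: "w \<in> carrier_vec n"
    have "T\<^sup>T *\<^sub>v w \<in> carrier_vec (p + (n - p))" using Tc pn w by simp
    then obtain x y where xy: "x \<in> carrier_vec p" "y \<in> carrier_vec (n - p)" "T\<^sup>T *\<^sub>v w = x @\<^sub>v y"
      by (rule carrier_vec_split)
    have "C *\<^sub>v w = (C * T) *\<^sub>v (x @\<^sub>v y)"
      using assoc_mult_mat_vec[OF C Tc(1) carr[OF xy(1,2)]] xy(3) orth_mat_inverse(1)[OF T w] by simp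
    also have "\<dots> = D *\<^sub>v x" unfolding CT
      using append_cols_mult_vec[OF D(1) zero_carrier_mat xy(1,2)] D xy
      by simp
    also have "\<dots> = D *\<^sub>v (F *\<^sub>v w)" using Fw[OF w] xy Pxy by simp
    also have "\<dots> = (D * F) *\<^sub>v w" by (rule assoc_mult_mat_vec[OF D(1) F w, symmetric])
    finally show "C *\<^sub>v w = (D * F) *\<^sub>v w" .
  qed (use D F in simp)
  moreover have "vec_space.rank p F = p"
  proof -
    have "(\<lambda>w. F *\<^sub>v w) ` carrier_vec n = (\<lambda>w. 1\<^sub>m p *\<^sub>v w) ` carrier_vec p"
    proof (intro equalityI subsetI)
      fix x :: "real vec" assume "x \<in> (\<lambda>w. 1\<^sub>m p *\<^sub>v w) ` carrier_vec p"
      then have x: "x \<in> carrier_vec p" by auto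
      have "F *\<^sub>v (T *\<^sub>v (x @\<^sub>v 0\<^sub>v (n - p))) = x"
        using Fw Tc carr[OF x, of "0\<^sub>v (n - p)"] orth_mat_inverse(2)[OF T] Pxy x by simp
      then show "x \<in> (\<lambda>w. F *\<^sub>v w) ` carrier_vec n"
        using carr[OF x, of "0\<^sub>v (n - p)"] Tc by (metis image_eqI mult_mat_vec_carrier zero_carrier_vec)
    qed (use F in force)
    then show ?thesis
      using rank_eq_subspace_dim[OF F] subspace_dim_inj_image[of "1\<^sub>m p" p p]
      by (simp add: inj_mat_def)
  qed
  ultimately show ?thesis
    unfolding full_rank_factorization_def using D F rank_inj_mat[OF D] by blast
qed

section \<open>Observability decomposition\<close>

lemma four_block_mat_split:
  assumes "X \<in> carrier_mat (a + b) (c + d)"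
  obtains Y Z V W where "Y \<in> carrier_mat a c" "Z \<in> carrier_mat a d" "V \<in> carrier_mat b c"
    "W \<in> carrier_mat b d" "X = four_block_mat Y Z V W"
proof -
  obtain Y Z V W where s: "split_block X a c = (Y, Z, V, W)" by (metis prod_cases4)
  from split_block[OF s, of b d] assms that show ?thesis by auto
qed

text \<open>Two rotations are composed. \<open>T1\<close> moves the unobservable subspace into the
  last \<open>n - v\<close> coordinates, where \<open>F\<close> vanishes. \<open>T2\<close> acts on
  the first \<open>v\<close> coordinates alone and moves the kernel of what is left of
  \<open>F\<close> to their end, so it does not disturb the first adaptation.\<close>

lemma unobs_space_adapted_orth_mat:
  fixes A F :: "real mat"
  assumes A: "A \<in> carrier_mat n n" and F: "F \<in> carrier_mat p n" and rank: "vec_space.rank p F = p"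
    and v: "v = n - subspace_dim n (unobs_space F A)"
  obtains T E where "orth_mat n T" "p \<le> v" "v \<le> n" "E \<in> carrier_mat p p" "inj_mat E"
    "F * T = E @\<^sub>c 0\<^sub>m p (v - p) @\<^sub>c 0\<^sub>m p (n - v)"
    "\<And>w y. w \<in> carrier_vec v \<Longrightarrow> y \<in> carrier_vec (n - v) \<Longrightarrow>
      T *\<^sub>v (w @\<^sub>v y) \<in> unobs_space F A \<longleftrightarrow> w = 0\<^sub>v v"
proof -
  let ?U = "unobs_space F A"
  note U = unobs_space_subspace[OF A F]
  obtain T1 k where T1: "orth_mat n T1" and k: "k \<le> n" and
    iff: "\<And>x y. x \<in> carrier_vec k \<Longrightarrow> y \<in> carrier_vec (n - k) \<Longrightarrow> T1 *\<^sub>v (x @\<^sub>v y) \<in> ?U \<longleftrightarrow> x = 0\<^sub>v k"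
    using orth_mat_adapted_to_subspace[OF U(1-4)] by blast
  have kv: "k = v" using subspace_dim_adapted[OF T1 k U(1) iff] v k by simp
  have vn: "v \<le> n" using k kv by simp
  note iff = iff[unfolded kv]
  note T1c = orth_matD[OF T1]
  have carr: "x @\<^sub>v y \<in> carrier_vec n" if "x \<in> carrier_vec v" "y \<in> carrier_vec (n - v)" for x y :: "real vec"
    using append_carrier_vec[OF that] vn by simp
  have "F * T1 \<in> carrier_mat p (v + (n - v))" using F T1c vn by simp
  then obtain X Z where X: "X \<in> carrier_mat p v" and Z: "Z \<in> carrier_mat p (n - v)"
    and FT1: "F * T1 = X @\<^sub>c Z" by (rule append_cols_split)
  have app: "F *\<^sub>v (T1 *\<^sub>v (x @\<^sub>v y)) = X *\<^sub>v x + Z *\<^sub>v y"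
    if "x \<in> carrier_vec v" "y \<in> carrier_vec (n - v)" for x y
    using assoc_mult_mat_vec[OF F T1c(1) carr[OF that]] append_cols_mult_vec[OF X Z that] FT1 by simp
  \<comment> \<open>The power 0 in the description of the unobservable subspace: its vectors produce
    no output.\<close>
  have Zy: "Z *\<^sub>v y = 0\<^sub>v p" if y: "y \<in> carrier_vec (n - v)" for y
  proof -
    have "T1 *\<^sub>v (0\<^sub>v v @\<^sub>v y) \<in> ?U" using iff y by simp
    then have "F *\<^sub>v (A ^\<^sub>m 0 *\<^sub>v (T1 *\<^sub>v (0\<^sub>v v @\<^sub>v y))) = 0\<^sub>v p" unfolding unobs_space_iff[OF A F] by blast
    then have "F *\<^sub>v (T1 *\<^sub>v (0\<^sub>v v @\<^sub>v y)) = 0\<^sub>v p"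
      using carr[OF _ y] T1c A by simp
    then show ?thesis using app[of "0\<^sub>v v" y] y X Z by simp
  qed
  obtain T2 l E where T2: "orth_mat v T2" and l: "l \<le> v" and E: "E \<in> carrier_mat p l" "inj_mat E"
    and XT2: "X * T2 = E @\<^sub>c 0\<^sub>m p (v - l)" and rX: "vec_space.rank p X = l"
    using mult_orth_mat_adapted_to_kernel[OF X] by metis
  have "(\<lambda>w. F *\<^sub>v w) ` carrier_vec n = (\<lambda>w. X *\<^sub>v w) ` carrier_vec v"
  proof (intro equalityI subsetI)
    fix c assume "c \<in> (\<lambda>w. F *\<^sub>v w) ` carrier_vec n"
    then obtain w where w: "w \<in> carrier_vec n" "c = F *\<^sub>v w" by auto
    have "T1\<^sup>T *\<^sub>v w \<in> carrier_vec (v + (n - v))" using T1c vn w by simp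
    then obtain x y where xy: "x \<in> carrier_vec v" "y \<in> carrier_vec (n - v)" "T1\<^sup>T *\<^sub>v w = x @\<^sub>v y"
      by (rule carrier_vec_split)
    then have "c = F *\<^sub>v (T1 *\<^sub>v (x @\<^sub>v y))" using orth_mat_inverse(1)[OF T1 w(1)] w by simp
    then have "c = X *\<^sub>v x" using app xy Zy X by simp
    then show "c \<in> (\<lambda>w. X *\<^sub>v w) ` carrier_vec v" using xy by auto
  next
    fix c assume "c \<in> (\<lambda>w. X *\<^sub>v w) ` carrier_vec v"
    then obtain x where x: "x \<in> carrier_vec v" "c = X *\<^sub>v x" by auto
    then have "c = F *\<^sub>v (T1 *\<^sub>v (x @\<^sub>v 0\<^sub>v (n - v)))" using app[of x "0\<^sub>v (n - v)"] Z X by simp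
    then show "c \<in> (\<lambda>w. F *\<^sub>v w) ` carrier_vec n"
      using x carr T1c by (metis image_eqI mult_mat_vec_carrier zero_carrier_vec)
  qed
  \<comment> \<open>\<open>F\<close> and its block \<open>X\<close> have the same image, hence the
    same rank; this makes \<open>E\<close> square.\<close>
  then have lp: "l = p"
    using rank_eq_subspace_dim[OF F] rank_eq_subspace_dim[OF X] rX rank by simp
  note T2c = orth_matD[OF T2]
  have pv: "p \<le> v" using l lp by simp
  have Ep: "E \<in> carrier_mat p p" using E lp by simp
  define B where "B = four_block_mat T2 (0\<^sub>m v (n - v)) (0\<^sub>m (n - v) v) (1\<^sub>m (n - v))"
  have B: "orth_mat n B"
    unfolding B_def using orth_mat_diag_block[OF T2 orth_mat_one[of "n - v"]] vn by simp
  have Bwy: "B *\<^sub>v (w @\<^sub>v y) = T2 *\<^sub>v w @\<^sub>v y" if "w \<in> carrier_vec v" "y \<in> carrier_vec (n - v)" for w y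
    unfolding B_def using mult_mat_vec_split[OF T2c(1) one_carrier_mat that] that by simp
  define T where "T = T1 * B"
  have T: "orth_mat n T" unfolding T_def by (rule orth_mat_mult[OF T1 B])
  have Twy: "T *\<^sub>v (w @\<^sub>v y) = T1 *\<^sub>v (T2 *\<^sub>v w @\<^sub>v y)" if "w \<in> carrier_vec v" "y \<in> carrier_vec (n - v)" for w y
    unfolding T_def using assoc_mult_mat_vec[OF T1c(1) orth_matD(1)[OF B] carr[OF that]] Bwy[OF that] by simp
  have 1: "T *\<^sub>v (w @\<^sub>v y) \<in> ?U \<longleftrightarrow> w = 0\<^sub>v v" if w: "w \<in> carrier_vec v" and y: "y \<in> carrier_vec (n - v)" for w y
  proof -
    have "T2 *\<^sub>v w = 0\<^sub>v v \<longleftrightarrow> w = 0\<^sub>v v"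
      using orth_mat_inverse(2)[OF T2 w] T2c by auto
    then show ?thesis unfolding Twy[OF w y] using iff[of "T2 *\<^sub>v w" y] w y T2c by simp
  qed
  have "F * T = E @\<^sub>c 0\<^sub>m p (v - p) @\<^sub>c 0\<^sub>m p (n - v)"
  proof (rule mat_eqI_mult_vec[where n = n and m = p])
    have "0\<^sub>m p (v - p) @\<^sub>c 0\<^sub>m p (n - v) \<in> carrier_mat p ((v - p) + (n - v))" by auto
    from append_cols_carrier[OF Ep this]
    show "E @\<^sub>c 0\<^sub>m p (v - p) @\<^sub>c 0\<^sub>m p (n - v) \<in> carrier_mat p n" using pv vn by simp
    show "F * T \<in> carrier_mat p n" using F orth_matD(1)[OF T] by simp
    fix w :: "real vec" assume "w \<in> carrier_vec n"
    then have "w \<in> carrier_vec (p + ((v - p) + (n - v)))" using pv vn by simp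
    then obtain x w' where x: "x \<in> carrier_vec p" and "w' \<in> carrier_vec ((v - p) + (n - v))" and w: "w = x @\<^sub>v w'"
      by (rule carrier_vec_split)
    then obtain y z where y: "y \<in> carrier_vec (v - p)" and z: "z \<in> carrier_vec (n - v)" and w': "w' = y @\<^sub>v z"
      by (metis carrier_vec_split)
    have xy: "x @\<^sub>v y \<in> carrier_vec v" using append_carrier_vec[OF x y] pv by simp
    have T2xy: "T2 *\<^sub>v (x @\<^sub>v y) \<in> carrier_vec v" using T2c xy by simp
    have "(F * T) *\<^sub>v w = F *\<^sub>v (T *\<^sub>v ((x @\<^sub>v y) @\<^sub>v z))"
      unfolding w w' append_vec_assoc[symmetric] by (rule assoc_mult_mat_vec[OF F orth_matD(1)[OF T] carr[OF xy z]])
    also have "\<dots> = X *\<^sub>v (T2 *\<^sub>v (x @\<^sub>v y))"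
      unfolding Twy[OF xy z] app[OF T2xy z] Zy[OF z] using X T2xy by simp
    also have "\<dots> = (X * T2) *\<^sub>v (x @\<^sub>v y)" by (rule assoc_mult_mat_vec[OF X T2c(1) xy, symmetric])
    also have "\<dots> = E *\<^sub>v x" unfolding XT2 lp
      using append_cols_mult_vec[OF Ep zero_carrier_mat x y] Ep x y by simp
    also have "\<dots> = (E @\<^sub>c 0\<^sub>m p (v - p) @\<^sub>c 0\<^sub>m p (n - v)) *\<^sub>v w"
      unfolding w w' append_cols_mult_vec[OF Ep append_cols_carrier[OF zero_carrier_mat zero_carrier_mat] x append_carrier_vec[OF y z]]
      append_cols_mult_vec[OF zero_carrier_mat zero_carrier_mat y z] using Ep x y z by simp
    finally show "(F * T) *\<^sub>v w = (E @\<^sub>c 0\<^sub>m p (v - p) @\<^sub>c 0\<^sub>m p (n - v)) *\<^sub>v w" .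
  qed
  from that[OF T pv vn Ep E(2) this] 1 show ?thesis by blast
qed

lemma output_form_mult_vec:
  assumes E: "E \<in> carrier_mat p p" and FT: "F * T = E @\<^sub>c 0\<^sub>m p a @\<^sub>c 0\<^sub>m p b"
    and F: "F \<in> carrier_mat p n" and T: "T \<in> carrier_mat n n" and n: "n = p + (a + b)"
    and x: "x \<in> carrier_vec p" and y: "y \<in> carrier_vec a" and z: "(z :: real vec) \<in> carrier_vec b"
  shows "F *\<^sub>v (T *\<^sub>v (x @\<^sub>v (y @\<^sub>v z))) = E *\<^sub>v x"
proof -
  have c: "x @\<^sub>v (y @\<^sub>v z) \<in> carrier_vec n" using n x y z by simp
  have "F *\<^sub>v (T *\<^sub>v (x @\<^sub>v (y @\<^sub>v z))) = (F * T) *\<^sub>v (x @\<^sub>v (y @\<^sub>v z))"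
    by (rule assoc_mult_mat_vec[OF F T c, symmetric])
  also have "\<dots> = E *\<^sub>v x"
    unfolding FT append_cols_mult_vec[OF E append_cols_carrier[OF zero_carrier_mat zero_carrier_mat] x append_carrier_vec[OF y z]]
      append_cols_mult_vec[OF zero_carrier_mat zero_carrier_mat y z] using E x y z by simp
  finally show ?thesis .
qed

lemma orth_similar_mult_vec:
  assumes T: "orth_mat n T" and A: "A \<in> carrier_mat n n" and w: "w \<in> carrier_vec n"
  shows "A *\<^sub>v (T *\<^sub>v w) = T *\<^sub>v ((T\<^sup>T * A * T) *\<^sub>v w)"
proof -
  note Tc = orth_matD[OF T]
  have "(T\<^sup>T * A * T) *\<^sub>v w = (T\<^sup>T * A) *\<^sub>v (T *\<^sub>v w)"
    by (rule assoc_mult_mat_vec[of _ n n _ n]) (use Tc A w in simp_all)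
  also have "\<dots> = T\<^sup>T *\<^sub>v (A *\<^sub>v (T *\<^sub>v w))"
    by (rule assoc_mult_mat_vec[of _ n n _ n]) (use Tc A w in simp_all)
  finally show ?thesis using orth_mat_inverse(1)[OF T, of "A *\<^sub>v (T *\<^sub>v w)"] A Tc w by simp
qed

text \<open>The zero upper right block lets the first \<open>v\<close> coordinates evolve on their
  own. What happens in the last \<open>q\<close> coordinates has no influence on the output and is
  left unspecified.\<close>

lemma block_lower_pow_mult_vec:
  assumes Ao: "Ao \<in> carrier_mat v v" and X: "X \<in> carrier_mat q v" and Au: "Au \<in> carrier_mat q q"
    and B: "B = four_block_mat Ao (0\<^sub>m v q) X Au"
    and w: "w \<in> carrier_vec v" and z: "(z :: real vec) \<in> carrier_vec q"
  shows "\<exists>z'\<in>carrier_vec q. B ^\<^sub>m k *\<^sub>v (w @\<^sub>v z) = Ao ^\<^sub>m k *\<^sub>v w @\<^sub>v z'"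
  using w z
proof (induction k arbitrary: w z)
  case 0
  have "dim_row B = v + q" using B Ao Au by simp
  then show ?case using 0 Ao by (intro bexI[of _ z]) simp_all
next
  case (Suc k)
  have Bc: "B \<in> carrier_mat (v + q) (v + q)" using B Ao Au by simp
  have step: "B *\<^sub>v (w @\<^sub>v z) = Ao *\<^sub>v w @\<^sub>v (X *\<^sub>v w + Au *\<^sub>v z)"
    unfolding B using four_block_mat_mult_vec[OF Ao zero_carrier_mat X Au Suc.prems] Suc.prems Ao by simp
  have "X *\<^sub>v w + Au *\<^sub>v z \<in> carrier_vec q" "Ao *\<^sub>v w \<in> carrier_vec v" using X Au Ao Suc.prems by auto
  from Suc.IH[OF this(2,1)] show ?case
    using pow_mat_Suc_mult_vec[OF Bc append_carrier_vec[OF Suc.prems]] pow_mat_Suc_mult_vec[OF Ao Suc.prems(1)] step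
    by (simp del: pow_mat.simps)
qed

lemma orth_similar_pow_mult_vec:
  assumes T: "orth_mat n T" and A: "A \<in> carrier_mat n n" and w: "w \<in> carrier_vec n"
  shows "A ^\<^sub>m k *\<^sub>v (T *\<^sub>v w) = T *\<^sub>v ((T\<^sup>T * A * T) ^\<^sub>m k *\<^sub>v w)"
  using w
proof (induction k arbitrary: w)
  case 0
  then show ?case using orth_matD[OF T] A by simp
next
  case (Suc k)
  note Tc = orth_matD[OF T]
  have B: "T\<^sup>T * A * T \<in> carrier_mat n n" by (intro mult_carrier_mat[of _ n n]) (use Tc A in simp_all)
  show ?case
    using pow_mat_Suc_mult_vec[OF A, of "T *\<^sub>v w" k] pow_mat_Suc_mult_vec[OF B Suc.prems, of k]
      orth_similar_mult_vec[OF T A Suc.prems] Suc.IH[of "(T\<^sup>T * A * T) *\<^sub>v w"] B Tc Suc.prems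
    by (simp del: pow_mat.simps assoc_mult_mat_vec assoc_mult_mat)
qed

text \<open>The upper right block vanishes because the unobservable subspace is invariant under
  \<open>A\<close>. The leading pair is observable because a vector it cannot see, extended by zeros
  and rotated back, is unobservable for \<open>F\<close> and \<open>A\<close>, and the adapted basis
  leaves only 0 for its first \<open>v\<close> coordinates.\<close>

lemma obs_decomposition_exists:
  fixes A F :: "real mat"
  assumes A: "A \<in> carrier_mat n n" and F: "F \<in> carrier_mat p n" and rank: "vec_space.rank p F = p"
    and v: "v = n - subspace_dim n (unobs_space F A)"
  shows "p \<le> v" "v \<le> n" "\<exists>d. obs_decomposition n p v A F d"
proof -
  let ?U = "unobs_space F A"
  obtain T E where T: "orth_mat n T" and pv: "p \<le> v" and vn: "v \<le> n" and E: "E \<in> carrier_mat p p" "inj_mat E"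
    and FT: "F * T = E @\<^sub>c 0\<^sub>m p (v - p) @\<^sub>c 0\<^sub>m p (n - v)"
    and iff: "\<And>w y. w \<in> carrier_vec v \<Longrightarrow> y \<in> carrier_vec (n - v) \<Longrightarrow> T *\<^sub>v (w @\<^sub>v y) \<in> ?U \<longleftrightarrow> w = 0\<^sub>v v"
    using unobs_space_adapted_orth_mat[OF A F rank v] by metis
  note Tc = orth_matD[OF T]
  have carr: "x @\<^sub>v y \<in> carrier_vec n" if "x \<in> carrier_vec v" "y \<in> carrier_vec (n - v)" for x y :: "real vec"
    using append_carrier_vec[OF that] vn by simp
  let ?B = "T\<^sup>T * A * T"
  have B: "?B \<in> carrier_mat n n" by (intro mult_carrier_mat[of _ n n]) (use Tc A in simp_all)
  then have "?B \<in> carrier_mat (v + (n - v)) (v + (n - v))" using vn by simp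
  then obtain Ao Z X Au where Ao: "Ao \<in> carrier_mat v v" and Z: "Z \<in> carrier_mat v (n - v)"
    and X: "X \<in> carrier_mat (n - v) v" and Au: "Au \<in> carrier_mat (n - v) (n - v)"
    and Beq: "?B = four_block_mat Ao Z X Au" by (rule four_block_mat_split)
  have "Z = 0\<^sub>m v (n - v)"
  proof (rule mat_eqI_mult_vec[OF Z])
    fix z :: "real vec" assume z: "z \<in> carrier_vec (n - v)"
    have "T *\<^sub>v (0\<^sub>v v @\<^sub>v z) \<in> ?U" using iff z by simp
    then have "A *\<^sub>v (T *\<^sub>v (0\<^sub>v v @\<^sub>v z)) \<in> ?U" by (rule unobs_space_subspace(5)[OF A F])
    moreover have "?B *\<^sub>v (0\<^sub>v v @\<^sub>v z) = Z *\<^sub>v z @\<^sub>v Au *\<^sub>v z"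
      unfolding Beq four_block_mat_mult_vec[OF Ao Z X Au zero_carrier_vec z] using Ao Z X Au z by simp
    ultimately have "T *\<^sub>v (Z *\<^sub>v z @\<^sub>v Au *\<^sub>v z) \<in> ?U"
      using orth_similar_mult_vec[OF T A carr[OF zero_carrier_vec z]] by simp
    then show "Z *\<^sub>v z = 0\<^sub>m v (n - v) *\<^sub>v z" using iff[of "Z *\<^sub>v z" "Au *\<^sub>v z"] Z Au z by simp
  qed simp
  note Beq = Beq[unfolded this]
  have "Ao \<in> carrier_mat (p + (v - p)) (p + (v - p))" using Ao pv by simp
  then obtain A11 A12 A21 A22 where a: "A11 \<in> carrier_mat p p" "A12 \<in> carrier_mat p (v - p)"
    "A21 \<in> carrier_mat (v - p) p" "A22 \<in> carrier_mat (v - p) (v - p)"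
    and Aoeq: "Ao = four_block_mat A11 A12 A21 A22" by (rule four_block_mat_split)
  have "X \<in> carrier_mat (n - v) (p + (v - p))" using X pv by simp
  then obtain A31 A32 where b: "A31 \<in> carrier_mat (n - v) p" "A32 \<in> carrier_mat (n - v) (v - p)"
    and Xeq: "X = A31 @\<^sub>c A32" by (rule append_cols_split)
  have Ez: "E @\<^sub>c 0\<^sub>m p (v - p) \<in> carrier_mat p v" using append_cols_carrier[OF E(1) zero_carrier_mat, of "v - p"] pv by simp
  have "observable (E @\<^sub>c 0\<^sub>m p (v - p)) Ao"
    unfolding observable_iff[OF Ao Ez]
  proof (intro ballI impI)
    fix w :: "real vec" assume w: "w \<in> carrier_vec v"
      and zero: "\<forall>k. (E @\<^sub>c 0\<^sub>m p (v - p)) *\<^sub>v (Ao ^\<^sub>m k *\<^sub>v w) = 0\<^sub>v p"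
    have w0: "w @\<^sub>v 0\<^sub>v (n - v) \<in> carrier_vec n" using carr w by simp
    have "F *\<^sub>v (A ^\<^sub>m k *\<^sub>v (T *\<^sub>v (w @\<^sub>v 0\<^sub>v (n - v)))) = 0\<^sub>v p" for k
    proof -
      obtain z where z: "z \<in> carrier_vec (n - v)"
        and Bk: "?B ^\<^sub>m k *\<^sub>v (w @\<^sub>v 0\<^sub>v (n - v)) = Ao ^\<^sub>m k *\<^sub>v w @\<^sub>v z"
        using block_lower_pow_mult_vec[OF Ao X Au Beq w zero_carrier_vec] by metis
      have "Ao ^\<^sub>m k *\<^sub>v w \<in> carrier_vec (p + (v - p))" using pow_mat_mult_vec_carrier[OF Ao w] pv by simp
      then obtain x y where xy: "x \<in> carrier_vec p" "y \<in> carrier_vec (v - p)" "Ao ^\<^sub>m k *\<^sub>v w = x @\<^sub>v y"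
        by (rule carrier_vec_split)
      have "F *\<^sub>v (A ^\<^sub>m k *\<^sub>v (T *\<^sub>v (w @\<^sub>v 0\<^sub>v (n - v)))) = F *\<^sub>v (T *\<^sub>v (x @\<^sub>v (y @\<^sub>v z)))"
        unfolding orth_similar_pow_mult_vec[OF T A w0] Bk xy(3) append_vec_assoc ..
      also have "\<dots> = E *\<^sub>v x"
        by (rule output_form_mult_vec[OF E(1) FT F Tc(1) _ xy(1,2) z]) (use pv vn in simp)
      also have "\<dots> = (E @\<^sub>c 0\<^sub>m p (v - p)) *\<^sub>v (x @\<^sub>v y)"
        unfolding append_cols_mult_vec[OF E(1) zero_carrier_mat xy(1,2)] using E xy by simp
      finally show ?thesis using zero[rule_format, of k] xy(3) by metis
    qed
    then have "T *\<^sub>v (w @\<^sub>v 0\<^sub>v (n - v)) \<in> ?U"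
      unfolding unobs_space_iff[OF A F] using Tc w0 by simp
    then show "w = 0\<^sub>v v" using iff w by simp
  qed
  then have "obs_decomposition n p v A F \<lparr>oT = T, oE = E, o11 = A11, o12 = A12, o21 = A21, o22 = A22,
      o31 = A31, o32 = A32, ou = Au\<rparr>"
    unfolding obs_decomposition_def using T E a b Au Beq FT Aoeq Xeq invertible_iff_inj[OF E(1)] by simp
  then show "\<exists>d. obs_decomposition n p v A F d" by blast
  show "p \<le> v" "v \<le> n" by fact+
qed

text \<open>If all \<open>E * A12 * A22^k\<close> annihilate \<open>w\<close>, then so do all
  \<open>A12 * A22^k\<close>, since \<open>E\<close> is invertible. The trajectory of
  \<open>(0, w)\<close> under the full block matrix then keeps its first component 0 and is
  invisible to \<open>[E 0]\<close>, so observability of the larger pair gives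
  \<open>w = 0\<close>.\<close>

lemma observable_reduced_pair:
  fixes E :: "real mat"
  assumes E: "E \<in> carrier_mat p p" "invertible_mat E"
    and a: "A11 \<in> carrier_mat p p" "A12 \<in> carrier_mat p q" "A21 \<in> carrier_mat q p" "A22 \<in> carrier_mat q q"
    and obs: "observable (E @\<^sub>c 0\<^sub>m p q) (four_block_mat A11 A12 A21 A22)"
  shows "observable (E * A12) A22"
proof -
  let ?A = "four_block_mat A11 A12 A21 A22"
  have A: "?A \<in> carrier_mat (p + q) (p + q)" using a by simp
  have E0: "E @\<^sub>c 0\<^sub>m p q \<in> carrier_mat p (p + q)" using E by simp
  have EA: "E * A12 \<in> carrier_mat p q" using E a by simp
  show ?thesis
    unfolding observable_iff[OF a(4) EA]
  proof (intro ballI impI)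
    fix w :: "real vec" assume w: "w \<in> carrier_vec q"
      and zero: "\<forall>k. (E * A12) *\<^sub>v (A22 ^\<^sub>m k *\<^sub>v w) = 0\<^sub>v p"
    have A12: "A12 *\<^sub>v (A22 ^\<^sub>m k *\<^sub>v w) = 0\<^sub>v p" for k
    proof (rule inj_matD[OF _ E(1)])
      show "inj_mat E" using invertible_iff_inj E by blast
      show "E *\<^sub>v (A12 *\<^sub>v (A22 ^\<^sub>m k *\<^sub>v w)) = 0\<^sub>v p"
        using zero assoc_mult_mat_vec[OF E(1) a(2) pow_mat_mult_vec_carrier[OF a(4) w]] by simp
    qed (use a w in simp)
    \<comment> \<open>The vector is kept arbitrary: one step of the dynamics replaces it by its
      image under \<open>A22\<close>, which satisfies the same hypothesis with shifted
      powers.\<close>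
    have pow: "?A ^\<^sub>m k *\<^sub>v (0\<^sub>v p @\<^sub>v w) = 0\<^sub>v p @\<^sub>v A22 ^\<^sub>m k *\<^sub>v w"
      if "w \<in> carrier_vec q" "\<And>k. A12 *\<^sub>v (A22 ^\<^sub>m k *\<^sub>v w) = 0\<^sub>v p" for k w
      using that
    proof (induction k arbitrary: w)
      case 0
      then show ?case using A a by simp
    next
      case (Suc k)
      have Aw: "A22 *\<^sub>v w \<in> carrier_vec q" using a Suc.prems by simp
      have "A12 *\<^sub>v w = 0\<^sub>v p" using Suc.prems(2)[of 0] Suc.prems(1) a by simp
      then have "?A *\<^sub>v (0\<^sub>v p @\<^sub>v w) = 0\<^sub>v p @\<^sub>v A22 *\<^sub>v w"
        unfolding four_block_mat_mult_vec[OF a zero_carrier_vec Suc.prems(1)] using a Aw by simp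
      moreover have "?A ^\<^sub>m k *\<^sub>v (0\<^sub>v p @\<^sub>v A22 *\<^sub>v w) = 0\<^sub>v p @\<^sub>v A22 ^\<^sub>m k *\<^sub>v (A22 *\<^sub>v w)"
        using Suc.IH[OF Aw] Suc.prems(2)[of "Suc _"] pow_mat_Suc_mult_vec[OF a(4) Suc.prems(1)] by metis
      ultimately show ?case
        using pow_mat_Suc_mult_vec[OF A append_carrier_vec[OF zero_carrier_vec Suc.prems(1)]]
          pow_mat_Suc_mult_vec[OF a(4) Suc.prems(1)] by (simp del: pow_mat.simps)
    qed
    have "(E @\<^sub>c 0\<^sub>m p q) *\<^sub>v (?A ^\<^sub>m k *\<^sub>v (0\<^sub>v p @\<^sub>v w)) = 0\<^sub>v p" for k
      unfolding pow[OF w A12] append_cols_mult_vec[OF E(1) zero_carrier_mat zero_carrier_vec pow_mat_mult_vec_carrier[OF a(4) w]]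
      using E a w by simp
    then have "0\<^sub>v p @\<^sub>v w = 0\<^sub>v (p + q)"
      using obs[unfolded observable_iff[OF A E0]] w by simp
    then show "w = 0\<^sub>v q" using append_vec_eq_zero[of "0\<^sub>v p" p w q] w by simp
  qed
qed

text \<open>Holds for every decomposition of the prescribed form, not just for the constructed one:
  the block structure keeps the first \<open>v\<close> coordinates at 0, and the output reads only
  the first \<open>p\<close> of them.\<close>

lemma obs_decomposition_unobs_space:
  assumes d: "obs_decomposition n p v A F d" and pv: "p \<le> v" "v \<le> n"
    and A: "A \<in> carrier_mat n n" and F: "F \<in> carrier_mat p n" and z: "z \<in> carrier_vec (n - v)"
  shows "oT d *\<^sub>v (0\<^sub>v v @\<^sub>v z) \<in> unobs_space F A"
proof -
  let ?Ao = "four_block_mat (o11 d) (o12 d) (o21 d) (o22 d)"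
  let ?B = "(oT d)\<^sup>T * A * oT d"
  have T: "orth_mat n (oT d)" and E: "oE d \<in> carrier_mat p p"
    and a: "o11 d \<in> carrier_mat p p" "o22 d \<in> carrier_mat (v - p) (v - p)"
    and X: "o31 d @\<^sub>c o32 d \<in> carrier_mat (n - v) (p + (v - p))" and Au: "ou d \<in> carrier_mat (n - v) (n - v)"
    and B: "?B = four_block_mat ?Ao (0\<^sub>m v (n - v)) (o31 d @\<^sub>c o32 d) (ou d)"
    and FT: "F * oT d = oE d @\<^sub>c 0\<^sub>m p (v - p) @\<^sub>c 0\<^sub>m p (n - v)"
    using d unfolding obs_decomposition_def by auto
  have Ao: "?Ao \<in> carrier_mat v v" using four_block_carrier_mat[OF a, of "o12 d" "o21 d"] pv by simp
  have X': "o31 d @\<^sub>c o32 d \<in> carrier_mat (n - v) v" using X pv by simp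
  have c: "0\<^sub>v v @\<^sub>v z \<in> carrier_vec n" using append_carrier_vec[OF zero_carrier_vec z, of v] pv by simp
  have "F *\<^sub>v (A ^\<^sub>m k *\<^sub>v (oT d *\<^sub>v (0\<^sub>v v @\<^sub>v z))) = 0\<^sub>v p" for k
  proof -
    obtain z' where z': "z' \<in> carrier_vec (n - v)" and Bk: "?B ^\<^sub>m k *\<^sub>v (0\<^sub>v v @\<^sub>v z) = ?Ao ^\<^sub>m k *\<^sub>v 0\<^sub>v v @\<^sub>v z'"
      using block_lower_pow_mult_vec[OF Ao X' Au B zero_carrier_vec z] by metis
    have "?Ao ^\<^sub>m k *\<^sub>v 0\<^sub>v v = 0\<^sub>v p @\<^sub>v 0\<^sub>v (v - p)"
      using mult_mat_zero_vec[OF pow_carrier_mat[OF Ao]] pv by (simp add: append_zero_vec)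
    then have "F *\<^sub>v (A ^\<^sub>m k *\<^sub>v (oT d *\<^sub>v (0\<^sub>v v @\<^sub>v z))) = F *\<^sub>v (oT d *\<^sub>v (0\<^sub>v p @\<^sub>v (0\<^sub>v (v - p) @\<^sub>v z')))"
      unfolding orth_similar_pow_mult_vec[OF T A c] Bk by (simp add: append_vec_assoc)
    also have "\<dots> = oE d *\<^sub>v 0\<^sub>v p"
      by (rule output_form_mult_vec[OF E FT F orth_matD(1)[OF T] _ _ _ z']) (use pv in simp_all)
    finally show ?thesis using E by simp
  qed
  then show ?thesis unfolding unobs_space_iff[OF A F] using orth_matD(1)[OF T] c by simp
qed

section \<open>Stein and Lyapunov equations\<close>

abbreviation cmat :: "real mat \<Rightarrow> complex mat" where
  "cmat \<equiv> map_mat complex_of_real"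

text \<open>The passage from the weak form of a matrix equation back to the equation itself.\<close>

lemma bilinear_eqI:
  fixes X Y :: "'a :: comm_ring_1 mat"
  assumes X: "X \<in> carrier_mat m n" and Y: "Y \<in> carrier_mat m n"
    and eq: "\<And>x y. x \<in> carrier_vec m \<Longrightarrow> y \<in> carrier_vec n \<Longrightarrow> x \<bullet> (X *\<^sub>v y) = x \<bullet> (Y *\<^sub>v y)"
  shows "X = Y"
proof (rule mat_eqI_mult_vec[OF X Y])
  fix w :: "'a vec" assume w: "w \<in> carrier_vec n"
  show "X *\<^sub>v w = Y *\<^sub>v w"
  proof (rule eq_vecI)
    fix i assume i: "i < dim_vec (Y *\<^sub>v w)"
    then have i: "i < m" using Y by simp
    have "unit_vec m i \<bullet> (X *\<^sub>v w) = unit_vec m i \<bullet> (Y *\<^sub>v w)" using eq w by simp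
    then show "(X *\<^sub>v w) $ i = (Y *\<^sub>v w) $ i"
      using i w X Y scalar_prod_left_unit[of "X *\<^sub>v w" m i] scalar_prod_left_unit[of "Y *\<^sub>v w" m i]
      by (simp del: index_mult_mat_vec)
  qed (use X Y in simp)
qed

lemma bilinear_form_expand:
  fixes Q :: "real mat"
  assumes "Q \<in> carrier_mat m n" "x \<in> carrier_vec m" "y \<in> carrier_vec n"
  shows "x \<bullet> (Q *\<^sub>v y) = (\<Sum>i<m. \<Sum>j<n. x $ i * y $ j * Q $$ (i, j))"
  using assms by (simp add: scalar_prod_def atLeast0LessThan sum_distrib_left mult_ac)

lemma mult_vec_entry:
  fixes A :: "'a :: semiring_0 mat"
  assumes "A \<in> carrier_mat m n" "w \<in> carrier_vec n" "i < m"
  shows "(A *\<^sub>v w) $ i = (\<Sum>j<n. A $$ (i, j) * w $ j)"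
  using assms by (simp add: scalar_prod_def atLeast0LessThan)

lemma smult_mat_mult_vec:
  fixes A :: "'a :: comm_semiring_0 mat"
  assumes "A \<in> carrier_mat m n" "w \<in> carrier_vec n"
  shows "(c \<cdot>\<^sub>m A) *\<^sub>v w = c \<cdot>\<^sub>v (A *\<^sub>v w)"
  using assms by (intro eq_vecI) auto

text \<open>Real and imaginary parts of a complex eigenvector, on which \<open>A\<close> acts as a
  scaled rotation. Stability can thus be examined with real quadratic forms.\<close>

lemma eigenvalue_real_pair:
  fixes A :: "real mat"
  assumes A: "A \<in> carrier_mat n n"
  shows "eigenvalue (cmat A) s \<longleftrightarrow> (\<exists>u \<in> carrier_vec n. \<exists>v \<in> carrier_vec n. (u \<noteq> 0\<^sub>v n \<or> v \<noteq> 0\<^sub>v n) \<and>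
    A *\<^sub>v u = Re s \<cdot>\<^sub>v u - Im s \<cdot>\<^sub>v v \<and> A *\<^sub>v v = Im s \<cdot>\<^sub>v u + Re s \<cdot>\<^sub>v v)"
proof -
  have entry: "(cmat A *\<^sub>v w) $ i = Complex ((A *\<^sub>v map_vec Re w) $ i) ((A *\<^sub>v map_vec Im w) $ i)"
    if "w \<in> carrier_vec n" "i < n" for w i
    using that A by (simp add: scalar_prod_def complex_eq_iff)
  have eq: "cmat A *\<^sub>v w = s \<cdot>\<^sub>v w \<longleftrightarrow> A *\<^sub>v map_vec Re w = Re s \<cdot>\<^sub>v map_vec Re w - Im s \<cdot>\<^sub>v map_vec Im w \<and>
      A *\<^sub>v map_vec Im w = Im s \<cdot>\<^sub>v map_vec Re w + Re s \<cdot>\<^sub>v map_vec Im w" if w: "w \<in> carrier_vec n" for w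
  proof -
    have "cmat A *\<^sub>v w = s \<cdot>\<^sub>v w \<longleftrightarrow> (\<forall>i<n. (cmat A *\<^sub>v w) $ i = (s \<cdot>\<^sub>v w) $ i)"
      using A w by (auto simp del: index_mult_mat_vec intro!: eq_vecI)
    also have "\<dots> \<longleftrightarrow> (\<forall>i<n. (A *\<^sub>v map_vec Re w) $ i = Re s * Re (w $ i) - Im s * Im (w $ i) \<and>
        (A *\<^sub>v map_vec Im w) $ i = Re s * Im (w $ i) + Im s * Re (w $ i))"
      using w by (auto simp add: entry complex_eq_iff simp del: index_mult_mat_vec)
    also have "\<dots> \<longleftrightarrow> A *\<^sub>v map_vec Re w = Re s \<cdot>\<^sub>v map_vec Re w - Im s \<cdot>\<^sub>v map_vec Im w \<and>
      A *\<^sub>v map_vec Im w = Im s \<cdot>\<^sub>v map_vec Re w + Re s \<cdot>\<^sub>v map_vec Im w"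
      using A w unfolding vec_eq_iff by (auto simp del: index_mult_mat_vec)
    finally show ?thesis .
  qed
  have zero: "w = 0\<^sub>v n \<longleftrightarrow> map_vec Re w = 0\<^sub>v n \<and> map_vec Im w = 0\<^sub>v n" if "w \<in> carrier_vec n" for w
    using that unfolding vec_eq_iff by (auto simp: complex_eq_iff)
  show ?thesis
  proof
    assume "eigenvalue (cmat A) s"
    then obtain w where "w \<in> carrier_vec n" "w \<noteq> 0\<^sub>v n" "cmat A *\<^sub>v w = s \<cdot>\<^sub>v w"
      unfolding eigenvalue_def eigenvector_def using A by auto
    then show "\<exists>u \<in> carrier_vec n. \<exists>v \<in> carrier_vec n. (u \<noteq> 0\<^sub>v n \<or> v \<noteq> 0\<^sub>v n) \<and>
      A *\<^sub>v u = Re s \<cdot>\<^sub>v u - Im s \<cdot>\<^sub>v v \<and> A *\<^sub>v v = Im s \<cdot>\<^sub>v u + Re s \<cdot>\<^sub>v v"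
      using eq zero by (intro bexI[of _ "map_vec Re w"] bexI[of _ "map_vec Im w"]) auto
  next
    assume "\<exists>u \<in> carrier_vec n. \<exists>v \<in> carrier_vec n. (u \<noteq> 0\<^sub>v n \<or> v \<noteq> 0\<^sub>v n) \<and>
      A *\<^sub>v u = Re s \<cdot>\<^sub>v u - Im s \<cdot>\<^sub>v v \<and> A *\<^sub>v v = Im s \<cdot>\<^sub>v u + Re s \<cdot>\<^sub>v v"
    then obtain u v where uv: "u \<in> carrier_vec n" "v \<in> carrier_vec n" "u \<noteq> 0\<^sub>v n \<or> v \<noteq> 0\<^sub>v n"
      "A *\<^sub>v u = Re s \<cdot>\<^sub>v u - Im s \<cdot>\<^sub>v v" "A *\<^sub>v v = Im s \<cdot>\<^sub>v u + Re s \<cdot>\<^sub>v v" by auto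
    define w where "w = vec n (\<lambda>i. Complex (u $ i) (v $ i))"
    have w: "w \<in> carrier_vec n" "map_vec Re w = u" "map_vec Im w = v"
      unfolding w_def using uv by auto
    then show "eigenvalue (cmat A) s"
      unfolding eigenvalue_def eigenvector_def using eq[OF w(1)] zero[OF w(1)] uv A by auto
  qed
qed

lemma eigenvalue_shift:
  fixes A :: "real mat"
  assumes A: "A \<in> carrier_mat n n" and ev: "eigenvalue (cmat (A + c \<cdot>\<^sub>m 1\<^sub>m n)) s"
  shows "eigenvalue (cmat A) (s - of_real c)"
proof -
  have Ac: "A + c \<cdot>\<^sub>m 1\<^sub>m n \<in> carrier_mat n n" using A by simp
  have "(A + c \<cdot>\<^sub>m 1\<^sub>m n) *\<^sub>v w = A *\<^sub>v w + c \<cdot>\<^sub>v w" if "w \<in> carrier_vec n" for w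
    using A that by (subst add_mult_distrib_mat_vec[of _ n n]) (auto simp: smult_mat_mult_vec[of _ n n])
  then have m: "A *\<^sub>v w = (A + c \<cdot>\<^sub>m 1\<^sub>m n) *\<^sub>v w - c \<cdot>\<^sub>v w" if "w \<in> carrier_vec n" for w
    using A that by (auto simp del: index_mult_mat_vec intro!: eq_vecI)
  obtain u v where uv: "u \<in> carrier_vec n" "v \<in> carrier_vec n" "u \<noteq> 0\<^sub>v n \<or> v \<noteq> 0\<^sub>v n"
      "(A + c \<cdot>\<^sub>m 1\<^sub>m n) *\<^sub>v u = Re s \<cdot>\<^sub>v u - Im s \<cdot>\<^sub>v v" "(A + c \<cdot>\<^sub>m 1\<^sub>m n) *\<^sub>v v = Im s \<cdot>\<^sub>v u + Re s \<cdot>\<^sub>v v"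
    using ev[unfolded eigenvalue_real_pair[OF Ac]] by auto
  have "A *\<^sub>v u = Re (s - of_real c) \<cdot>\<^sub>v u - Im (s - of_real c) \<cdot>\<^sub>v v"
    unfolding m[OF uv(1)] uv(4) using uv(1,2) by (intro eq_vecI) (auto simp: algebra_simps)
  moreover have "A *\<^sub>v v = Im (s - of_real c) \<cdot>\<^sub>v u + Re (s - of_real c) \<cdot>\<^sub>v v"
    unfolding m[OF uv(2)] uv(5) using uv(1,2) by (intro eq_vecI) (auto simp: algebra_simps)
  ultimately show ?thesis unfolding eigenvalue_real_pair[OF A] using uv by blast
qed

lemma eigenvalue_uminus:
  fixes A :: "real mat"
  assumes A: "A \<in> carrier_mat n n" and ev: "eigenvalue (cmat (- A)) s"
  shows "eigenvalue (cmat A) (- s)"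
proof -
  have Am: "- A \<in> carrier_mat n n" using A by simp
  obtain u v where uv: "u \<in> carrier_vec n" "v \<in> carrier_vec n" "u \<noteq> 0\<^sub>v n \<or> v \<noteq> 0\<^sub>v n"
      "- A *\<^sub>v u = Re s \<cdot>\<^sub>v u - Im s \<cdot>\<^sub>v v" "- A *\<^sub>v v = Im s \<cdot>\<^sub>v u + Re s \<cdot>\<^sub>v v"
    using ev[unfolded eigenvalue_real_pair[OF Am]] by auto
  have m: "A *\<^sub>v w = - (- A *\<^sub>v w)" if "w \<in> carrier_vec n" for w
    using A that uminus_mult_mat_vec[of w A] by simp
  have "A *\<^sub>v u = Re (- s) \<cdot>\<^sub>v u - Im (- s) \<cdot>\<^sub>v v"
    unfolding m[OF uv(1)] uv(4) using uv(1,2) by (intro eq_vecI) auto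
  moreover have "A *\<^sub>v v = Im (- s) \<cdot>\<^sub>v u + Re (- s) \<cdot>\<^sub>v v"
    unfolding m[OF uv(2)] uv(5) using uv(1,2) by (intro eq_vecI) auto
  ultimately show ?thesis unfolding eigenvalue_real_pair[OF A] using uv by blast
qed

section \<open>Powers of Schur stable matrices and the Stein equation\<close>

lemma pow_smult_mat:
  fixes A :: "'a :: comm_semiring_1 mat"
  assumes A: "A \<in> carrier_mat n n"
  shows "(c \<cdot>\<^sub>m A) ^\<^sub>m k = c ^ k \<cdot>\<^sub>m (A ^\<^sub>m k)"
proof (induction k)
  case 0
  show ?case using A by (intro eq_matI) auto
next
  case (Suc k)
  have "(c \<cdot>\<^sub>m A) ^\<^sub>m Suc k = (c ^ k \<cdot>\<^sub>m (A ^\<^sub>m k)) * (c \<cdot>\<^sub>m A)" using Suc by simp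
  also have "\<dots> = c ^ Suc k \<cdot>\<^sub>m (A ^\<^sub>m k * A)"
    using A mult_smult_distrib[OF smult_carrier_mat[OF pow_carrier_mat[OF A]] A]
      mult_smult_assoc_mat[OF pow_carrier_mat[OF A] A]
    by (intro eq_matI) (auto simp: algebra_simps)
  finally show ?case by simp
qed

text \<open>Dividing \<open>Z\<close> by a number \<rho> strictly between its spectral radius and 1
  leaves a spectral radius below 1, so the powers of the scaled matrix are bounded by its Jordan
  form. Undoing the scaling turns this bound into geometric decay.\<close>

lemma schur_stable_pow_bound:
  fixes Z :: "real mat"
  assumes Z: "Z \<in> carrier_mat n n" and ev: "\<forall>s. eigenvalue (cmat Z) s \<longrightarrow> cmod s < 1"
  obtains \<rho> c where "0 < \<rho>" "\<rho> < 1" "0 \<le> c" "\<And>k i j. i < n \<Longrightarrow> j < n \<Longrightarrow> \<bar>(Z ^\<^sub>m k) $$ (i, j)\<bar> \<le> c * \<rho> ^ k"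
proof (cases "n = 0")
  \<comment> \<open>Without eigenvalues there is no spectral radius to work with, and the bound on
    the entries is vacuous.\<close>
  case True
  then show ?thesis using that[of "1/2" 0] by simp
next
  case False
  have Zc: "cmat Z \<in> carrier_mat n n" using Z by simp
  note sr = spectral_radius_mem_max[OF Zc]
  have "spectral_radius (cmat Z) < 1"
    using sr(1) False ev unfolding spectrum_def by auto
  \<comment> \<open>The midpoint between the spectral radius and 1; the maximum with 0 makes its
    positivity immediate.\<close>
  define \<rho> where "\<rho> = (max 0 (spectral_radius (cmat Z)) + 1) / 2"
  have \<rho>: "0 < \<rho>" "\<rho> < 1" "spectral_radius (cmat Z) < \<rho>"
    unfolding \<rho>_def using \<open>spectral_radius (cmat Z) < 1\<close> by auto
  define B where "B = of_real (1 / \<rho>) \<cdot>\<^sub>m cmat Z"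
  have B: "B \<in> carrier_mat n n" unfolding B_def using Zc by simp
  have "cmod s < 1" if "eigenvalue B s" for s
  proof -
    from that obtain w where w: "w \<in> carrier_vec n" "w \<noteq> 0\<^sub>v n" "B *\<^sub>v w = s \<cdot>\<^sub>v w"
      unfolding eigenvalue_def eigenvector_def using B by auto
    have "B *\<^sub>v w = of_real (1 / \<rho>) \<cdot>\<^sub>v (cmat Z *\<^sub>v w)"
      unfolding B_def by (rule smult_mat_mult_vec[OF Zc w(1)])
    then have "of_real \<rho> \<cdot>\<^sub>v (of_real (1 / \<rho>) \<cdot>\<^sub>v (cmat Z *\<^sub>v w)) = of_real \<rho> \<cdot>\<^sub>v (s \<cdot>\<^sub>v w)"
      using w by simp
    then have "cmat Z *\<^sub>v w = (of_real \<rho> * s) \<cdot>\<^sub>v w" using \<rho>(1) by (simp add: smult_smult_assoc)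
    then have "eigenvalue (cmat Z) (of_real \<rho> * s)"
      unfolding eigenvalue_def eigenvector_def using w Zc by auto
    then have "cmod (of_real \<rho> * s) \<le> spectral_radius (cmat Z)"
      using sr(2) False unfolding spectrum_def by blast
    then have "\<rho> * cmod s < \<rho>" using \<rho> unfolding norm_mult norm_of_real by linarith
    then show ?thesis using \<rho>(1) by simp
  qed
  then have "spectral_radius B < 1"
    using spectral_radius_mem_max(1)[OF B] False unfolding spectrum_def by auto
  moreover obtain as where "char_poly B = (\<Prod>a\<leftarrow>as. [:- a, 1:])"
    using char_poly_factorized[OF B] by auto
  ultimately obtain c where c: "\<And>k. norm_bound (B ^\<^sub>m k) c"
    using spectral_radius_jnf_norm_bound_less_1[OF B] jordan_nf_exists[OF B] by blast
  have bound: "\<bar>(Z ^\<^sub>m k) $$ (i, j)\<bar> \<le> c * \<rho> ^ k" if ij: "i < n" "j < n" for k i j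
  proof -
    have "B ^\<^sub>m k = of_real (1 / \<rho>) ^ k \<cdot>\<^sub>m cmat (Z ^\<^sub>m k)"
      unfolding B_def pow_smult_mat[OF Zc] of_real_hom.mat_hom_pow[OF Z] ..
    then have eq: "norm ((B ^\<^sub>m k) $$ (i, j)) = (1 / \<rho>) ^ k * \<bar>(Z ^\<^sub>m k) $$ (i, j)\<bar>"
      using ij Z \<rho> by (simp add: norm_mult norm_power norm_divide power_one_over)
    have "norm ((B ^\<^sub>m k) $$ (i, j)) \<le> c"
      using c[of k] ij B pow_carrier_mat[OF B, of k] unfolding norm_bound_def by simp
    then have "\<rho> ^ k * norm ((B ^\<^sub>m k) $$ (i, j)) \<le> \<rho> ^ k * c"
      using \<rho> by (intro mult_left_mono) simp_all
    moreover have "\<bar>(Z ^\<^sub>m k) $$ (i, j)\<bar> = \<rho> ^ k * norm ((B ^\<^sub>m k) $$ (i, j))"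
      using \<rho> eq by (simp add: field_simps)
    ultimately show ?thesis unfolding mult.commute[of c] by linarith
  qed
  have "0 \<le> c" using bound[of 0 0 0] False by simp
  with that[of \<rho> c] \<rho> bound show ?thesis by blast
qed

lemma schur_stable_vec_bound:
  fixes Z :: "real mat"
  assumes Z: "Z \<in> carrier_mat n n" and ev: "\<forall>s. eigenvalue (cmat Z) s \<longrightarrow> cmod s < 1"
    and Q: "Q \<in> carrier_mat n n" and x: "x \<in> carrier_vec n" and y: "y \<in> carrier_vec n"
  obtains \<rho> c where "0 < \<rho>" "\<rho> < 1"
    "\<And>k. \<bar>(Z ^\<^sub>m k *\<^sub>v x) \<bullet> (Q *\<^sub>v (Z ^\<^sub>m k *\<^sub>v y))\<bar> \<le> c * \<rho> ^ k"
proof -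
  obtain \<rho> c where \<rho>: "0 < \<rho>" "\<rho> < 1" and c: "0 \<le> c"
    and b: "\<And>k i j. i < n \<Longrightarrow> j < n \<Longrightarrow> \<bar>(Z ^\<^sub>m k) $$ (i, j)\<bar> \<le> c * \<rho> ^ k"
    by (rule schur_stable_pow_bound[OF Z ev]) (rule that; blast)
  have vb: "\<bar>(Z ^\<^sub>m k *\<^sub>v w) $ i\<bar> \<le> (c * (\<Sum>j<n. \<bar>w $ j\<bar>)) * \<rho> ^ k"
    if "w \<in> carrier_vec n" "i < n" for w k i
  proof -
    have "\<bar>(Z ^\<^sub>m k *\<^sub>v w) $ i\<bar> = \<bar>\<Sum>j<n. (Z ^\<^sub>m k) $$ (i, j) * w $ j\<bar>"
      unfolding mult_vec_entry[OF pow_carrier_mat[OF Z] that] ..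
    also have "\<dots> \<le> (\<Sum>j<n. \<bar>(Z ^\<^sub>m k) $$ (i, j)\<bar> * \<bar>w $ j\<bar>)"
      by (rule order_trans[OF sum_abs]) (simp add: abs_mult)
    also have "\<dots> \<le> (\<Sum>j<n. (c * \<rho> ^ k) * \<bar>w $ j\<bar>)"
      using b that by (intro sum_mono mult_right_mono) auto
    finally show ?thesis by (simp add: sum_distrib_left mult_ac)
  qed
  define C where "C w = c * (\<Sum>j<n. \<bar>w $ j\<bar>)" for w
  have C: "0 \<le> C w" for w unfolding C_def using c by (simp add: sum_nonneg)
  have "\<bar>(Z ^\<^sub>m k *\<^sub>v x) \<bullet> (Q *\<^sub>v (Z ^\<^sub>m k *\<^sub>v y))\<bar> \<le> (\<Sum>i<n. \<Sum>j<n. C x * \<bar>Q $$ (i, j)\<bar> * C y) * \<rho> ^ k" for k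
  proof -
    let ?x = "Z ^\<^sub>m k *\<^sub>v x" and ?y = "Z ^\<^sub>m k *\<^sub>v y"
    have c': "?x \<in> carrier_vec n" "?y \<in> carrier_vec n" using Z x y by simp_all
    have "\<bar>?x \<bullet> (Q *\<^sub>v ?y)\<bar> = \<bar>\<Sum>i<n. \<Sum>j<n. ?x $ i * ?y $ j * Q $$ (i, j)\<bar>"
      unfolding bilinear_form_expand[OF Q c'] ..
    also have "\<dots> \<le> (\<Sum>i<n. \<Sum>j<n. \<bar>?x $ i * ?y $ j * Q $$ (i, j)\<bar>)"
      by (rule order_trans[OF sum_abs sum_mono]) (rule sum_abs)
    also have "\<dots> \<le> (\<Sum>i<n. \<Sum>j<n. C x * \<bar>Q $$ (i, j)\<bar> * C y * \<rho> ^ k)"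
    proof (intro sum_mono)
      fix i j assume ij: "i \<in> {..<n}" "j \<in> {..<n}"
      \<comment> \<open>Each of the two vectors contributes a factor \<open>\<rho> ^ k\<close>. One
        of them suffices for summability; the other is estimated by 1, so that the bound stays a
        plain geometric sequence.\<close>
      have r1: "\<rho> ^ k \<le> 1" using \<rho> by (simp add: power_le_one)
      have "\<bar>?x $ i\<bar> \<le> C x * \<rho> ^ k" using vb[OF x, of i k] ij unfolding C_def by simp
      moreover have "\<bar>?y $ j\<bar> \<le> C y"
        using vb[OF y, of j k] ij mult_left_mono[OF r1 C[of y]] unfolding C_def by simp
      ultimately have "\<bar>?x $ i\<bar> * (\<bar>Q $$ (i, j)\<bar> * \<bar>?y $ j\<bar>) \<le> (C x * \<rho> ^ k) * (\<bar>Q $$ (i, j)\<bar> * C y)"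
        using C \<rho> by (intro mult_mono) auto
      then show "\<bar>?x $ i * ?y $ j * Q $$ (i, j)\<bar> \<le> C x * \<bar>Q $$ (i, j)\<bar> * C y * \<rho> ^ k"
        by (simp add: abs_mult mult_ac del: index_mult_mat_vec)
    qed
    finally show ?thesis by (simp add: sum_distrib_right del: index_mult_mat_vec)
  qed
  with that[OF \<rho>] show ?thesis by blast
qed

lemma schur_stable_sums:
  fixes Z :: "real mat"
  assumes Z: "Z \<in> carrier_mat n n" and ev: "\<forall>s. eigenvalue (cmat Z) s \<longrightarrow> cmod s < 1"
    and Q: "Q \<in> carrier_mat n n" and x: "x \<in> carrier_vec n" and y: "y \<in> carrier_vec n"
  shows "(\<lambda>k. (Z ^\<^sub>m k *\<^sub>v x) \<bullet> (Q *\<^sub>v (Z ^\<^sub>m k *\<^sub>v y))) \<longlonglongrightarrow> 0"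
    and "summable (\<lambda>k. (Z ^\<^sub>m k *\<^sub>v x) \<bullet> (Q *\<^sub>v (Z ^\<^sub>m k *\<^sub>v y)))"
proof -
  obtain \<rho> c where \<rho>: "0 < \<rho>" "\<rho> < 1"
    and b: "\<And>k. \<bar>(Z ^\<^sub>m k *\<^sub>v x) \<bullet> (Q *\<^sub>v (Z ^\<^sub>m k *\<^sub>v y))\<bar> \<le> c * \<rho> ^ k"
    by (rule schur_stable_vec_bound[OF Z ev Q x y]) (rule that; blast)
  show s: "summable (\<lambda>k. (Z ^\<^sub>m k *\<^sub>v x) \<bullet> (Q *\<^sub>v (Z ^\<^sub>m k *\<^sub>v y)))"
    by (rule summable_comparison_test[of _ "\<lambda>k. c * \<rho> ^ k"])
      (use b \<rho> in \<open>auto intro!: summable_mult summable_geometric\<close>)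
  show "(\<lambda>k. (Z ^\<^sub>m k *\<^sub>v x) \<bullet> (Q *\<^sub>v (Z ^\<^sub>m k *\<^sub>v y))) \<longlonglongrightarrow> 0"
    by (rule summable_LIMSEQ_zero[OF s])
qed

text \<open>The matrix equation \<open>X = Q + Z\<^sup>T * X * Z\<close> in weak form.\<close>

definition stein :: "nat \<Rightarrow> real mat \<Rightarrow> real mat \<Rightarrow> real mat \<Rightarrow> bool" where
  "stein n Z Q X \<longleftrightarrow> (\<forall>x \<in> carrier_vec n. \<forall>y \<in> carrier_vec n.
     x \<bullet> (X *\<^sub>v y) = x \<bullet> (Q *\<^sub>v y) + (Z *\<^sub>v x) \<bullet> (X *\<^sub>v (Z *\<^sub>v y)))"

text \<open>Iterating the equation telescopes: the partial sums differ from the form of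
  \<open>X\<close> by its value at the \<open>K\<close>-th iterates, which tends to 0. A solution is
  therefore determined by \<open>Q\<close>, and symmetry and sign of \<open>Q\<close> pass to it
  term by term.\<close>

lemma stein_sums:
  assumes Z: "Z \<in> carrier_mat n n" and ev: "\<forall>s. eigenvalue (cmat Z) s \<longrightarrow> cmod s < 1"
    and X: "X \<in> carrier_mat n n" and stein: "stein n Z Q X"
    and x: "x \<in> carrier_vec n" and y: "y \<in> carrier_vec n"
  shows "(\<lambda>k. (Z ^\<^sub>m k *\<^sub>v x) \<bullet> (Q *\<^sub>v (Z ^\<^sub>m k *\<^sub>v y))) sums (x \<bullet> (X *\<^sub>v y))"
proof -
  have ZS: "Z *\<^sub>v (Z ^\<^sub>m k *\<^sub>v w) = Z ^\<^sub>m Suc k *\<^sub>v w" if "w \<in> carrier_vec n" for w k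
    using pow_mat_add_mult_vec[OF Z that, of 1 k] Z by simp
  have "(\<Sum>k<K. (Z ^\<^sub>m k *\<^sub>v x) \<bullet> (Q *\<^sub>v (Z ^\<^sub>m k *\<^sub>v y)))
      = x \<bullet> (X *\<^sub>v y) - (Z ^\<^sub>m K *\<^sub>v x) \<bullet> (X *\<^sub>v (Z ^\<^sub>m K *\<^sub>v y))" for K
  proof (induction K)
    case 0
    show ?case using Z x y by simp
  next
    case (Suc K)
    have "(Z ^\<^sub>m K *\<^sub>v x) \<bullet> (X *\<^sub>v (Z ^\<^sub>m K *\<^sub>v y)) = (Z ^\<^sub>m K *\<^sub>v x) \<bullet> (Q *\<^sub>v (Z ^\<^sub>m K *\<^sub>v y))
        + (Z ^\<^sub>m Suc K *\<^sub>v x) \<bullet> (X *\<^sub>v (Z ^\<^sub>m Suc K *\<^sub>v y))"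
      using stein[unfolded stein_def, rule_format, OF pow_mat_mult_vec_carrier[OF Z x] pow_mat_mult_vec_carrier[OF Z y]]
      unfolding ZS[OF x] ZS[OF y] .
    then show ?case using Suc by simp
  qed
  then show ?thesis
    unfolding sums_def using tendsto_diff[OF tendsto_const[of "x \<bullet> (X *\<^sub>v y)"] schur_stable_sums(1)[OF Z ev X x y]]
    by simp
qed

text \<open>The solution is the series of \<open>(Z^k)\<^sup>T * Q * Z^k\<close>, defined entrywise
  as scalar series on unit vectors and extended by bilinearity. Splitting off the term for k = 0
  reproduces the equation, since the rest of the series is the same series at the images under
  \<open>Z\<close>.\<close>

lemma stein_solution_exists:
  assumes Z: "Z \<in> carrier_mat n n" and ev: "\<forall>s. eigenvalue (cmat Z) s \<longrightarrow> cmod s < 1"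
    and Q: "Q \<in> carrier_mat n n"
  shows "\<exists>X \<in> carrier_mat n n. stein n Z Q X"
proof -
  define f where "f k x y = (Z ^\<^sub>m k *\<^sub>v x) \<bullet> (Q *\<^sub>v (Z ^\<^sub>m k *\<^sub>v y))" for k x y
  define X where "X = mat n n (\<lambda>(i, j). suminf (\<lambda>k. f k (unit_vec n i) (unit_vec n j)))"
  have X: "X \<in> carrier_mat n n" unfolding X_def by simp
  have summ: "summable (\<lambda>k. f k x y)" if "x \<in> carrier_vec n" "y \<in> carrier_vec n" for x y
    unfolding f_def by (rule schur_stable_sums(2)[OF Z ev Q that])
  have f_expand: "f k x y = (\<Sum>i<n. \<Sum>j<n. x $ i * y $ j * f k (unit_vec n i) (unit_vec n j))"
    if x: "x \<in> carrier_vec n" and y: "y \<in> carrier_vec n" for k x y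
  proof -
    define G where "G = (Z ^\<^sub>m k)\<^sup>T * (Q * Z ^\<^sub>m k)"
    have P: "Z ^\<^sub>m k \<in> carrier_mat n n" using Z by simp
    have QP: "Q * Z ^\<^sub>m k \<in> carrier_mat n n" using P Q by simp
    have PT: "(Z ^\<^sub>m k)\<^sup>T \<in> carrier_mat n n" using P by simp
    have G: "G \<in> carrier_mat n n" unfolding G_def using PT QP by (rule mult_carrier_mat)
    have fG: "f k a b = a \<bullet> (G *\<^sub>v b)" if a: "a \<in> carrier_vec n" and b: "b \<in> carrier_vec n" for a b
    proof -
      have "G *\<^sub>v b = (Z ^\<^sub>m k)\<^sup>T *\<^sub>v (Q *\<^sub>v (Z ^\<^sub>m k *\<^sub>v b))"
        unfolding G_def using assoc_mult_mat_vec[OF PT QP b] assoc_mult_mat_vec[OF Q P b] by simp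
      then have "a \<bullet> (G *\<^sub>v b) = ((Z ^\<^sub>m k)\<^sup>T\<^sup>T *\<^sub>v a) \<bullet> (Q *\<^sub>v (Z ^\<^sub>m k *\<^sub>v b))"
        using adjoint_scalar_prod[OF PT a mult_mat_vec_carrier[OF Q mult_mat_vec_carrier[OF P b]]] by simp
      then show ?thesis unfolding f_def by simp
    qed
    have "G $$ (i, j) = f k (unit_vec n i) (unit_vec n j)" if "i < n" "j < n" for i j
      using that G by (simp add: fG mult_unit_vec[OF G] scalar_prod_left_unit[OF col_carrier_vec[OF _ G]])
    moreover have "f k x y = (\<Sum>i<n. \<Sum>j<n. x $ i * y $ j * G $$ (i, j))"
      unfolding fG[OF x y] by (rule bilinear_form_expand[OF G x y])
    ultimately show ?thesis by simp
  qed
  have Xf: "x \<bullet> (X *\<^sub>v y) = suminf (\<lambda>k. f k x y)" if x: "x \<in> carrier_vec n" and y: "y \<in> carrier_vec n" for x y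
  proof -
    have "(\<lambda>k. f k x y) sums (\<Sum>i<n. \<Sum>j<n. x $ i * y $ j * X $$ (i, j))"
      unfolding f_expand[OF x y] X_def
      by (intro sums_sum sums_mult) (auto intro!: summable_sums summ)
    moreover have "x \<bullet> (X *\<^sub>v y) = (\<Sum>i<n. \<Sum>j<n. x $ i * y $ j * X $$ (i, j))"
      by (rule bilinear_form_expand[OF X x y])
    ultimately show ?thesis by (simp add: sums_iff)
  qed
  have "stein n Z Q X"
    unfolding stein_def
  proof (intro ballI)
    fix x y :: "real vec" assume x: "x \<in> carrier_vec n" and y: "y \<in> carrier_vec n"
    have "suminf (\<lambda>k. f k x y) = suminf (\<lambda>k. f (Suc k) x y) + f 0 x y"
      using suminf_split_head[OF summ[OF x y]] by simp
    also have "(\<lambda>k. f (Suc k) x y) = (\<lambda>k. f k (Z *\<^sub>v x) (Z *\<^sub>v y))"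
      unfolding f_def pow_mat_Suc_mult_vec[OF Z x] pow_mat_Suc_mult_vec[OF Z y] ..
    finally show "x \<bullet> (X *\<^sub>v y) = x \<bullet> (Q *\<^sub>v y) + (Z *\<^sub>v x) \<bullet> (X *\<^sub>v (Z *\<^sub>v y))"
      using Xf x y Z by (simp add: f_def)
  qed
  then show ?thesis using X by blast
qed

section \<open>Quadratic forms and the Lyapunov equation\<close>

lemma form_linear:
  fixes X :: "'a :: field mat"
  assumes X: "X \<in> carrier_mat m n"
  shows form_add_left: "\<lbrakk>a \<in> carrier_vec m; b \<in> carrier_vec m; y \<in> carrier_vec n\<rbrakk> \<Longrightarrow>
      (a + b) \<bullet> (X *\<^sub>v y) = a \<bullet> (X *\<^sub>v y) + b \<bullet> (X *\<^sub>v y)"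
    and form_diff_left: "\<lbrakk>a \<in> carrier_vec m; b \<in> carrier_vec m; y \<in> carrier_vec n\<rbrakk> \<Longrightarrow>
      (a - b) \<bullet> (X *\<^sub>v y) = a \<bullet> (X *\<^sub>v y) - b \<bullet> (X *\<^sub>v y)"
    and form_smult_left: "\<lbrakk>a \<in> carrier_vec m; y \<in> carrier_vec n\<rbrakk> \<Longrightarrow>
      (c \<cdot>\<^sub>v a) \<bullet> (X *\<^sub>v y) = c * (a \<bullet> (X *\<^sub>v y))"
    and form_add_right: "\<lbrakk>a \<in> carrier_vec m; y \<in> carrier_vec n; z \<in> carrier_vec n\<rbrakk> \<Longrightarrow>
      a \<bullet> (X *\<^sub>v (y + z)) = a \<bullet> (X *\<^sub>v y) + a \<bullet> (X *\<^sub>v z)"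
    and form_diff_right: "\<lbrakk>a \<in> carrier_vec m; y \<in> carrier_vec n; z \<in> carrier_vec n\<rbrakk> \<Longrightarrow>
      a \<bullet> (X *\<^sub>v (y - z)) = a \<bullet> (X *\<^sub>v y) - a \<bullet> (X *\<^sub>v z)"
    and form_smult_right: "\<lbrakk>a \<in> carrier_vec m; y \<in> carrier_vec n\<rbrakk> \<Longrightarrow>
      a \<bullet> (X *\<^sub>v (c \<cdot>\<^sub>v y)) = c * (a \<bullet> (X *\<^sub>v y))"
proof -
  have c: "X *\<^sub>v y \<in> carrier_vec m" if "y \<in> carrier_vec n" for y using X that by simp
  show "\<lbrakk>a \<in> carrier_vec m; b \<in> carrier_vec m; y \<in> carrier_vec n\<rbrakk> \<Longrightarrow>
      (a + b) \<bullet> (X *\<^sub>v y) = a \<bullet> (X *\<^sub>v y) + b \<bullet> (X *\<^sub>v y)"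
    using add_scalar_prod_distrib[of a m b "X *\<^sub>v y"] c by simp
  show "\<lbrakk>a \<in> carrier_vec m; b \<in> carrier_vec m; y \<in> carrier_vec n\<rbrakk> \<Longrightarrow>
      (a - b) \<bullet> (X *\<^sub>v y) = a \<bullet> (X *\<^sub>v y) - b \<bullet> (X *\<^sub>v y)"
    using minus_scalar_prod_distrib[of a m b "X *\<^sub>v y"] c by simp
  show "\<lbrakk>a \<in> carrier_vec m; y \<in> carrier_vec n\<rbrakk> \<Longrightarrow> (c \<cdot>\<^sub>v a) \<bullet> (X *\<^sub>v y) = c * (a \<bullet> (X *\<^sub>v y))"
    using smult_scalar_prod_distrib[of a m "X *\<^sub>v y"] c by simp
  show "\<lbrakk>a \<in> carrier_vec m; y \<in> carrier_vec n; z \<in> carrier_vec n\<rbrakk> \<Longrightarrow>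
      a \<bullet> (X *\<^sub>v (y + z)) = a \<bullet> (X *\<^sub>v y) + a \<bullet> (X *\<^sub>v z)"
    using scalar_prod_add_distrib[OF _ c c, of a] mult_add_distrib_mat_vec[OF X] by simp
  show "\<lbrakk>a \<in> carrier_vec m; y \<in> carrier_vec n; z \<in> carrier_vec n\<rbrakk> \<Longrightarrow>
      a \<bullet> (X *\<^sub>v (y - z)) = a \<bullet> (X *\<^sub>v y) - a \<bullet> (X *\<^sub>v z)"
    using scalar_prod_minus_distrib[OF _ c c, of a] mult_minus_distrib_mat_vec[OF X] by simp
  show "\<lbrakk>a \<in> carrier_vec m; y \<in> carrier_vec n\<rbrakk> \<Longrightarrow> a \<bullet> (X *\<^sub>v (c \<cdot>\<^sub>v y)) = c * (a \<bullet> (X *\<^sub>v y))"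
    using scalar_prod_smult_distrib[of a m "X *\<^sub>v y"] mult_mat_vec[OF X] c by simp
qed

lemma form_sym:
  fixes X :: "'a :: comm_ring_1 mat"
  assumes "X \<in> carrier_mat n n" "X\<^sup>T = X" "a \<in> carrier_vec n" "b \<in> carrier_vec n"
  shows "a \<bullet> (X *\<^sub>v b) = b \<bullet> (X *\<^sub>v a)"
  using adjoint_scalar_prod[OF assms(1,3,4)] assms
  by (simp add: comm_scalar_prod[of "X *\<^sub>v a" n b])

text \<open>A zero of a semidefinite form is a minimum. If the gradient direction
  \<open>u = X *\<^sub>v w\<close> were nonzero, a small step against it would make the form
  negative.\<close>

lemma psd_kernel:
  fixes X :: "real mat"
  assumes X: "X \<in> carrier_mat n n" "X\<^sup>T = X" and psd: "\<And>w. w \<in> carrier_vec n \<Longrightarrow> 0 \<le> w \<bullet> (X *\<^sub>v w)"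
    and w: "w \<in> carrier_vec n" "w \<bullet> (X *\<^sub>v w) = 0"
  shows "X *\<^sub>v w = 0\<^sub>v n"
proof (rule ccontr)
  define u where "u = X *\<^sub>v w"
  assume "X *\<^sub>v w \<noteq> 0\<^sub>v n"
  moreover have u: "u \<in> carrier_vec n" unfolding u_def using X w by simp
  ultimately have d: "0 < u \<bullet> u" unfolding u_def by (intro scalar_prod_self_pos)
  \<comment> \<open>The form at \<open>w - t u\<close> is t (t c - 2 d). The step length keeps t c
    below d, and adding 1 keeps the denominator positive when c = 0.\<close>
  define d c t where "d = u \<bullet> u" and "c = u \<bullet> (X *\<^sub>v u)" and "t = d / (c + 1)"
  have c: "0 \<le> c" unfolding c_def using psd u by simp
  have tu: "t \<cdot>\<^sub>v u \<in> carrier_vec n" "w - t \<cdot>\<^sub>v u \<in> carrier_vec n" using u w by auto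
  have "u \<bullet> (X *\<^sub>v w) = d" unfolding d_def u_def ..
  moreover have "w \<bullet> (X *\<^sub>v u) = d" using form_sym[OF X w(1) u] calculation by simp
  ultimately have "(w - t \<cdot>\<^sub>v u) \<bullet> (X *\<^sub>v (w - t \<cdot>\<^sub>v u)) = t * (t * c) - 2 * t * d"
    using w u tu by (simp add: form_linear[OF X(1)] c_def[symmetric] algebra_simps)
  moreover have "t * c < 2 * d"
    unfolding t_def using c d unfolding d_def[symmetric] by (simp add: field_simps add_nonneg_pos)
  moreover have "0 < t" unfolding t_def using c d unfolding d_def[symmetric] by simp
  ultimately have "(w - t \<cdot>\<^sub>v u) \<bullet> (X *\<^sub>v (w - t \<cdot>\<^sub>v u)) < 0"
    using mult_strict_left_mono[of "t * c" "2 * d" t] by simp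
  then show False using psd[OF tu(2)] by simp
qed

definition hurwitz :: "real mat \<Rightarrow> bool" where
  "hurwitz M \<longleftrightarrow> (\<forall>s. eigenvalue (cmat M) s \<longrightarrow> Re s < 0)"

text \<open>Weak form of the Lyapunov equation; \<open>lyap_iff\<close> connects it with the matrix
  equation.\<close>

definition lyap :: "nat \<Rightarrow> real mat \<Rightarrow> real mat \<Rightarrow> real mat \<Rightarrow> bool" where
  "lyap n M Q X \<longleftrightarrow> (\<forall>x \<in> carrier_vec n. \<forall>y \<in> carrier_vec n.
     (M *\<^sub>v x) \<bullet> (X *\<^sub>v y) + x \<bullet> (X *\<^sub>v (M *\<^sub>v y)) + x \<bullet> (Q *\<^sub>v y) = 0)"

lemma lyap_iff:
  assumes M: "M \<in> carrier_mat n n" and Q: "Q \<in> carrier_mat n n" and X: "X \<in> carrier_mat n n"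
  shows "M\<^sup>T * X + X * M + Q = 0\<^sub>m n n \<longleftrightarrow> lyap n M Q X"
proof -
  have MT: "M\<^sup>T \<in> carrier_mat n n" using M by simp
  have c: "M\<^sup>T * X \<in> carrier_mat n n" "X * M \<in> carrier_mat n n" "M\<^sup>T * X + X * M \<in> carrier_mat n n"
    "M\<^sup>T * X + X * M + Q \<in> carrier_mat n n"
    using mult_carrier_mat[OF MT X] mult_carrier_mat[OF X M] Q by auto
  have "x \<bullet> ((M\<^sup>T * X + X * M + Q) *\<^sub>v y) =
     (M *\<^sub>v x) \<bullet> (X *\<^sub>v y) + x \<bullet> (X *\<^sub>v (M *\<^sub>v y)) + x \<bullet> (Q *\<^sub>v y)"
    if x: "x \<in> carrier_vec n" and y: "y \<in> carrier_vec n" for x y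
  proof -
    have "(M\<^sup>T * X + X * M + Q) *\<^sub>v y = M\<^sup>T *\<^sub>v (X *\<^sub>v y) + X *\<^sub>v (M *\<^sub>v y) + Q *\<^sub>v y"
      unfolding add_mult_distrib_mat_vec[OF c(3) Q y] add_mult_distrib_mat_vec[OF c(1,2) y]
        assoc_mult_mat_vec[OF MT X y] assoc_mult_mat_vec[OF X M y] ..
    moreover have "x \<bullet> (M\<^sup>T *\<^sub>v (X *\<^sub>v y)) = (M *\<^sub>v x) \<bullet> (X *\<^sub>v y)"
      using adjoint_scalar_prod[OF MT x, of "X *\<^sub>v y"] X y by simp
    ultimately show ?thesis
      using scalar_prod_add_distrib[of x n] x y M X Q MT by (simp add: mult_mat_vec_carrier[OF X] mult_mat_vec_carrier[OF M])
  qed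
  then show ?thesis
    unfolding lyap_def using bilinear_eqI[OF c(4) zero_carrier_mat] by fastforce
qed

text \<open>With \<open>W = (M - 1)\<^sup>-\<^sup>1\<close>, the Cayley transform \<open>Z = (M + 1) W\<close> turns the Lyapunov equation for \<open>M\<close> into the
  Stein equation for \<open>Z\<close>.\<close>
lemma cayley_transform:
  assumes M: "M \<in> carrier_mat n n" and hur: "hurwitz M"
  obtains W Z where "W \<in> carrier_mat n n" "Z \<in> carrier_mat n n"
    "\<And>x. x \<in> carrier_vec n \<Longrightarrow> M *\<^sub>v (W *\<^sub>v x) - W *\<^sub>v x = x"
    "\<And>x. x \<in> carrier_vec n \<Longrightarrow> W *\<^sub>v (M *\<^sub>v x - x) = x"
    "\<And>x. x \<in> carrier_vec n \<Longrightarrow> Z *\<^sub>v x = M *\<^sub>v (W *\<^sub>v x) + W *\<^sub>v x"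
    "\<forall>s. eigenvalue (cmat Z) s \<longrightarrow> cmod s < 1"
proof -
  define K where "K = M - 1\<^sub>m n"
  have K: "K \<in> carrier_mat n n" unfolding K_def using minus_carrier_mat one_carrier_mat by blast
  have Kx: "K *\<^sub>v x = M *\<^sub>v x - x" if "x \<in> carrier_vec n" for x
    unfolding K_def using minus_mult_distrib_mat_vec[OF M one_carrier_mat that] that by simp
  \<comment> \<open>A kernel vector would be an eigenvector of \<open>M\<close> for the eigenvalue
    1, whose real part is not negative.\<close>
  have "inj_mat K"
  proof (rule inj_matI[OF K], rule ccontr)
    fix w :: "real vec" assume w: "w \<in> carrier_vec n" "K *\<^sub>v w = 0\<^sub>v n" "w \<noteq> 0\<^sub>v n"
    have "M *\<^sub>v w = K *\<^sub>v w + w" unfolding Kx[OF w(1)] using w M by (intro eq_vecI) auto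
    then have "M *\<^sub>v w = w" using w by simp
    then have "eigenvalue (cmat M) 1"
      unfolding eigenvalue_real_pair[OF M] using w by (intro bexI[of _ w] bexI[of _ "0\<^sub>v n"]) (auto simp: M)
    then show False using hur unfolding hurwitz_def by force
  qed
  note inv = minv_right_left[OF K this]
  define W where "W = minv K"
  have W: "W \<in> carrier_mat n n" unfolding W_def by (rule inv)
  have KW: "K * W = 1\<^sub>m n" "W * K = 1\<^sub>m n" unfolding W_def using inv by auto
  define L where "L = M + 1\<^sub>m n"
  have L: "L \<in> carrier_mat n n" unfolding L_def using M by simp
  define Z where "Z = L * W"
  have Z: "Z \<in> carrier_mat n n" unfolding Z_def using L W by simp
  have 1: "M *\<^sub>v (W *\<^sub>v x) - W *\<^sub>v x = x" if x: "x \<in> carrier_vec n" for x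
    using assoc_mult_mat_vec[OF K W x] Kx[OF mult_mat_vec_carrier[OF W x]] KW x by simp
  have 2: "W *\<^sub>v (M *\<^sub>v x - x) = x" if x: "x \<in> carrier_vec n" for x
    using assoc_mult_mat_vec[OF W K x] Kx[OF x] KW x by simp
  have Lx: "L *\<^sub>v x = M *\<^sub>v x + x" if x: "x \<in> carrier_vec n" for x
    unfolding L_def using add_mult_distrib_mat_vec[OF M one_carrier_mat that] that by simp
  have 3: "Z *\<^sub>v x = M *\<^sub>v (W *\<^sub>v x) + W *\<^sub>v x" if x: "x \<in> carrier_vec n" for x
    unfolding Z_def using assoc_mult_mat_vec[OF L W x] Lx[OF mult_mat_vec_carrier[OF W x]] by simp
  have cc: "cmat M \<in> carrier_mat n n" "cmat K \<in> carrier_mat n n" "cmat W \<in> carrier_mat n n" "cmat L \<in> carrier_mat n n"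
    using M K W L by auto
  have 4: "\<forall>s. eigenvalue (cmat Z) s \<longrightarrow> cmod s < 1"
  proof (intro allI impI)
    fix s assume "eigenvalue (cmat Z) s"
    then obtain w where w: "w \<in> carrier_vec n" "w \<noteq> 0\<^sub>v n" "cmat Z *\<^sub>v w = s \<cdot>\<^sub>v w"
      unfolding eigenvalue_def eigenvector_def using Z by auto
    define u where "u = cmat W *\<^sub>v w"
    have u: "u \<in> carrier_vec n" unfolding u_def using cc w by simp
    have cK: "cmat K = cmat M - 1\<^sub>m n" and cL: "cmat L = cmat M + 1\<^sub>m n"
      unfolding K_def L_def using M by (auto intro!: eq_matI)
    have "cmat K * cmat W = 1\<^sub>m n"
      using of_real_hom.mat_hom_mult[OF K W, where ?'a = complex] KW of_real_hom.mat_hom_one by metis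
    then have wu: "w = cmat K *\<^sub>v u"
      unfolding u_def using assoc_mult_mat_vec[OF cc(2,3) w(1)] w by simp
    then have wu: "w = cmat M *\<^sub>v u - u"
      unfolding cK using minus_mult_distrib_mat_vec[OF cc(1) one_carrier_mat u] u by simp
    have u0: "u \<noteq> 0\<^sub>v n" using wu w(2) cc by auto
    have "cmat Z = cmat L * cmat W" unfolding Z_def by (rule of_real_hom.mat_hom_mult[OF L W])
    then have "cmat Z *\<^sub>v w = cmat L *\<^sub>v u"
      unfolding u_def using assoc_mult_mat_vec[OF cc(4,3) w(1)] by simp
    then have Lu: "s \<cdot>\<^sub>v (cmat M *\<^sub>v u - u) = cmat M *\<^sub>v u + u"
      using w(3) wu unfolding cL using add_mult_distrib_mat_vec[OF cc(1) one_carrier_mat u] u by simp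
    have ent: "(s - 1) * (cmat M *\<^sub>v u) $ i = (s + 1) * u $ i" if i: "i < n" for i
    proof -
      have "(s \<cdot>\<^sub>v (cmat M *\<^sub>v u - u)) $ i = (cmat M *\<^sub>v u + u) $ i" using Lu by simp
      then have "s * ((cmat M *\<^sub>v u) $ i - u $ i) = (cmat M *\<^sub>v u) $ i + u $ i"
        using i u M by (simp del: index_mult_mat_vec)
      then show ?thesis by (simp add: algebra_simps del: index_mult_mat_vec)
    qed
    \<comment> \<open>For s = 1 the relation \<open>ent\<close> reads 0 = 2 u.\<close>
    have s1: "s \<noteq> 1"
    proof
      assume "s = 1"
      then have "u = 0\<^sub>v n" using ent u by (intro eq_vecI) (auto simp del: index_mult_mat_vec)
      then show False using u0 by simp
    qed
    have "cmat M *\<^sub>v u = ((s + 1) / (s - 1)) \<cdot>\<^sub>v u"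
    proof (rule eq_vecI)
      fix i assume "i < dim_vec (((s + 1) / (s - 1)) \<cdot>\<^sub>v u)"
      then have i: "i < n" using u by simp
      then show "(cmat M *\<^sub>v u) $ i = (((s + 1) / (s - 1)) \<cdot>\<^sub>v u) $ i"
        using ent[OF i] s1 u by (simp add: field_simps del: index_mult_mat_vec)
    qed (use u M in simp)
    \<comment> \<open>The Cayley map inverted. The real part of (s + 1) / (s - 1) is (|s|^2 - 1) /
      |s - 1|^2, so its sign tells on which side of the unit circle s lies.\<close>
    then have "eigenvalue (cmat M) ((s + 1) / (s - 1))"
      unfolding eigenvalue_def eigenvector_def using u u0 M by auto
    then have "Re ((s + 1) / (s - 1)) < 0" using hur unfolding hurwitz_def by blast
    then have lt: "((Re s + 1) * (Re s - 1) + Im s * Im s) / ((Re s - 1)\<^sup>2 + (Im s)\<^sup>2) < 0"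
      by (simp add: Re_divide)
    have "\<not> (0 \<le> (Re s + 1) * (Re s - 1) + Im s * Im s)"
    proof
      assume "0 \<le> (Re s + 1) * (Re s - 1) + Im s * Im s"
      then have "0 \<le> ((Re s + 1) * (Re s - 1) + Im s * Im s) / ((Re s - 1)\<^sup>2 + (Im s)\<^sup>2)"
        by (intro divide_nonneg_nonneg) auto
      then show False using lt by simp
    qed
    then have "(cmod s)\<^sup>2 < 1\<^sup>2" unfolding cmod_power2 by (simp add: power2_eq_square algebra_simps)
    then show "cmod s < 1" by (rule power_less_imp_less_base) simp
  qed
  show ?thesis by (rule that[OF W Z 1 2 3 4])
qed

text \<open>With x = (M - 1) a and y = (M + 1) a one has a = W x and y = Z x. The difference of the
  form of \<open>X\<close> at these two images of a equals -2 times the two terms of the Lyapunov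
  equation, which explains the factor 2 in \<open>Q'\<close>. As \<open>W\<close> is bijective, the
  translation works in both directions.\<close>

lemma lyap_stein:
  assumes M: "M \<in> carrier_mat n n" and hur: "hurwitz M" and Q: "Q \<in> carrier_mat n n"
  obtains W Z Q' where "Z \<in> carrier_mat n n" "Q' \<in> carrier_mat n n" "W \<in> carrier_mat n n"
    "\<forall>s. eigenvalue (cmat Z) s \<longrightarrow> cmod s < 1"
    "\<And>x. x \<in> carrier_vec n \<Longrightarrow> W *\<^sub>v x = 0\<^sub>v n \<Longrightarrow> x = 0\<^sub>v n"
    "\<And>x y. x \<in> carrier_vec n \<Longrightarrow> y \<in> carrier_vec n \<Longrightarrow> x \<bullet> (Q' *\<^sub>v y) = 2 * ((W *\<^sub>v x) \<bullet> (Q *\<^sub>v (W *\<^sub>v y)))"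
    "\<And>X. X \<in> carrier_mat n n \<Longrightarrow> stein n Z Q' X \<longleftrightarrow> lyap n M Q X"
proof -
  obtain W Z where W: "W \<in> carrier_mat n n" and Z: "Z \<in> carrier_mat n n"
    and MW: "\<And>x. x \<in> carrier_vec n \<Longrightarrow> M *\<^sub>v (W *\<^sub>v x) - W *\<^sub>v x = x"
    and WM: "\<And>x. x \<in> carrier_vec n \<Longrightarrow> W *\<^sub>v (M *\<^sub>v x - x) = x"
    and Zx: "\<And>x. x \<in> carrier_vec n \<Longrightarrow> Z *\<^sub>v x = M *\<^sub>v (W *\<^sub>v x) + W *\<^sub>v x"
    and st: "\<forall>s. eigenvalue (cmat Z) s \<longrightarrow> cmod s < 1"
    using cayley_transform[OF M hur] by metis
  define Q' where "Q' = 2 \<cdot>\<^sub>m (W\<^sup>T * (Q * W))"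
  have WT: "W\<^sup>T \<in> carrier_mat n n" and QW: "Q * W \<in> carrier_mat n n" using W Q by auto
  have WQW: "W\<^sup>T * (Q * W) \<in> carrier_mat n n" by (rule mult_carrier_mat[OF WT QW])
  have Q': "Q' \<in> carrier_mat n n" unfolding Q'_def using WQW by simp
  have form: "x \<bullet> (Q' *\<^sub>v y) = 2 * ((W *\<^sub>v x) \<bullet> (Q *\<^sub>v (W *\<^sub>v y)))"
    if x: "x \<in> carrier_vec n" and y: "y \<in> carrier_vec n" for x y
  proof -
    have "Q' *\<^sub>v y = 2 \<cdot>\<^sub>v (W\<^sup>T *\<^sub>v (Q *\<^sub>v (W *\<^sub>v y)))"
      unfolding Q'_def smult_mat_mult_vec[OF WQW y] assoc_mult_mat_vec[OF WT QW y] assoc_mult_mat_vec[OF Q W y] ..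
    moreover have c: "Q *\<^sub>v (W *\<^sub>v y) \<in> carrier_vec n" using Q W y by simp
    ultimately show ?thesis
      using adjoint_scalar_prod[OF WT x c] mult_mat_vec_carrier[OF WT c] x by simp
  qed
  have W0: "x = 0\<^sub>v n" if "x \<in> carrier_vec n" "W *\<^sub>v x = 0\<^sub>v n" for x
    using MW[OF that(1)] that M by simp
  have equiv: "stein n Z Q' X \<longleftrightarrow> lyap n M Q X" if X: "X \<in> carrier_mat n n" for X
  proof -
    have key: "(M *\<^sub>v a - a) \<bullet> (X *\<^sub>v (M *\<^sub>v b - b)) - (M *\<^sub>v a + a) \<bullet> (X *\<^sub>v (M *\<^sub>v b + b)) =
        - 2 * ((M *\<^sub>v a) \<bullet> (X *\<^sub>v b) + a \<bullet> (X *\<^sub>v (M *\<^sub>v b)))"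
      if "a \<in> carrier_vec n" "b \<in> carrier_vec n" for a b
      using that M by (simp add: form_linear[OF X])
    show ?thesis
    proof
      assume s: "stein n Z Q' X"
      show "lyap n M Q X" unfolding lyap_def
      proof (intro ballI)
        fix a b :: "real vec" assume a: "a \<in> carrier_vec n" and b: "b \<in> carrier_vec n"
        define x y where "x = M *\<^sub>v a - a" and "y = M *\<^sub>v b - b"
        have xy: "x \<in> carrier_vec n" "y \<in> carrier_vec n" unfolding x_def y_def using M a b by auto
        have Wxy: "W *\<^sub>v x = a" "W *\<^sub>v y = b" unfolding x_def y_def using WM a b by auto
        have "x \<bullet> (X *\<^sub>v y) = 2 * (a \<bullet> (Q *\<^sub>v b)) + (M *\<^sub>v a + a) \<bullet> (X *\<^sub>v (M *\<^sub>v b + b))"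
          using s[unfolded stein_def, rule_format, OF xy] form[OF xy] Zx[OF xy(1)] Zx[OF xy(2)] Wxy by simp
        then show "(M *\<^sub>v a) \<bullet> (X *\<^sub>v b) + a \<bullet> (X *\<^sub>v (M *\<^sub>v b)) + a \<bullet> (Q *\<^sub>v b) = 0"
          using key[OF a b] unfolding x_def[symmetric] y_def[symmetric] by simp
      qed
    next
      assume l: "lyap n M Q X"
      show "stein n Z Q' X" unfolding stein_def
      proof (intro ballI)
        fix x y :: "real vec" assume xy: "x \<in> carrier_vec n" "y \<in> carrier_vec n"
        define a b where "a = W *\<^sub>v x" and "b = W *\<^sub>v y"
        have ab: "a \<in> carrier_vec n" "b \<in> carrier_vec n" unfolding a_def b_def using W xy by auto
        show "x \<bullet> (X *\<^sub>v y) = x \<bullet> (Q' *\<^sub>v y) + (Z *\<^sub>v x) \<bullet> (X *\<^sub>v (Z *\<^sub>v y))"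
          using key[OF ab] l[unfolded lyap_def, rule_format, OF ab] form[OF xy] Zx[OF xy(1)] Zx[OF xy(2)]
            MW[OF xy(1)] MW[OF xy(2)] unfolding a_def[symmetric] b_def[symmetric] by simp
      qed
    qed
  qed
  show ?thesis by (rule that[OF Z Q' W st W0 form equiv])
qed

lemma lyapunov_exists:
  assumes "M \<in> carrier_mat n n" "hurwitz M" "Q \<in> carrier_mat n n"
  shows "\<exists>X \<in> carrier_mat n n. lyap n M Q X"
  by (rule lyap_stein[OF assms]) (metis stein_solution_exists)

text \<open>\<open>Q'\<close> inherits the symmetry of \<open>Q\<close>, so exchanging the two
  arguments changes no term of the series that represents \<open>X\<close>.\<close>

lemma lyapunov_symmetric:
  assumes "M \<in> carrier_mat n n" "hurwitz M" and Q: "Q \<in> carrier_mat n n" "Q\<^sup>T = Q"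
    and X: "X \<in> carrier_mat n n" "lyap n M Q X"
  shows "X\<^sup>T = X"
proof (rule lyap_stein[OF assms(1-3)])
  fix W Z Q'
  assume Z: "Z \<in> carrier_mat n n" "\<forall>s. eigenvalue (cmat Z) s \<longrightarrow> cmod s < 1"
    and Q': "Q' \<in> carrier_mat n n" and W: "W \<in> carrier_mat n n"
    and form: "\<And>x y. x \<in> carrier_vec n \<Longrightarrow> y \<in> carrier_vec n \<Longrightarrow> x \<bullet> (Q' *\<^sub>v y) = 2 * ((W *\<^sub>v x) \<bullet> (Q *\<^sub>v (W *\<^sub>v y)))"
    and equiv: "\<And>X. X \<in> carrier_mat n n \<Longrightarrow> stein n Z Q' X \<longleftrightarrow> lyap n M Q X"
  have "stein n Z Q' X" using equiv X by simp
  note sums = stein_sums[OF Z X(1) this]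
  have symQ': "x \<bullet> (Q' *\<^sub>v y) = y \<bullet> (Q' *\<^sub>v x)" if "x \<in> carrier_vec n" "y \<in> carrier_vec n" for x y
    unfolding form[OF that] form[OF that(2,1)] using form_sym[OF Q] W that by simp
  have XT: "X\<^sup>T \<in> carrier_mat n n" using X by simp
  show "X\<^sup>T = X"
  proof (rule bilinear_eqI[OF XT X(1)])
    fix x y :: "real vec" assume x: "x \<in> carrier_vec n" and y: "y \<in> carrier_vec n"
    have "(\<lambda>k. (Z ^\<^sub>m k *\<^sub>v x) \<bullet> (Q' *\<^sub>v (Z ^\<^sub>m k *\<^sub>v y))) = (\<lambda>k. (Z ^\<^sub>m k *\<^sub>v y) \<bullet> (Q' *\<^sub>v (Z ^\<^sub>m k *\<^sub>v x)))"
      using symQ' Z x y by simp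
    then have "x \<bullet> (X *\<^sub>v y) = y \<bullet> (X *\<^sub>v x)"
      using sums_unique2[OF sums[OF x y]] sums[OF y x] by simp
    also have "\<dots> = (X *\<^sub>v x) \<bullet> y" by (rule comm_scalar_prod[OF y]) (use X x in simp)
    also have "\<dots> = x \<bullet> (X\<^sup>T *\<^sub>v y)" using adjoint_scalar_prod[OF XT x y] by simp
    finally show "x \<bullet> (X\<^sup>T *\<^sub>v y) = x \<bullet> (X *\<^sub>v y)" by simp
  qed
qed

text \<open>The form of \<open>X\<close> is a series of nonnegative terms and dominates its term for
  k = 0, which is 2 (W w) . Q (W w). For definite \<open>Q\<close> and nonzero \<open>w\<close> that
  term is positive, as \<open>W\<close> is injective.\<close>

lemma lyapunov_psd:
  assumes "M \<in> carrier_mat n n" "hurwitz M" and Q: "Q \<in> carrier_mat n n"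
    and psd: "\<And>w. w \<in> carrier_vec n \<Longrightarrow> 0 \<le> w \<bullet> (Q *\<^sub>v w)"
    and X: "X \<in> carrier_mat n n" "lyap n M Q X" and w: "w \<in> carrier_vec n"
  shows "0 \<le> w \<bullet> (X *\<^sub>v w)"
    and "\<lbrakk>\<And>u. u \<in> carrier_vec n \<Longrightarrow> u \<noteq> 0\<^sub>v n \<Longrightarrow> 0 < u \<bullet> (Q *\<^sub>v u); w \<noteq> 0\<^sub>v n\<rbrakk> \<Longrightarrow> 0 < w \<bullet> (X *\<^sub>v w)"
proof -
  obtain W Z Q' where Z: "Z \<in> carrier_mat n n" and st: "\<forall>s. eigenvalue (cmat Z) s \<longrightarrow> cmod s < 1"
    and Q': "Q' \<in> carrier_mat n n" and W: "W \<in> carrier_mat n n"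
    and W0: "\<And>x. x \<in> carrier_vec n \<Longrightarrow> W *\<^sub>v x = 0\<^sub>v n \<Longrightarrow> x = 0\<^sub>v n"
    and form: "\<And>x y. x \<in> carrier_vec n \<Longrightarrow> y \<in> carrier_vec n \<Longrightarrow> x \<bullet> (Q' *\<^sub>v y) = 2 * ((W *\<^sub>v x) \<bullet> (Q *\<^sub>v (W *\<^sub>v y)))"
    and equiv: "\<And>X. X \<in> carrier_mat n n \<Longrightarrow> stein n Z Q' X \<longleftrightarrow> lyap n M Q X"
    using lyap_stein[OF assms(1-3)] by metis
  have "stein n Z Q' X" using equiv X by simp
  note sums = stein_sums[OF Z st X(1) this w w]
  let ?f = "\<lambda>k. (Z ^\<^sub>m k *\<^sub>v w) \<bullet> (Q' *\<^sub>v (Z ^\<^sub>m k *\<^sub>v w))"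
  have nn: "0 \<le> ?f k" for k
    using form[of "Z ^\<^sub>m k *\<^sub>v w" "Z ^\<^sub>m k *\<^sub>v w"] psd[of "W *\<^sub>v (Z ^\<^sub>m k *\<^sub>v w)"] Z W w by simp
  have "sum ?f {0} \<le> suminf ?f"
    by (rule sum_le_suminf) (use sums nn in \<open>auto simp: sums_iff\<close>)
  moreover have "suminf ?f = w \<bullet> (X *\<^sub>v w)" using sums by (simp add: sums_iff)
  moreover have "sum ?f {0} = 2 * ((W *\<^sub>v w) \<bullet> (Q *\<^sub>v (W *\<^sub>v w)))" using form[OF w w] Z w by simp
  ultimately have le: "2 * ((W *\<^sub>v w) \<bullet> (Q *\<^sub>v (W *\<^sub>v w))) \<le> w \<bullet> (X *\<^sub>v w)" by simp
  have Ww: "W *\<^sub>v w \<in> carrier_vec n" using W w by simp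
  show "0 \<le> w \<bullet> (X *\<^sub>v w)" using le psd[OF Ww] by simp
  show "0 < w \<bullet> (X *\<^sub>v w)" if "\<And>u. u \<in> carrier_vec n \<Longrightarrow> u \<noteq> 0\<^sub>v n \<Longrightarrow> 0 < u \<bullet> (Q *\<^sub>v u)" "w \<noteq> 0\<^sub>v n"
  proof -
    have "W *\<^sub>v w \<noteq> 0\<^sub>v n" using W0[OF w] that(2) by blast
    from that(1)[OF Ww this] show ?thesis using le by simp
  qed
qed

text \<open>Bass' method: solving \<open>(A + b)\<^sup>T W + W (A + b) = C\<^sup>T C\<close> with \<open>b\<close> large gives the gain \<open>W\<^sup>-\<^sup>1 C\<^sup>T\<close>.\<close>
lemma observer_gain_exists:
  fixes A C :: "real mat"
  assumes A: "A \<in> carrier_mat n n" and C: "C \<in> carrier_mat m n" and obs: "observable C A"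
  shows "\<exists>H \<in> carrier_mat n m. \<forall>s. eigenvalue (cmat (A - H * C)) s \<longrightarrow> Re s < - \<alpha>"
proof -
  have cA: "cmat A \<in> carrier_mat n n" using A by simp
  have "finite (cmod ` spectrum (cmat A))" using card_finite_spectrum(1)[OF cA] by simp
  then obtain B where B: "\<And>s. eigenvalue (cmat A) s \<Longrightarrow> cmod s \<le> B"
    unfolding spectrum_def using bdd_above_finite bdd_above_def by (metis image_eqI mem_Collect_eq)
  \<comment> \<open>Above the modulus of every eigenvalue of \<open>A\<close>, so that -(A + b) is
    Hurwitz, and above \<alpha>, because -b will bound the real parts of the closed loop. The
    absolute value of \<open>B\<close> covers the case without eigenvalues, where \<open>B\<close>
    may be negative.\<close>
  define b where "b = \<bar>B\<bar> + \<bar>\<alpha>\<bar> + 1"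
  define M where "M = - (A + b \<cdot>\<^sub>m 1\<^sub>m n)"
  have Ab: "A + b \<cdot>\<^sub>m 1\<^sub>m n \<in> carrier_mat n n" using A by simp
  have M: "M \<in> carrier_mat n n" unfolding M_def using Ab by simp
  have Mx: "M *\<^sub>v x = (- 1) \<cdot>\<^sub>v (A *\<^sub>v x) - b \<cdot>\<^sub>v x" if x: "x \<in> carrier_vec n" for x
  proof -
    have "M *\<^sub>v x = - ((A + b \<cdot>\<^sub>m 1\<^sub>m n) *\<^sub>v x)" unfolding M_def using x A by (intro uminus_mult_mat_vec) simp
    also have "(A + b \<cdot>\<^sub>m 1\<^sub>m n) *\<^sub>v x = A *\<^sub>v x + b \<cdot>\<^sub>v x"
      using add_mult_distrib_mat_vec[OF A _ x, of "b \<cdot>\<^sub>m 1\<^sub>m n"] smult_mat_mult_vec[OF one_carrier_mat x, of b] x by simp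
    finally show ?thesis using A x by (auto simp del: index_mult_mat_vec intro!: eq_vecI)
  qed
  have hur: "hurwitz M"
    unfolding hurwitz_def
  proof (intro allI impI)
    fix s assume "eigenvalue (cmat M) s"
    then have "eigenvalue (cmat (A + b \<cdot>\<^sub>m 1\<^sub>m n)) (- s)" unfolding M_def by (rule eigenvalue_uminus[OF Ab])
    then have "eigenvalue (cmat A) (- s - of_real b)" by (rule eigenvalue_shift[OF A])
    from B[OF this] have "\<bar>Re (- s - of_real b)\<bar> \<le> B" using abs_Re_le_cmod order_trans by blast
    then show "Re s < 0" unfolding b_def by simp
  qed
  have CT: "C\<^sup>T \<in> carrier_mat n m" using C by simp
  define Q where "Q = C\<^sup>T * C"
  have Q: "Q \<in> carrier_mat n n" unfolding Q_def by (rule mult_carrier_mat[OF CT C])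
  have Qf: "x \<bullet> (Q *\<^sub>v y) = (C *\<^sub>v x) \<bullet> (C *\<^sub>v y)" if x: "x \<in> carrier_vec n" and y: "y \<in> carrier_vec n" for x y
    unfolding Q_def assoc_mult_mat_vec[OF CT C y] using adjoint_scalar_prod[OF CT x, of "C *\<^sub>v y"] C y by simp
  have QT: "Q\<^sup>T = Q" unfolding Q_def using transpose_mult[OF CT C] by simp
  have Qpsd: "0 \<le> w \<bullet> (Q *\<^sub>v w)" if "w \<in> carrier_vec n" for w
    unfolding Qf[OF that that] by (rule scalar_prod_self_nonneg)
  obtain W where W: "W \<in> carrier_mat n n" and lyap: "lyap n M Q W"
    using lyapunov_exists[OF M hur Q] by blast
  have WT: "W\<^sup>T = W" by (rule lyapunov_symmetric[OF M hur Q QT W lyap])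
  have Wpsd: "0 \<le> w \<bullet> (W *\<^sub>v w)" if "w \<in> carrier_vec n" for w
    by (rule lyapunov_psd(1)[OF M hur Q Qpsd W lyap that])
  have eq: "x \<bullet> (W *\<^sub>v (A *\<^sub>v y)) + (A *\<^sub>v x) \<bullet> (W *\<^sub>v y) = (C *\<^sub>v x) \<bullet> (C *\<^sub>v y) - 2 * b * (x \<bullet> (W *\<^sub>v y))"
    if x: "x \<in> carrier_vec n" and y: "y \<in> carrier_vec n" for x y
    using lyap[unfolded lyap_def, rule_format, OF x y] A x y
    unfolding Mx[OF x] Mx[OF y] Qf[OF x y] by (simp add: form_linear[OF W])
  \<comment> \<open>By the equation, the kernel of \<open>W\<close> is annihilated by
    \<open>C\<close> and invariant under \<open>A\<close>; its vectors are unobservable.\<close>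
  have kerW: "w = 0\<^sub>v n" if w: "w \<in> carrier_vec n" and w0: "W *\<^sub>v w = 0\<^sub>v n" for w
  proof -
    have step: "C *\<^sub>v y = 0\<^sub>v m \<and> W *\<^sub>v (A *\<^sub>v y) = 0\<^sub>v n" if y: "y \<in> carrier_vec n" "W *\<^sub>v y = 0\<^sub>v n" for y
    proof -
      have Ay: "A *\<^sub>v y \<in> carrier_vec n" using A y by simp
      have Cy: "C *\<^sub>v y \<in> carrier_vec m" using C y by simp
      have "y \<bullet> (W *\<^sub>v (A *\<^sub>v y)) = 0" using form_sym[OF W WT y(1) Ay] y Ay by simp
      then have "(C *\<^sub>v y) \<bullet> (C *\<^sub>v y) = 0" using eq[OF y(1) y(1)] y Ay by simp
      then have C0: "C *\<^sub>v y = 0\<^sub>v m" using scalar_prod_self_eq_0 Cy by blast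
      have "x \<bullet> (W *\<^sub>v (A *\<^sub>v y)) = 0" if x: "x \<in> carrier_vec n" for x
        using eq[OF x y(1)] C0 y x A C by simp
      then have "(W *\<^sub>v (A *\<^sub>v y)) \<bullet> (W *\<^sub>v (A *\<^sub>v y)) = 0" using W Ay by simp
      then show ?thesis using scalar_prod_self_eq_0[of "W *\<^sub>v (A *\<^sub>v y)" n] W Ay C0 by simp
    qed
    have "W *\<^sub>v (A ^\<^sub>m k *\<^sub>v w) = 0\<^sub>v n" for k
    proof (induction k)
      case 0
      then show ?case using w0 w A by simp
    next
      case (Suc k)
      have "A ^\<^sub>m Suc k *\<^sub>v w = A *\<^sub>v (A ^\<^sub>m k *\<^sub>v w)"
        using pow_mat_add_mult_vec[OF A w, of 1 k] A by simp
      then show ?case using step[OF pow_mat_mult_vec_carrier[OF A w] Suc] by simp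
    qed
    then have "C *\<^sub>v (A ^\<^sub>m k *\<^sub>v w) = 0\<^sub>v m" for k
      using step[OF pow_mat_mult_vec_carrier[OF A w]] by blast
    then show ?thesis using obs[unfolded observable_iff[OF A C]] w by blast
  qed
  have Wpd: "0 < w \<bullet> (W *\<^sub>v w)" if "w \<in> carrier_vec n" "w \<noteq> 0\<^sub>v n" for w
    using Wpsd[OF that(1)] psd_kernel[OF W WT Wpsd that(1)] kerW[OF that(1)] that(2) by force
  have "inj_mat W" by (rule inj_matI[OF W]) (rule kerW)
  note inv = minv_right_left[OF W this]
  define H where "H = minv W * C\<^sup>T"
  have H: "H \<in> carrier_mat n m" unfolding H_def by (rule mult_carrier_mat[OF inv(1) CT])
  have HC: "H * C \<in> carrier_mat n n" by (rule mult_carrier_mat[OF H C])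
  have B: "A - H * C \<in> carrier_mat n n" using HC by (rule minus_carrier_mat)
  \<comment> \<open>The drift contributes half of |C w|^2 with the wrong sign; the output injection
    subtracts all of it, and a nonpositive remainder is left beside the term with -b.\<close>
  have Bw: "w \<bullet> (W *\<^sub>v ((A - H * C) *\<^sub>v w)) = - b * (w \<bullet> (W *\<^sub>v w)) - ((C *\<^sub>v w) \<bullet> (C *\<^sub>v w)) / 2"
    if w: "w \<in> carrier_vec n" for w
  proof -
    have Cw: "C *\<^sub>v w \<in> carrier_vec m" using C w by simp
    have Aw: "A *\<^sub>v w \<in> carrier_vec n" using A w by simp
    have HCw: "H *\<^sub>v (C *\<^sub>v w) \<in> carrier_vec n" using H Cw by simp
    have "(A - H * C) *\<^sub>v w = A *\<^sub>v w - H *\<^sub>v (C *\<^sub>v w)"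
      using minus_mult_distrib_mat_vec[OF A HC w] assoc_mult_mat_vec[OF H C w] by simp
    moreover have "W *\<^sub>v (H *\<^sub>v (C *\<^sub>v w)) = C\<^sup>T *\<^sub>v (C *\<^sub>v w)"
    proof -
      have "H *\<^sub>v (C *\<^sub>v w) = minv W *\<^sub>v (C\<^sup>T *\<^sub>v (C *\<^sub>v w))"
        unfolding H_def by (rule assoc_mult_mat_vec[OF inv(1) CT Cw])
      then have "W *\<^sub>v (H *\<^sub>v (C *\<^sub>v w)) = (W * minv W) *\<^sub>v (C\<^sup>T *\<^sub>v (C *\<^sub>v w))"
        using assoc_mult_mat_vec[OF W inv(1) mult_mat_vec_carrier[OF CT Cw]] by simp
      then show ?thesis unfolding inv(3) using CT Cw by simp
    qed
    moreover have "w \<bullet> (C\<^sup>T *\<^sub>v (C *\<^sub>v w)) = (C *\<^sub>v w) \<bullet> (C *\<^sub>v w)"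
      using adjoint_scalar_prod[OF CT w Cw] by simp
    ultimately have "w \<bullet> (W *\<^sub>v ((A - H * C) *\<^sub>v w)) = w \<bullet> (W *\<^sub>v (A *\<^sub>v w)) - (C *\<^sub>v w) \<bullet> (C *\<^sub>v w)"
      using form_diff_right[OF W w Aw HCw] by simp
    moreover have "2 * (w \<bullet> (W *\<^sub>v (A *\<^sub>v w))) = (C *\<^sub>v w) \<bullet> (C *\<^sub>v w) - 2 * b * (w \<bullet> (W *\<^sub>v w))"
      using eq[OF w w] form_sym[OF W WT Aw w] by simp
    ultimately show ?thesis by simp
  qed
  have "Re s < - \<alpha>" if ev: "eigenvalue (cmat (A - H * C)) s" for s
  proof -
    obtain u v where u: "u \<in> carrier_vec n" and v: "v \<in> carrier_vec n" and uv: "u \<noteq> 0\<^sub>v n \<or> v \<noteq> 0\<^sub>v n"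
      and Bu: "(A - H * C) *\<^sub>v u = Re s \<cdot>\<^sub>v u - Im s \<cdot>\<^sub>v v" and Bv: "(A - H * C) *\<^sub>v v = Im s \<cdot>\<^sub>v u + Re s \<cdot>\<^sub>v v"
      using ev[unfolded eigenvalue_real_pair[OF B]] by blast
    \<comment> \<open>The forms at the real and the imaginary part are added, so that the rotation
      terms with Im s cancel by symmetry of \<open>W\<close>.\<close>
    define S where "S = u \<bullet> (W *\<^sub>v u) + v \<bullet> (W *\<^sub>v v)"
    have S: "0 < S" unfolding S_def using Wpd[OF u] Wpd[OF v] Wpsd[OF u] Wpsd[OF v] uv
      by (cases "u = 0\<^sub>v n") (auto intro: add_pos_nonneg add_nonneg_pos)
    have "u \<bullet> (W *\<^sub>v ((A - H * C) *\<^sub>v u)) + v \<bullet> (W *\<^sub>v ((A - H * C) *\<^sub>v v)) = Re s * S"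
      unfolding Bu Bv S_def using u v form_sym[OF W WT u v] by (simp add: form_linear[OF W] algebra_simps)
    then have "Re s * S \<le> - b * S"
      unfolding Bw[OF u] Bw[OF v] S_def
      using scalar_prod_self_nonneg[of "C *\<^sub>v u"] scalar_prod_self_nonneg[of "C *\<^sub>v v"] by (simp add: algebra_simps)
    then have "Re s \<le> - b" using S mult_le_cancel_right_pos[OF S, of "Re s" "- b"] by blast
    then show ?thesis unfolding b_def by simp
  qed
  then show ?thesis using H by blast
qed

section \<open>Left null vectors of the Laplacian\<close>

lemma laplacian_carrier [simp]: "a \<in> carrier_mat N N \<Longrightarrow> laplacian N a \<in> carrier_mat N N"
  unfolding laplacian_def by (simp add: minus_carrier_mat)

lemma laplacian_entry:
  "\<lbrakk>a \<in> carrier_mat N N; i < N; j < N\<rbrakk> \<Longrightarrow>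
    laplacian N a $$ (i, j) = (if i = j then \<Sum>k<N. a $$ (i, k) else 0) - a $$ (i, j)"
  unfolding laplacian_def by (simp add: mat_diag_def)

text \<open>The condition \<open>f L = 0\<close> read as a balance: with every edge weight
  multiplied by the value of \<open>f\<close> at its head, the inflow of each node equals its
  outflow. A function instead of a vector makes sums and absolute values of null vectors easy to
  form.\<close>

definition left_null :: "nat \<Rightarrow> real mat \<Rightarrow> (nat \<Rightarrow> real) \<Rightarrow> bool" where
  "left_null N a f \<longleftrightarrow> (\<forall>j<N. f j * (\<Sum>k<N. a $$ (j, k)) = (\<Sum>i<N. f i * a $$ (i, j)))"

lemma sum_mult_laplacian:
  assumes a: "a \<in> carrier_mat N N" and j: "j < N"
  shows "(\<Sum>i<N. f i * laplacian N a $$ (i, j)) = f j * (\<Sum>k<N. a $$ (j, k)) - (\<Sum>i<N. f i * a $$ (i, j))"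
proof -
  have "(\<Sum>i<N. f i * laplacian N a $$ (i, j))
      = (\<Sum>i<N. (if i = j then f i * (\<Sum>k<N. a $$ (i, k)) else 0) - f i * a $$ (i, j))"
    using j by (intro sum.cong) (auto simp: laplacian_entry[OF a] algebra_simps)
  also have "\<dots> = f j * (\<Sum>k<N. a $$ (j, k)) - (\<Sum>i<N. f i * a $$ (i, j))"
    using j by (simp add: sum_subtractf)
  finally show ?thesis .
qed

lemma laplacian_weights_iff:
  assumes a: "a \<in> carrier_mat N N"
  shows "laplacian_weights N a r \<longleftrightarrow> r \<in> carrier_vec N \<and> (\<forall>i<N. 0 < r $ i) \<and>
    left_null N a (\<lambda>i. r $ i) \<and> (\<Sum>i<N. r $ i) = real N"
proof -
  have "mat_of_row r * laplacian N a = 0\<^sub>m 1 N \<longleftrightarrow> left_null N a (\<lambda>i. r $ i)" if r: "r \<in> carrier_vec N"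
  proof -
    have "(mat_of_row r * laplacian N a) $$ (0, j) =
      r $ j * (\<Sum>k<N. a $$ (j, k)) - (\<Sum>i<N. r $ i * a $$ (i, j))" if j: "j < N" for j
    proof -
      have "(mat_of_row r * laplacian N a) $$ (0, j) = (\<Sum>i<N. r $ i * laplacian N a $$ (i, j))"
        using j r laplacian_carrier[OF a] by (simp add: scalar_prod_def atLeast0LessThan)
      then show ?thesis using sum_mult_laplacian[OF a j] by simp
    qed
    then have "left_null N a (\<lambda>i. r $ i) \<longleftrightarrow> (\<forall>j<N. (mat_of_row r * laplacian N a) $$ (0, j) = 0)"
      unfolding left_null_def by simp
    also have "\<dots> \<longleftrightarrow> mat_of_row r * laplacian N a = 0\<^sub>m 1 N"
      using laplacian_carrier[OF a] by (auto simp del: index_mult_mat(1) intro!: eq_matI)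
    finally show ?thesis by simp
  qed
  then show ?thesis unfolding laplacian_weights_def by auto
qed

text \<open>At a zero of \<open>f\<close> the inflow is 0, so the outflow, a sum of nonnegative
  terms, is 0 as well. Thus \<open>f\<close> vanishes at the head of every outgoing edge, and strong
  connectivity carries the zero to all nodes.\<close>

lemma left_null_zero_propagates:
  assumes g: "weighted_digraph N a" and sc: "strongly_connected N a" and null: "left_null N a f"
    and nn: "\<And>i. i < N \<Longrightarrow> 0 \<le> f i" and j: "j < N" "f j = 0" and i: "i < N"
  shows "f i = 0"
proof -
  have step: "f l = 0" if "(k, l) \<in> edges N a" "f k = 0" for k l
  proof -
    have kl: "k < N" "l < N" "a $$ (l, k) \<noteq> 0" using that unfolding edges_def by auto
    have "(\<Sum>i<N. f i * a $$ (i, k)) = 0" using null kl that(2) unfolding left_null_def by force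
    then have "f l * a $$ (l, k) = 0"
      using sum_nonneg_eq_0_iff[of "{..<N}" "\<lambda>i. f i * a $$ (i, k)"] g nn kl
      unfolding weighted_digraph_def by auto
    then show ?thesis using kl by simp
  qed
  have reach: "f l = 0" if "(k, l) \<in> (edges N a)\<^sup>+" "f k = 0" for k l
    using that(1,2) by (induction rule: trancl_induct) (auto intro: step)
  show ?thesis
  proof (cases "i = j")
    case False
    then have "(j, i) \<in> (edges N a)\<^sup>+" using sc i j unfolding strongly_connected_def by auto
    then show ?thesis using reach j by blast
  qed (use j in simp)
qed

text \<open>A Perron-Frobenius argument. The triangle inequality makes the balance of the absolute
  values nonnegative at each node; summed over all nodes, every edge occurs once as inflow and once
  as outflow, so the total is 0 and no node has a gap.\<close>

lemma left_null_abs: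
  assumes g: "weighted_digraph N a" and null: "left_null N a f"
  shows "left_null N a (\<lambda>i. \<bar>f i\<bar>)"
proof -
  have a: "0 \<le> a $$ (i, j)" if "i < N" "j < N" for i j
    using g that unfolding weighted_digraph_def by simp
  define gap where "gap j = (\<Sum>i<N. \<bar>f i\<bar> * a $$ (i, j)) - \<bar>f j\<bar> * (\<Sum>k<N. a $$ (j, k))" for j
  have nn: "0 \<le> gap j" if j: "j < N" for j
  proof -
    have "\<bar>f j\<bar> * (\<Sum>k<N. a $$ (j, k)) = \<bar>f j * (\<Sum>k<N. a $$ (j, k))\<bar>"
      using sum_nonneg[of "{..<N}" "\<lambda>k. a $$ (j, k)"] a j by (simp add: abs_mult)
    also have "\<dots> = \<bar>\<Sum>i<N. f i * a $$ (i, j)\<bar>" using null j unfolding left_null_def by simp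
    also have "\<dots> \<le> (\<Sum>i<N. \<bar>f i * a $$ (i, j)\<bar>)" by (rule sum_abs)
    also have "\<dots> = (\<Sum>i<N. \<bar>f i\<bar> * a $$ (i, j))" using a j by (intro sum.cong) (auto simp: abs_mult)
    finally show ?thesis unfolding gap_def by simp
  qed
  have "(\<Sum>j<N. gap j) = 0"
    unfolding gap_def sum_subtractf by (subst sum.swap) (simp add: sum_distrib_left)
  then have "gap j = 0" if "j < N" for j
    using sum_nonneg_eq_0_iff[of "{..<N}" gap] nn that by auto
  then show ?thesis unfolding left_null_def gap_def by simp
qed

lemma left_null_scale: "left_null N a f \<Longrightarrow> left_null N a (\<lambda>i. c * f i)"
  unfolding left_null_def by (simp add: mult.assoc sum_distrib_left[symmetric])

lemma left_null_add: "\<lbrakk>left_null N a f; left_null N a h\<rbrakk> \<Longrightarrow> left_null N a (\<lambda>i. f i + h i)"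
  unfolding left_null_def by (simp add: distrib_right sum.distrib)

lemma left_null_cong: "(\<And>i. i < N \<Longrightarrow> f i = h i) \<Longrightarrow> left_null N a f = left_null N a h"
  unfolding left_null_def by simp

lemma left_null_abs_pos:
  assumes g: "weighted_digraph N a" and sc: "strongly_connected N a" and null: "left_null N a f"
    and nz: "\<exists>i<N. f i \<noteq> 0" and i: "i < N"
  shows "0 < \<bar>f i\<bar>"
proof (rule ccontr)
  assume "\<not> 0 < \<bar>f i\<bar>"
  then have "\<bar>f i\<bar> = 0" by simp
  with left_null_zero_propagates[OF g sc left_null_abs[OF g null] _ i] have "\<bar>f j\<bar> = 0" if "j < N" for j
    using that by simp
  then show False using nz by auto
qed

text \<open>The rows of the Laplacian sum to 0, so the all-ones vector makes its determinant vanish;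
  the transposed matrix is then singular too.\<close>

lemma left_null_vector_exists:
  assumes a: "a \<in> carrier_mat N N" and N: "0 < N"
  obtains f where "left_null N a f" "\<exists>i<N. f i \<noteq> 0"
proof -
  let ?L = "laplacian N a"
  note L = laplacian_carrier[OF a]
  define one where "one = vec N (\<lambda>_. 1 :: real)"
  have one: "one \<in> carrier_vec N" unfolding one_def by simp
  have "?L *\<^sub>v one = 0\<^sub>v N"
  proof (rule eq_vecI)
    fix i assume "i < dim_vec (0\<^sub>v N :: real vec)"
    then have i: "i < N" by simp
    have "(?L *\<^sub>v one) $ i = (\<Sum>j<N. (if i = j then \<Sum>k<N. a $$ (i, k) else 0) - a $$ (i, j))"
      unfolding mult_vec_entry[OF L one i] using i by (intro sum.cong) (auto simp: laplacian_entry[OF a] one_def)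
    also have "\<dots> = 0" using i by (simp add: sum_subtractf)
    finally show "(?L *\<^sub>v one) $ i = 0\<^sub>v N $ i" using i by simp
  qed (use L in simp)
  moreover have "one \<noteq> 0\<^sub>v N"
  proof
    assume "one = 0\<^sub>v N"
    then have "one $ 0 = 0\<^sub>v N $ 0" by simp
    then show False unfolding one_def using N by simp
  qed
  ultimately have "det ?L = 0" using det_0_iff_vec_prod_zero_field[OF L] one by blast
  then have "det ?L\<^sup>T = 0" using det_transpose[OF L] by simp
  then obtain r where r: "r \<in> carrier_vec N" "r \<noteq> 0\<^sub>v N" "?L\<^sup>T *\<^sub>v r = 0\<^sub>v N"
    using det_0_iff_vec_prod_zero_field[of "?L\<^sup>T" N] L by auto
  have LT: "?L\<^sup>T \<in> carrier_mat N N" using L by simp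
  have "left_null N a (\<lambda>i. r $ i)"
    unfolding left_null_def
  proof (intro allI impI)
    fix j assume j: "j < N"
    have "(\<Sum>i<N. r $ i * ?L $$ (i, j)) = (?L\<^sup>T *\<^sub>v r) $ j"
      unfolding mult_vec_entry[OF LT r(1) j] using j L by (intro sum.cong) auto
    then show "r $ j * (\<Sum>k<N. a $$ (j, k)) = (\<Sum>i<N. r $ i * a $$ (i, j))"
      using sum_mult_laplacian[OF a j, of "\<lambda>i. r $ i"] r(3) j by simp
  qed
  moreover have "\<exists>i<N. r $ i \<noteq> 0" using r(1,2) by (metis carrier_vecD eq_vecI index_zero_vec)
  ultimately show ?thesis using that by blast
qed

text \<open>The absolute value of any nonzero null vector is positive at each node and only needs to
  be normalized. Two solutions differ by a null vector with sum 0, and a nonzero null vector cannot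
  change sign.\<close>

lemma laplacian_weights_unique_exists:
  assumes g: "weighted_digraph N a" and sc: "strongly_connected N a"
  shows "\<exists>!r. laplacian_weights N a r"
proof -
  have a: "a \<in> carrier_mat N N" using g unfolding weighted_digraph_def by simp
  note iff = laplacian_weights_iff[OF a]
  show ?thesis
  proof (rule ex_ex1I)
    show "\<exists>r. laplacian_weights N a r"
    proof (cases "N = 0")
      case True
      then show ?thesis unfolding iff left_null_def by (intro exI[of _ "0\<^sub>v 0"]) auto
    next
      case False
      then obtain f where f: "left_null N a f" "\<exists>i<N. f i \<noteq> 0" using left_null_vector_exists[OF a] by auto
      define S where "S = (\<Sum>i<N. \<bar>f i\<bar>)"
      have pos: "0 < \<bar>f i\<bar>" if "i < N" for i using left_null_abs_pos[OF g sc f that] .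
      have S: "0 < S" unfolding S_def using False pos by (intro sum_pos) auto
      define r where "r = vec N (\<lambda>i. (real N / S) * \<bar>f i\<bar>)"
      have "left_null N a (\<lambda>i. r $ i)"
        using left_null_scale[OF left_null_abs[OF g f(1)], of "real N / S"]
        by (subst left_null_cong[of N _ "\<lambda>i. (real N / S) * \<bar>f i\<bar>"]) (auto simp: r_def)
      moreover have "(\<Sum>i<N. r $ i) = real N"
      proof -
        have "(\<Sum>i<N. r $ i) = (\<Sum>i<N. (real N / S) * \<bar>f i\<bar>)" unfolding r_def by (intro sum.cong) auto
        also have "\<dots> = (real N / S) * S" unfolding S_def by (rule sum_distrib_left[symmetric])
        finally show ?thesis using S by simp
      qed
      moreover have "\<forall>i<N. 0 < r $ i" using pos S False by (simp add: r_def)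
      ultimately show ?thesis unfolding iff by (intro exI[of _ r]) (simp add: r_def)
    qed
  next
    fix r s assume "laplacian_weights N a r" "laplacian_weights N a s"
    then have r: "r \<in> carrier_vec N" "left_null N a (\<lambda>i. r $ i)" "(\<Sum>i<N. r $ i) = real N"
      and s: "s \<in> carrier_vec N" "left_null N a (\<lambda>i. s $ i)" "(\<Sum>i<N. s $ i) = real N"
      unfolding iff by auto
    define q where "q i = r $ i + (- 1) * s $ i" for i
    have q: "left_null N a q" unfolding q_def by (intro left_null_add left_null_scale r s)
    have sum: "(\<Sum>i<N. q i) = 0" unfolding q_def using r s by (simp add: sum_subtractf)
    have "\<forall>i<N. q i = 0"
    proof (rule ccontr)
      assume "\<not> (\<forall>i<N. q i = 0)"
      then have nz: "\<exists>i<N. q i \<noteq> 0" by simp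
      then have N: "{..<N} \<noteq> {}" by auto
      have pos: "0 < \<bar>q i\<bar>" if "i < N" for i using left_null_abs_pos[OF g sc q nz that] .
      \<comment> \<open>Twice the positive part of \<open>q\<close>: a nonnegative null vector,
        which vanishes at all nodes or at none. In either case \<open>q\<close> has one strict sign,
        against its sum 0.\<close>
      have null: "left_null N a (\<lambda>i. \<bar>q i\<bar> + q i)" by (intro left_null_add left_null_abs[OF g] q)
      show False
      proof (cases "\<exists>j<N. \<bar>q j\<bar> + q j = 0")
        case True
        then obtain j where j: "j < N" "\<bar>q j\<bar> + q j = 0" by auto
        have "\<bar>q i\<bar> + q i = 0" if i: "i < N" for i
          by (rule left_null_zero_propagates[OF g sc null _ j i]) (simp add: abs_ge_minus_self add_increasing)
        then have neg: "q i < 0" if "i < N" for i using pos[OF that] that by fastforce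
        then have "(\<Sum>i<N. - q i) > 0" using N by (intro sum_pos) auto
        then show False using sum by (simp add: sum_negf)
      next
        case False
        then have "0 < q i" if "i < N" for i using that by (cases "0 \<le> q i") (use pos[OF that] in auto)
        then have "(\<Sum>i<N. q i) > 0" using N by (intro sum_pos) auto
        then show False using sum by simp
      qed
    qed
    then show "r = s" using r s by (intro eq_vecI) (auto simp: q_def)
  qed
qed

section \<open>Dissipation of the weighted Laplacian\<close>

definition sym_laplacian :: "nat \<Rightarrow> real mat \<Rightarrow> real vec \<Rightarrow> real mat" where
  "sym_laplacian N a r = weight_mat N r * laplacian N a + (laplacian N a)\<^sup>T * weight_mat N r"

lemma weight_mat_carrier [simp]: "weight_mat N r \<in> carrier_mat N N"
  unfolding weight_mat_def by simp

lemma weight_laplacian_entry: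
  assumes a: "a \<in> carrier_mat N N" and ij: "i < N" "j < N"
  shows "(weight_mat N r * laplacian N a) $$ (i, j) = r $ i * laplacian N a $$ (i, j)"
    and "((laplacian N a)\<^sup>T * weight_mat N r) $$ (i, j) = laplacian N a $$ (j, i) * r $ j"
proof -
  note L = laplacian_carrier[OF a]
  show "(weight_mat N r * laplacian N a) $$ (i, j) = r $ i * laplacian N a $$ (i, j)"
    unfolding weight_mat_def mat_diag_mult_left[OF L] using ij by simp
  have LT: "(laplacian N a)\<^sup>T \<in> carrier_mat N N" using L by simp
  show "((laplacian N a)\<^sup>T * weight_mat N r) $$ (i, j) = laplacian N a $$ (j, i) * r $ j"
    unfolding weight_mat_def mat_diag_mult_right[OF LT] using ij L by simp
qed

lemma sym_laplacian_carrier: "a \<in> carrier_mat N N \<Longrightarrow> sym_laplacian N a r \<in> carrier_mat N N"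
  unfolding sym_laplacian_def
  by (intro add_carrier_mat mult_carrier_mat[of _ N N]) simp_all

lemma sym_laplacian_entry:
  assumes a: "a \<in> carrier_mat N N" and ij: "i < N" "j < N"
  shows "sym_laplacian N a r $$ (i, j) = r $ i * laplacian N a $$ (i, j) + laplacian N a $$ (j, i) * r $ j"
proof -
  have "(laplacian N a)\<^sup>T * weight_mat N r \<in> carrier_mat N N"
    by (intro mult_carrier_mat[of _ N N]) (use a in simp_all)
  then show ?thesis
    unfolding sym_laplacian_def using weight_laplacian_entry[OF a ij] ij
    by (subst index_add_mat(1)) (auto simp del: index_mult_mat(1))
qed

text \<open>Expanding (x_i - x_j)^2 produces squares at the heads and at the tails of the edges. The
  row sums \<open>d\<close> account for the heads, the balance of the weights \<open>r\<close> for
  the tails, so that together they give the doubled diagonal of the Laplacian form.\<close>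

lemma laplacian_dissipation:
  assumes a: "a \<in> carrier_mat N N" and null: "left_null N a (\<lambda>i. r $ i)"
  shows "(\<Sum>i<N. \<Sum>j<N. sym_laplacian N a r $$ (i, j) * (x i * x j))
    = (\<Sum>i<N. \<Sum>j<N. r $ i * a $$ (i, j) * (x i - x j)\<^sup>2)"
proof -
  let ?L = "laplacian N a"
  define d where "d i = (\<Sum>k<N. a $$ (i, k))" for i
  have Lrow: "(\<Sum>j<N. ?L $$ (i, j) * x j) = d i * x i - (\<Sum>j<N. a $$ (i, j) * x j)" if i: "i < N" for i
  proof -
    have "(\<Sum>j<N. ?L $$ (i, j) * x j) = (\<Sum>j<N. (if i = j then d i * x j else 0) - a $$ (i, j) * x j)"
      using i by (intro sum.cong) (auto simp: laplacian_entry[OF a] d_def algebra_simps)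
    then show ?thesis using i by (simp add: sum_subtractf)
  qed
  have "(\<Sum>i<N. \<Sum>j<N. sym_laplacian N a r $$ (i, j) * (x i * x j))
      = (\<Sum>i<N. \<Sum>j<N. r $ i * ?L $$ (i, j) * (x i * x j)) + (\<Sum>i<N. \<Sum>j<N. ?L $$ (j, i) * r $ j * (x i * x j))"
    by (simp add: sym_laplacian_entry[OF a] distrib_right sum.distrib)
  also have "(\<Sum>i<N. \<Sum>j<N. ?L $$ (j, i) * r $ j * (x i * x j)) = (\<Sum>i<N. \<Sum>j<N. r $ i * ?L $$ (i, j) * (x i * x j))"
    by (subst sum.swap) (simp add: mult_ac)
  finally have "(\<Sum>i<N. \<Sum>j<N. sym_laplacian N a r $$ (i, j) * (x i * x j))
      = 2 * (\<Sum>i<N. r $ i * x i * (\<Sum>j<N. ?L $$ (i, j) * x j))"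
    by (simp add: sum_distrib_left mult_ac)
  also have "\<dots> = 2 * (\<Sum>i<N. r $ i * x i * (d i * x i - (\<Sum>j<N. a $$ (i, j) * x j)))"
    using Lrow by simp
  also have "\<dots> = 2 * (\<Sum>i<N. r $ i * d i * (x i)\<^sup>2) - 2 * (\<Sum>i<N. \<Sum>j<N. r $ i * a $$ (i, j) * (x i * x j))"
    by (simp add: right_diff_distrib sum_subtractf sum_distrib_left power2_eq_square mult_ac)
  finally have 1: "(\<Sum>i<N. \<Sum>j<N. sym_laplacian N a r $$ (i, j) * (x i * x j))
    = 2 * (\<Sum>i<N. r $ i * d i * (x i)\<^sup>2) - 2 * (\<Sum>i<N. \<Sum>j<N. r $ i * a $$ (i, j) * (x i * x j))" .
  have "(\<Sum>i<N. \<Sum>j<N. r $ i * a $$ (i, j) * (x i - x j)\<^sup>2)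
      = (\<Sum>i<N. \<Sum>j<N. r $ i * a $$ (i, j) * (x i)\<^sup>2) + (\<Sum>i<N. \<Sum>j<N. r $ i * a $$ (i, j) * (x j)\<^sup>2)
        - 2 * (\<Sum>i<N. \<Sum>j<N. r $ i * a $$ (i, j) * (x i * x j))"
    by (simp add: power2_diff algebra_simps sum.distrib sum_subtractf sum_distrib_left)
  moreover have "(\<Sum>i<N. \<Sum>j<N. r $ i * a $$ (i, j) * (x i)\<^sup>2) = (\<Sum>i<N. r $ i * d i * (x i)\<^sup>2)"
    by (simp add: d_def sum_distrib_left sum_distrib_right mult_ac)
  moreover have "(\<Sum>i<N. \<Sum>j<N. r $ i * a $$ (i, j) * (x j)\<^sup>2) = (\<Sum>j<N. (\<Sum>i<N. r $ i * a $$ (i, j)) * (x j)\<^sup>2)"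
    by (subst sum.swap) (simp add: sum_distrib_right)
  \<comment> \<open>Here the weights enter as a left null vector: the weighted column sums become
    weighted row sums.\<close>
  moreover have "(\<Sum>j<N. (\<Sum>i<N. r $ i * a $$ (i, j)) * (x j)\<^sup>2) = (\<Sum>i<N. r $ i * d i * (x i)\<^sup>2)"
    using null unfolding left_null_def d_def by (intro sum.cong) auto
  ultimately show ?thesis using 1 by simp
qed

lemma laplacian_dissipation_vec:
  assumes a: "a \<in> carrier_mat N N" and null: "left_null N a (\<lambda>i. r $ i)"
    and w: "\<And>i. i < N \<Longrightarrow> w i \<in> carrier_vec n"
  shows "(\<Sum>i<N. \<Sum>j<N. sym_laplacian N a r $$ (i, j) * (w i \<bullet> w j))
    = (\<Sum>i<N. \<Sum>j<N. r $ i * a $$ (i, j) * (\<Sum>k<n. (w i $ k - w j $ k)\<^sup>2))"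
proof -
  have wd: "dim_vec (w i) = n" if "i < N" for i using w[OF that] by simp
  have "(\<Sum>i<N. \<Sum>j<N. sym_laplacian N a r $$ (i, j) * (w i \<bullet> w j))
    = (\<Sum>i<N. \<Sum>j<N. \<Sum>k<n. sym_laplacian N a r $$ (i, j) * (w i $ k * w j $ k))"
    by (intro sum.cong) (auto simp: wd scalar_prod_def atLeast0LessThan sum_distrib_left)
  also have "\<dots> = (\<Sum>k<n. \<Sum>i<N. \<Sum>j<N. sym_laplacian N a r $$ (i, j) * (w i $ k * w j $ k))"
    by (subst sum.swap[of _ "{..<N}" "{..<n}", symmetric]) (simp add: sum.swap[of _ "{..<n}" "{..<N}"])
  also have "\<dots> = (\<Sum>k<n. \<Sum>i<N. \<Sum>j<N. r $ i * a $$ (i, j) * (w i $ k - w j $ k)\<^sup>2)"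
    by (simp only: laplacian_dissipation[OF a null, of "\<lambda>i. w i $ _"])
  also have "\<dots> = (\<Sum>i<N. \<Sum>j<N. \<Sum>k<n. r $ i * a $$ (i, j) * (w i $ k - w j $ k)\<^sup>2)"
    by (subst sum.swap[of _ "{..<N}" "{..<n}", symmetric]) (simp add: sum.swap[of _ "{..<n}" "{..<N}"])
  finally show ?thesis by (simp add: sum_distrib_left)
qed

lemma double_sum_nonneg_eq_0:
  fixes f :: "nat \<Rightarrow> nat \<Rightarrow> real"
  assumes nn: "\<And>i j. i < N \<Longrightarrow> j < N \<Longrightarrow> 0 \<le> f i j" and zero: "(\<Sum>i<N. \<Sum>j<N. f i j) = 0"
    and ij: "i < N" "j < N"
  shows "f i j = 0"
proof -
  have "0 \<le> (\<Sum>j<N. f i j)" if "i < N" for i using nn[OF that] by (intro sum_nonneg) auto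
  then have "\<forall>i\<in>{..<N}. (\<Sum>j<N. f i j) = 0" using zero by (subst (asm) sum_nonneg_eq_0_iff) auto
  then have "(\<Sum>j<N. f i j) = 0" using ij by simp
  then have "\<forall>j\<in>{..<N}. f i j = 0" using nn ij by (subst (asm) sum_nonneg_eq_0_iff) auto
  then show ?thesis using ij by simp
qed

lemma consensus_if_no_dissipation:
  assumes g: "weighted_digraph N a" and sc: "strongly_connected N a" and r: "laplacian_weights N a r"
    and w: "\<And>i. i < N \<Longrightarrow> w i \<in> carrier_vec n"
  shows "0 \<le> (\<Sum>i<N. \<Sum>j<N. sym_laplacian N a r $$ (i, j) * (w i \<bullet> w j))"
    and "(\<Sum>i<N. \<Sum>j<N. sym_laplacian N a r $$ (i, j) * (w i \<bullet> w j)) = 0 \<Longrightarrow> i < N \<Longrightarrow> j < N \<Longrightarrow> w i = w j"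
proof -
  have a: "a \<in> carrier_mat N N" and ann: "\<And>i j. i < N \<Longrightarrow> j < N \<Longrightarrow> 0 \<le> a $$ (i, j)"
    using g unfolding weighted_digraph_def by auto
  have rpos: "\<And>i. i < N \<Longrightarrow> 0 < r $ i" and null: "left_null N a (\<lambda>i. r $ i)"
    using r unfolding laplacian_weights_iff[OF a] by auto
  have eq: "(\<Sum>i<N. \<Sum>j<N. sym_laplacian N a r $$ (i, j) * (w i \<bullet> w j))
    = (\<Sum>i<N. \<Sum>j<N. r $ i * a $$ (i, j) * (\<Sum>k<n. (w i $ k - w j $ k)\<^sup>2))"
    by (rule laplacian_dissipation_vec[OF a null w])
  have t: "0 \<le> r $ i * a $$ (i, j) * (\<Sum>k<n. (w i $ k - w j $ k)\<^sup>2)" if "i < N" "j < N" for i j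
    using rpos[OF that(1)] ann[OF that] by (intro mult_nonneg_nonneg sum_nonneg) auto
  show "0 \<le> (\<Sum>i<N. \<Sum>j<N. sym_laplacian N a r $$ (i, j) * (w i \<bullet> w j))"
    unfolding eq using t by (intro sum_nonneg) auto
  assume zero: "(\<Sum>i<N. \<Sum>j<N. sym_laplacian N a r $$ (i, j) * (w i \<bullet> w j)) = 0" and ij: "i < N" "j < N"
  have term0: "r $ i * a $$ (i, j) * (\<Sum>k<n. (w i $ k - w j $ k)\<^sup>2) = 0" if "i < N" "j < N" for i j
    using double_sum_nonneg_eq_0[of N "\<lambda>i j. r $ i * a $$ (i, j) * (\<Sum>k<n. (w i $ k - w j $ k)\<^sup>2)", OF t zero[unfolded eq] that]
    by simp
  have edge: "w k = w l" if "(k, l) \<in> edges N a" for k l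
  proof -
    have kl: "k < N" "l < N" "a $$ (l, k) \<noteq> 0" using that unfolding edges_def by auto
    then have "(\<Sum>m<n. (w l $ m - w k $ m)\<^sup>2) = 0" using term0[OF kl(2,1)] rpos[OF kl(2)] by auto
    then have "\<forall>m<n. w l $ m = w k $ m" by (subst (asm) sum_nonneg_eq_0_iff) auto
    then show ?thesis using w[OF kl(1)] w[OF kl(2)] by (intro eq_vecI) auto
  qed
  show "w i = w j"
  proof (cases "i = j")
    case False
    then have "(i, j) \<in> (edges N a)\<^sup>+" using sc ij unfolding strongly_connected_def by auto
    then show ?thesis by (induction rule: trancl_induct) (auto dest: edge)
  qed simp
qed

section \<open>Definite matrices\<close>

text \<open>Each product of two entries of \<open>w\<close> is at most \<open>w \<bullet> w\<close>
  in absolute value, so the sum of the absolute entries of \<open>Y\<close> serves as the constant;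
  its size is irrelevant later on.\<close>

lemma form_bound:
  fixes Y :: "real mat"
  assumes Y: "Y \<in> carrier_mat n n"
  shows "\<exists>B\<ge>0. \<forall>w \<in> carrier_vec n. \<bar>w \<bullet> (Y *\<^sub>v w)\<bar> \<le> B * (w \<bullet> w)"
proof (intro exI[of _ "\<Sum>i<n. \<Sum>j<n. \<bar>Y $$ (i, j)\<bar>"] conjI ballI)
  fix w :: "real vec" assume w: "w \<in> carrier_vec n"
  have sq: "w $ i * w $ i \<le> w \<bullet> w" if "i < n" for i
    using w that member_le_sum[of i "{0..<n}" "\<lambda>i. w $ i * w $ i"] by (simp add: scalar_prod_def)
  have prod: "\<bar>w $ i * w $ j\<bar> \<le> w \<bullet> w" if "i < n" "j < n" for i j
  proof -
    have "0 \<le> (\<bar>w $ i\<bar> - \<bar>w $ j\<bar>)\<^sup>2" by simp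
    then have "2 * \<bar>w $ i * w $ j\<bar> \<le> w $ i * w $ i + w $ j * w $ j"
      by (simp add: power2_eq_square algebra_simps abs_mult)
    then show ?thesis using sq[OF that(1)] sq[OF that(2)] by simp
  qed
  have "\<bar>w \<bullet> (Y *\<^sub>v w)\<bar> \<le> (\<Sum>i<n. \<Sum>j<n. \<bar>w $ i * w $ j * Y $$ (i, j)\<bar>)"
    unfolding bilinear_form_expand[OF Y w w] by (rule order_trans[OF sum_abs sum_mono]) (rule sum_abs)
  also have "\<dots> \<le> (\<Sum>i<n. \<Sum>j<n. (w \<bullet> w) * \<bar>Y $$ (i, j)\<bar>)"
    using prod by (intro sum_mono) (simp add: abs_mult[of _ "Y $$ _"] mult_right_mono)
  finally show "\<bar>w \<bullet> (Y *\<^sub>v w)\<bar> \<le> (\<Sum>i<n. \<Sum>j<n. \<bar>Y $$ (i, j)\<bar>) * (w \<bullet> w)"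
    by (simp add: sum_distrib_left sum_distrib_right mult.commute)
qed (auto intro: sum_nonneg)

text \<open>Cauchy--Schwarz for the inner product of \<open>X\<close>, applied to \<open>w\<close> and \<open>X\<^sup>-\<^sup>1 w\<close>, bounds \<open>w \<bullet> X w\<close> from
  below by \<open>|w|\<^sup>2 / B\<close> with \<open>B\<close> a bound for the form of \<open>X\<^sup>-\<^sup>1\<close>; no compactness is needed.\<close>
lemma pos_def_margin:
  assumes pd: "pos_def X" and X: "X \<in> carrier_mat n n"
  shows "\<exists>\<delta>>0. \<forall>w \<in> carrier_vec n. \<delta> * (w \<bullet> w) \<le> w \<bullet> (X *\<^sub>v w)"
proof -
  have XT: "X\<^sup>T = X" and pos: "\<And>w. w \<in> carrier_vec n \<Longrightarrow> w \<noteq> 0\<^sub>v n \<Longrightarrow> 0 < w \<bullet> (X *\<^sub>v w)"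
    using pd X unfolding pos_def_def by auto
  have psd: "0 \<le> w \<bullet> (X *\<^sub>v w)" if "w \<in> carrier_vec n" for w
    using pos[OF that] that X by (cases "w = 0\<^sub>v n") (auto simp: less_imp_le)
  have inj: "inj_mat X"
  proof (rule inj_matI[OF X], rule ccontr)
    fix w :: "real vec" assume "w \<in> carrier_vec n" "X *\<^sub>v w = 0\<^sub>v n" "w \<noteq> 0\<^sub>v n"
    then show False using pos[of w] by simp
  qed
  note inv = minv_right_left[OF X inj]
  obtain B where B: "0 \<le> B" "\<And>w. w \<in> carrier_vec n \<Longrightarrow> \<bar>w \<bullet> (minv X *\<^sub>v w)\<bar> \<le> B * (w \<bullet> w)"
    using form_bound[OF inv(1)] by blast
  have "1 / (B + 1) * (w \<bullet> w) \<le> w \<bullet> (X *\<^sub>v w)" if w: "w \<in> carrier_vec n" for w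
  proof (cases "w = 0\<^sub>v n")
    case True
    then show ?thesis using psd[OF w] by simp
  next
    case False
    define u where "u = minv X *\<^sub>v w"
    have u: "u \<in> carrier_vec n" unfolding u_def using inv(1) w by simp
    have Xu: "X *\<^sub>v u = w" unfolding u_def using assoc_mult_mat_vec[OF X inv(1) w] inv(3) w by simp
    define b c where "b = w \<bullet> w" and "c = u \<bullet> w"
    have b: "0 < b" unfolding b_def using scalar_prod_self_pos w False by blast
    have "u \<noteq> 0\<^sub>v n" using Xu False X by auto
    then have c0: "0 < c" using pos[OF u] Xu unfolding c_def by simp
    have cB: "c \<le> B * b" using B(2)[OF w] comm_scalar_prod[OF u w] unfolding c_def b_def u_def[symmetric] by simp
    \<comment> \<open>The minimizer of the form at \<open>w - t u\<close>; nonnegativity there is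
      the Cauchy-Schwarz inequality.\<close>
    define t where "t = b / c"
    have tu: "t \<cdot>\<^sub>v u \<in> carrier_vec n" "w - t \<cdot>\<^sub>v u \<in> carrier_vec n" using u w by auto
    have forms: "u \<bullet> (X *\<^sub>v w) = b" "w \<bullet> (X *\<^sub>v u) = b" "u \<bullet> (X *\<^sub>v u) = c"
      using form_sym[OF X XT u w] Xu unfolding b_def c_def by simp_all
    have "(w - t \<cdot>\<^sub>v u) \<bullet> (X *\<^sub>v (w - t \<cdot>\<^sub>v u)) = w \<bullet> (X *\<^sub>v w) - 2 * t * b + t * t * c"
      using w u tu forms by (simp add: form_linear[OF X] algebra_simps)
    then have "0 \<le> w \<bullet> (X *\<^sub>v w) - 2 * t * b + t * t * c" using psd[OF tu(2)] by simp
    also have "\<dots> = w \<bullet> (X *\<^sub>v w) - b * b / c" unfolding t_def using c0 by (simp add: field_simps)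
    finally have ge: "b * b / c \<le> w \<bullet> (X *\<^sub>v w)" by simp
    have "b * c \<le> b * (b * (B + 1))" using cB b by (intro mult_left_mono) (auto simp: algebra_simps)
    then have "1 / (B + 1) * b \<le> b * b / c" using c0 B(1) by (simp add: field_simps)
    then show ?thesis using ge unfolding b_def[symmetric] by simp
  qed
  then show ?thesis using B(1) by (intro exI[of _ "1 / (B + 1)"]) auto
qed

section \<open>Block vectors\<close>

text \<open>Allows blocks of different lengths and follows the recursion of
  \<open>block_diag\<close>. \<open>stack_vec\<close>, with its index arithmetic for equal lengths,
  fits the Kronecker product; the two agree on equal lengths.\<close>

primrec cat_vec :: "nat \<Rightarrow> (nat \<Rightarrow> 'a :: zero vec) \<Rightarrow> 'a vec" where
  "cat_vec 0 w = 0\<^sub>v 0"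
| "cat_vec (Suc N) w = cat_vec N w @\<^sub>v w N"

lemma cat_vec_carrier:
  "(\<And>i. i < N \<Longrightarrow> w i \<in> carrier_vec (c i)) \<Longrightarrow> cat_vec N w \<in> carrier_vec (\<Sum>i<N. c i)"
  by (induction N) (auto intro!: append_carrier_vec)

lemma cat_vec_cong: "(\<And>i. i < N \<Longrightarrow> u i = w i) \<Longrightarrow> cat_vec N u = cat_vec N w"
  by (induction N) auto

lemma cat_vec_split:
  assumes "x \<in> carrier_vec (\<Sum>i<N. c i)"
  shows "\<exists>w. (\<forall>i<N. w i \<in> carrier_vec (c i)) \<and> x = cat_vec N w"
  using assms
proof (induction N arbitrary: x)
  case 0
  then show ?case by auto
next
  case (Suc N)
  then have "x \<in> carrier_vec ((\<Sum>i<N. c i) + c N)" by simp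
  then obtain y z where y: "y \<in> carrier_vec (\<Sum>i<N. c i)" and z: "z \<in> carrier_vec (c N)" and x: "x = y @\<^sub>v z"
    by (rule carrier_vec_split)
  from Suc.IH[OF y] obtain w where w: "\<forall>i<N. w i \<in> carrier_vec (c i)" "y = cat_vec N w" by blast
  have "cat_vec N (w(N := z)) = cat_vec N w" by (rule cat_vec_cong) auto
  then have "x = cat_vec (Suc N) (w(N := z))" using w(2) x by (simp only: cat_vec.simps fun_upd_same)
  moreover have "\<forall>i<Suc N. (w(N := z)) i \<in> carrier_vec (c i)" using w(1) z by (simp add: less_Suc_eq)
  ultimately show ?case by blast
qed

lemma cat_vec_scalar_prod:
  fixes u w :: "nat \<Rightarrow> 'a :: semiring_0 vec"
  assumes "\<And>i. i < N \<Longrightarrow> u i \<in> carrier_vec (c i)" "\<And>i. i < N \<Longrightarrow> w i \<in> carrier_vec (c i)"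
  shows "cat_vec N u \<bullet> cat_vec N w = (\<Sum>i<N. u i \<bullet> w i)"
  using assms
proof (induction N)
  case (Suc N)
  have "cat_vec N u \<in> carrier_vec (\<Sum>i<N. c i)" "cat_vec N w \<in> carrier_vec (\<Sum>i<N. c i)"
    using Suc.prems by (auto intro!: cat_vec_carrier)
  then show ?case using scalar_prod_append[of _ _ "u N" "c N" "cat_vec N w" "w N"] Suc by simp
qed (simp add: scalar_prod_def)

lemma append_vec_diff:
  fixes x y :: "'a :: ab_group_add vec"
  assumes "x \<in> carrier_vec m" "x' \<in> carrier_vec m" "y \<in> carrier_vec n" "y' \<in> carrier_vec n"
  shows "(x @\<^sub>v y) - (x' @\<^sub>v y') = (x - x') @\<^sub>v (y - y')"
  using assms by (intro eq_vecI) auto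

lemma append_vec_smult:
  fixes x y :: "'a :: semiring_0 vec"
  shows "c \<cdot>\<^sub>v (x @\<^sub>v y) = (c \<cdot>\<^sub>v x) @\<^sub>v (c \<cdot>\<^sub>v y)"
  by (intro eq_vecI) auto

lemma cat_vec_diff:
  fixes u w :: "nat \<Rightarrow> 'a :: ab_group_add vec"
  assumes "\<And>i. i < N \<Longrightarrow> u i \<in> carrier_vec (c i)" "\<And>i. i < N \<Longrightarrow> w i \<in> carrier_vec (c i)"
  shows "cat_vec N u - cat_vec N w = cat_vec N (\<lambda>i. u i - w i)"
  using assms
proof (induction N)
  case (Suc N)
  have "cat_vec N u \<in> carrier_vec (\<Sum>i<N. c i)" "cat_vec N w \<in> carrier_vec (\<Sum>i<N. c i)"
    using Suc.prems by (auto intro!: cat_vec_carrier)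
  then show ?case using append_vec_diff[of _ _ _ "u N" "c N" "w N"] Suc by simp
qed simp

lemma cat_vec_smult:
  fixes w :: "nat \<Rightarrow> 'a :: semiring_0 vec"
  shows "k \<cdot>\<^sub>v cat_vec N w = cat_vec N (\<lambda>i. k \<cdot>\<^sub>v w i)"
  by (induction N) (auto simp: append_vec_smult)

lemma block_diag_0 [simp]: "block_diag 0 X = 0\<^sub>m 0 0"
  by (simp add: block_diag_def)

lemma block_diag_Suc:
  "block_diag (Suc N) X = four_block_mat (block_diag N X)
     (0\<^sub>m (dim_row (block_diag N X)) (dim_col (X N))) (0\<^sub>m (dim_row (X N)) (dim_col (block_diag N X))) (X N)"
  by (simp add: block_diag_def diag_block_mat_last Let_def)

lemma block_diag_carrier:
  "(\<And>i. i < N \<Longrightarrow> X i \<in> carrier_mat (b i) (c i)) \<Longrightarrow>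
    block_diag N X \<in> carrier_mat (\<Sum>i<N. b i) (\<Sum>i<N. c i)"
  by (induction N) (auto simp: block_diag_Suc)

lemma block_diag_mult_cat_vec:
  fixes X :: "nat \<Rightarrow> 'a :: comm_ring_1 mat"
  assumes "\<And>i. i < N \<Longrightarrow> X i \<in> carrier_mat (b i) (c i)" "\<And>i. i < N \<Longrightarrow> w i \<in> carrier_vec (c i)"
  shows "block_diag N X *\<^sub>v cat_vec N w = cat_vec N (\<lambda>i. X i *\<^sub>v w i)"
  using assms
proof (induction N)
  case 0
  show ?case by (intro eq_vecI) auto
next
  case (Suc N)
  have B: "block_diag N X \<in> carrier_mat (\<Sum>i<N. b i) (\<Sum>i<N. c i)"
    using Suc.prems(1) by (auto intro!: block_diag_carrier)
  have w: "cat_vec N w \<in> carrier_vec (\<Sum>i<N. c i)" using Suc.prems(2) by (auto intro!: cat_vec_carrier)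
  have XN: "X N \<in> carrier_mat (b N) (c N)" "w N \<in> carrier_vec (c N)" using Suc.prems by auto
  have IH: "block_diag N X *\<^sub>v cat_vec N w = cat_vec N (\<lambda>i. X i *\<^sub>v w i)" using Suc by simp
  have c: "cat_vec N (\<lambda>i. X i *\<^sub>v w i) \<in> carrier_vec (\<Sum>i<N. b i)"
    using IH B w by (metis mult_mat_vec_carrier)
  have "block_diag (Suc N) X *\<^sub>v cat_vec (Suc N) w
      = (block_diag N X *\<^sub>v cat_vec N w + 0\<^sub>m (\<Sum>i<N. b i) (c N) *\<^sub>v w N) @\<^sub>v
        (0\<^sub>m (b N) (\<Sum>i<N. c i) *\<^sub>v cat_vec N w + X N *\<^sub>v w N)"
    unfolding block_diag_Suc cat_vec.simps
    using four_block_mat_mult_vec[OF B zero_carrier_mat zero_carrier_mat XN(1) w XN(2)] B XN by simp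
  also have "\<dots> = cat_vec (Suc N) (\<lambda>i. X i *\<^sub>v w i)" using IH c w XN by simp
  finally show ?case .
qed

lemma block_diag_transpose:
  assumes "\<And>i. i < N \<Longrightarrow> X i \<in> carrier_mat (b i) (c i)"
  shows "(block_diag N X)\<^sup>T = block_diag N (\<lambda>i. (X i)\<^sup>T)"
  using assms
proof (induction N)
  case (Suc N)
  have B: "block_diag N X \<in> carrier_mat (\<Sum>i<N. b i) (\<Sum>i<N. c i)"
    using Suc.prems by (auto intro!: block_diag_carrier)
  have XN: "X N \<in> carrier_mat (b N) (c N)" using Suc.prems by auto
  have IH: "(block_diag N X)\<^sup>T = block_diag N (\<lambda>i. (X i)\<^sup>T)" using Suc by simp
  show ?case
    unfolding block_diag_Suc IH[symmetric]
    using transpose_four_block_mat[OF B zero_carrier_mat zero_carrier_mat XN] B XN by simp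
qed simp

lemma stack_vec_Suc:
  assumes "w N \<in> carrier_vec n"
  shows "stack_vec n (Suc N) w = stack_vec n N w @\<^sub>v w N"
proof (rule eq_vecI)
  fix k assume "k < dim_vec (stack_vec n N w @\<^sub>v w N)"
  then have k: "k < N * n + n" using assms by (simp add: stack_vec_def)
  show "stack_vec n (Suc N) w $ k = (stack_vec n N w @\<^sub>v w N) $ k"
  proof (cases "k < N * n")
    case False
    then obtain l where l: "k = N * n + l" "l < n" using k by (metis add_less_cancel_left le_Suc_ex not_less)
    then show ?thesis using assms False by (simp add: stack_vec_def)
  qed (use k assms in \<open>simp add: stack_vec_def\<close>)
qed (use assms in \<open>simp add: stack_vec_def\<close>)

lemma stack_vec_eq_cat_vec:
  "(\<And>i. i < N \<Longrightarrow> w i \<in> carrier_vec n) \<Longrightarrow> stack_vec n N w = cat_vec N w"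
proof (induction N)
  case 0
  show ?case by (intro eq_vecI) (auto simp: stack_vec_def)
next
  case (Suc N)
  then show ?case by (simp add: stack_vec_Suc)
qed

lemma stack_vec_carrier [simp]: "stack_vec n N w \<in> carrier_vec (N * n)"
  by (simp add: stack_vec_def)

lemma stack_vec_cong: "(\<And>i. i < N \<Longrightarrow> u i = w i) \<Longrightarrow> stack_vec n N u = stack_vec n N w"
  unfolding stack_vec_def by (intro eq_vecI) (auto simp: less_mult_imp_div_less)

section \<open>Blocks of equal length and the Kronecker coupling\<close>

definition block :: "nat \<Rightarrow> nat \<Rightarrow> 'a vec \<Rightarrow> 'a vec" where
  "block n i x = vec n (\<lambda>k. x $ (i * n + k))"

lemma block_carrier [simp]: "block n i x \<in> carrier_vec n" "dim_vec (block n i x) = n"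
  by (simp_all add: block_def)

lemma block_index_less:
  assumes "i < N" "(k :: nat) < n"
  shows "i * n + k < N * n"
proof -
  have "i * n + k < Suc i * n" using assms by simp
  also have "\<dots> \<le> N * n" using assms by (intro mult_right_mono) auto
  finally show ?thesis .
qed

lemma stack_vec_block: "x \<in> carrier_vec (N * n) \<Longrightarrow> stack_vec n N (\<lambda>i. block n i x) = x"
proof (rule eq_vecI)
  fix i assume x: "x \<in> carrier_vec (N * n)" and "i < dim_vec x"
  then have i: "i < N * n" by simp
  then have "i mod n < n" by (intro mod_less_divisor gr0I) auto
  then show "stack_vec n N (\<lambda>i. block n i x) $ i = x $ i" using i by (simp add: stack_vec_def block_def)
qed (simp add: stack_vec_def)

lemma block_stack_vec: "\<lbrakk>i < N; w i \<in> carrier_vec n\<rbrakk> \<Longrightarrow> block n i (stack_vec n N w) = w i"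
  unfolding stack_vec_def block_def by (intro eq_vecI) (auto simp: block_index_less)

lemma sum_blocks:
  fixes f :: "nat \<Rightarrow> 'a :: comm_monoid_add"
  shows "(\<Sum>b<N * n. f b) = (\<Sum>j<N. \<Sum>l<n. f (j * n + l))"
proof (induction N)
  case (Suc N)
  have split: "(\<Sum>b<k + l. f b) = (\<Sum>b<k. f b) + (\<Sum>i<l. f (k + i))" for k l
    by (induction l) (simp_all add: add.assoc)
  have "(\<Sum>b<Suc N * n. f b) = (\<Sum>b<N * n + n. f b)" by (simp add: add.commute)
  also have "\<dots> = (\<Sum>b<N * n. f b) + (\<Sum>l<n. f (N * n + l))" by (rule split)
  finally show ?case using Suc by simp
qed simp

text \<open>Block \<open>i\<close> of the Kronecker product of \<open>K\<close> with the identity,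
  applied to the stacked vectors \<open>w\<close>.\<close>

definition mix :: "nat \<Rightarrow> nat \<Rightarrow> real mat \<Rightarrow> (nat \<Rightarrow> real vec) \<Rightarrow> nat \<Rightarrow> real vec" where
  "mix n N K w i = vec n (\<lambda>k. \<Sum>j<N. K $$ (i, j) * w j $ k)"

lemma mix_carrier [simp]: "mix n N K w i \<in> carrier_vec n" "dim_vec (mix n N K w i) = n"
  by (simp_all add: mix_def)

lemma scalar_prod_mix:
  assumes "u \<in> carrier_vec n" "\<And>i. i < N \<Longrightarrow> w i \<in> carrier_vec n"
  shows "u \<bullet> mix n N K w i = (\<Sum>j<N. K $$ (i, j) * (u \<bullet> w j))"
proof -
  have wd: "dim_vec (w i) = n" if "i < N" for i using assms(2)[OF that] by simp
  have "u \<bullet> mix n N K w i = (\<Sum>k<n. \<Sum>j<N. K $$ (i, j) * (u $ k * w j $ k))"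
    unfolding mix_def using assms by (simp add: scalar_prod_def atLeast0LessThan sum_distrib_left mult_ac)
  also have "\<dots> = (\<Sum>j<N. \<Sum>k<n. K $$ (i, j) * (u $ k * w j $ k))" by (rule sum.swap)
  also have "\<dots> = (\<Sum>j<N. K $$ (i, j) * (u \<bullet> w j))"
    by (intro sum.cong) (auto simp: scalar_prod_def atLeast0LessThan sum_distrib_left wd)
  finally show ?thesis .
qed

lemma kron_one_carrier: "K \<in> carrier_mat N N \<Longrightarrow> kron K (1\<^sub>m n) \<in> carrier_mat (N * n) (N * n)"
  by (simp add: kron_def)

lemma kron_one_mult_stack_vec:
  assumes K: "K \<in> carrier_mat N N"
  shows "kron K (1\<^sub>m n) *\<^sub>v stack_vec n N w = stack_vec n N (mix n N K w)"
proof (rule eq_vecI)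
  fix b assume "b < dim_vec (stack_vec n N (mix n N K w))"
  then have b: "b < N * n" by (simp add: stack_vec_def)
  then have n: "0 < n" by (auto intro: gr0I)
  define i k where "i = b div n" and "k = b mod n"
  have i: "i < N" unfolding i_def using b by (simp add: less_mult_imp_div_less)
  have k: "k < n" unfolding k_def using n by simp
  have "(kron K (1\<^sub>m n) *\<^sub>v stack_vec n N w) $ b
      = (\<Sum>c<N * n. kron K (1\<^sub>m n) $$ (b, c) * stack_vec n N w $ c)"
    by (rule mult_vec_entry[OF kron_one_carrier[OF K] stack_vec_carrier b])
  also have "\<dots> = (\<Sum>j<N. \<Sum>l<n. kron K (1\<^sub>m n) $$ (b, j * n + l) * stack_vec n N w $ (j * n + l))"
    by (rule sum_blocks)
  also have "\<dots> = (\<Sum>j<N. \<Sum>l<n. if l = k then K $$ (i, j) * w j $ l else 0)"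
    using K b n k by (intro sum.cong)
      (auto simp: kron_def stack_vec_def block_index_less i_def[symmetric] k_def[symmetric])
  also have "\<dots> = stack_vec n N (mix n N K w) $ b"
    using k b by (simp add: stack_vec_def mix_def i_def[symmetric] k_def[symmetric])
  finally show "(kron K (1\<^sub>m n) *\<^sub>v stack_vec n N w) $ b = stack_vec n N (mix n N K w) $ b" .
qed (use K in \<open>simp add: kron_def stack_vec_def\<close>)

lemma col_blocks_carrier:
  "(\<And>i. i < N \<Longrightarrow> C i \<in> carrier_mat (m i) n) \<Longrightarrow> col_blocks n N C \<in> carrier_mat (\<Sum>i<N. m i) n
    \<and> (\<forall>w \<in> carrier_vec n. (\<forall>i<N. C i *\<^sub>v w = 0\<^sub>v (m i)) \<longrightarrow>
        col_blocks n N (C :: nat \<Rightarrow> real mat) *\<^sub>v w = 0\<^sub>v (\<Sum>i<N. m i))"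
proof -
  have "foldr (@\<^sub>r) (map C xs) (0\<^sub>m 0 n) \<in> carrier_mat (\<Sum>i\<leftarrow>xs. m i) n
    \<and> (\<forall>w \<in> carrier_vec n. (\<forall>i \<in> set xs. C i *\<^sub>v w = 0\<^sub>v (m i)) \<longrightarrow>
        foldr (@\<^sub>r) (map C xs) (0\<^sub>m 0 n) *\<^sub>v w = 0\<^sub>v (\<Sum>i\<leftarrow>xs. m i))"
    if "\<And>i. i \<in> set xs \<Longrightarrow> C i \<in> carrier_mat (m i) n" for xs
    using that
  proof (induction xs)
    case Nil
    then show ?case by (auto intro!: eq_vecI)
  next
    case (Cons y xs)
    have y: "C y \<in> carrier_mat (m y) n" using Cons.prems by simp
    have IH: "foldr (@\<^sub>r) (map C xs) (0\<^sub>m 0 n) \<in> carrier_mat (\<Sum>i\<leftarrow>xs. m i) n"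
      "\<And>w. w \<in> carrier_vec n \<Longrightarrow> (\<forall>i \<in> set xs. C i *\<^sub>v w = 0\<^sub>v (m i)) \<Longrightarrow>
        foldr (@\<^sub>r) (map C xs) (0\<^sub>m 0 n) *\<^sub>v w = 0\<^sub>v (\<Sum>i\<leftarrow>xs. m i)"
      using Cons by auto
    show ?case
      using carrier_append_rows[OF y IH(1)] mat_mult_append[OF y IH(1)] IH(2) by (auto simp: append_zero_vec)
  qed
  from this[of "[0..<N]"] show "(\<And>i. i < N \<Longrightarrow> C i \<in> carrier_mat (m i) n) \<Longrightarrow> ?thesis"
    by (simp add: col_blocks_def interv_sum_list_conv_sum_set_nat atLeast0LessThan)
qed

section \<open>Coupling parameters\<close>

lemma symmetric_if_form:
  fixes X :: "real mat"
  assumes X: "X \<in> carrier_mat n n"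
    and form: "\<And>x y. x \<in> carrier_vec n \<Longrightarrow> y \<in> carrier_vec n \<Longrightarrow> x \<bullet> (X *\<^sub>v y) = y \<bullet> (X *\<^sub>v x)"
  shows "X\<^sup>T = X"
proof (rule bilinear_eqI)
  show XT: "X\<^sup>T \<in> carrier_mat n n" "X \<in> carrier_mat n n" using X by auto
  fix x y :: "real vec" assume x: "x \<in> carrier_vec n" and y: "y \<in> carrier_vec n"
  have "x \<bullet> (X\<^sup>T *\<^sub>v y) = (X *\<^sub>v x) \<bullet> y" using adjoint_scalar_prod[OF XT(1) x y] by simp
  also have "\<dots> = y \<bullet> (X *\<^sub>v x)" using X x y by (intro comm_scalar_prod[of _ n]) auto
  finally show "x \<bullet> (X\<^sup>T *\<^sub>v y) = x \<bullet> (X *\<^sub>v y)" using form[OF x y] by simp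
qed

lemma vec_first_append [simp]: "x \<in> carrier_vec k \<Longrightarrow> vec_first (x @\<^sub>v y) k = x"
  unfolding vec_first_def by (intro eq_vecI) auto

lemma G_block_carrier: "v \<le> n \<Longrightarrow> G_block n v g \<in> carrier_mat n n"
  unfolding G_block_def using four_block_carrier_mat[of "g \<cdot>\<^sub>m 1\<^sub>m v" v v "0\<^sub>m (n - v) (n - v)" "n - v" "n - v"] by simp

lemma G_block_form:
  assumes v: "v \<le> n" and x: "x \<in> carrier_vec n" and y: "y \<in> carrier_vec n"
  shows "x \<bullet> (G_block n v 1 *\<^sub>v y) = vec_first x v \<bullet> vec_first y v"
proof -
  have "x \<in> carrier_vec (v + (n - v))" "y \<in> carrier_vec (v + (n - v))" using v x y by auto
  then obtain x1 x2 y1 y2 where xs: "x1 \<in> carrier_vec v" "x2 \<in> carrier_vec (n - v)" "x = x1 @\<^sub>v x2"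
    and ys: "y1 \<in> carrier_vec v" "y2 \<in> carrier_vec (n - v)" "y = y1 @\<^sub>v y2"
    by (metis carrier_vec_split)
  have one: "(1 :: real) \<cdot>\<^sub>m 1\<^sub>m v \<in> carrier_mat v v" by simp
  have "G_block n v 1 *\<^sub>v y = y1 @\<^sub>v 0\<^sub>v (n - v)"
    unfolding G_block_def ys(3)
      four_block_mat_mult_vec[OF one zero_carrier_mat zero_carrier_mat zero_carrier_mat ys(1,2)]
    using ys smult_mat_mult_vec[OF one_carrier_mat ys(1), of 1] by simp
  then have "x \<bullet> (G_block n v 1 *\<^sub>v y) = x1 \<bullet> y1"
    unfolding xs(3) using scalar_prod_append[OF xs(1,2) ys(1) zero_carrier_vec] xs by simp
  then show ?thesis using xs ys by simp
qed

text \<open>Once \<kappa> is at least 1, the quadratic term with 1/\<kappa> is bounded independently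
  of \<kappa>, and the shift dominates it together with the symmetric part. The threshold
  \<open>B1 + B2 + 1\<close> secures both \<kappa> at least 1 and strictness, and every larger
  \<kappa> works as well.\<close>

lemma neg_def_large_shift:
  fixes M S :: "real mat"
  assumes M: "M \<in> carrier_mat q q" and S: "S \<in> carrier_mat q k"
  shows "\<exists>\<kappa>\<^sub>0>0. \<forall>\<kappa>\<ge>\<kappa>\<^sub>0. neg_def (M\<^sup>T + M - \<kappa> \<cdot>\<^sub>m 1\<^sub>m q + (1 / \<kappa>) \<cdot>\<^sub>m (S * S\<^sup>T))"
proof -
  define P where "P = M\<^sup>T + M"
  define Y where "Y = S * S\<^sup>T"
  have ST: "S\<^sup>T \<in> carrier_mat k q" using S by simp
  have P: "P \<in> carrier_mat q q" unfolding P_def using M by simp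
  have Y: "Y \<in> carrier_mat q q" unfolding Y_def by (rule mult_carrier_mat[OF S ST])
  have PT: "P\<^sup>T = P" unfolding P_def using M by (subst transpose_add[of _ q q]) (auto intro: comm_add_mat)
  have YT: "Y\<^sup>T = Y" unfolding Y_def using transpose_mult[OF S ST] by simp
  obtain B1 where B1: "0 \<le> B1" "\<And>w. w \<in> carrier_vec q \<Longrightarrow> \<bar>w \<bullet> (P *\<^sub>v w)\<bar> \<le> B1 * (w \<bullet> w)"
    using form_bound[OF P] by blast
  obtain B2 where B2: "0 \<le> B2" "\<And>w. w \<in> carrier_vec q \<Longrightarrow> \<bar>w \<bullet> (Y *\<^sub>v w)\<bar> \<le> B2 * (w \<bullet> w)"
    using form_bound[OF Y] by blast
  have neg: "- (u - k \<cdot>\<^sub>v y + c \<cdot>\<^sub>v w) = k \<cdot>\<^sub>v y - u - c \<cdot>\<^sub>v w"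
    if "u \<in> carrier_vec q" "w \<in> carrier_vec q" "y \<in> carrier_vec q" for u w y :: "real vec" and k c
    using that by (auto intro!: eq_vecI)
  have "neg_def (P - \<kappa> \<cdot>\<^sub>m 1\<^sub>m q + (1 / \<kappa>) \<cdot>\<^sub>m Y)" if k: "B1 + B2 + 1 \<le> \<kappa>" for \<kappa>
  proof -
    let ?Z = "P - \<kappa> \<cdot>\<^sub>m 1\<^sub>m q + (1 / \<kappa>) \<cdot>\<^sub>m Y"
    have c1: "\<kappa> \<cdot>\<^sub>m 1\<^sub>m q \<in> carrier_mat q q" "(1 / \<kappa>) \<cdot>\<^sub>m Y \<in> carrier_mat q q" using Y by auto
    have c2: "P - \<kappa> \<cdot>\<^sub>m 1\<^sub>m q \<in> carrier_mat q q" by (rule minus_carrier_mat[OF c1(1)])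
    have Z: "?Z \<in> carrier_mat q q" "- ?Z \<in> carrier_mat q q" using c1 c2 by auto
    have form: "x \<bullet> ((- ?Z) *\<^sub>v y) = \<kappa> * (x \<bullet> y) - x \<bullet> (P *\<^sub>v y) - (1 / \<kappa>) * (x \<bullet> (Y *\<^sub>v y))"
      if x: "x \<in> carrier_vec q" and y: "y \<in> carrier_vec q" for x y
    proof -
      have Py: "P *\<^sub>v y \<in> carrier_vec q" "Y *\<^sub>v y \<in> carrier_vec q" using P Y y by auto
      have "?Z *\<^sub>v y = P *\<^sub>v y - \<kappa> \<cdot>\<^sub>v y + (1 / \<kappa>) \<cdot>\<^sub>v (Y *\<^sub>v y)"
        unfolding add_mult_distrib_mat_vec[OF c2 c1(2) y] minus_mult_distrib_mat_vec[OF P c1(1) y]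
          smult_mat_mult_vec[OF one_carrier_mat y] smult_mat_mult_vec[OF Y y] using y by simp
      moreover have "(- ?Z) *\<^sub>v y = - (?Z *\<^sub>v y)" using c1 c2 Y y by (intro uminus_mult_mat_vec) simp
      ultimately have "(- ?Z) *\<^sub>v y = \<kappa> \<cdot>\<^sub>v y - P *\<^sub>v y - (1 / \<kappa>) \<cdot>\<^sub>v (Y *\<^sub>v y)"
        using neg[OF Py y, of \<kappa> "1 / \<kappa>"] by simp
      then show ?thesis using x y Py
        by (simp add: scalar_prod_minus_distrib[of x q])
    qed
    have T: "(- ?Z)\<^sup>T = - ?Z"
      by (rule symmetric_if_form[OF Z(2)])
        (simp add: form form_sym[OF P PT] form_sym[OF Y YT] comm_scalar_prod[of _ q])
    have "0 < w \<bullet> ((- ?Z) *\<^sub>v w)" if w: "w \<in> carrier_vec q" "w \<noteq> 0\<^sub>v q" for w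
    proof -
      have ww: "0 < w \<bullet> w" by (rule scalar_prod_self_pos[OF w])
      have k1: "1 \<le> \<kappa>" using k B1(1) B2(1) by simp
      have "(1 / \<kappa>) * (w \<bullet> (Y *\<^sub>v w)) \<le> (1 / \<kappa>) * (B2 * (w \<bullet> w))"
        using B2(2)[OF w(1)] k1 by (intro mult_left_mono) auto
      also have "\<dots> \<le> 1 * (B2 * (w \<bullet> w))" using k1 B2(1) ww by (intro mult_right_mono) auto
      finally have "(1 / \<kappa>) * (w \<bullet> (Y *\<^sub>v w)) \<le> B2 * (w \<bullet> w)" by simp
      moreover have "w \<bullet> (P *\<^sub>v w) \<le> B1 * (w \<bullet> w)" using B1(2)[OF w(1)] by simp
      moreover have "(B1 + B2 + 1) * (w \<bullet> w) \<le> \<kappa> * (w \<bullet> w)" using k ww by (intro mult_right_mono) auto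
      ultimately show ?thesis unfolding form[OF w(1) w(1)] using ww by (simp add: algebra_simps)
    qed
    then show ?thesis unfolding neg_def_def pos_def_def using T Z Y by auto
  qed
  then show ?thesis unfolding P_def Y_def using B1(1) B2(1) by (intro exI[of _ "B1 + B2 + 1"]) auto
qed

section \<open>Existence of admissible \<open>\<epsilon>\<close> and \<open>\<gamma>\<close>\<close>

lemma cat_vec_zero: "(\<And>i. i < N \<Longrightarrow> x i = 0\<^sub>v n) \<Longrightarrow> cat_vec N x = 0\<^sub>v (N * n)"
  by (induction N) (auto simp: append_zero_vec add.commute)

text \<open>The data fixed before \<epsilon> and \<gamma> are chosen. Observability of the stacked
  pair enters as \<open>joint\<close>, a statement about the unobservable subspaces of the nodes,
  which is the form in which the energy argument consumes it.\<close>

locale observer_design =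
  fixes n N :: nat and A a :: "real mat" and r :: "real vec" and p v :: "nat \<Rightarrow> nat"
    and F :: "nat \<Rightarrow> real mat" and d :: "nat \<Rightarrow> obs_form"
  assumes A: "A \<in> carrier_mat n n"
    and graph: "weighted_digraph N a" and sc: "strongly_connected N a" and weights: "laplacian_weights N a r"
    and F: "\<And>i. i < N \<Longrightarrow> F i \<in> carrier_mat (p i) n"
    and dec: "\<And>i. i < N \<Longrightarrow> obs_decomposition n (p i) (v i) A (F i) (d i)"
    and pv: "\<And>i. i < N \<Longrightarrow> p i \<le> v i" and vn: "\<And>i. i < N \<Longrightarrow> v i \<le> n"
    and joint: "\<And>w. w \<in> carrier_vec n \<Longrightarrow> (\<And>i. i < N \<Longrightarrow> w \<in> unobs_space (F i) A) \<Longrightarrow> w = 0\<^sub>v n"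
begin

lemma a: "a \<in> carrier_mat N N"
  using graph unfolding weighted_digraph_def by simp

lemma T: "i < N \<Longrightarrow> orth_mat n (oT (d i))"
  using dec unfolding obs_decomposition_def by blast

lemmas Tc = orth_matD(1)[OF T] orth_matD(2)[OF T]

abbreviation K :: "real mat" where "K \<equiv> sym_laplacian N a r"

definition eps_mat :: "real \<Rightarrow> real mat" where
  "eps_mat \<epsilon> = (block_diag N (\<lambda>i. oT (d i)))\<^sup>T * kron K (1\<^sub>m n) * block_diag N (\<lambda>i. oT (d i))
     + block_diag N (\<lambda>i. G_block n (v i) 1) - \<epsilon> \<cdot>\<^sub>m 1\<^sub>m (n * N)"

lemma admissible_eps_iff:
  "admissible_eps n N v a r (\<lambda>i. 1) d \<epsilon> \<longleftrightarrow> 0 < \<epsilon> \<and> pos_def (eps_mat \<epsilon>)"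
  unfolding admissible_eps_def eps_mat_def sym_laplacian_def Let_def by simp

text \<open>The bilinear form of \<open>eps_mat 0\<close> in blocks: \<open>x i\<close> holds
  coordinates in the rotated basis of node \<open>i\<close>, the double sum is the coupling and the
  single sum the contribution of \<open>G\<close>. It is kept polarized because
  \<open>pos_def\<close> also asks for symmetry.\<close>

definition energy :: "(nat \<Rightarrow> real vec) \<Rightarrow> (nat \<Rightarrow> real vec) \<Rightarrow> real" where
  "energy x y = (\<Sum>i<N. \<Sum>j<N. K $$ (i, j) * ((oT (d i) *\<^sub>v x i) \<bullet> (oT (d j) *\<^sub>v y j)))
     + (\<Sum>i<N. vec_first (x i) (v i) \<bullet> vec_first (y i) (v i))"

text \<open>Evaluates the block diagonal and Kronecker factors on concatenated vectors. From here on
  the matrix inequality for \<epsilon> is used only as an inequality between finite sums.\<close>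

lemma eps_mat_form:
  shows eps_mat_carrier: "eps_mat \<epsilon> \<in> carrier_mat (N * n) (N * n)"
    and "\<lbrakk>\<And>i. i < N \<Longrightarrow> x i \<in> carrier_vec n; \<And>i. i < N \<Longrightarrow> y i \<in> carrier_vec n\<rbrakk> \<Longrightarrow>
      cat_vec N x \<bullet> (eps_mat \<epsilon> *\<^sub>v cat_vec N y) = energy x y - \<epsilon> * (\<Sum>i<N. x i \<bullet> y i)"
proof -
  let ?T = "block_diag N (\<lambda>i. oT (d i))" and ?G = "block_diag N (\<lambda>i. G_block n (v i) 1)" and ?k = "kron K (1\<^sub>m n)"
  have nN: "n * N = N * n" by simp
  have T': "?T \<in> carrier_mat (N * n) (N * n)"
    using block_diag_carrier[of N "\<lambda>i. oT (d i)" "\<lambda>_. n" "\<lambda>_. n"] Tc by simp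
  have TT: "?T\<^sup>T \<in> carrier_mat (N * n) (N * n)" using T' by simp
  have G: "?G \<in> carrier_mat (N * n) (N * n)"
    using block_diag_carrier[of N "\<lambda>i. G_block n (v i) 1" "\<lambda>_. n" "\<lambda>_. n"] G_block_carrier[OF vn] by simp
  have k: "?k \<in> carrier_mat (N * n) (N * n)" by (rule kron_one_carrier[OF sym_laplacian_carrier[OF a]])
  have Tk: "?T\<^sup>T * ?k \<in> carrier_mat (N * n) (N * n)" by (rule mult_carrier_mat[OF TT k])
  have TkT: "?T\<^sup>T * ?k * ?T \<in> carrier_mat (N * n) (N * n)" by (rule mult_carrier_mat[OF Tk T'])
  have S: "?T\<^sup>T * ?k * ?T + ?G \<in> carrier_mat (N * n) (N * n)" using TkT G by simp
  have E: "\<epsilon> \<cdot>\<^sub>m 1\<^sub>m (N * n) \<in> carrier_mat (N * n) (N * n)" by simp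
  show "eps_mat \<epsilon> \<in> carrier_mat (N * n) (N * n)"
    unfolding eps_mat_def nN by (rule minus_carrier_mat[OF E])
  assume x: "\<And>i. i < N \<Longrightarrow> x i \<in> carrier_vec n" and y: "\<And>i. i < N \<Longrightarrow> y i \<in> carrier_vec n"
  have cx: "cat_vec N x \<in> carrier_vec (N * n)" and cy: "cat_vec N y \<in> carrier_vec (N * n)"
    using cat_vec_carrier[of N x "\<lambda>_. n"] cat_vec_carrier[of N y "\<lambda>_. n"] x y by auto
  let ?Ty = "\<lambda>i. oT (d i) *\<^sub>v y i"
  have Tx: "oT (d i) *\<^sub>v x i \<in> carrier_vec n" and Ty: "?Ty i \<in> carrier_vec n" if "i < N" for i
    using Tc[OF that] x[OF that] y[OF that] by auto
  have "?T *\<^sub>v cat_vec N y = stack_vec n N ?Ty"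
    using block_diag_mult_cat_vec[of N "\<lambda>i. oT (d i)" "\<lambda>_. n" "\<lambda>_. n" y] Tc y stack_vec_eq_cat_vec[of N ?Ty n] Ty by simp
  then have "?k *\<^sub>v (?T *\<^sub>v cat_vec N y) = cat_vec N (mix n N K ?Ty)"
    using kron_one_mult_stack_vec[OF sym_laplacian_carrier[OF a]] stack_vec_eq_cat_vec[of N "mix n N K ?Ty" n] by simp
  then have "?T\<^sup>T *\<^sub>v (?k *\<^sub>v (?T *\<^sub>v cat_vec N y)) = cat_vec N (\<lambda>i. (oT (d i))\<^sup>T *\<^sub>v mix n N K ?Ty i)"
    using block_diag_transpose[of N "\<lambda>i. oT (d i)" "\<lambda>_. n" "\<lambda>_. n"] Tc
      block_diag_mult_cat_vec[of N "\<lambda>i. (oT (d i))\<^sup>T" "\<lambda>_. n" "\<lambda>_. n" "mix n N K ?Ty"] by simp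
  then have "cat_vec N x \<bullet> (?T\<^sup>T *\<^sub>v (?k *\<^sub>v (?T *\<^sub>v cat_vec N y))) = (\<Sum>i<N. x i \<bullet> ((oT (d i))\<^sup>T *\<^sub>v mix n N K ?Ty i))"
    using cat_vec_scalar_prod[of N x "\<lambda>_. n" "\<lambda>i. (oT (d i))\<^sup>T *\<^sub>v mix n N K ?Ty i"] x
      mult_mat_vec_carrier[OF Tc(2) mix_carrier(1)] by simp
  also have "\<dots> = (\<Sum>i<N. \<Sum>j<N. K $$ (i, j) * ((oT (d i) *\<^sub>v x i) \<bullet> ?Ty j))"
  proof (intro sum.cong refl)
    fix i assume "i \<in> {..<N}"
    then have i: "i < N" by simp
    have "x i \<bullet> ((oT (d i))\<^sup>T *\<^sub>v mix n N K ?Ty i) = (oT (d i) *\<^sub>v x i) \<bullet> mix n N K ?Ty i"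
      using adjoint_scalar_prod[OF Tc(2)[OF i] x[OF i] mix_carrier(1)] by simp
    then show "x i \<bullet> ((oT (d i))\<^sup>T *\<^sub>v mix n N K ?Ty i) = (\<Sum>j<N. K $$ (i, j) * ((oT (d i) *\<^sub>v x i) \<bullet> ?Ty j))"
      using scalar_prod_mix[OF Tx[OF i], of N ?Ty K i] Ty by simp
  qed
  finally have 1: "cat_vec N x \<bullet> (?T\<^sup>T *\<^sub>v (?k *\<^sub>v (?T *\<^sub>v cat_vec N y)))
    = (\<Sum>i<N. \<Sum>j<N. K $$ (i, j) * ((oT (d i) *\<^sub>v x i) \<bullet> ?Ty j))" .
  have Gy: "G_block n (v i) 1 *\<^sub>v y i \<in> carrier_vec n" if "i < N" for i
    by (rule mult_mat_vec_carrier[OF G_block_carrier[OF vn[OF that]] y[OF that]])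
  have "?G *\<^sub>v cat_vec N y = cat_vec N (\<lambda>i. G_block n (v i) 1 *\<^sub>v y i)"
    using block_diag_mult_cat_vec[of N "\<lambda>i. G_block n (v i) 1" "\<lambda>_. n" "\<lambda>_. n" y] G_block_carrier[OF vn] y by simp
  then have "cat_vec N x \<bullet> (?G *\<^sub>v cat_vec N y) = (\<Sum>i<N. x i \<bullet> (G_block n (v i) 1 *\<^sub>v y i))"
    using cat_vec_scalar_prod[of N x "\<lambda>_. n" "\<lambda>i. G_block n (v i) 1 *\<^sub>v y i"] x Gy by simp
  then have 2: "cat_vec N x \<bullet> (?G *\<^sub>v cat_vec N y) = (\<Sum>i<N. vec_first (x i) (v i) \<bullet> vec_first (y i) (v i))"
    using G_block_form[OF vn x y] by simp
  have 3: "cat_vec N x \<bullet> cat_vec N y = (\<Sum>i<N. x i \<bullet> y i)"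
    using cat_vec_scalar_prod[of N x "\<lambda>_. n" y] x y by simp
  have "eps_mat \<epsilon> *\<^sub>v cat_vec N y
      = ?T\<^sup>T *\<^sub>v (?k *\<^sub>v (?T *\<^sub>v cat_vec N y)) + ?G *\<^sub>v cat_vec N y - \<epsilon> \<cdot>\<^sub>v cat_vec N y"
    unfolding eps_mat_def nN minus_mult_distrib_mat_vec[OF S E cy] add_mult_distrib_mat_vec[OF TkT G cy]
      assoc_mult_mat_vec[OF Tk T' cy] assoc_mult_mat_vec[OF TT k mult_mat_vec_carrier[OF T' cy]]
      smult_mat_mult_vec[OF one_carrier_mat cy] using cy by simp
  moreover have "?T\<^sup>T *\<^sub>v (?k *\<^sub>v (?T *\<^sub>v cat_vec N y)) \<in> carrier_vec (N * n)" "?G *\<^sub>v cat_vec N y \<in> carrier_vec (N * n)"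
    using mult_mat_vec_carrier[OF TT mult_mat_vec_carrier[OF k mult_mat_vec_carrier[OF T' cy]]] mult_mat_vec_carrier[OF G cy] by auto
  ultimately show "cat_vec N x \<bullet> (eps_mat \<epsilon> *\<^sub>v cat_vec N y) = energy x y - \<epsilon> * (\<Sum>i<N. x i \<bullet> y i)"
    using cx cy 1 2 3 unfolding energy_def
    by (simp add: scalar_prod_minus_distrib[of _ "N * n"] scalar_prod_add_distrib[of _ "N * n"])
qed

lemma energy_sym:
  assumes x: "\<And>i. i < N \<Longrightarrow> x i \<in> carrier_vec n" and y: "\<And>i. i < N \<Longrightarrow> y i \<in> carrier_vec n"
  shows "energy x y = energy y x"
proof -
  have Ksym: "K $$ (i, j) = K $$ (j, i)" if "i < N" "j < N" for i j
    using sym_laplacian_entry[OF a] that by simp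
  have "(oT (d i) *\<^sub>v x i) \<bullet> (oT (d j) *\<^sub>v y j) = (oT (d j) *\<^sub>v y j) \<bullet> (oT (d i) *\<^sub>v x i)" if "i < N" "j < N" for i j
    using Tc[OF that(1)] Tc[OF that(2)] x y that by (intro comm_scalar_prod[of _ n]) auto
  then have "(\<Sum>i<N. \<Sum>j<N. K $$ (i, j) * ((oT (d i) *\<^sub>v x i) \<bullet> (oT (d j) *\<^sub>v y j)))
    = (\<Sum>i<N. \<Sum>j<N. K $$ (j, i) * ((oT (d j) *\<^sub>v y j) \<bullet> (oT (d i) *\<^sub>v x i)))"
    using Ksym by (intro sum.cong) auto
  also have "\<dots> = (\<Sum>i<N. \<Sum>j<N. K $$ (i, j) * ((oT (d i) *\<^sub>v y i) \<bullet> (oT (d j) *\<^sub>v x j)))" by (rule sum.swap)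
  finally show ?thesis
    unfolding energy_def by (simp add: comm_scalar_prod[OF vec_first_carrier vec_first_carrier])
qed

lemma eps_mat_sym: "(eps_mat \<epsilon>)\<^sup>T = eps_mat \<epsilon>"
proof (rule symmetric_if_form[OF eps_mat_carrier])
  fix x y :: "real vec" assume "x \<in> carrier_vec (N * n)" "y \<in> carrier_vec (N * n)"
  then obtain xs ys where xs: "\<And>i. i < N \<Longrightarrow> xs i \<in> carrier_vec n" "x = cat_vec N xs"
    and ys: "\<And>i. i < N \<Longrightarrow> ys i \<in> carrier_vec n" "y = cat_vec N ys"
    using cat_vec_split[of x "\<lambda>_. n" N] cat_vec_split[of y "\<lambda>_. n" N] by auto
  have "(\<Sum>i<N. xs i \<bullet> ys i) = (\<Sum>i<N. ys i \<bullet> xs i)"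
    using xs ys by (intro sum.cong) (auto intro: comm_scalar_prod)
  then show "x \<bullet> (eps_mat \<epsilon> *\<^sub>v y) = y \<bullet> (eps_mat \<epsilon> *\<^sub>v x)"
    unfolding xs(2) ys(2) using eps_mat_form(2)[of xs ys] eps_mat_form(2)[of ys xs] xs ys energy_sym[of xs ys] by simp
qed

lemma pos_def_eps_mat_iff:
  "pos_def (eps_mat \<epsilon>) \<longleftrightarrow> (\<forall>x \<in> carrier_vec (N * n). x \<noteq> 0\<^sub>v (N * n) \<longrightarrow> 0 < x \<bullet> (eps_mat \<epsilon> *\<^sub>v x))"
  unfolding pos_def_def using eps_mat_sym eps_mat_carrier[of \<epsilon>] by auto

lemma energy_pos:
  assumes x: "\<And>i. i < N \<Longrightarrow> x i \<in> carrier_vec n"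
  shows "0 \<le> energy x x" and "energy x x = 0 \<Longrightarrow> i < N \<Longrightarrow> x i = 0\<^sub>v n"
proof -
  let ?w = "\<lambda>i. oT (d i) *\<^sub>v x i"
  have w: "?w i \<in> carrier_vec n" if "i < N" for i using Tc[OF that] x[OF that] by simp
  let ?D = "\<Sum>i<N. \<Sum>j<N. K $$ (i, j) * (?w i \<bullet> ?w j)" and ?g = "\<lambda>i. vec_first (x i) (v i) \<bullet> vec_first (x i) (v i)"
  have D: "0 \<le> ?D" by (rule consensus_if_no_dissipation(1)[OF graph sc weights w])
  have g: "0 \<le> ?g i" for i by (rule scalar_prod_self_nonneg)
  then have gs: "0 \<le> (\<Sum>i<N. ?g i)" by (intro sum_nonneg) auto
  show "0 \<le> energy x x" unfolding energy_def using D gs by simp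
  assume "energy x x = 0" and i: "i < N"
  then have D0: "?D = 0" and g0: "(\<Sum>i<N. ?g i) = 0" unfolding energy_def using D gs by linarith+
  have eq: "?w j = ?w i" if "j < N" for j
    by (rule consensus_if_no_dissipation(2)[OF graph sc weights w D0 that i])
  have "?w i \<in> unobs_space (F j) A" if j: "j < N" for j
  proof -
    have "?g j = 0" using g0 g j sum_nonneg_eq_0_iff[of "{..<N}" ?g] by auto
    then have "vec_first (x j) (v j) = 0\<^sub>v (v j)" using scalar_prod_self_eq_0[OF vec_first_carrier] by blast
    moreover have "x j \<in> carrier_vec (v j + (n - v j))" using x[OF j] vn[OF j] by simp
    then have "x j = vec_first (x j) (v j) @\<^sub>v vec_last (x j) (n - v j)" by simp
    ultimately have "x j = 0\<^sub>v (v j) @\<^sub>v vec_last (x j) (n - v j)" by simp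
    then have "?w j \<in> unobs_space (F j) A"
      using obs_decomposition_unobs_space[OF dec[OF j] pv[OF j] vn[OF j] A F[OF j] vec_last_carrier, of "x j"] by simp
    then show ?thesis using eq[OF j] by simp
  qed
  then have "?w i = 0\<^sub>v n" by (rule joint[OF w[OF i]])
  then show "x i = 0\<^sub>v n" using orth_mat_inverse(2)[OF T[OF i] x[OF i]] Tc[OF i] by simp
qed

lemma admissible_eps_exists: "\<exists>\<epsilon>. admissible_eps n N v a r (\<lambda>i. 1) d \<epsilon>"
proof -
  have "pos_def (eps_mat 0)"
    unfolding pos_def_eps_mat_iff
  proof (intro ballI impI)
    fix x :: "real vec" assume "x \<in> carrier_vec (N * n)" and x0: "x \<noteq> 0\<^sub>v (N * n)"
    then obtain xs where xs: "\<And>i. i < N \<Longrightarrow> xs i \<in> carrier_vec n" "x = cat_vec N xs"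
      using cat_vec_split[of x "\<lambda>_. n" N] by auto
    have "energy xs xs \<noteq> 0"
      using energy_pos(2)[of xs] xs x0 cat_vec_zero[of N xs] by auto
    then show "0 < x \<bullet> (eps_mat 0 *\<^sub>v x)"
      unfolding xs(2) using eps_mat_form(2)[of xs xs 0] energy_pos(1)[of xs] xs by simp
  qed
  from pos_def_margin[OF this eps_mat_carrier] obtain \<delta> where \<delta>: "0 < \<delta>"
    "\<And>x. x \<in> carrier_vec (N * n) \<Longrightarrow> \<delta> * (x \<bullet> x) \<le> x \<bullet> (eps_mat 0 *\<^sub>v x)" by blast
  \<comment> \<open>Half of the margin, as \<delta> itself would only guarantee a nonnegative
    form.\<close>
  have "pos_def (eps_mat (\<delta> / 2))"
    unfolding pos_def_eps_mat_iff
  proof (intro ballI impI)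
    fix x :: "real vec" assume x: "x \<in> carrier_vec (N * n)" and x0: "x \<noteq> 0\<^sub>v (N * n)"
    then obtain xs where xs: "\<And>i. i < N \<Longrightarrow> xs i \<in> carrier_vec n" "x = cat_vec N xs"
      using cat_vec_split[of x "\<lambda>_. n" N] by auto
    have "x \<bullet> x = (\<Sum>i<N. xs i \<bullet> xs i)" unfolding xs(2) using cat_vec_scalar_prod[of N xs "\<lambda>_. n" xs] xs by simp
    moreover have "0 < x \<bullet> x" by (rule scalar_prod_self_pos[OF x x0])
    ultimately show "0 < x \<bullet> (eps_mat (\<delta> / 2) *\<^sub>v x)"
      using \<delta>(1) \<delta>(2)[OF x] eps_mat_form(2)[of xs xs 0] eps_mat_form(2)[of xs xs "\<delta> / 2"] xs
      unfolding xs(2)[symmetric] by (smt (verit) mult_pos_pos field_sum_of_halves distrib_right)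
  qed
  then show ?thesis unfolding admissible_eps_iff using \<delta>(1) by (intro exI[of _ "\<delta> / 2"]) simp
qed

text \<open>Strict definiteness leaves room \<delta> beyond \<epsilon>. This room is later converted
  into the surplus \<mu> of the decay rate.\<close>

lemma admissible_eps_margin:
  assumes "admissible_eps n N v a r (\<lambda>i. 1) d \<epsilon>"
  obtains \<delta> where "0 < \<delta>" "\<And>x. (\<And>i. i < N \<Longrightarrow> x i \<in> carrier_vec n) \<Longrightarrow>
    (\<epsilon> + \<delta>) * (\<Sum>i<N. x i \<bullet> x i) \<le> energy x x"
proof -
  have pd: "pos_def (eps_mat \<epsilon>)" using assms unfolding admissible_eps_iff by simp
  from pos_def_margin[OF this eps_mat_carrier] obtain \<delta> where \<delta>: "0 < \<delta>"
    "\<And>x. x \<in> carrier_vec (N * n) \<Longrightarrow> \<delta> * (x \<bullet> x) \<le> x \<bullet> (eps_mat \<epsilon> *\<^sub>v x)" by blast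
  have "(\<epsilon> + \<delta>) * (\<Sum>i<N. x i \<bullet> x i) \<le> energy x x" if x: "\<And>i. i < N \<Longrightarrow> x i \<in> carrier_vec n" for x
  proof -
    have "cat_vec N x \<in> carrier_vec (N * n)" using cat_vec_carrier[of N x "\<lambda>_. n"] x by simp
    from \<delta>(2)[OF this] show ?thesis
      using eps_mat_form(2)[of x x \<epsilon>] cat_vec_scalar_prod[of N x "\<lambda>_. n" x] x by (simp add: algebra_simps)
  qed
  then show ?thesis using that \<delta>(1) by blast
qed

text \<open>Consensus vectors do not dissipate, so only \<open>G \<le> I\<close> is left of the energy.\<close>
lemma admissible_eps_less_1:
  assumes eps: "admissible_eps n N v a r (\<lambda>i. 1) d \<epsilon>" and N: "0 < N" and n: "0 < n"
  shows "\<epsilon> < 1"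
proof -
  obtain \<delta> where \<delta>: "0 < \<delta>" "\<And>x. (\<And>i. i < N \<Longrightarrow> x i \<in> carrier_vec n) \<Longrightarrow>
    (\<epsilon> + \<delta>) * (\<Sum>i<N. x i \<bullet> x i) \<le> energy x x" using admissible_eps_margin[OF eps] by metis
  define w where "w = (unit_vec n 0 :: real vec)"
  have w: "w \<in> carrier_vec n" "w \<bullet> w = 1" unfolding w_def using n by simp_all
  \<comment> \<open>One unit vector expressed in the rotated basis of every node, hence a consensus
    vector.\<close>
  define x where "x i = (oT (d i))\<^sup>T *\<^sub>v w" for i
  have x: "x i \<in> carrier_vec n" if "i < N" for i unfolding x_def using Tc[OF that] w by simp
  have Tx: "oT (d i) *\<^sub>v x i = w" if "i < N" for i
    unfolding x_def using orth_mat_inverse(1)[OF T[OF that] w(1)] .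
  have xx: "x i \<bullet> x i = 1" if "i < N" for i
    using adjoint_scalar_prod[OF Tc(2)[OF that] x[OF that] w(1)] Tx[OF that] w unfolding x_def by simp
  have null: "left_null N a (\<lambda>i. r $ i)" using weights unfolding laplacian_weights_iff[OF a] by blast
  have "(\<Sum>i<N. \<Sum>j<N. K $$ (i, j) * (w \<bullet> w)) = 0"
    using laplacian_dissipation_vec[OF a null, of "\<lambda>_. w" n] w by simp
  then have "energy x x = (\<Sum>i<N. vec_first (x i) (v i) \<bullet> vec_first (x i) (v i))"
    unfolding energy_def using Tx by simp
  also have "\<dots> \<le> (\<Sum>i<N. 1)"
  proof (intro sum_mono)
    fix i assume "i \<in> {..<N}"
    then have i: "i < N" by simp
    have "x i \<in> carrier_vec (v i + (n - v i))" using x[OF i] vn[OF i] by simp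
    then have "x i = vec_first (x i) (v i) @\<^sub>v vec_last (x i) (n - v i)" by simp
    then have "x i \<bullet> x i = vec_first (x i) (v i) \<bullet> vec_first (x i) (v i) + vec_last (x i) (n - v i) \<bullet> vec_last (x i) (n - v i)"
      using scalar_prod_append[OF vec_first_carrier vec_last_carrier vec_first_carrier vec_last_carrier] by metis
    then show "vec_first (x i) (v i) \<bullet> vec_first (x i) (v i) \<le> 1"
      using xx[OF i] scalar_prod_self_nonneg[of "vec_last (x i) (n - v i)"] by simp
  qed
  finally have "energy x x \<le> real N" by simp
  then have "(\<epsilon> + \<delta>) * real N \<le> real N" using \<delta>(2)[of x] x xx by simp
  then have "\<epsilon> + \<delta> \<le> 1" using N by simp
  then show ?thesis using \<delta>(1) by simp
qed

text \<open>With \<kappa> = \<gamma> \<epsilon> - 2 \<alpha> the condition at each node is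
  negativity for a large shift, and \<kappa> grows with \<gamma> because \<epsilon> is
  positive.\<close>

lemma admissible_gamma_exists:
  assumes eps: "0 < \<epsilon>" and \<alpha>: "0 \<le> \<alpha>"
  shows "\<exists>\<gamma>\<^sub>0. \<forall>\<gamma>\<ge>\<gamma>\<^sub>0. admissible_gamma n N v \<alpha> \<epsilon> d \<gamma>"
proof -
  have "\<exists>\<kappa>\<^sub>0>0. \<forall>\<kappa>\<ge>\<kappa>\<^sub>0. neg_def ((ou (d i))\<^sup>T + ou (d i) - \<kappa> \<cdot>\<^sub>m 1\<^sub>m (n - v i) + (1 / \<kappa>) \<cdot>\<^sub>m (o32 (d i) * (o32 (d i))\<^sup>T))"
    if "i < N" for i
    using dec[OF that] neg_def_large_shift unfolding obs_decomposition_def by blast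
  then obtain k where k: "\<And>i. i < N \<Longrightarrow> 0 < k i"
    "\<And>i \<kappa>. i < N \<Longrightarrow> k i \<le> \<kappa> \<Longrightarrow> neg_def ((ou (d i))\<^sup>T + ou (d i) - \<kappa> \<cdot>\<^sub>m 1\<^sub>m (n - v i) + (1 / \<kappa>) \<cdot>\<^sub>m (o32 (d i) * (o32 (d i))\<^sup>T))"
    by metis
  \<comment> \<open>The sum exceeds each of the positive thresholds; the added 1 makes it positive
    even without nodes, as 2 \<alpha> < \<gamma> \<epsilon> is required there too.\<close>
  define \<kappa>\<^sub>0 where "\<kappa>\<^sub>0 = 1 + (\<Sum>i<N. k i)"
  have k0: "0 < \<kappa>\<^sub>0" unfolding \<kappa>\<^sub>0_def using k(1) by (intro add_pos_nonneg sum_nonneg) (auto simp: less_imp_le)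
  have ki: "k i \<le> \<kappa>\<^sub>0" if "i < N" for i
    unfolding \<kappa>\<^sub>0_def using member_le_sum[of i "{..<N}" k] k(1) that by (force simp: less_imp_le)
  have "admissible_gamma n N v \<alpha> \<epsilon> d \<gamma>" if \<gamma>: "(\<kappa>\<^sub>0 + 2 * \<alpha>) / \<epsilon> \<le> \<gamma>" for \<gamma>
  proof -
    have ge: "\<kappa>\<^sub>0 \<le> \<gamma> * \<epsilon> - 2 * \<alpha>" using \<gamma> eps by (simp add: field_simps)
    then have "0 < \<gamma> * \<epsilon>" using k0 \<alpha> by linarith
    then have "0 < \<gamma>" using eps by (simp add: zero_less_mult_iff)
    moreover have "2 * \<alpha> < \<gamma> * \<epsilon>" using ge k0 by linarith
    ultimately show ?thesis unfolding admissible_gamma_def using k(2) ki ge order_trans by blast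
  qed
  then show ?thesis by blast
qed

end

section \<open>Vector-valued differential equations on the half line\<close>

lemma has_vec_derivD:
  assumes "has_vec_deriv d f f'" "0 \<le> t"
  shows "f t \<in> carrier_vec d" "f' t \<in> carrier_vec d"
    "j < d \<Longrightarrow> ((\<lambda>s. f s $ j) has_real_derivative f' t $ j) (at t within {0..})"
  using assms unfolding has_vec_deriv_def by auto

text \<open>Derivatives are taken within the half line, hence one-sided at 0, so functions that
  agree for nonnegative times may be exchanged even at time 0.\<close>

lemma has_real_derivative_half_line_transform:
  assumes "(f has_real_derivative D) (at t within {0..})" "0 \<le> t" "\<And>s. 0 \<le> s \<Longrightarrow> f s = g s"
  shows "(g has_real_derivative D) (at t within {0..})"
  by (rule has_field_derivative_transform_within[OF assms(1), where d = 1]) (use assms in auto)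

lemma has_vec_deriv_cong:
  assumes "has_vec_deriv d f f'" and "\<And>t. 0 \<le> t \<Longrightarrow> g t = f t" and "\<And>t. 0 \<le> t \<Longrightarrow> g' t = f' t"
  shows "has_vec_deriv d g g'"
  unfolding has_vec_deriv_def
proof (intro allI impI conjI)
  fix t :: real assume t: "0 \<le> t"
  show "g t \<in> carrier_vec d" "g' t \<in> carrier_vec d" using assms t has_vec_derivD by auto
  fix j assume j: "j < d"
  show "((\<lambda>s. g s $ j) has_real_derivative g' t $ j) (at t within {0..})"
    unfolding assms(3)[OF t]
    by (rule has_real_derivative_half_line_transform[OF has_vec_derivD(3)[OF assms(1) t j] t])
      (use t assms(2) in auto)
qed

lemma has_vec_deriv_mult_mat:
  assumes f: "has_vec_deriv n f f'" and B: "B \<in> carrier_mat m n"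
  shows "has_vec_deriv m (\<lambda>t. B *\<^sub>v f t) (\<lambda>t. B *\<^sub>v f' t)"
  unfolding has_vec_deriv_def
proof (intro allI impI conjI)
  fix t :: real assume t: "0 \<le> t"
  note ft = has_vec_derivD[OF f t]
  show "B *\<^sub>v f t \<in> carrier_vec m" "B *\<^sub>v f' t \<in> carrier_vec m" using ft B by auto
  fix j assume j: "j < m"
  have "((\<lambda>s. \<Sum>k<n. B $$ (j, k) * f s $ k) has_real_derivative (\<Sum>k<n. B $$ (j, k) * f' t $ k)) (at t within {0..})"
    by (intro DERIV_sum DERIV_cmult ft(3)) auto
  then show "((\<lambda>s. (B *\<^sub>v f s) $ j) has_real_derivative (B *\<^sub>v f' t) $ j) (at t within {0..})"
    unfolding mult_vec_entry[OF B ft(2) j]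
    by (rule has_real_derivative_half_line_transform[OF _ t])
      (use t mult_vec_entry[OF B has_vec_derivD(1)[OF f] j] in auto)
qed

lemma has_vec_deriv_add:
  assumes f: "has_vec_deriv d f f'" and g: "has_vec_deriv d g g'"
  shows "has_vec_deriv d (\<lambda>t. f t + g t) (\<lambda>t. f' t + g' t)"
  unfolding has_vec_deriv_def
proof (intro allI impI conjI)
  fix t :: real assume t: "0 \<le> t"
  note ft = has_vec_derivD[OF f t] and gt = has_vec_derivD[OF g t]
  show "f t + g t \<in> carrier_vec d" "f' t + g' t \<in> carrier_vec d" using ft gt by auto
  fix j assume j: "j < d"
  have "((\<lambda>s. f s $ j + g s $ j) has_real_derivative (f' t $ j + g' t $ j)) (at t within {0..})"
    by (intro DERIV_add ft(3) gt(3) j)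
  then have "((\<lambda>s. (f s + g s) $ j) has_real_derivative (f' t $ j + g' t $ j)) (at t within {0..})"
    by (rule has_real_derivative_half_line_transform[OF _ t])
      (use j in \<open>simp add: carrier_vecD[OF has_vec_derivD(1)[OF g]]\<close>)
  then show "((\<lambda>s. (f s + g s) $ j) has_real_derivative (f' t + g' t) $ j) (at t within {0..})"
    using gt j by simp
qed

lemma has_vec_deriv_diff:
  assumes f: "has_vec_deriv d f f'" and g: "has_vec_deriv d g g'"
  shows "has_vec_deriv d (\<lambda>t. f t - g t) (\<lambda>t. f' t - g' t)"
proof -
  have h: "has_vec_deriv d (\<lambda>t. f t + (- (1\<^sub>m d :: real mat)) *\<^sub>v g t) (\<lambda>t. f' t + (- (1\<^sub>m d)) *\<^sub>v g' t)"
    by (rule has_vec_deriv_add[OF f has_vec_deriv_mult_mat[OF g]]) simp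
  have m: "x + (- (1\<^sub>m d :: real mat)) *\<^sub>v y = x - y" if "x \<in> carrier_vec d" "y \<in> carrier_vec d" for x y
  proof -
    have "(- (1\<^sub>m d :: real mat)) *\<^sub>v y = - (1\<^sub>m d *\<^sub>v y)" using that by (intro uminus_mult_mat_vec) simp
    then show ?thesis using that by (intro eq_vecI) auto
  qed
  show ?thesis
    by (rule has_vec_deriv_cong[OF h]) (use m has_vec_derivD(1,2)[OF f] has_vec_derivD(1,2)[OF g] in auto)
qed

lemma has_vec_deriv_block:
  assumes e: "has_vec_deriv (N * n) e e'" and i: "i < N"
  shows "has_vec_deriv n (\<lambda>t. block n i (e t)) (\<lambda>t. block n i (e' t))"
  unfolding has_vec_deriv_def
proof (intro allI impI conjI)
  fix t :: real and j assume t: "0 \<le> t" and j: "j < n"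
  show "((\<lambda>s. block n i (e s) $ j) has_real_derivative block n i (e' t) $ j) (at t within {0..})"
    using has_vec_derivD(3)[OF e t block_index_less[OF i j]] j by (simp add: block_def)
qed simp_all

lemma has_vec_deriv_stack:
  assumes f: "\<And>i. i < N \<Longrightarrow> has_vec_deriv n (f i) (f' i)"
  shows "has_vec_deriv (N * n) (\<lambda>t. stack_vec n N (\<lambda>i. f i t)) (\<lambda>t. stack_vec n N (\<lambda>i. f' i t))"
  unfolding has_vec_deriv_def
proof (intro allI impI conjI)
  fix t :: real and j assume t: "0 \<le> t" and j: "j < N * n"
  then have "j mod n < n" by (intro mod_less_divisor gr0I) auto
  moreover have "j div n < N" using j by (rule less_mult_imp_div_less)
  ultimately show "((\<lambda>s. stack_vec n N (\<lambda>i. f i s) $ j) has_real_derivative stack_vec n N (\<lambda>i. f' i t) $ j) (at t within {0..})"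
    using has_vec_derivD(3)[OF f t, of "j div n" "j mod n"] j by (simp add: stack_vec_def)
qed simp_all

text \<open>At interior points the derivative within the half line is an ordinary derivative; at 0
  it contributes continuity only, which is what the mean value argument asks of an endpoint.\<close>

lemma nonincreasing_half_line:
  fixes g :: "real \<Rightarrow> real"
  assumes g: "\<And>t. 0 \<le> t \<Longrightarrow> (g has_real_derivative g' t) (at t within {0..})"
    and le: "\<And>t. 0 \<le> t \<Longrightarrow> g' t \<le> 0" and t: "0 \<le> t"
  shows "g t \<le> g 0"
proof (rule DERIV_nonpos_imp_decreasing_open[OF t])
  fix x assume x: "0 < x" "x < t"
  have "(g has_real_derivative g' x) (at x within {0<..})"
    by (rule DERIV_subset[OF g]) (use x in auto)
  then have "(g has_real_derivative g' x) (at x)" using x by (simp add: at_within_open[of x "{0<..}"])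
  then show "\<exists>y. (g has_real_derivative y) (at x) \<and> y \<le> 0" using le[of x] x by auto
next
  have "continuous_on {0..} g"
    unfolding continuous_on_eq_continuous_within using g DERIV_continuous by blast
  then show "continuous_on {0..t} g" by (rule continuous_on_subset) auto
qed

text \<open>Each component and its negative are nonincreasing.\<close>

lemma has_vec_deriv_zero_imp_const:
  assumes f: "has_vec_deriv d f f'" and zero: "\<And>t. 0 \<le> t \<Longrightarrow> f' t = 0\<^sub>v d" and t: "0 \<le> t"
  shows "f t = f 0"
proof (rule eq_vecI)
  fix j assume "j < dim_vec (f 0)"
  then have j: "j < d" using has_vec_derivD(1)[OF f, of 0] by simp
  have d: "((\<lambda>s. f s $ j) has_real_derivative 0) (at t within {0..})" if "0 \<le> t" for t
    using has_vec_derivD(3)[OF f that j] zero[OF that] j by simp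
  then have d': "((\<lambda>s. - f s $ j) has_real_derivative 0) (at t within {0..})" if "0 \<le> t" for t
    using DERIV_minus[OF d[OF that]] by simp
  show "f t $ j = f 0 $ j"
    using nonincreasing_half_line[of "\<lambda>s. f s $ j" "\<lambda>_. 0" t] nonincreasing_half_line[of "\<lambda>s. - f s $ j" "\<lambda>_. 0" t] d d' t
    by auto
qed (use has_vec_derivD(1)[OF f t] has_vec_derivD(1)[OF f order_refl] in simp)

text \<open>The integrating factor exp (k t) makes the product with \<open>V\<close>
  nonincreasing.\<close>

lemma exponential_decay:
  fixes V :: "real \<Rightarrow> real"
  assumes V: "\<And>t. 0 \<le> t \<Longrightarrow> (V has_real_derivative V' t) (at t within {0..})"
    and le: "\<And>t. 0 \<le> t \<Longrightarrow> V' t \<le> - k * V t" and t: "0 \<le> t"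
  shows "V t \<le> exp (- k * t) * V 0"
proof -
  have "((\<lambda>s. exp (k * s) * V s) has_real_derivative exp (k * t) * (k * V t + V' t)) (at t within {0..})" if "0 \<le> t" for t
    by (auto intro!: derivative_eq_intros V that simp: algebra_simps)
  moreover have "exp (k * t) * (k * V t + V' t) \<le> 0" if "0 \<le> t" for t
    using le[OF that] by (intro mult_nonneg_nonpos) auto
  ultimately have "exp (k * t) * V t \<le> exp (k * 0) * V 0"
    using nonincreasing_half_line[of "\<lambda>s. exp (k * s) * V s" "\<lambda>t. exp (k * t) * (k * V t + V' t)" t] t by blast
  then have "exp (- k * t) * (exp (k * t) * V t) \<le> exp (- k * t) * V 0" by (intro mult_left_mono) auto
  moreover have "exp (- k * t) * (exp (k * t) * V t) = V t"
    by (simp add: mult.assoc[symmetric] exp_add[symmetric])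
  ultimately show ?thesis by (simp only:)
qed

lemma has_real_derivative_form:
  assumes f: "has_vec_deriv d f f'" and Y: "Y \<in> carrier_mat d d" "Y\<^sup>T = Y" and t: "0 \<le> t"
  shows "((\<lambda>s. f s \<bullet> (Y *\<^sub>v f s)) has_real_derivative 2 * (f t \<bullet> (Y *\<^sub>v f' t))) (at t within {0..})"
proof -
  note ft = has_vec_derivD[OF f t]
  have "((\<lambda>s. \<Sum>i<d. \<Sum>j<d. f s $ i * f s $ j * Y $$ (i, j)) has_real_derivative
      (\<Sum>i<d. \<Sum>j<d. (f' t $ i * f t $ j + f' t $ j * f t $ i) * Y $$ (i, j))) (at t within {0..})"
    by (intro DERIV_sum DERIV_cmult_right DERIV_mult' DERIV_mult ft(3)) auto
  also have "(\<Sum>i<d. \<Sum>j<d. (f' t $ i * f t $ j + f' t $ j * f t $ i) * Y $$ (i, j))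
      = f' t \<bullet> (Y *\<^sub>v f t) + f t \<bullet> (Y *\<^sub>v f' t)"
    unfolding bilinear_form_expand[OF Y(1) ft(2,1)] bilinear_form_expand[OF Y(1) ft(1,2)] sum.distrib[symmetric]
    by (intro sum.cong) (auto simp: algebra_simps)
  also have "\<dots> = 2 * (f t \<bullet> (Y *\<^sub>v f' t))" using form_sym[OF Y ft(2,1)] by simp
  finally show ?thesis
    by (rule has_real_derivative_half_line_transform[OF _ t])
      (use t bilinear_form_expand[OF Y(1) has_vec_derivD(1)[OF f] has_vec_derivD(1)[OF f]] in auto)
qed

section \<open>The error system\<close>

lemma vec_eqI_scalar_prod:
  fixes x y :: "real vec"
  assumes x: "x \<in> carrier_vec n" and y: "y \<in> carrier_vec n"
    and eq: "\<And>z. z \<in> carrier_vec n \<Longrightarrow> z \<bullet> x = z \<bullet> y"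
  shows "x = y"
proof (rule eq_vecI)
  fix i assume "i < dim_vec y"
  then have i: "i < n" using y by simp
  then show "x $ i = y $ i" using eq[of "unit_vec n i"] x y by simp
qed (use x y in simp)

lemma S_mat_transpose_mult_vec:
  assumes "p \<le> n" and x: "x \<in> carrier_vec p" and y: "y \<in> carrier_vec (n - p)"
  shows "(S_mat n p)\<^sup>T *\<^sub>v (x @\<^sub>v y) = y"
proof (rule vec_eqI_scalar_prod)
  have S: "S_mat n p \<in> carrier_mat n (n - p)" "(S_mat n p)\<^sup>T \<in> carrier_mat (n - p) n"
    using S_mat_carrier[OF assms(1)] by auto
  have xy: "x @\<^sub>v y \<in> carrier_vec n" using append_carrier_vec[OF x y] assms(1) by simp
  show "(S_mat n p)\<^sup>T *\<^sub>v (x @\<^sub>v y) \<in> carrier_vec (n - p)" using S xy by simp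
  show "z \<bullet> ((S_mat n p)\<^sup>T *\<^sub>v (x @\<^sub>v y)) = z \<bullet> y" if z: "z \<in> carrier_vec (n - p)" for z
    using adjoint_scalar_prod[OF S(2) z xy] S_mat_mult_vec[OF z]
      scalar_prod_append[OF zero_carrier_vec z x y] x by simp
qed (rule y)

lemma mat_mult_vec3:
  fixes A B C :: "real mat"
  assumes "A \<in> carrier_mat a b" "B \<in> carrier_mat b c" "C \<in> carrier_mat c d" "w \<in> carrier_vec d"
  shows "(A * B * C) *\<^sub>v w = A *\<^sub>v (B *\<^sub>v (C *\<^sub>v w))"
  using assoc_mult_mat_vec[OF mult_carrier_mat[OF assms(1,2)] assms(3,4)]
    assoc_mult_mat_vec[OF assms(1,2) mult_mat_vec_carrier[OF assms(3,4)]] by simp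

text \<open>All factors except the Kronecker product are block diagonal, so the large system falls
  apart into one equation per node that sees the other nodes only through
  \<open>mix\<close>.\<close>

lemma error_mat_mult_stack_vec:
  assumes a: "a \<in> carrier_mat N N"
    and Ts: "\<And>i. i < N \<Longrightarrow> Ts i \<in> carrier_mat n (c i)"
    and Ns: "\<And>i. i < N \<Longrightarrow> gN (obs i) \<in> carrier_mat (c i) (c i)"
    and Ms: "\<And>i. i < N \<Longrightarrow> gM (obs i) \<in> carrier_mat (c i) n"
    and w: "\<And>i. i < N \<Longrightarrow> w i \<in> carrier_vec n"
  shows "error_mat n N a r \<gamma> Ts obs *\<^sub>v stack_vec n N w = stack_vec n N (\<lambda>i. Ts i *\<^sub>v
    (gN (obs i) *\<^sub>v ((Ts i)\<^sup>T *\<^sub>v w i) - \<gamma> \<cdot>\<^sub>v (gM (obs i) *\<^sub>v mix n N (weight_mat N r * laplacian N a) w i)))"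
proof -
  let ?T = "block_diag N Ts" and ?N = "block_diag N (\<lambda>i. gN (obs i))" and ?M = "block_diag N (\<lambda>i. gM (obs i))"
  let ?RL = "weight_mat N r * laplacian N a" and ?c = "\<Sum>i<N. c i"
  let ?k = "kron ?RL (1\<^sub>m n)"
  have RL: "?RL \<in> carrier_mat N N" by (intro mult_carrier_mat[of _ N N]) (use a in simp_all)
  have T: "?T \<in> carrier_mat (N * n) ?c" using block_diag_carrier[of N Ts "\<lambda>_. n" c] Ts by simp
  have TT: "?T\<^sup>T \<in> carrier_mat ?c (N * n)" using T by simp
  have Nc: "?N \<in> carrier_mat ?c ?c" using block_diag_carrier[of N "\<lambda>i. gN (obs i)" c c] Ns by simp
  have M: "?M \<in> carrier_mat ?c (N * n)" using block_diag_carrier[of N "\<lambda>i. gM (obs i)" c "\<lambda>_. n"] Ms by simp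
  have k: "?k \<in> carrier_mat (N * n) (N * n)" by (rule kron_one_carrier[OF RL])
  have TNT: "?T * ?N * ?T\<^sup>T \<in> carrier_mat (N * n) (N * n)"
    by (rule mult_carrier_mat[OF mult_carrier_mat[OF T Nc] TT])
  have TMk: "?T * ?M * ?k \<in> carrier_mat (N * n) (N * n)"
    by (rule mult_carrier_mat[OF mult_carrier_mat[OF T M] k])
  then have gTMk: "\<gamma> \<cdot>\<^sub>m (?T * ?M * ?k) \<in> carrier_mat (N * n) (N * n)" by simp
  have sw: "stack_vec n N w = cat_vec N w" by (rule stack_vec_eq_cat_vec[OF w])
  have s: "stack_vec n N w \<in> carrier_vec (N * n)" by simp
  have TsT: "(Ts i)\<^sup>T \<in> carrier_mat (c i) n" if "i < N" for i using Ts[OF that] by simp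
  have TsTw: "(Ts i)\<^sup>T *\<^sub>v w i \<in> carrier_vec (c i)" if "i < N" for i using TsT[OF that] w[OF that] by simp
  have Nw: "gN (obs i) *\<^sub>v ((Ts i)\<^sup>T *\<^sub>v w i) \<in> carrier_vec (c i)" if "i < N" for i
    using Ns[OF that] TsTw[OF that] by simp
  have Mw: "gM (obs i) *\<^sub>v mix n N ?RL w i \<in> carrier_vec (c i)" if "i < N" for i
    by (rule mult_mat_vec_carrier[OF Ms[OF that] mix_carrier(1)])
  have BT: "?T\<^sup>T = block_diag N (\<lambda>i. (Ts i)\<^sup>T)" by (rule block_diag_transpose[of N Ts "\<lambda>_. n" c]) (rule Ts)
  have TNTw: "(?T * ?N * ?T\<^sup>T) *\<^sub>v stack_vec n N w = cat_vec N (\<lambda>i. Ts i *\<^sub>v (gN (obs i) *\<^sub>v ((Ts i)\<^sup>T *\<^sub>v w i)))"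
    unfolding mat_mult_vec3[OF T Nc TT s] unfolding sw BT
    using block_diag_mult_cat_vec[of N "\<lambda>i. (Ts i)\<^sup>T" c "\<lambda>_. n" w, OF TsT w]
      block_diag_mult_cat_vec[of N "\<lambda>i. gN (obs i)" c c "\<lambda>i. (Ts i)\<^sup>T *\<^sub>v w i", OF Ns TsTw]
      block_diag_mult_cat_vec[of N Ts "\<lambda>_. n" c "\<lambda>i. gN (obs i) *\<^sub>v ((Ts i)\<^sup>T *\<^sub>v w i)", OF Ts Nw] by simp
  have TMkw: "(?T * ?M * ?k) *\<^sub>v stack_vec n N w = cat_vec N (\<lambda>i. Ts i *\<^sub>v (gM (obs i) *\<^sub>v mix n N ?RL w i))"
    unfolding mat_mult_vec3[OF T M k s] kron_one_mult_stack_vec[OF RL]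
    using stack_vec_eq_cat_vec[of N "mix n N ?RL w" n]
      block_diag_mult_cat_vec[of N "\<lambda>i. gM (obs i)" c "\<lambda>_. n" "mix n N ?RL w", OF Ms mix_carrier(1)]
      block_diag_mult_cat_vec[of N Ts "\<lambda>_. n" c "\<lambda>i. gM (obs i) *\<^sub>v mix n N ?RL w i", OF Ts Mw] by simp
  have c1: "Ts i *\<^sub>v (gN (obs i) *\<^sub>v ((Ts i)\<^sup>T *\<^sub>v w i)) \<in> carrier_vec n"
    and c2: "\<gamma> \<cdot>\<^sub>v (Ts i *\<^sub>v (gM (obs i) *\<^sub>v mix n N ?RL w i)) \<in> carrier_vec n" if "i < N" for i
    using Ts[OF that] Nw[OF that] Mw[OF that] by auto
  have "error_mat n N a r \<gamma> Ts obs *\<^sub>v stack_vec n N w =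
    (?T * ?N * ?T\<^sup>T) *\<^sub>v stack_vec n N w - \<gamma> \<cdot>\<^sub>v ((?T * ?M * ?k) *\<^sub>v stack_vec n N w)"
    unfolding error_mat_def using minus_mult_distrib_mat_vec[OF TNT gTMk s] smult_mat_mult_vec[OF TMk s] by simp
  also have "\<dots> = cat_vec N (\<lambda>i. Ts i *\<^sub>v (gN (obs i) *\<^sub>v ((Ts i)\<^sup>T *\<^sub>v w i)) - \<gamma> \<cdot>\<^sub>v (Ts i *\<^sub>v (gM (obs i) *\<^sub>v mix n N ?RL w i)))"
    unfolding TNTw TMkw cat_vec_smult by (rule cat_vec_diff[of N _ "\<lambda>_. n", OF c1 c2])
  also have "\<dots> = cat_vec N (\<lambda>i. Ts i *\<^sub>v (gN (obs i) *\<^sub>v ((Ts i)\<^sup>T *\<^sub>v w i) - \<gamma> \<cdot>\<^sub>v (gM (obs i) *\<^sub>v mix n N ?RL w i)))"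
  proof (rule cat_vec_cong)
    fix i assume i: "i < N"
    have "\<gamma> \<cdot>\<^sub>v (gM (obs i) *\<^sub>v mix n N ?RL w i) \<in> carrier_vec (c i)" using Mw[OF i] by simp
    then show "Ts i *\<^sub>v (gN (obs i) *\<^sub>v ((Ts i)\<^sup>T *\<^sub>v w i)) - \<gamma> \<cdot>\<^sub>v (Ts i *\<^sub>v (gM (obs i) *\<^sub>v mix n N ?RL w i))
      = Ts i *\<^sub>v (gN (obs i) *\<^sub>v ((Ts i)\<^sup>T *\<^sub>v w i) - \<gamma> \<cdot>\<^sub>v (gM (obs i) *\<^sub>v mix n N ?RL w i))"
      using mult_minus_distrib_mat_vec[OF Ts[OF i] Nw[OF i]] mult_mat_vec[OF Ts[OF i] Mw[OF i]] by simp
  qed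
  also have "\<dots> = stack_vec n N (\<lambda>i. Ts i *\<^sub>v
    (gN (obs i) *\<^sub>v ((Ts i)\<^sup>T *\<^sub>v w i) - \<gamma> \<cdot>\<^sub>v (gM (obs i) *\<^sub>v mix n N ?RL w i)))"
  proof (rule stack_vec_eq_cat_vec[symmetric])
    fix i assume i: "i < N"
    show "Ts i *\<^sub>v (gN (obs i) *\<^sub>v ((Ts i)\<^sup>T *\<^sub>v w i) - \<gamma> \<cdot>\<^sub>v (gM (obs i) *\<^sub>v mix n N ?RL w i)) \<in> carrier_vec n"
      using Ts[OF i] Nw[OF i] Mw[OF i] by (intro mult_mat_vec_carrier[OF Ts[OF i]]) auto
  qed
  finally show ?thesis .
qed

lemma closed_loop_carrier:
  assumes "o22 d \<in> carrier_mat q q" "o12 d \<in> carrier_mat p q" "oE d \<in> carrier_mat p p" "H \<in> carrier_mat q p"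
  shows "closed_loop d H \<in> carrier_mat q q"
  unfolding closed_loop_def
  by (rule minus_carrier_mat, rule mult_carrier_mat[OF mult_carrier_mat[OF assms(4,3)] assms(2)])

lemma closed_loop_mult_vec:
  assumes c: "o22 d \<in> carrier_mat q q" "o12 d \<in> carrier_mat p q" "oE d \<in> carrier_mat p p" "H \<in> carrier_mat q p"
    and y: "y \<in> carrier_vec q"
  shows "closed_loop d H *\<^sub>v y = o22 d *\<^sub>v y - H *\<^sub>v (oE d *\<^sub>v (o12 d *\<^sub>v y))"
proof -
  have HE: "H * oE d * o12 d \<in> carrier_mat q q"
    by (rule mult_carrier_mat[OF mult_carrier_mat[OF c(4,3)] c(2)])
  show ?thesis unfolding closed_loop_def minus_mult_distrib_mat_vec[OF c(1) HE y] mat_mult_vec3[OF c(4,3,2) y] ..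
qed

lemma shift_mult_vec:
  assumes "(M :: real mat) \<in> carrier_mat q q" "y \<in> carrier_vec q"
  shows "(M + c \<cdot>\<^sub>m 1\<^sub>m q) *\<^sub>v y = M *\<^sub>v y + c \<cdot>\<^sub>v y"
  using add_mult_distrib_mat_vec[OF assms(1) _ assms(2), of "c \<cdot>\<^sub>m 1\<^sub>m q"]
    smult_mat_mult_vec[OF one_carrier_mat assms(2), of c] assms by simp

lemma lyapunov_solution_iff:
  assumes M: "closed_loop d H \<in> carrier_mat (v - p) (v - p)"
  shows "lyapunov_solution p v \<alpha> \<gamma> d H X \<longleftrightarrow> X \<in> carrier_mat (v - p) (v - p) \<and>
    lyap (v - p) (closed_loop d H + \<alpha> \<cdot>\<^sub>m 1\<^sub>m (v - p)) ((\<gamma> - 2 * \<alpha>) \<cdot>\<^sub>m 1\<^sub>m (v - p)) X"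
  unfolding lyapunov_solution_def using lyap_iff[of "closed_loop d H + \<alpha> \<cdot>\<^sub>m 1\<^sub>m (v - p)" "v - p"] M by auto

text \<open>The shift by \<alpha> turns eigenvalues left of -\<alpha> into eigenvalues with negative
  real part, and the constant term is positive definite once 2 \<alpha> < \<gamma>. For an empty
  block definiteness is vacuous, hence the guard on the condition for \<gamma>.\<close>

lemma lyapunov_solution_exists_pos_def:
  assumes M: "closed_loop d H \<in> carrier_mat (v - p) (v - p)" and H: "admissible_H p v \<alpha> d H"
    and \<gamma>: "0 < v - p \<Longrightarrow> 2 * \<alpha> < \<gamma>"
  shows "\<exists>X. lyapunov_solution p v \<alpha> \<gamma> d H X"
    and "lyapunov_solution p v \<alpha> \<gamma> d H X \<Longrightarrow> pos_def X"
proof -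
  let ?q = "v - p"
  let ?M = "closed_loop d H + \<alpha> \<cdot>\<^sub>m 1\<^sub>m ?q" and ?Q = "(\<gamma> - 2 * \<alpha>) \<cdot>\<^sub>m 1\<^sub>m ?q"
  have Mc: "?M \<in> carrier_mat ?q ?q" and Q: "?Q \<in> carrier_mat ?q ?q" using M by auto
  have QT: "?Q\<^sup>T = ?Q" by (intro eq_matI) auto
  have hur: "hurwitz ?M"
    unfolding hurwitz_def
  proof (intro allI impI)
    fix s assume "eigenvalue (cmat ?M) s"
    then have "eigenvalue (cmat (closed_loop d H)) (s - of_real \<alpha>)" by (rule eigenvalue_shift[OF M])
    then have "Re (s - of_real \<alpha>) < - \<alpha>" using H unfolding admissible_H_def by blast
    then show "Re s < 0" by simp
  qed
  show "\<exists>X. lyapunov_solution p v \<alpha> \<gamma> d H X"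
    unfolding lyapunov_solution_iff[OF M] using lyapunov_exists[OF Mc hur Q] by blast
  have Qpd: "0 < u \<bullet> (?Q *\<^sub>v u)" if u: "u \<in> carrier_vec ?q" "u \<noteq> 0\<^sub>v ?q" for u
  proof -
    have "0 < ?q" using u by (cases "?q = 0") auto
    moreover have "u \<bullet> (?Q *\<^sub>v u) = (\<gamma> - 2 * \<alpha>) * (u \<bullet> u)"
      using smult_mat_mult_vec[OF one_carrier_mat u(1), of "\<gamma> - 2 * \<alpha>"] u by simp
    ultimately show ?thesis using \<gamma> scalar_prod_self_pos[OF u] by simp
  qed
  have Qpsd: "0 \<le> u \<bullet> (?Q *\<^sub>v u)" if u: "u \<in> carrier_vec ?q" for u
    using Qpd[OF u] scalar_prod_left_zero[OF mult_mat_vec_carrier[OF Q u]]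
    by (cases "u = 0\<^sub>v ?q") (auto simp: less_imp_le)
  assume "lyapunov_solution p v \<alpha> \<gamma> d H X"
  then have X: "X \<in> carrier_mat ?q ?q" "lyap ?q ?M ?Q X" unfolding lyapunov_solution_iff[OF M] by auto
  have "0 < u \<bullet> (X *\<^sub>v u)" if "u \<in> carrier_vec ?q" "u \<noteq> 0\<^sub>v ?q" for u
    by (rule lyapunov_psd(2)[OF Mc hur Q Qpsd X that(1) Qpd that(2)])
  then show "pos_def X"
    unfolding pos_def_def using lyapunov_symmetric[OF Mc hur Q QT X] X by auto
qed

section \<open>Node equations in the decomposed coordinates\<close>

context observer_design
begin

lemma shapes:
  assumes "i < N"
  shows "oE (d i) \<in> carrier_mat (p i) (p i)" "invertible_mat (oE (d i))"
    "o11 (d i) \<in> carrier_mat (p i) (p i)" "o12 (d i) \<in> carrier_mat (p i) (v i - p i)"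
    "o21 (d i) \<in> carrier_mat (v i - p i) (p i)" "o22 (d i) \<in> carrier_mat (v i - p i) (v i - p i)"
    "o31 (d i) \<in> carrier_mat (n - v i) (p i)" "o32 (d i) \<in> carrier_mat (n - v i) (v i - p i)"
    "ou (d i) \<in> carrier_mat (n - v i) (n - v i)"
  using dec[OF assms] unfolding obs_decomposition_def by auto

lemma dims:
  assumes "i < N"
  shows "p i \<le> n" "(v i - p i) + (n - v i) = n - p i" "p i + ((v i - p i) + (n - v i)) = n"
    "p i + (v i - p i) = v i" "v i + (n - v i) = n"
  using pv[OF assms] vn[OF assms] by auto

lemma plant_mult_vec:
  assumes i: "i < N" and x: "x1 \<in> carrier_vec (p i)" "x2 \<in> carrier_vec (v i - p i)" "x3 \<in> carrier_vec (n - v i)"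
  shows "A *\<^sub>v (oT (d i) *\<^sub>v (x1 @\<^sub>v (x2 @\<^sub>v x3))) = oT (d i) *\<^sub>v
    ((o11 (d i) *\<^sub>v x1 + o12 (d i) *\<^sub>v x2) @\<^sub>v ((o21 (d i) *\<^sub>v x1 + o22 (d i) *\<^sub>v x2) @\<^sub>v
     (o31 (d i) *\<^sub>v x1 + o32 (d i) *\<^sub>v x2 + ou (d i) *\<^sub>v x3)))"
proof -
  note s = shapes[OF i]
  let ?Ao = "four_block_mat (o11 (d i)) (o12 (d i)) (o21 (d i)) (o22 (d i))"
  have B: "(oT (d i))\<^sup>T * A * oT (d i) = four_block_mat ?Ao (0\<^sub>m (v i) (n - v i)) (o31 (d i) @\<^sub>c o32 (d i)) (ou (d i))"
    using dec[OF i] unfolding obs_decomposition_def by blast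
  have Ao: "?Ao \<in> carrier_mat (v i) (v i)"
    using four_block_carrier_mat[OF s(3,6), of "o12 (d i)" "o21 (d i)"] dims[OF i] by simp
  have A3: "o31 (d i) @\<^sub>c o32 (d i) \<in> carrier_mat (n - v i) (v i)"
    using append_cols_carrier[OF s(7,8)] dims[OF i] by simp
  have x12: "x1 @\<^sub>v x2 \<in> carrier_vec (v i)" using append_carrier_vec[OF x(1,2)] dims[OF i] by simp
  have c: "x1 @\<^sub>v (x2 @\<^sub>v x3) \<in> carrier_vec n"
    using append_carrier_vec[OF x(1) append_carrier_vec[OF x(2,3)]] dims[OF i] by simp
  have Aox: "?Ao *\<^sub>v (x1 @\<^sub>v x2) = (o11 (d i) *\<^sub>v x1 + o12 (d i) *\<^sub>v x2) @\<^sub>v (o21 (d i) *\<^sub>v x1 + o22 (d i) *\<^sub>v x2)"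
    by (rule four_block_mat_mult_vec[OF s(3-6) x(1,2)])
  have "((oT (d i))\<^sup>T * A * oT (d i)) *\<^sub>v (x1 @\<^sub>v (x2 @\<^sub>v x3)) =
      (?Ao *\<^sub>v (x1 @\<^sub>v x2)) @\<^sub>v ((o31 (d i) @\<^sub>c o32 (d i)) *\<^sub>v (x1 @\<^sub>v x2) + ou (d i) *\<^sub>v x3)"
    unfolding B append_vec_assoc[symmetric]
    using four_block_mat_mult_vec[OF Ao zero_carrier_mat A3 s(9) x12 x(3)] mult_mat_vec_carrier[OF Ao x12] x(3) by simp
  also have "\<dots> = (o11 (d i) *\<^sub>v x1 + o12 (d i) *\<^sub>v x2) @\<^sub>v ((o21 (d i) *\<^sub>v x1 + o22 (d i) *\<^sub>v x2) @\<^sub>v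
     (o31 (d i) *\<^sub>v x1 + o32 (d i) *\<^sub>v x2 + ou (d i) *\<^sub>v x3))"
    unfolding Aox append_vec_assoc append_cols_mult_vec[OF s(7,8) x(1,2)] ..
  finally show ?thesis using orth_similar_mult_vec[OF T[OF i] A c] by simp
qed

lemma output_mult_vec:
  assumes i: "i < N" and x: "x1 \<in> carrier_vec (p i)" "x2 \<in> carrier_vec (v i - p i)" "x3 \<in> carrier_vec (n - v i)"
  shows "F i *\<^sub>v (oT (d i) *\<^sub>v (x1 @\<^sub>v (x2 @\<^sub>v x3))) = oE (d i) *\<^sub>v x1"
proof -
  have FT: "F i * oT (d i) = oE (d i) @\<^sub>c 0\<^sub>m (p i) (v i - p i) @\<^sub>c 0\<^sub>m (p i) (n - v i)"
    using dec[OF i] unfolding obs_decomposition_def by blast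
  show ?thesis
    by (rule output_form_mult_vec[OF shapes(1)[OF i] FT F[OF i] Tc(1)[OF i] _ x]) (use dims[OF i] in simp)
qed

abbreviation Ts :: "nat \<Rightarrow> real mat" where "Ts i \<equiv> Ts_mat n (p i) (d i)"

lemma Ts:
  assumes i: "i < N"
  shows Ts_carrier: "Ts i \<in> carrier_mat n (n - p i)"
    and Ts_mult_vec: "y \<in> carrier_vec (n - p i) \<Longrightarrow> Ts i *\<^sub>v y = oT (d i) *\<^sub>v (0\<^sub>v (p i) @\<^sub>v y)"
    and Ts_transpose_Ts: "y \<in> carrier_vec (n - p i) \<Longrightarrow> (Ts i)\<^sup>T *\<^sub>v (Ts i *\<^sub>v y) = y"
proof -
  have S: "S_mat n (p i) \<in> carrier_mat n (n - p i)" "(S_mat n (p i))\<^sup>T \<in> carrier_mat (n - p i) n"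
    using S_mat_carrier[OF dims(1)[OF i]] by auto
  note Tc = Tc[OF i]
  show "Ts i \<in> carrier_mat n (n - p i)" unfolding Ts_mat_def by (rule mult_carrier_mat[OF Tc(1) S(1)])
  assume y: "y \<in> carrier_vec (n - p i)"
  show 1: "Ts i *\<^sub>v y = oT (d i) *\<^sub>v (0\<^sub>v (p i) @\<^sub>v y)"
    unfolding Ts_mat_def assoc_mult_mat_vec[OF Tc(1) S(1) y] S_mat_mult_vec[OF y] ..
  have c: "0\<^sub>v (p i) @\<^sub>v y \<in> carrier_vec n" using append_carrier_vec[OF zero_carrier_vec y, of "p i"] dims(1)[OF i] by simp
  have "(Ts i)\<^sup>T = (S_mat n (p i))\<^sup>T * (oT (d i))\<^sup>T" unfolding Ts_mat_def by (rule transpose_mult[OF Tc(1) S(1)])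
  then have "(Ts i)\<^sup>T *\<^sub>v (Ts i *\<^sub>v y) = (S_mat n (p i))\<^sup>T *\<^sub>v ((oT (d i))\<^sup>T *\<^sub>v (oT (d i) *\<^sub>v (0\<^sub>v (p i) @\<^sub>v y)))"
    unfolding 1 using assoc_mult_mat_vec[OF S(2) Tc(2) mult_mat_vec_carrier[OF Tc(1) c]] by simp
  then show "(Ts i)\<^sup>T *\<^sub>v (Ts i *\<^sub>v y) = y"
    using orth_mat_inverse(2)[OF T[OF i] c] S_mat_transpose_mult_vec[OF dims(1)[OF i] zero_carrier_vec y] by simp
qed

lemma observer_gains_exist:
  assumes i: "i < N"
  shows "observable (oE (d i) * o12 (d i)) (o22 (d i))" and "\<exists>H. admissible_H (p i) (v i) \<alpha> (d i) H"
proof -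
  note s = shapes[OF i]
  show obs: "observable (oE (d i) * o12 (d i)) (o22 (d i))"
    by (rule observable_reduced_pair[OF s(1-6)]) (use dec[OF i] in \<open>auto simp: obs_decomposition_def\<close>)
  have E12: "oE (d i) * o12 (d i) \<in> carrier_mat (p i) (v i - p i)" by (rule mult_carrier_mat[OF s(1,4)])
  obtain H where H: "H \<in> carrier_mat (v i - p i) (p i)"
    "\<forall>s. eigenvalue (cmat (o22 (d i) - H * (oE (d i) * o12 (d i)))) s \<longrightarrow> Re s < - \<alpha>"
    using observer_gain_exists[OF s(6) E12 obs] by blast
  have "H * (oE (d i) * o12 (d i)) = H * oE (d i) * o12 (d i)" by (rule assoc_mult_mat[OF H(1) s(1,4), symmetric])
  with H show "\<exists>H. admissible_H (p i) (v i) \<alpha> (d i) H" unfolding admissible_H_def closed_loop_def by auto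
qed

text \<open>Since \<epsilon> < 1, the bound 2 \<alpha> < \<gamma> \<epsilon> yields the one that the
  Lyapunov equation asks for. A nonempty block at some node provides the node and the dimension that
  \<epsilon> < 1 relies on.\<close>

lemma gamma_bound:
  assumes eps: "admissible_eps n N v a r (\<lambda>i. 1) d \<epsilon>" and gam: "admissible_gamma n N v \<alpha> \<epsilon> d \<gamma>"
    and i: "i < N" "0 < v i - p i"
  shows "2 * \<alpha> < \<gamma>"
proof -
  have "\<epsilon> < 1" by (rule admissible_eps_less_1[OF eps]) (use i vn[OF i(1)] in auto)
  moreover have "0 < \<gamma>" "2 * \<alpha> < \<gamma> * \<epsilon>" using gam unfolding admissible_gamma_def by auto
  moreover from calculation have "\<gamma> * \<epsilon> < \<gamma> * 1" by (intro mult_strict_left_mono) auto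
  ultimately show ?thesis by linarith
qed

text \<open>A matrix and its transpose have the same quadratic form; the coupling, which involves
  only R L, can therefore be measured by its symmetrization.\<close>

lemma sum_mix_weight_laplacian:
  assumes u: "\<And>i. i < N \<Longrightarrow> u i \<in> carrier_vec n"
  shows "2 * (\<Sum>i<N. u i \<bullet> mix n N (weight_mat N r * laplacian N a) u i) = (\<Sum>i<N. \<Sum>j<N. K $$ (i, j) * (u i \<bullet> u j))"
proof -
  let ?k = "\<lambda>i j. r $ i * laplacian N a $$ (i, j)"
  have "(\<Sum>i<N. u i \<bullet> mix n N (weight_mat N r * laplacian N a) u i) = (\<Sum>i<N. \<Sum>j<N. ?k i j * (u i \<bullet> u j))"
    using u by (intro sum.cong) (auto simp: scalar_prod_mix weight_laplacian_entry(1)[OF a] simp del: index_mult_mat(1))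
  moreover have "(\<Sum>i<N. \<Sum>j<N. ?k i j * (u i \<bullet> u j)) = (\<Sum>i<N. \<Sum>j<N. ?k j i * (u i \<bullet> u j))"
    using u by (subst sum.swap) (intro sum.cong, auto simp: comm_scalar_prod[of _ n])
  moreover have "(\<Sum>i<N. \<Sum>j<N. K $$ (i, j) * (u i \<bullet> u j))
      = (\<Sum>i<N. \<Sum>j<N. ?k i j * (u i \<bullet> u j)) + (\<Sum>i<N. \<Sum>j<N. ?k j i * (u i \<bullet> u j))"
    unfolding sum.distrib[symmetric] by (intro sum.cong) (auto simp: sym_laplacian_entry[OF a] algebra_simps)
  ultimately show ?thesis by simp
qed

end

section \<open>Lyapunov function\<close>

lemma vnorm_nonneg: "0 \<le> vnorm w"
  unfolding vnorm_def using scalar_prod_self_nonneg by simp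

locale gain_design = observer_design +
  fixes m :: "nat \<Rightarrow> nat" and C D H X :: "nat \<Rightarrow> real mat" and \<alpha> \<gamma> \<epsilon> :: real
  assumes \<alpha>: "0 \<le> \<alpha>"
    and fac: "\<And>i. i < N \<Longrightarrow> full_rank_factorization (m i) n (p i) (C i) (D i) (F i)"
    and eps: "admissible_eps n N v a r (\<lambda>i. 1) d \<epsilon>" and gam: "admissible_gamma n N v \<alpha> \<epsilon> d \<gamma>"
    and H: "\<And>i. i < N \<Longrightarrow> admissible_H (p i) (v i) \<alpha> (d i) (H i)"
    and X: "\<And>i. i < N \<Longrightarrow> lyapunov_solution (p i) (v i) \<alpha> \<gamma> (d i) (H i) (X i)"
begin

abbreviation obs :: "nat \<Rightarrow> gains" where
  "obs i \<equiv> designed_gains n (p i) (v i) (D i) (d i) (H i) (X i)"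

abbreviation M :: "nat \<Rightarrow> real mat" where "M i \<equiv> closed_loop (d i) (H i)"

definition \<Theta> :: "nat \<Rightarrow> real mat" where
  "\<Theta> i = four_block_mat (X i) (0\<^sub>m (v i - p i) (n - v i)) (0\<^sub>m (n - v i) (v i - p i)) (1\<^sub>m (n - v i))"

lemma M_carrier: "i < N \<Longrightarrow> M i \<in> carrier_mat (v i - p i) (v i - p i)"
  using closed_loop_carrier[of "d i" "v i - p i" "p i" "H i"] shapes[of i] H[of i] unfolding admissible_H_def by blast

lemma X_props:
  assumes i: "i < N"
  shows "X i \<in> carrier_mat (v i - p i) (v i - p i)" "pos_def (X i)" "(X i)\<^sup>T = X i"
    "y \<in> carrier_vec (v i - p i) \<Longrightarrow>
      2 * (y \<bullet> (X i *\<^sub>v (M i *\<^sub>v y))) = - 2 * \<alpha> * (y \<bullet> (X i *\<^sub>v y)) - (\<gamma> - 2 * \<alpha>) * (y \<bullet> y)"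
proof -
  let ?q = "v i - p i"
  show Xc: "X i \<in> carrier_mat ?q ?q" using X[OF i] unfolding lyapunov_solution_def by blast
  show pd: "pos_def (X i)"
    by (rule lyapunov_solution_exists_pos_def(2)[OF M_carrier[OF i] H[OF i] gamma_bound[OF eps gam i] X[OF i]])
  then show XT: "(X i)\<^sup>T = X i" unfolding pos_def_def by blast
  assume y: "y \<in> carrier_vec ?q"
  have My: "M i *\<^sub>v y \<in> carrier_vec ?q" using M_carrier[OF i] y by simp
  have "lyap ?q (M i + \<alpha> \<cdot>\<^sub>m 1\<^sub>m ?q) ((\<gamma> - 2 * \<alpha>) \<cdot>\<^sub>m 1\<^sub>m ?q) (X i)"
    using X[OF i] unfolding lyapunov_solution_iff[OF M_carrier[OF i]] by blast
  then have "(M i *\<^sub>v y + \<alpha> \<cdot>\<^sub>v y) \<bullet> (X i *\<^sub>v y) + y \<bullet> (X i *\<^sub>v (M i *\<^sub>v y + \<alpha> \<cdot>\<^sub>v y)) + (\<gamma> - 2 * \<alpha>) * (y \<bullet> y) = 0"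
    unfolding lyap_def using y shift_mult_vec[OF M_carrier[OF i] y]
      smult_mat_mult_vec[OF one_carrier_mat y, of "\<gamma> - 2 * \<alpha>"] by fastforce
  then show "2 * (y \<bullet> (X i *\<^sub>v (M i *\<^sub>v y))) = - 2 * \<alpha> * (y \<bullet> (X i *\<^sub>v y)) - (\<gamma> - 2 * \<alpha>) * (y \<bullet> y)"
    using form_sym[OF Xc XT My y] y My by (simp add: form_linear[OF Xc] algebra_simps)
qed

lemma \<Theta>_carrier: "i < N \<Longrightarrow> \<Theta> i \<in> carrier_mat (n - p i) (n - p i)"
  unfolding \<Theta>_def using four_block_carrier_mat[OF X_props(1) one_carrier_mat] dims(2) by metis

lemma \<Theta>_mult_vec:
  assumes i: "i < N" and y: "y \<in> carrier_vec (v i - p i)" and z: "z \<in> carrier_vec (n - v i)"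
  shows "\<Theta> i *\<^sub>v (y @\<^sub>v z) = (X i *\<^sub>v y) @\<^sub>v z"
  unfolding \<Theta>_def
  using four_block_mat_mult_vec[OF X_props(1)[OF i] zero_carrier_mat zero_carrier_mat one_carrier_mat y z]
    mult_mat_vec_carrier[OF X_props(1)[OF i] y] y z by simp

lemma \<Theta>_form:
  assumes i: "i < N" and w: "y \<in> carrier_vec (v i - p i)" "z \<in> carrier_vec (n - v i)"
    "y' \<in> carrier_vec (v i - p i)" "z' \<in> carrier_vec (n - v i)"
  shows "(y @\<^sub>v z) \<bullet> (\<Theta> i *\<^sub>v (y' @\<^sub>v z')) = y \<bullet> (X i *\<^sub>v y') + z \<bullet> z'"
  unfolding \<Theta>_mult_vec[OF i w(3,4)]
  by (rule scalar_prod_append[OF w(1,2) _ w(4)]) (use X_props(1)[OF i] w in simp)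

lemma split_state:
  assumes i: "i < N" and "w \<in> carrier_vec (n - p i)"
  obtains y z where "y \<in> carrier_vec (v i - p i)" "z \<in> carrier_vec (n - v i)" "w = y @\<^sub>v z"
  using assms carrier_vec_split[of w "v i - p i" "n - v i"] dims(2)[OF i] by metis

lemma \<Theta>_sym: assumes i: "i < N" shows "(\<Theta> i)\<^sup>T = \<Theta> i"
proof (rule symmetric_if_form[OF \<Theta>_carrier[OF i]])
  fix x x' :: "real vec" assume "x \<in> carrier_vec (n - p i)" "x' \<in> carrier_vec (n - p i)"
  then obtain y z y' z' where w: "y \<in> carrier_vec (v i - p i)" "z \<in> carrier_vec (n - v i)" "x = y @\<^sub>v z"
    "y' \<in> carrier_vec (v i - p i)" "z' \<in> carrier_vec (n - v i)" "x' = y' @\<^sub>v z'"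
    using split_state[OF i] by metis
  show "x \<bullet> (\<Theta> i *\<^sub>v x') = x' \<bullet> (\<Theta> i *\<^sub>v x)"
    unfolding w(3,6) \<Theta>_form[OF i w(1,2,4,5)] \<Theta>_form[OF i w(4,5,1,2)]
    using form_sym[OF X_props(1)[OF i] X_props(3)[OF i] w(1,4)] comm_scalar_prod[OF w(2,5)] by simp
qed

lemma \<Theta>_pos_def: assumes i: "i < N" shows "pos_def (\<Theta> i)"
proof -
  have "0 < x \<bullet> (\<Theta> i *\<^sub>v x)" if x: "x \<in> carrier_vec (n - p i)" "x \<noteq> 0\<^sub>v (n - p i)" for x
  proof -
    obtain y z where w: "y \<in> carrier_vec (v i - p i)" "z \<in> carrier_vec (n - v i)" "x = y @\<^sub>v z"
      using split_state[OF i x(1)] .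
    have Xy: "y \<noteq> 0\<^sub>v (v i - p i) \<Longrightarrow> 0 < y \<bullet> (X i *\<^sub>v y)"
      using X_props(1,2)[OF i] w(1) unfolding pos_def_def by auto
    have Xy0: "y = 0\<^sub>v (v i - p i) \<Longrightarrow> y \<bullet> (X i *\<^sub>v y) = 0"
      using scalar_prod_left_zero[OF mult_mat_vec_carrier[OF X_props(1)[OF i] w(1)]] by simp
    have "y \<noteq> 0\<^sub>v (v i - p i) \<or> z \<noteq> 0\<^sub>v (n - v i)"
      using x(2) append_vec_eq_zero[OF w(1,2)] w(3) dims(2)[OF i] by auto
    then show ?thesis
      unfolding w(3) \<Theta>_form[OF i w(1,2,1,2)]
      using Xy Xy0 scalar_prod_self_pos[OF w(2)] scalar_prod_self_nonneg[of z]
      by (cases "y = 0\<^sub>v (v i - p i)") auto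
  qed
  then show ?thesis unfolding pos_def_def using \<Theta>_sym[OF i] \<Theta>_carrier[OF i] by auto
qed

lemma gN_carrier: assumes i: "i < N" shows "gN (obs i) \<in> carrier_mat (n - p i) (n - p i)"
  using four_block_carrier_mat[OF M_carrier[OF i] shapes(9)[OF i]] dims(2)[OF i]
  by (simp add: designed_gains_def N_mat_def)

lemma gN_mult_vec:
  assumes i: "i < N" and y: "y \<in> carrier_vec (v i - p i)" and z: "z \<in> carrier_vec (n - v i)"
  shows "gN (obs i) *\<^sub>v (y @\<^sub>v z) = (M i *\<^sub>v y) @\<^sub>v (o32 (d i) *\<^sub>v y + ou (d i) *\<^sub>v z)"
  using four_block_mat_mult_vec[OF M_carrier[OF i] zero_carrier_mat shapes(8,9)[OF i] y z]
    mult_mat_vec_carrier[OF M_carrier[OF i] y] z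
  by (simp add: designed_gains_def N_mat_def)

lemma X_inverse:
  assumes i: "i < N"
  shows "minv (X i) \<in> carrier_mat (v i - p i) (v i - p i)"
    "y \<in> carrier_vec (v i - p i) \<Longrightarrow> X i *\<^sub>v (minv (X i) *\<^sub>v y) = y"
proof -
  note Xc = X_props(1)[OF i]
  have "inj_mat (X i)"
  proof (rule inj_matI[OF Xc], rule ccontr)
    fix w :: "real vec" assume w: "w \<in> carrier_vec (v i - p i)" "X i *\<^sub>v w = 0\<^sub>v (v i - p i)" "w \<noteq> 0\<^sub>v (v i - p i)"
    then have "0 < w \<bullet> (X i *\<^sub>v w)" using X_props(2)[OF i] Xc unfolding pos_def_def by auto
    then show False using w by simp
  qed
  note inv = minv_right_left[OF Xc this]
  show "minv (X i) \<in> carrier_mat (v i - p i) (v i - p i)" by (rule inv)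
  show "X i *\<^sub>v (minv (X i) *\<^sub>v y) = y" if "y \<in> carrier_vec (v i - p i)"
    using assoc_mult_mat_vec[OF Xc inv(1) that] inv(3) that by simp
qed

lemma gM:
  assumes i: "i < N"
  shows gM_carrier: "gM (obs i) \<in> carrier_mat (n - p i) n"
    and \<Theta>_gM: "s \<in> carrier_vec n \<Longrightarrow> \<Theta> i *\<^sub>v (gM (obs i) *\<^sub>v s) = (Ts i)\<^sup>T *\<^sub>v s"
proof -
  let ?Y = "four_block_mat (minv (X i)) (0\<^sub>m (v i - p i) (n - v i)) (0\<^sub>m (n - v i) (v i - p i)) (1\<^sub>m (n - v i))"
  have Y: "?Y \<in> carrier_mat (n - p i) (n - p i)"
    using four_block_carrier_mat[OF X_inverse(1)[OF i] one_carrier_mat, of _ _ "n - v i"] dims(2)[OF i] by simp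
  have TsT: "(Ts i)\<^sup>T \<in> carrier_mat (n - p i) n" using Ts_carrier[OF i] by simp
  have gM: "gM (obs i) = ?Y * (Ts i)\<^sup>T" by (simp add: designed_gains_def)
  show "gM (obs i) \<in> carrier_mat (n - p i) n" unfolding gM by (rule mult_carrier_mat[OF Y TsT])
  assume s: "s \<in> carrier_vec n"
  then have "(Ts i)\<^sup>T *\<^sub>v s \<in> carrier_vec (n - p i)" using TsT by simp
  then obtain y z where yz: "y \<in> carrier_vec (v i - p i)" "z \<in> carrier_vec (n - v i)" "(Ts i)\<^sup>T *\<^sub>v s = y @\<^sub>v z"
    by (rule split_state[OF i])
  have Xy: "minv (X i) *\<^sub>v y \<in> carrier_vec (v i - p i)" using X_inverse(1)[OF i] yz by simp
  have "gM (obs i) *\<^sub>v s = minv (X i) *\<^sub>v y @\<^sub>v z"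
    unfolding gM assoc_mult_mat_vec[OF Y TsT s] yz(3)
    using four_block_mat_mult_vec[OF X_inverse(1)[OF i] zero_carrier_mat zero_carrier_mat one_carrier_mat yz(1,2)] Xy yz by simp
  then show "\<Theta> i *\<^sub>v (gM (obs i) *\<^sub>v s) = (Ts i)\<^sup>T *\<^sub>v s"
    using \<Theta>_mult_vec[OF i Xy yz(2)] X_inverse(2)[OF i yz(1)] yz(3) by simp
qed

text \<open>The extra terms \<gamma> |y|^2 - \<gamma> \<epsilon> |(y, z)|^2 bound what the coupling
  will contribute. The Lyapunov equation turns the first into 2 \<alpha> |y|^2, so that with
  \<kappa> = \<gamma> \<epsilon> - 2 \<alpha> exactly -\<kappa> |y|^2 remains to pay for the cross
  term between y and z. The remainder of the cross term is the one with 1/\<kappa> in the inequality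
  for \<gamma>, which disposes of z.\<close>

lemma node_estimate:
  assumes i: "i < N" and y: "y \<in> carrier_vec (v i - p i)" and z: "z \<in> carrier_vec (n - v i)"
  shows "2 * ((y @\<^sub>v z) \<bullet> (\<Theta> i *\<^sub>v (gN (obs i) *\<^sub>v (y @\<^sub>v z)))) + \<gamma> * (y \<bullet> y) - \<gamma> * \<epsilon> * ((y @\<^sub>v z) \<bullet> (y @\<^sub>v z))
    \<le> - 2 * \<alpha> * ((y @\<^sub>v z) \<bullet> (\<Theta> i *\<^sub>v (y @\<^sub>v z)))"
proof -
  note s = shapes[OF i]
  define \<kappa> where "\<kappa> = \<gamma> * \<epsilon> - 2 * \<alpha>"
  define c where "c = 1 / \<kappa>"
  have \<kappa>: "0 < \<kappa>" and neg: "neg_def ((ou (d i))\<^sup>T + ou (d i) - \<kappa> \<cdot>\<^sub>m 1\<^sub>m (n - v i) + c \<cdot>\<^sub>m (o32 (d i) * (o32 (d i))\<^sup>T))"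
    using gam i unfolding admissible_gamma_def \<kappa>_def c_def by auto
  have My: "M i *\<^sub>v y \<in> carrier_vec (v i - p i)" using M_carrier[OF i] y by simp
  have Az: "o32 (d i) *\<^sub>v y \<in> carrier_vec (n - v i)" "ou (d i) *\<^sub>v z \<in> carrier_vec (n - v i)" using s y z by auto
  have o32T: "(o32 (d i))\<^sup>T \<in> carrier_mat (v i - p i) (n - v i)" using s by simp
  define b where "b = (o32 (d i))\<^sup>T *\<^sub>v z"
  have b: "b \<in> carrier_vec (v i - p i)" unfolding b_def using o32T z by simp
  have cross: "z \<bullet> (o32 (d i) *\<^sub>v y) = b \<bullet> y" unfolding b_def by (rule adjoint_scalar_prod[OF s(8) z y])
  \<comment> \<open>Young's inequality with weight \<kappa>, chosen so that its first term consumes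
    precisely the available damping of y.\<close>
  have young: "2 * (b \<bullet> y) \<le> \<kappa> * (y \<bullet> y) + c * (b \<bullet> b)"
  proof -
    have "0 \<le> (\<kappa> \<cdot>\<^sub>v y - b) \<bullet> (\<kappa> \<cdot>\<^sub>v y - b)" by (rule scalar_prod_self_nonneg)
    also have "\<dots> = \<kappa> * (\<kappa> * (y \<bullet> y)) - 2 * \<kappa> * (b \<bullet> y) + b \<bullet> b"
      using y b comm_scalar_prod[OF y b]
      by (simp add: minus_scalar_prod_distrib[of _ "v i - p i"] scalar_prod_minus_distrib[of _ "v i - p i"] algebra_simps)
    finally have "2 * \<kappa> * (b \<bullet> y) \<le> \<kappa> * (\<kappa> * (y \<bullet> y)) + b \<bullet> b" by simp
    then show ?thesis unfolding c_def using \<kappa> by (simp add: field_simps)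
  qed
  have z2: "2 * (z \<bullet> (ou (d i) *\<^sub>v z)) - \<kappa> * (z \<bullet> z) + c * (b \<bullet> b) \<le> 0"
  proof -
    let ?P = "(ou (d i))\<^sup>T + ou (d i)" and ?Y = "o32 (d i) * (o32 (d i))\<^sup>T"
    let ?Z = "?P - \<kappa> \<cdot>\<^sub>m 1\<^sub>m (n - v i) + c \<cdot>\<^sub>m ?Y"
    have ouT: "(ou (d i))\<^sup>T \<in> carrier_mat (n - v i) (n - v i)" using s by simp
    have P: "?P \<in> carrier_mat (n - v i) (n - v i)" using s by simp
    have Y: "?Y \<in> carrier_mat (n - v i) (n - v i)" by (rule mult_carrier_mat[OF s(8) o32T])
    have c1: "\<kappa> \<cdot>\<^sub>m 1\<^sub>m (n - v i) \<in> carrier_mat (n - v i) (n - v i)" "c \<cdot>\<^sub>m ?Y \<in> carrier_mat (n - v i) (n - v i)" using Y by auto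
    have c2: "?P - \<kappa> \<cdot>\<^sub>m 1\<^sub>m (n - v i) \<in> carrier_mat (n - v i) (n - v i)" by (rule minus_carrier_mat[OF c1(1)])
    have Z: "?Z \<in> carrier_mat (n - v i) (n - v i)" using c1 c2 by simp
    have Yz: "?Y *\<^sub>v z = o32 (d i) *\<^sub>v b" unfolding b_def by (rule assoc_mult_mat_vec[OF s(8) o32T z])
    have ouTz: "(ou (d i))\<^sup>T *\<^sub>v z \<in> carrier_vec (n - v i)" "o32 (d i) *\<^sub>v b \<in> carrier_vec (n - v i)" using ouT s b z by auto
    have "?Z *\<^sub>v z = (ou (d i))\<^sup>T *\<^sub>v z + ou (d i) *\<^sub>v z - \<kappa> \<cdot>\<^sub>v z + c \<cdot>\<^sub>v (o32 (d i) *\<^sub>v b)"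
      unfolding add_mult_distrib_mat_vec[OF c2 c1(2) z] minus_mult_distrib_mat_vec[OF P c1(1) z]
        add_mult_distrib_mat_vec[OF ouT s(9) z]
        smult_mat_mult_vec[OF one_carrier_mat z] smult_mat_mult_vec[OF Y z] Yz using z by simp
    then have "z \<bullet> (?Z *\<^sub>v z) = z \<bullet> ((ou (d i))\<^sup>T *\<^sub>v z) + z \<bullet> (ou (d i) *\<^sub>v z) - \<kappa> * (z \<bullet> z) + c * (z \<bullet> (o32 (d i) *\<^sub>v b))"
      using z ouTz Az
      by (simp add: scalar_prod_minus_distrib[of z "n - v i"] scalar_prod_add_distrib[of z "n - v i"])
    moreover have "z \<bullet> ((ou (d i))\<^sup>T *\<^sub>v z) = z \<bullet> (ou (d i) *\<^sub>v z)"
      using adjoint_scalar_prod[OF ouT z z] comm_scalar_prod[OF z Az(2)] by simp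
    moreover have "z \<bullet> (o32 (d i) *\<^sub>v b) = b \<bullet> b" unfolding adjoint_scalar_prod[OF s(8) z b] b_def[symmetric] ..
    moreover have "z \<bullet> (?Z *\<^sub>v z) \<le> 0"
    proof (cases "z = 0\<^sub>v (n - v i)")
      case True
      then show ?thesis using scalar_prod_left_zero[OF mult_mat_vec_carrier[OF Z z]] by simp
    next
      case False
      then have "0 < z \<bullet> ((- ?Z) *\<^sub>v z)" using neg Z z unfolding neg_def_def pos_def_def by auto
      also have "(- ?Z) *\<^sub>v z = - (?Z *\<^sub>v z)" using Z z s by (intro uminus_mult_mat_vec) simp
      also have "z \<bullet> (- (?Z *\<^sub>v z)) = - (z \<bullet> (?Z *\<^sub>v z))"
        using mult_mat_vec_carrier[OF Z z] z s by (intro scalar_prod_uminus_right) simp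
      finally show ?thesis by simp
    qed
    ultimately show ?thesis by simp
  qed
  have zz: "(y @\<^sub>v z) \<bullet> (y @\<^sub>v z) = y \<bullet> y + z \<bullet> z" by (rule scalar_prod_append[OF y z y z])
  have "(y @\<^sub>v z) \<bullet> (\<Theta> i *\<^sub>v (gN (obs i) *\<^sub>v (y @\<^sub>v z))) = y \<bullet> (X i *\<^sub>v (M i *\<^sub>v y)) + (b \<bullet> y + z \<bullet> (ou (d i) *\<^sub>v z))"
    unfolding gN_mult_vec[OF i y z] using \<Theta>_form[OF i y z My, of "o32 (d i) *\<^sub>v y + ou (d i) *\<^sub>v z"] Az
      scalar_prod_add_distrib[OF z Az] cross by simp
  then have "2 * ((y @\<^sub>v z) \<bullet> (\<Theta> i *\<^sub>v (gN (obs i) *\<^sub>v (y @\<^sub>v z)))) =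
    - 2 * \<alpha> * (y \<bullet> (X i *\<^sub>v y)) - (\<gamma> - 2 * \<alpha>) * (y \<bullet> y) + 2 * (b \<bullet> y) + 2 * (z \<bullet> (ou (d i) *\<^sub>v z))"
    using X_props(4)[OF i y] by simp
  moreover have "- 2 * \<alpha> * ((y @\<^sub>v z) \<bullet> (\<Theta> i *\<^sub>v (y @\<^sub>v z))) = - 2 * \<alpha> * (y \<bullet> (X i *\<^sub>v y)) - 2 * \<alpha> * (z \<bullet> z)"
    unfolding \<Theta>_form[OF i y z y z] by (simp add: algebra_simps)
  moreover have "\<gamma> * \<epsilon> * (y \<bullet> y + z \<bullet> z) = \<kappa> * (y \<bullet> y) + 2 * \<alpha> * (y \<bullet> y) + \<kappa> * (z \<bullet> z) + 2 * \<alpha> * (z \<bullet> z)"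
    unfolding \<kappa>_def by (simp add: algebra_simps)
  moreover have "(\<gamma> - 2 * \<alpha>) * (y \<bullet> y) = \<gamma> * (y \<bullet> y) - 2 * \<alpha> * (y \<bullet> y)" by (simp add: algebra_simps)
  ultimately show ?thesis unfolding zz using young z2 by linarith
qed

definition rhs :: "(nat \<Rightarrow> real vec) \<Rightarrow> nat \<Rightarrow> real vec" where
  "rhs w i = gN (obs i) *\<^sub>v w i - \<gamma> \<cdot>\<^sub>v (gM (obs i) *\<^sub>v mix n N (weight_mat N r * laplacian N a) (\<lambda>i. Ts i *\<^sub>v w i) i)"

text \<open>Dissipation of \<open>\<Sum>\<^sub>i w\<^sub>i \<bullet> \<Theta>\<^sub>i w\<^sub>i\<close> along the error dynamics \<open>w\<^sub>i' = rhs w i\<close>; \<open>\<delta>\<close> is the margin in the choice of \<open>\<epsilon>\<close>.\<close>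
lemma dissipation:
  assumes \<delta>: "\<And>x. (\<And>i. i < N \<Longrightarrow> x i \<in> carrier_vec n) \<Longrightarrow> (\<epsilon> + \<delta>) * (\<Sum>i<N. x i \<bullet> x i) \<le> energy x x"
    and w: "\<And>i. i < N \<Longrightarrow> w i \<in> carrier_vec (n - p i)"
  shows "(\<Sum>i<N. 2 * (w i \<bullet> (\<Theta> i *\<^sub>v rhs w i)))
    \<le> - 2 * \<alpha> * (\<Sum>i<N. w i \<bullet> (\<Theta> i *\<^sub>v w i)) - \<gamma> * \<delta> * (\<Sum>i<N. w i \<bullet> w i)"
proof -
  let ?RL = "weight_mat N r * laplacian N a"
  let ?e = "\<lambda>i. Ts i *\<^sub>v w i" and ?x = "\<lambda>i. 0\<^sub>v (p i) @\<^sub>v w i" and ?y = "\<lambda>i. vec_first (w i) (v i - p i)"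
  have \<gamma>: "0 < \<gamma>" using gam unfolding admissible_gamma_def by blast
  have e: "?e i \<in> carrier_vec n" if "i < N" for i using Ts_carrier[OF that] w[OF that] by simp
  have x: "?x i \<in> carrier_vec n" if "i < N" for i
    using append_carrier_vec[OF zero_carrier_vec w[OF that], of "p i"] dims(1)[OF that] by simp
  have Tx: "oT (d i) *\<^sub>v ?x i = ?e i" if "i < N" for i using Ts_mult_vec[OF that w[OF that]] by simp
  have xx: "?x i \<bullet> ?x i = w i \<bullet> w i" if "i < N" for i
    using scalar_prod_append[OF zero_carrier_vec w[OF that] zero_carrier_vec w[OF that], of "p i"] by simp
  have wv: "w i = ?y i @\<^sub>v vec_last (w i) (n - v i)" if "i < N" for i
    using vec_first_last_append[of "w i" "v i - p i" "n - v i"] w[OF that] dims(2)[OF that] by simp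
  \<comment> \<open>The measured coordinates of the error are 0, so only the block \<open>?y\<close>
    remains of its observable coordinates; this is the part that the Lyapunov equation
    damps.\<close>
  have "vec_first (?x i) (v i) \<bullet> vec_first (?x i) (v i) = ?y i \<bullet> ?y i" if i: "i < N" for i
  proof -
    have "?x i = (0\<^sub>v (p i) @\<^sub>v ?y i) @\<^sub>v vec_last (w i) (n - v i)" using wv[OF i] by (metis append_vec_assoc)
    moreover have "0\<^sub>v (p i) @\<^sub>v ?y i \<in> carrier_vec (v i)"
      using append_carrier_vec[OF zero_carrier_vec[of "p i"] vec_first_carrier[of "w i" "v i - p i"]] dims(4)[OF i] by simp
    ultimately have "vec_first (?x i) (v i) = 0\<^sub>v (p i) @\<^sub>v ?y i" by simp
    then show ?thesis
      using scalar_prod_append[OF zero_carrier_vec vec_first_carrier zero_carrier_vec vec_first_carrier,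
          of "p i" "w i" "v i - p i" "w i"] by simp
  qed
  then have "energy ?x ?x = (\<Sum>i<N. \<Sum>j<N. K $$ (i, j) * (?e i \<bullet> ?e j)) + (\<Sum>i<N. ?y i \<bullet> ?y i)"
    unfolding energy_def using Tx by simp
  then have en: "(\<epsilon> + \<delta>) * (\<Sum>i<N. w i \<bullet> w i) \<le> 2 * (\<Sum>i<N. ?e i \<bullet> mix n N ?RL ?e i) + (\<Sum>i<N. ?y i \<bullet> ?y i)"
    using \<delta>[of ?x, OF x] xx sum_mix_weight_laplacian[of ?e, OF e] by simp
  have one: "w i \<bullet> (\<Theta> i *\<^sub>v rhs w i) = w i \<bullet> (\<Theta> i *\<^sub>v (gN (obs i) *\<^sub>v w i)) - \<gamma> * (?e i \<bullet> mix n N ?RL ?e i)" if i: "i < N" for i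
  proof -
    have c: "gN (obs i) *\<^sub>v w i \<in> carrier_vec (n - p i)" "gM (obs i) *\<^sub>v mix n N ?RL ?e i \<in> carrier_vec (n - p i)"
      using mult_mat_vec_carrier[OF gN_carrier[OF i] w[OF i]] mult_mat_vec_carrier[OF gM_carrier[OF i] mix_carrier(1)] by auto
    have "w i \<bullet> (\<Theta> i *\<^sub>v (gM (obs i) *\<^sub>v mix n N ?RL ?e i)) = ?e i \<bullet> mix n N ?RL ?e i"
      unfolding \<Theta>_gM[OF i mix_carrier(1)]
      using adjoint_scalar_prod[of "(Ts i)\<^sup>T" "n - p i" n "w i"] Ts_carrier[OF i] w[OF i] by simp
    then show ?thesis
      unfolding rhs_def using c w[OF i] by (simp add: form_linear[OF \<Theta>_carrier[OF i]])
  qed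
  have node: "2 * (w i \<bullet> (\<Theta> i *\<^sub>v (gN (obs i) *\<^sub>v w i))) \<le> - 2 * \<alpha> * (w i \<bullet> (\<Theta> i *\<^sub>v w i)) - \<gamma> * (?y i \<bullet> ?y i) + \<gamma> * \<epsilon> * (w i \<bullet> w i)"
    if i: "i < N" for i
    using node_estimate[OF i vec_first_carrier vec_last_carrier, of "w i" "w i"] wv[OF i, symmetric] by simp
  have "(\<Sum>i<N. 2 * (w i \<bullet> (\<Theta> i *\<^sub>v rhs w i)))
      = (\<Sum>i<N. 2 * (w i \<bullet> (\<Theta> i *\<^sub>v (gN (obs i) *\<^sub>v w i)))) - \<gamma> * (2 * (\<Sum>i<N. ?e i \<bullet> mix n N ?RL ?e i))"
    using one by (simp add: sum_subtractf sum_distrib_left right_diff_distrib mult_ac)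
  also have "\<dots> \<le> (\<Sum>i<N. - 2 * \<alpha> * (w i \<bullet> (\<Theta> i *\<^sub>v w i)) - \<gamma> * (?y i \<bullet> ?y i) + \<gamma> * \<epsilon> * (w i \<bullet> w i))
      - \<gamma> * ((\<epsilon> + \<delta>) * (\<Sum>i<N. w i \<bullet> w i) - (\<Sum>i<N. ?y i \<bullet> ?y i))"
    using en \<gamma> node by (intro diff_mono sum_mono mult_left_mono) auto
  also have "\<dots> = - 2 * \<alpha> * (\<Sum>i<N. w i \<bullet> (\<Theta> i *\<^sub>v w i)) - \<gamma> * \<delta> * (\<Sum>i<N. w i \<bullet> w i)"
    by (simp add: sum.distrib sum_subtractf sum_distrib_left[symmetric] sum_negf algebra_simps)
  finally show ?thesis .
qed

end

section \<open>Convergence rates and omniscience\<close>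

lemma converge_with_rate_antimono:
  assumes "converge_with_rate \<beta> E" "\<alpha> \<le> \<beta>" "E' \<subseteq> E"
  shows "converge_with_rate \<alpha> E'"
proof -
  obtain c where c: "0 < c" "\<And>e t. e \<in> E \<Longrightarrow> 0 \<le> t \<Longrightarrow> vnorm (e t) \<le> c * exp (- \<beta> * t) * vnorm (e 0)"
    using assms(1) unfolding converge_with_rate_def by blast
  have "vnorm (e t) \<le> c * exp (- \<alpha> * t) * vnorm (e 0)" if "e \<in> E'" "0 \<le> t" for e t
  proof -
    have "exp (- \<beta> * t) \<le> exp (- \<alpha> * t)" using assms(2) that(2) by (simp add: mult_right_mono)
    then have "c * exp (- \<beta> * t) * vnorm (e 0) \<le> c * exp (- \<alpha> * t) * vnorm (e 0)"
      using c(1) vnorm_nonneg by (intro mult_right_mono mult_left_mono) auto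
    then show ?thesis using c(2)[of e t] that assms(3) by auto
  qed
  then show ?thesis unfolding converge_with_rate_def using c(1) by blast
qed

text \<open>The error of one node is dominated by the stacked error. The rate has to be positive, so
  in the design this is applied with \<alpha> + \<mu>, which also covers \<alpha> = 0.\<close>

lemma omniscient_if_errors_decay:
  assumes rate: "converge_with_rate \<beta> (observer_errors n N A C a r \<gamma> obs)" and \<beta>: "0 < \<beta>"
    and est: "\<And>x z i t. plant_observer n N A C a r \<gamma> obs x z \<Longrightarrow> i < N \<Longrightarrow> 0 \<le> t \<Longrightarrow>
      estimate C obs x z i t - x t \<in> carrier_vec n"
  shows "omniscient n N A C a r \<gamma> obs"
  unfolding omniscient_def
proof (intro allI impI)
  fix x z i assume po: "plant_observer n N A C a r \<gamma> obs x z" and i: "i < N"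
  let ?e = "est_error n N C obs x z" and ?ei = "\<lambda>i t. estimate C obs x z i t - x t"
  obtain c where c: "0 < c" "\<And>e t. e \<in> observer_errors n N A C a r \<gamma> obs \<Longrightarrow> 0 \<le> t \<Longrightarrow>
      vnorm (e t) \<le> c * exp (- \<beta> * t) * vnorm (e 0)"
    using rate unfolding converge_with_rate_def by blast
  have le: "vnorm (?ei i t) \<le> c * exp (- \<beta> * t) * vnorm (?e 0)" if t: "0 \<le> t" for t
  proof -
    have "?e t = cat_vec N (\<lambda>i. ?ei i t)"
      unfolding est_error_def using stack_vec_eq_cat_vec[of N "\<lambda>i. ?ei i t" n] est[OF po _ t] by simp
    then have "?e t \<bullet> ?e t = (\<Sum>i<N. ?ei i t \<bullet> ?ei i t)"
      using cat_vec_scalar_prod[of N "\<lambda>i. ?ei i t" "\<lambda>_. n" "\<lambda>i. ?ei i t"] est[OF po _ t] by simp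
    moreover have "?ei i t \<bullet> ?ei i t \<le> (\<Sum>i<N. ?ei i t \<bullet> ?ei i t)"
      using i scalar_prod_self_nonneg by (intro member_le_sum) auto
    ultimately have "vnorm (?ei i t) \<le> vnorm (?e t)" unfolding vnorm_def by simp
    also have "\<dots> \<le> c * exp (- \<beta> * t) * vnorm (?e 0)"
      using c(2)[of ?e t] po t unfolding observer_errors_def by blast
    finally show ?thesis .
  qed
  have "((\<lambda>t. exp (- \<beta> * t)) \<longlongrightarrow> 0) at_top"
    using \<beta> by (intro filterlim_compose[OF exp_at_bot] filterlim_tendsto_neg_mult_at_bot[OF tendsto_const _ filterlim_ident]) auto
  then have "((\<lambda>t. c * exp (- \<beta> * t) * vnorm (?e 0)) \<longlongrightarrow> c * 0 * vnorm (?e 0)) at_top"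
    by (intro tendsto_intros)
  then have lim: "((\<lambda>t. c * exp (- \<beta> * t) * vnorm (?e 0)) \<longlongrightarrow> 0) at_top" by simp
  show "((\<lambda>t. vnorm (?ei i t)) \<longlongrightarrow> 0) at_top"
  proof (rule tendsto_sandwich[OF _ _ tendsto_const lim])
    show "\<forall>\<^sub>F t in at_top. 0 \<le> vnorm (?ei i t)" using vnorm_nonneg by simp
    show "\<forall>\<^sub>F t in at_top. vnorm (?ei i t) \<le> c * exp (- \<beta> * t) * vnorm (?e 0)"
      using eventually_ge_at_top[of "0 :: real"] by (rule eventually_mono) (rule le)
  qed
qed

section \<open>Exponential decay of the error system\<close>

context gain_design
begin

text \<open>The right-hand side of the error system takes values in the range of \<open>T_s\<close>,
  and the columns of \<open>T_s\<close> are orthonormal. The component of a solution orthogonal to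
  that range is thus constant, and it is 0 initially, so the solution is recovered from its
  coordinates w.\<close>

lemma solution_states:
  assumes "e \<in> error_system_solutions n N a r \<gamma> Ts obs"
  shows "\<exists>w. (\<forall>i<N. has_vec_deriv (n - p i) (w i) (\<lambda>t. rhs (\<lambda>i. w i t) i)) \<and>
    (\<forall>t\<ge>0. e t = stack_vec n N (\<lambda>i. Ts i *\<^sub>v w i t))"
proof -
  let ?E = "error_mat n N a r \<gamma> Ts obs" and ?RL = "weight_mat N r * laplacian N a"
  have de: "has_vec_deriv (N * n) e (\<lambda>t. ?E *\<^sub>v e t)"
    and e0: "e 0 \<in> (\<lambda>w. block_diag N Ts *\<^sub>v w) ` carrier_vec (dim_col (block_diag N Ts))"
    using assms unfolding error_system_solutions_def by auto
  have "block_diag N Ts \<in> carrier_mat (\<Sum>i<N. n) (\<Sum>i<N. n - p i)" by (rule block_diag_carrier) (rule Ts_carrier)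
  then obtain y where y: "y \<in> carrier_vec (\<Sum>i<N. n - p i)" "e 0 = block_diag N Ts *\<^sub>v y" using e0 by auto
  obtain ys where ys: "\<And>i. i < N \<Longrightarrow> ys i \<in> carrier_vec (n - p i)" "y = cat_vec N ys"
    using cat_vec_split[OF y(1)] by blast
  have Tys: "Ts i *\<^sub>v ys i \<in> carrier_vec n" if "i < N" for i using Ts_carrier[OF that] ys(1)[OF that] by simp
  have e0': "e 0 = stack_vec n N (\<lambda>i. Ts i *\<^sub>v ys i)"
    unfolding y(2) ys(2) using block_diag_mult_cat_vec[of N Ts "\<lambda>_. n" "\<lambda>i. n - p i" ys, OF Ts_carrier ys(1)]
      stack_vec_eq_cat_vec[of N "\<lambda>i. Ts i *\<^sub>v ys i" n, OF Tys] by simp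
  define es where "es i t = block n i (e t)" for i t
  have es: "es i t \<in> carrier_vec n" for i t unfolding es_def by simp
  define w where "w i t = (Ts i)\<^sup>T *\<^sub>v es i t" for i t
  define g where "g i t = gN (obs i) *\<^sub>v w i t - \<gamma> \<cdot>\<^sub>v (gM (obs i) *\<^sub>v mix n N ?RL (\<lambda>i. es i t) i)" for i t
  have TsT: "(Ts i)\<^sup>T \<in> carrier_mat (n - p i) n" if "i < N" for i using Ts_carrier[OF that] by simp
  have w: "w i t \<in> carrier_vec (n - p i)" if "i < N" for i t unfolding w_def using TsT[OF that] es by simp
  have g: "g i t \<in> carrier_vec (n - p i)" if "i < N" for i t
    unfolding g_def using mult_mat_vec_carrier[OF gN_carrier[OF that] w[OF that]]
      mult_mat_vec_carrier[OF gM_carrier[OF that] mix_carrier(1)] by (intro minus_carrier_vec) auto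
  have est: "stack_vec n N (\<lambda>i. es i t) = e t" if "0 \<le> t" for t
    unfolding es_def by (rule stack_vec_block[OF has_vec_derivD(1)[OF de that]])
  have Ee: "?E *\<^sub>v e t = stack_vec n N (\<lambda>i. Ts i *\<^sub>v g i t)" if "0 \<le> t" for t
    using error_mat_mult_stack_vec[of a N Ts n "\<lambda>i. n - p i" obs "\<lambda>i. es i t" r \<gamma>, OF a Ts_carrier gN_carrier gM_carrier es]
    unfolding est[OF that] g_def w_def by simp
  have Tg: "Ts i *\<^sub>v g i t \<in> carrier_vec n" if "i < N" for i t using Ts_carrier[OF that] g[OF that] by simp
  have des: "has_vec_deriv n (es i) (\<lambda>t. Ts i *\<^sub>v g i t)" if i: "i < N" for i
    unfolding es_def
    by (rule has_vec_deriv_cong[OF has_vec_deriv_block[OF de i]])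
      (auto simp: Ee block_stack_vec[where w = "\<lambda>i. Ts i *\<^sub>v g i _", OF i Tg[OF i]])
  have es_range: "es i t = Ts i *\<^sub>v w i t" if i: "i < N" and t: "0 \<le> t" for i t
  proof -
    \<comment> \<open>The component of the solution orthogonal to the range of \<open>Ts i\<close>;
      its derivative vanishes.\<close>
    have d: "has_vec_deriv n (\<lambda>t. es i t - Ts i *\<^sub>v ((Ts i)\<^sup>T *\<^sub>v es i t))
      (\<lambda>t. Ts i *\<^sub>v g i t - Ts i *\<^sub>v ((Ts i)\<^sup>T *\<^sub>v (Ts i *\<^sub>v g i t)))"
      by (rule has_vec_deriv_diff[OF des[OF i] has_vec_deriv_mult_mat[OF has_vec_deriv_mult_mat[OF des[OF i] TsT[OF i]] Ts_carrier[OF i]]])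
    have "es i t - Ts i *\<^sub>v ((Ts i)\<^sup>T *\<^sub>v es i t) = es i 0 - Ts i *\<^sub>v ((Ts i)\<^sup>T *\<^sub>v es i 0)"
      by (rule has_vec_deriv_zero_imp_const[OF d _ t]) (use Ts_transpose_Ts[OF i g[OF i]] Tg[OF i] in simp)
    also have "es i 0 = Ts i *\<^sub>v ys i"
      unfolding es_def e0' using block_stack_vec[where w = "\<lambda>i. Ts i *\<^sub>v ys i", OF i Tys[OF i]] by simp
    also have "Ts i *\<^sub>v ys i - Ts i *\<^sub>v ((Ts i)\<^sup>T *\<^sub>v (Ts i *\<^sub>v ys i)) = 0\<^sub>v n"
      using Ts_transpose_Ts[OF i ys(1)[OF i]] Tys[OF i] by simp
    finally have z: "es i t - Ts i *\<^sub>v w i t = 0\<^sub>v n" unfolding w_def .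
    have Tw: "Ts i *\<^sub>v w i t \<in> carrier_vec n" using Ts_carrier[OF i] w[OF i] by simp
    have "es i t = (es i t - Ts i *\<^sub>v w i t) + Ts i *\<^sub>v w i t"
      using es[of i t] Tw Ts_carrier[OF i] by (intro eq_vecI) (auto simp del: index_mult_mat_vec(1))
    then show ?thesis unfolding z using Tw by simp
  qed
  have "has_vec_deriv (n - p i) (w i) (\<lambda>t. rhs (\<lambda>i. w i t) i)" if i: "i < N" for i
  proof (rule has_vec_deriv_cong[OF has_vec_deriv_mult_mat[OF des[OF i] TsT[OF i]]])
    fix t :: real assume t: "0 \<le> t"
    show "w i t = (Ts i)\<^sup>T *\<^sub>v es i t" unfolding w_def ..
    have "mix n N ?RL (\<lambda>i. es i t) i = mix n N ?RL (\<lambda>i. Ts i *\<^sub>v w i t) i"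
      unfolding mix_def using es_range[OF _ t] by auto
    then show "rhs (\<lambda>i. w i t) i = (Ts i)\<^sup>T *\<^sub>v (Ts i *\<^sub>v g i t)"
      unfolding Ts_transpose_Ts[OF i g[OF i]] unfolding rhs_def g_def by simp
  qed
  moreover have "e t = stack_vec n N (\<lambda>i. Ts i *\<^sub>v w i t)" if "0 \<le> t" for t
    unfolding est[OF that, symmetric] by (rule stack_vec_cong) (rule es_range[OF _ that])
  ultimately show ?thesis by blast
qed

text \<open>The surplus in the dissipation is a multiple of |w|^2, so V is compared with |w|^2 in
  both directions: from above to convert the surplus into a rate, from below to return to the error,
  whose length equals that of w.\<close>

lemma error_system_decay: "\<exists>\<mu>>0. converge_with_rate (\<alpha> + \<mu>) (error_system_solutions n N a r \<gamma> Ts obs)"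
proof -
  obtain \<delta> where \<delta>: "0 < \<delta>" "\<And>x. (\<And>i. i < N \<Longrightarrow> x i \<in> carrier_vec n) \<Longrightarrow>
    (\<epsilon> + \<delta>) * (\<Sum>i<N. x i \<bullet> x i) \<le> energy x x" using admissible_eps_margin[OF eps] by metis
  have \<gamma>: "0 < \<gamma>" using gam unfolding admissible_gamma_def by blast
  have "\<exists>b\<ge>0. \<forall>w \<in> carrier_vec (n - p i). \<bar>w \<bullet> (\<Theta> i *\<^sub>v w)\<bar> \<le> b * (w \<bullet> w)" if "i < N" for i
    by (rule form_bound[OF \<Theta>_carrier[OF that]])
  then obtain b where b: "\<And>i. i < N \<Longrightarrow> 0 \<le> b i"
    "\<And>i w. i < N \<Longrightarrow> w \<in> carrier_vec (n - p i) \<Longrightarrow> \<bar>w \<bullet> (\<Theta> i *\<^sub>v w)\<bar> \<le> b i * (w \<bullet> w)" by metis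
  have "\<exists>c>0. \<forall>w \<in> carrier_vec (n - p i). c * (w \<bullet> w) \<le> w \<bullet> (\<Theta> i *\<^sub>v w)" if "i < N" for i
    by (rule pos_def_margin[OF \<Theta>_pos_def[OF that] \<Theta>_carrier[OF that]])
  then obtain c where c: "\<And>i. i < N \<Longrightarrow> 0 < c i"
    "\<And>i w. i < N \<Longrightarrow> w \<in> carrier_vec (n - p i) \<Longrightarrow> c i * (w \<bullet> w) \<le> w \<bullet> (\<Theta> i *\<^sub>v w)" by metis
  \<comment> \<open>Constants common to all nodes; the added 1 keeps them positive even without
    nodes.\<close>
  define b' where "b' = 1 + (\<Sum>i<N. b i)"
  define c' where "c' = 1 + (\<Sum>i<N. 1 / c i)"
  have b': "0 < b'" unfolding b'_def using b(1) by (intro add_pos_nonneg sum_nonneg) auto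
  have c': "0 < c'" unfolding c'_def using c(1) by (intro add_pos_nonneg sum_nonneg) (auto simp: less_imp_le)
  have bi: "b i \<le> b'" if "i < N" for i
    unfolding b'_def using member_le_sum[of i "{..<N}" b] b(1) that by force
  have ci: "1 / c i \<le> c'" if "i < N" for i
    unfolding c'_def using member_le_sum[of i "{..<N}" "\<lambda>i. 1 / c i"] c(1) that by (force simp: less_imp_le)
  \<comment> \<open>Chosen such that 2 \<mu> b' = \<gamma> \<delta>: the surplus -\<gamma> \<delta>
    |w|^2 is then at most -2 \<mu> V.\<close>
  define \<mu> where "\<mu> = \<gamma> * \<delta> / b' / 2"
  have \<mu>: "0 < \<mu>" unfolding \<mu>_def using \<gamma> \<delta>(1) b' by simp
  have upper: "(\<Sum>i<N. w i \<bullet> (\<Theta> i *\<^sub>v w i)) \<le> b' * (\<Sum>i<N. w i \<bullet> w i)"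
    and lower: "(\<Sum>i<N. w i \<bullet> w i) \<le> c' * (\<Sum>i<N. w i \<bullet> (\<Theta> i *\<^sub>v w i))"
    if w: "\<And>i. i < N \<Longrightarrow> w i \<in> carrier_vec (n - p i)" for w
  proof -
    have "w i \<bullet> (\<Theta> i *\<^sub>v w i) \<le> b' * (w i \<bullet> w i)" if i: "i < N" for i
      using b(2)[OF i w[OF i]] mult_right_mono[OF bi[OF i] scalar_prod_self_nonneg[of "w i"]] by simp
    then show "(\<Sum>i<N. w i \<bullet> (\<Theta> i *\<^sub>v w i)) \<le> b' * (\<Sum>i<N. w i \<bullet> w i)"
      unfolding sum_distrib_left by (intro sum_mono) auto
    have "w i \<bullet> w i \<le> c' * (w i \<bullet> (\<Theta> i *\<^sub>v w i))" if i: "i < N" for i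
    proof -
      have le: "w i \<bullet> w i \<le> 1 / c i * (w i \<bullet> (\<Theta> i *\<^sub>v w i))" using c(2)[OF i w[OF i]] c(1)[OF i] by (simp add: field_simps)
      have "0 \<le> c i * (w i \<bullet> w i)" using c(1)[OF i] scalar_prod_self_nonneg[of "w i"] by simp
      then have "0 \<le> w i \<bullet> (\<Theta> i *\<^sub>v w i)" using c(2)[OF i w[OF i]] by linarith
      from le mult_right_mono[OF ci[OF i] this] show ?thesis by linarith
    qed
    then show "(\<Sum>i<N. w i \<bullet> w i) \<le> c' * (\<Sum>i<N. w i \<bullet> (\<Theta> i *\<^sub>v w i))"
      unfolding sum_distrib_left by (intro sum_mono) auto
  qed
  have "vnorm (e t) \<le> sqrt (c' * b') * exp (- (\<alpha> + \<mu>) * t) * vnorm (e 0)"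
    if e: "e \<in> error_system_solutions n N a r \<gamma> Ts obs" and t: "0 \<le> t" for e t
  proof -
    obtain w where "\<forall>i<N. has_vec_deriv (n - p i) (w i) (\<lambda>t. rhs (\<lambda>i. w i t) i)"
      "\<forall>t\<ge>0. e t = stack_vec n N (\<lambda>i. Ts i *\<^sub>v w i t)" using solution_states[OF e] by (elim exE conjE)
    then have dw: "\<And>i. i < N \<Longrightarrow> has_vec_deriv (n - p i) (w i) (\<lambda>t. rhs (\<lambda>i. w i t) i)"
      and ew: "\<And>t. 0 \<le> t \<Longrightarrow> e t = stack_vec n N (\<lambda>i. Ts i *\<^sub>v w i t)" by simp_all
    have w: "w i t \<in> carrier_vec (n - p i)" if "i < N" "0 \<le> t" for i t using has_vec_derivD(1)[OF dw that(2)] that by blast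
    have ee: "e t \<bullet> e t = (\<Sum>i<N. w i t \<bullet> w i t)" if t: "0 \<le> t" for t
    proof -
      have Tw: "Ts i *\<^sub>v w i t \<in> carrier_vec n" if "i < N" for i using Ts_carrier[OF that] w[OF that t] by simp
      have "(Ts i *\<^sub>v w i t) \<bullet> (Ts i *\<^sub>v w i t) = w i t \<bullet> w i t" if i: "i < N" for i
        using adjoint_scalar_prod[OF Ts_carrier[OF i] Tw[OF i] w[OF i t]] Ts_transpose_Ts[OF i w[OF i t]] by simp
      moreover have "stack_vec n N (\<lambda>i. Ts i *\<^sub>v w i t) = cat_vec N (\<lambda>i. Ts i *\<^sub>v w i t)"
        by (rule stack_vec_eq_cat_vec[OF Tw])
      ultimately show ?thesis
        unfolding ew[OF t] using cat_vec_scalar_prod[of N "\<lambda>i. Ts i *\<^sub>v w i t" "\<lambda>_. n" "\<lambda>i. Ts i *\<^sub>v w i t", OF Tw Tw] by simp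
    qed
    define V where "V t = (\<Sum>i<N. w i t \<bullet> (\<Theta> i *\<^sub>v w i t))" for t
    define V' where "V' t = (\<Sum>i<N. 2 * (w i t \<bullet> (\<Theta> i *\<^sub>v rhs (\<lambda>i. w i t) i)))" for t
    have dV: "(V has_real_derivative V' t) (at t within {0..})" if "0 \<le> t" for t
      unfolding V_def V'_def
      by (intro DERIV_sum has_real_derivative_form[OF dw \<Theta>_carrier \<Theta>_sym that]) auto
    have le: "V' t \<le> - (2 * (\<alpha> + \<mu>)) * V t" if t: "0 \<le> t" for t
    proof -
      have "V' t \<le> - 2 * \<alpha> * V t - \<gamma> * \<delta> * (\<Sum>i<N. w i t \<bullet> w i t)"
        unfolding V_def V'_def by (rule dissipation[OF \<delta>(2)]) (use w t in auto)
      moreover have "2 * \<mu> * V t \<le> 2 * \<mu> * (b' * (\<Sum>i<N. w i t \<bullet> w i t))"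
        unfolding V_def using upper[of "\<lambda>i. w i t"] w t \<mu> by (intro mult_left_mono) auto
      moreover have "2 * \<mu> * (b' * (\<Sum>i<N. w i t \<bullet> w i t)) = \<gamma> * \<delta> * (\<Sum>i<N. w i t \<bullet> w i t)"
        unfolding \<mu>_def using b' by simp
      moreover have "- (2 * (\<alpha> + \<mu>)) * V t = - 2 * \<alpha> * V t - 2 * \<mu> * V t" by (simp add: algebra_simps)
      ultimately show ?thesis by linarith
    qed
    have "V t \<le> exp (- (2 * (\<alpha> + \<mu>)) * t) * V 0" by (rule exponential_decay[OF dV le t])
    moreover have "V 0 \<le> b' * (e 0 \<bullet> e 0)" unfolding V_def ee[OF order_refl] using upper[of "\<lambda>i. w i 0"] w by simp
    ultimately have "V t \<le> exp (- (2 * (\<alpha> + \<mu>)) * t) * (b' * (e 0 \<bullet> e 0))"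
      by (meson exp_ge_zero mult_left_mono order_trans)
    then have "c' * V t \<le> c' * (exp (- (2 * (\<alpha> + \<mu>)) * t) * (b' * (e 0 \<bullet> e 0)))" using c' by (intro mult_left_mono) auto
    moreover have "e t \<bullet> e t \<le> c' * V t" unfolding V_def ee[OF t] using lower[of "\<lambda>i. w i t"] w t by simp
    ultimately have "e t \<bullet> e t \<le> c' * b' * exp (- (2 * (\<alpha> + \<mu>)) * t) * (e 0 \<bullet> e 0)" by (simp add: mult_ac)
    also have "exp (- (2 * (\<alpha> + \<mu>)) * t) = (exp (- (\<alpha> + \<mu>) * t))\<^sup>2"
      by (simp add: power2_eq_square exp_add[symmetric] algebra_simps)
    finally have "sqrt (e t \<bullet> e t) \<le> sqrt (c' * b' * (exp (- (\<alpha> + \<mu>) * t))\<^sup>2 * (e 0 \<bullet> e 0))" by simp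
    then show ?thesis unfolding vnorm_def real_sqrt_mult by simp
  qed
  then have "converge_with_rate (\<alpha> + \<mu>) (error_system_solutions n N a r \<gamma> Ts obs)"
    unfolding converge_with_rate_def using b' c' by (intro exI[of _ "sqrt (c' * b')"]) auto
  then show ?thesis using \<mu> by blast
qed

end

section \<open>Correctness of the design\<close>

context gain_design
begin

lemma fac_props:
  assumes i: "i < N"
  shows "D i \<in> carrier_mat (m i) (p i)" "inj_mat (D i)" "C i = D i * F i" "C i \<in> carrier_mat (m i) n"
proof -
  have f: "D i \<in> carrier_mat (m i) (p i)" "vec_space.rank (m i) (D i) = p i" "C i = D i * F i"
    using fac[OF i] unfolding full_rank_factorization_def by auto
  show "D i \<in> carrier_mat (m i) (p i)" "C i = D i * F i" by fact+
  show "inj_mat (D i)" by (rule inj_mat_if_full_rank[OF f(1,2)])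
  show "C i \<in> carrier_mat (m i) n" unfolding f(3) by (rule mult_carrier_mat[OF f(1) F[OF i]])
qed

lemma gain_parts:
  assumes i: "i < N"
  shows "H i \<in> carrier_mat (v i - p i) (p i)"
    "minv (oE (d i)) \<in> carrier_mat (p i) (p i)"
    "y \<in> carrier_vec (p i) \<Longrightarrow> minv (oE (d i)) *\<^sub>v (oE (d i) *\<^sub>v y) = y"
    "pinv (D i) \<in> carrier_mat (p i) (m i)"
    "y \<in> carrier_vec (p i) \<Longrightarrow> pinv (D i) *\<^sub>v (D i *\<^sub>v y) = y"
proof -
  note E = shapes(1,2)[OF i]
  show "H i \<in> carrier_mat (v i - p i) (p i)" using H[OF i] unfolding admissible_H_def by blast
  have "inj_mat (oE (d i))" using invertible_iff_inj[OF E(1)] E(2) by blast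
  note inv = minv_right_left[OF E(1) this]
  show "minv (oE (d i)) \<in> carrier_mat (p i) (p i)" by (rule inv)
  show "minv (oE (d i)) *\<^sub>v (oE (d i) *\<^sub>v y) = y" if "y \<in> carrier_vec (p i)"
    using assoc_mult_mat_vec[OF inv(1) E(1) that] inv(2) that by simp
  note pinv = pinv_mult_left[OF fac_props(1,2)[OF i]]
  show "pinv (D i) \<in> carrier_mat (p i) (m i)" by (rule pinv)
  show "pinv (D i) *\<^sub>v (D i *\<^sub>v y) = y" if "y \<in> carrier_vec (p i)"
    using assoc_mult_mat_vec[OF pinv(1) fac_props(1)[OF i] that] pinv(2) that by simp
qed

abbreviation Kg :: "nat \<Rightarrow> real mat" where
  "Kg i \<equiv> K_mat n (p i) (v i) (D i) (d i) (H i)"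

text \<open>Outputs have the form \<open>D i\<close> times \<open>oE (d i)\<close> times the first
  \<open>p i\<close> coordinates of the state. On such vectors the gain returns these coordinates
  themselves and adds their image under the output injection.\<close>

lemma Kg:
  assumes i: "i < N"
  shows Kg_carrier: "Kg i \<in> carrier_mat n (m i)"
    and Kg_mult_vec: "y \<in> carrier_vec (p i) \<Longrightarrow> Kg i *\<^sub>v (D i *\<^sub>v (oE (d i) *\<^sub>v y))
      = y @\<^sub>v (H i *\<^sub>v (oE (d i) *\<^sub>v y) @\<^sub>v 0\<^sub>v (n - v i))"
proof -
  note g = gain_parts[OF i] and E = shapes(1)[OF i]
  have R1: "H i @\<^sub>r 0\<^sub>m (n - v i) (p i) \<in> carrier_mat ((v i - p i) + (n - v i)) (p i)"
    by (rule carrier_append_rows[OF g(1) zero_carrier_mat])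
  have R: "minv (oE (d i)) @\<^sub>r H i @\<^sub>r 0\<^sub>m (n - v i) (p i) \<in> carrier_mat n (p i)"
    using carrier_append_rows[OF g(2) R1] dims(3)[OF i] by simp
  show "Kg i \<in> carrier_mat n (m i)" unfolding K_mat_def by (rule mult_carrier_mat[OF R g(4)])
  assume y: "y \<in> carrier_vec (p i)"
  have Ey: "oE (d i) *\<^sub>v y \<in> carrier_vec (p i)" using E y by simp
  have DEy: "D i *\<^sub>v (oE (d i) *\<^sub>v y) \<in> carrier_vec (m i)" using fac_props(1)[OF i] Ey by simp
  show "Kg i *\<^sub>v (D i *\<^sub>v (oE (d i) *\<^sub>v y)) = y @\<^sub>v (H i *\<^sub>v (oE (d i) *\<^sub>v y) @\<^sub>v 0\<^sub>v (n - v i))"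
    unfolding K_mat_def assoc_mult_mat_vec[OF R g(4) DEy] g(5)[OF Ey]
      mat_mult_append[OF g(2) R1 Ey] mat_mult_append[OF g(1) zero_carrier_mat Ey] g(3)[OF y]
    using Ey by simp
qed

lemma gP_eq: "gP (obs i) = Ts i"
  by (simp add: designed_gains_def)

lemma gQ:
  assumes i: "i < N"
  shows gQ_carrier: "gQ (obs i) \<in> carrier_mat n (m i)"
    and gQ_mult_vec: "y \<in> carrier_vec (p i) \<Longrightarrow> gQ (obs i) *\<^sub>v (D i *\<^sub>v (oE (d i) *\<^sub>v y))
      = oT (d i) *\<^sub>v (y @\<^sub>v (H i *\<^sub>v (oE (d i) *\<^sub>v y) @\<^sub>v 0\<^sub>v (n - v i)))"
proof -
  have gQ: "gQ (obs i) = oT (d i) * Kg i" by (simp add: designed_gains_def)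
  show "gQ (obs i) \<in> carrier_mat n (m i)" unfolding gQ by (rule mult_carrier_mat[OF Tc(1)[OF i] Kg_carrier[OF i]])
  assume y: "y \<in> carrier_vec (p i)"
  have "D i *\<^sub>v (oE (d i) *\<^sub>v y) \<in> carrier_vec (m i)" using fac_props(1)[OF i] shapes(1)[OF i] y by simp
  then show "gQ (obs i) *\<^sub>v (D i *\<^sub>v (oE (d i) *\<^sub>v y))
      = oT (d i) *\<^sub>v (y @\<^sub>v (H i *\<^sub>v (oE (d i) *\<^sub>v y) @\<^sub>v 0\<^sub>v (n - v i)))"
    unfolding gQ using assoc_mult_mat_vec[OF Tc(1)[OF i] Kg_carrier[OF i]] Kg_mult_vec[OF i y] by simp
qed

lemma gL:
  assumes i: "i < N"
  shows gL_carrier: "gL (obs i) \<in> carrier_mat (n - p i) (m i)"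
    and gL_mult_vec: "y \<in> carrier_vec (p i) \<Longrightarrow> gL (obs i) *\<^sub>v (D i *\<^sub>v (oE (d i) *\<^sub>v y))
      = ((o21 (d i) *\<^sub>v y - H i *\<^sub>v (oE (d i) *\<^sub>v (o11 (d i) *\<^sub>v y))) @\<^sub>v o31 (d i) *\<^sub>v y)
        + gN (obs i) *\<^sub>v (H i *\<^sub>v (oE (d i) *\<^sub>v y) @\<^sub>v 0\<^sub>v (n - v i))"
proof -
  note g = gain_parts[OF i] and s = shapes[OF i]
  let ?B = "o21 (d i) - H i * oE (d i) * o11 (d i)"
  have HE: "H i * oE (d i) * o11 (d i) \<in> carrier_mat (v i - p i) (p i)"
    by (rule mult_carrier_mat[OF mult_carrier_mat[OF g(1) s(1)] s(3)])
  have B: "?B \<in> carrier_mat (v i - p i) (p i)" by (rule minus_carrier_mat[OF HE])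
  have B3: "?B @\<^sub>r o31 (d i) \<in> carrier_mat (n - p i) (p i)"
    using carrier_append_rows[OF B s(7)] dims(2)[OF i] by simp
  have S: "(S_mat n (p i))\<^sup>T \<in> carrier_mat (n - p i) n" using S_mat_carrier[OF dims(1)[OF i]] by simp
  have c1: "(?B @\<^sub>r o31 (d i)) * minv (oE (d i)) * pinv (D i) \<in> carrier_mat (n - p i) (m i)"
    by (rule mult_carrier_mat[OF mult_carrier_mat[OF B3 g(2)] g(4)])
  have c2: "gN (obs i) * (S_mat n (p i))\<^sup>T * Kg i \<in> carrier_mat (n - p i) (m i)"
    by (rule mult_carrier_mat[OF mult_carrier_mat[OF gN_carrier[OF i] S] Kg_carrier[OF i]])
  have gL: "gL (obs i) = (?B @\<^sub>r o31 (d i)) * minv (oE (d i)) * pinv (D i) + gN (obs i) * (S_mat n (p i))\<^sup>T * Kg i"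
    by (simp add: designed_gains_def)
  show "gL (obs i) \<in> carrier_mat (n - p i) (m i)" unfolding gL using c1 c2 by simp
  assume y: "y \<in> carrier_vec (p i)"
  have Ey: "oE (d i) *\<^sub>v y \<in> carrier_vec (p i)" using s y by simp
  have DEy: "D i *\<^sub>v (oE (d i) *\<^sub>v y) \<in> carrier_vec (m i)" using fac_props(1)[OF i] Ey by simp
  have "H i *\<^sub>v (oE (d i) *\<^sub>v y) @\<^sub>v 0\<^sub>v (n - v i) \<in> carrier_vec (n - p i)"
    using append_carrier_vec[OF mult_mat_vec_carrier[OF g(1) Ey] zero_carrier_vec, of "n - v i"] dims(2)[OF i] by simp
  note ST = S_mat_transpose_mult_vec[OF dims(1)[OF i] y this]
  show "gL (obs i) *\<^sub>v (D i *\<^sub>v (oE (d i) *\<^sub>v y))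
      = ((o21 (d i) *\<^sub>v y - H i *\<^sub>v (oE (d i) *\<^sub>v (o11 (d i) *\<^sub>v y))) @\<^sub>v o31 (d i) *\<^sub>v y)
        + gN (obs i) *\<^sub>v (H i *\<^sub>v (oE (d i) *\<^sub>v y) @\<^sub>v 0\<^sub>v (n - v i))"
    unfolding gL add_mult_distrib_mat_vec[OF c1 c2 DEy] mat_mult_vec3[OF B3 g(2,4) DEy] g(5)[OF Ey] g(3)[OF y]
      mat_mult_vec3[OF gN_carrier[OF i] S Kg_carrier[OF i] DEy] Kg_mult_vec[OF i y] ST
      mat_mult_append[OF B s(7) y] minus_mult_distrib_mat_vec[OF s(5) HE y] mat_mult_vec3[OF g(1) s(1,3) y] ..
qed

text \<open>In the coordinates \<open>\<xi> = T\<^sub>i\<^sup>T x\<close> the estimation error of node \<open>i\<close> is \<open>T\<^sub>i\<^sub>s \<omega>\<close>, and the coupling-free part of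
  its derivative is \<open>T\<^sub>i\<^sub>s N\<^sub>i \<omega>\<close>.\<close>
lemma node_error:
  assumes i: "i < N" and x: "x \<in> carrier_vec n" and z: "z \<in> carrier_vec (n - p i)"
  obtains \<omega> where "\<omega> \<in> carrier_vec (n - p i)"
    "gP (obs i) *\<^sub>v z + gQ (obs i) *\<^sub>v (C i *\<^sub>v x) - x = Ts i *\<^sub>v \<omega>"
    "gP (obs i) *\<^sub>v (gN (obs i) *\<^sub>v z + gL (obs i) *\<^sub>v (C i *\<^sub>v x)) + gQ (obs i) *\<^sub>v (C i *\<^sub>v (A *\<^sub>v x)) - A *\<^sub>v x
      = Ts i *\<^sub>v (gN (obs i) *\<^sub>v \<omega>)"
proof -
  note g = gain_parts[OF i] and s = shapes[OF i] and Tci = Tc[OF i]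
  have "(oT (d i))\<^sup>T *\<^sub>v x \<in> carrier_vec (p i + ((v i - p i) + (n - v i)))" using Tci x dims(3)[OF i] by simp
  then obtain x1 x' where x1: "x1 \<in> carrier_vec (p i)" and "x' \<in> carrier_vec ((v i - p i) + (n - v i))"
    and "(oT (d i))\<^sup>T *\<^sub>v x = x1 @\<^sub>v x'" by (rule carrier_vec_split)
  then obtain x2 x3 where x2: "x2 \<in> carrier_vec (v i - p i)" and x3: "x3 \<in> carrier_vec (n - v i)"
    and xi: "(oT (d i))\<^sup>T *\<^sub>v x = x1 @\<^sub>v (x2 @\<^sub>v x3)" by (metis carrier_vec_split)
  have xT: "x = oT (d i) *\<^sub>v (x1 @\<^sub>v (x2 @\<^sub>v x3))" using orth_mat_inverse(1)[OF T[OF i] x] xi by simp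
  obtain z1 z2 where z1: "z1 \<in> carrier_vec (v i - p i)" and z2: "z2 \<in> carrier_vec (n - v i)" and zz: "z = z1 @\<^sub>v z2"
    using split_state[OF i z] .
  have Cf: "C i *\<^sub>v y = D i *\<^sub>v (F i *\<^sub>v y)" if "y \<in> carrier_vec n" for y
    unfolding fac_props(3)[OF i] by (rule assoc_mult_mat_vec[OF fac_props(1)[OF i] F[OF i] that])
  define a1 where "a1 = o11 (d i) *\<^sub>v x1 + o12 (d i) *\<^sub>v x2"
  define a2 where "a2 = o21 (d i) *\<^sub>v x1 + o22 (d i) *\<^sub>v x2"
  define a3 where "a3 = o31 (d i) *\<^sub>v x1 + o32 (d i) *\<^sub>v x2 + ou (d i) *\<^sub>v x3"
  have ac: "a1 \<in> carrier_vec (p i)" "a2 \<in> carrier_vec (v i - p i)" "a3 \<in> carrier_vec (n - v i)"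
    unfolding a1_def a2_def a3_def using s x1 x2 x3 by auto
  have Ax: "A *\<^sub>v x = oT (d i) *\<^sub>v (a1 @\<^sub>v (a2 @\<^sub>v a3))"
    unfolding a1_def a2_def a3_def xT by (rule plant_mult_vec[OF i x1 x2 x3])
  have Axc: "A *\<^sub>v x \<in> carrier_vec n" using A x by simp
  have Cx: "C i *\<^sub>v x = D i *\<^sub>v (oE (d i) *\<^sub>v x1)"
    unfolding Cf[OF x] unfolding xT output_mult_vec[OF i x1 x2 x3] ..
  have CAx: "C i *\<^sub>v (A *\<^sub>v x) = D i *\<^sub>v (oE (d i) *\<^sub>v a1)"
    unfolding Cf[OF Axc] unfolding Ax output_mult_vec[OF i ac] ..
  \<comment> \<open>The injection applied to the measured coordinates of the state gives
    \<open>h\<close>, to those of its derivative \<open>k\<close>; \<open>k1\<close> and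
    \<open>k2\<close> are the shares of the two state blocks that drive the measured part.\<close>
  define h where "h = H i *\<^sub>v (oE (d i) *\<^sub>v x1)"
  define k where "k = H i *\<^sub>v (oE (d i) *\<^sub>v a1)"
  define k1 where "k1 = H i *\<^sub>v (oE (d i) *\<^sub>v (o11 (d i) *\<^sub>v x1))"
  define k2 where "k2 = H i *\<^sub>v (oE (d i) *\<^sub>v (o12 (d i) *\<^sub>v x2))"
  have hk: "h \<in> carrier_vec (v i - p i)" "k \<in> carrier_vec (v i - p i)" "k1 \<in> carrier_vec (v i - p i)" "k2 \<in> carrier_vec (v i - p i)"
    unfolding h_def k_def k1_def k2_def using g(1) s x1 x2 ac by auto
  have k: "k = k1 + k2"
  proof -
    have c: "o11 (d i) *\<^sub>v x1 \<in> carrier_vec (p i)" "o12 (d i) *\<^sub>v x2 \<in> carrier_vec (p i)" using s x1 x2 by auto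
    show ?thesis unfolding k_def k1_def k2_def a1_def mult_add_distrib_mat_vec[OF s(1) c]
      by (rule mult_add_distrib_mat_vec[OF g(1)]) (use s c in auto)
  qed
  \<comment> \<open>\<open>z1\<close> does not estimate \<open>x2\<close> itself but
    \<open>x2 - h\<close>, the usual reduced-order change of variable that spares differentiating
    the output.\<close>
  define \<omega> where "\<omega> = (z1 + h - x2) @\<^sub>v (z2 - x3)"
  have w1: "z1 + h - x2 \<in> carrier_vec (v i - p i)" and w2: "z2 - x3 \<in> carrier_vec (n - v i)"
    using z1 z2 x2 x3 hk by auto
  have \<omega>: "\<omega> \<in> carrier_vec (n - p i)" unfolding \<omega>_def using append_carrier_vec[OF w1 w2] dims(2)[OF i] by simp
  have c3: "u1 @\<^sub>v (u2 @\<^sub>v u3) \<in> carrier_vec n"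
    if "u1 \<in> carrier_vec (p i)" "u2 \<in> carrier_vec (v i - p i)" "u3 \<in> carrier_vec (n - v i)" for u1 u2 u3 :: "real vec"
    using append_carrier_vec[OF that(1) append_carrier_vec[OF that(2,3)]] dims(3)[OF i] by simp
  have combine: "oT (d i) *\<^sub>v (0\<^sub>v (p i) @\<^sub>v (u2 @\<^sub>v u3)) + oT (d i) *\<^sub>v (y1 @\<^sub>v (y2 @\<^sub>v 0\<^sub>v (n - v i)))
      - oT (d i) *\<^sub>v (y1 @\<^sub>v (q2 @\<^sub>v q3)) = Ts i *\<^sub>v ((u2 + y2 - q2) @\<^sub>v (u3 - q3))"
    if c: "u2 \<in> carrier_vec (v i - p i)" "u3 \<in> carrier_vec (n - v i)" "y1 \<in> carrier_vec (p i)" "y2 \<in> carrier_vec (v i - p i)"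
      "q2 \<in> carrier_vec (v i - p i)" "q3 \<in> carrier_vec (n - v i)" for u2 u3 y1 y2 q2 q3
  proof -
    have "(0\<^sub>v (p i) @\<^sub>v (u2 @\<^sub>v u3)) + (y1 @\<^sub>v (y2 @\<^sub>v 0\<^sub>v (n - v i))) - (y1 @\<^sub>v (q2 @\<^sub>v q3))
        = 0\<^sub>v (p i) @\<^sub>v ((u2 + y2 - q2) @\<^sub>v (u3 - q3))"
      using c by (intro eq_vecI) auto
    moreover have "(u2 + y2 - q2) @\<^sub>v (u3 - q3) \<in> carrier_vec (n - p i)"
      using append_carrier_vec[of "u2 + y2 - q2" "v i - p i" "u3 - q3" "n - v i"] c dims(2)[OF i] by simp
    moreover note c3s = c3[OF zero_carrier_vec c(1,2)] c3[OF c(3,4) zero_carrier_vec] c3[OF c(3,5,6)]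
    ultimately show ?thesis
      unfolding mult_add_distrib_mat_vec[OF Tci(1) c3s(1,2), symmetric]
        mult_minus_distrib_mat_vec[OF Tci(1) add_carrier_vec[OF c3s(1,2)] c3s(3), symmetric]
      using Ts_mult_vec[OF i] by simp
  qed
  have gQx: "gQ (obs i) *\<^sub>v (C i *\<^sub>v x) = oT (d i) *\<^sub>v (x1 @\<^sub>v (h @\<^sub>v 0\<^sub>v (n - v i)))"
    unfolding Cx h_def by (rule gQ_mult_vec[OF i x1])
  have gQAx: "gQ (obs i) *\<^sub>v (C i *\<^sub>v (A *\<^sub>v x)) = oT (d i) *\<^sub>v (a1 @\<^sub>v (k @\<^sub>v 0\<^sub>v (n - v i)))"
    unfolding CAx k_def by (rule gQ_mult_vec[OF i ac(1)])
  have 1: "gP (obs i) *\<^sub>v z + gQ (obs i) *\<^sub>v (C i *\<^sub>v x) - x = Ts i *\<^sub>v \<omega>"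
    unfolding gP_eq Ts_mult_vec[OF i z] gQx unfolding zz xT \<omega>_def
    by (rule combine[OF z1 z2 x1 hk(1) x2 x3])
  note Mc = M_carrier[OF i]
  have Mv: "M i *\<^sub>v z1 \<in> carrier_vec (v i - p i)" "M i *\<^sub>v h \<in> carrier_vec (v i - p i)" "M i *\<^sub>v x2 \<in> carrier_vec (v i - p i)"
    "o32 (d i) *\<^sub>v z1 \<in> carrier_vec (n - v i)" "o32 (d i) *\<^sub>v h \<in> carrier_vec (n - v i)" "o32 (d i) *\<^sub>v x2 \<in> carrier_vec (n - v i)"
    "ou (d i) *\<^sub>v z2 \<in> carrier_vec (n - v i)" "ou (d i) *\<^sub>v x3 \<in> carrier_vec (n - v i)"
    "o21 (d i) *\<^sub>v x1 \<in> carrier_vec (v i - p i)" "o22 (d i) *\<^sub>v x2 \<in> carrier_vec (v i - p i)" "o31 (d i) *\<^sub>v x1 \<in> carrier_vec (n - v i)"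
    using Mc s z1 z2 x1 x2 x3 hk by auto
  define u2 where "u2 = M i *\<^sub>v z1 + (o21 (d i) *\<^sub>v x1 - k1 + M i *\<^sub>v h)"
  define u3 where "u3 = (o32 (d i) *\<^sub>v z1 + ou (d i) *\<^sub>v z2) + (o31 (d i) *\<^sub>v x1 + o32 (d i) *\<^sub>v h)"
  have uc: "u2 \<in> carrier_vec (v i - p i)" "u3 \<in> carrier_vec (n - v i)" unfolding u2_def u3_def using Mv hk by auto
  have drift: "gN (obs i) *\<^sub>v z + gL (obs i) *\<^sub>v (C i *\<^sub>v x) = u2 @\<^sub>v u3"
  proof -
    have "gL (obs i) *\<^sub>v (C i *\<^sub>v x) = ((o21 (d i) *\<^sub>v x1 - k1) @\<^sub>v o31 (d i) *\<^sub>v x1) + (M i *\<^sub>v h @\<^sub>v o32 (d i) *\<^sub>v h)"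
      unfolding Cx gL_mult_vec[OF i x1] k1_def[symmetric] h_def[symmetric] gN_mult_vec[OF i hk(1) zero_carrier_vec]
      using s(9) Mv by simp
    moreover have c: "o21 (d i) *\<^sub>v x1 - k1 \<in> carrier_vec (v i - p i)" using Mv hk by simp
    ultimately have "gL (obs i) *\<^sub>v (C i *\<^sub>v x)
        = (o21 (d i) *\<^sub>v x1 - k1 + M i *\<^sub>v h) @\<^sub>v (o31 (d i) *\<^sub>v x1 + o32 (d i) *\<^sub>v h)"
      using append_vec_add[OF c Mv(2) Mv(11,5)] by metis
    then show ?thesis
      unfolding zz gN_mult_vec[OF i z1 z2] u2_def u3_def
      using append_vec_add[OF Mv(1) add_carrier_vec[OF c Mv(2)] add_carrier_vec[OF Mv(4,7)] add_carrier_vec[OF Mv(11,5)]]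
      by metis
  qed
  \<comment> \<open>\<open>k2\<close>, the part of the output derivative due to \<open>x2\<close>,
    completes \<open>o22 (d i)\<close> to the closed loop matrix, while \<open>k1\<close> is
    cancelled by the corresponding term of \<open>gL\<close>.\<close>
  have N\<omega>: "gN (obs i) *\<^sub>v \<omega> = (u2 + k - a2) @\<^sub>v (u3 - a3)"
  proof -
    have "M i *\<^sub>v (z1 + h - x2) = M i *\<^sub>v z1 + M i *\<^sub>v h - M i *\<^sub>v x2"
      using mult_minus_distrib_mat_vec[OF Mc _ x2, of "z1 + h"] mult_add_distrib_mat_vec[OF Mc z1 hk(1)] z1 hk by simp
    also have "M i *\<^sub>v x2 = o22 (d i) *\<^sub>v x2 - k2"
      unfolding k2_def by (rule closed_loop_mult_vec[OF s(6,4,1) g(1) x2])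
    also have "M i *\<^sub>v z1 + M i *\<^sub>v h - (o22 (d i) *\<^sub>v x2 - k2) = u2 + k - a2"
    proof -
      have "u + w - (y - k2) = u + (q - k1 + w) + (k1 + k2) - (q + y)"
        if "u \<in> carrier_vec (v i - p i)" "w \<in> carrier_vec (v i - p i)" "y \<in> carrier_vec (v i - p i)"
          "q \<in> carrier_vec (v i - p i)" for u w y q :: "real vec"
        using that hk by (intro eq_vecI) auto
      from this[OF Mv(1,2,10,9)] show ?thesis unfolding u2_def a2_def k .
    qed
    finally have 1: "M i *\<^sub>v (z1 + h - x2) = u2 + k - a2" .
    have "o32 (d i) *\<^sub>v (z1 + h - x2) + ou (d i) *\<^sub>v (z2 - x3)
        = (o32 (d i) *\<^sub>v z1 + o32 (d i) *\<^sub>v h - o32 (d i) *\<^sub>v x2) + (ou (d i) *\<^sub>v z2 - ou (d i) *\<^sub>v x3)"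
      using mult_minus_distrib_mat_vec[OF s(8) _ x2, of "z1 + h"] mult_add_distrib_mat_vec[OF s(8) z1 hk(1)]
        mult_minus_distrib_mat_vec[OF s(9) z2 x3] z1 hk by simp
    also have "\<dots> = u3 - a3"
    proof -
      have "(u + w - y) + (q - b) = (u + q) + (c + w) - (c + y + b)"
        if "u \<in> carrier_vec (n - v i)" "w \<in> carrier_vec (n - v i)" "y \<in> carrier_vec (n - v i)"
          "q \<in> carrier_vec (n - v i)" "b \<in> carrier_vec (n - v i)" "c \<in> carrier_vec (n - v i)" for u w y q b c :: "real vec"
        using that by (intro eq_vecI) auto
      from this[OF Mv(4-8,11)] show ?thesis unfolding u3_def a3_def .
    qed
    finally show ?thesis unfolding \<omega>_def gN_mult_vec[OF i w1 w2] using 1 by simp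
  qed
  have u23: "u2 @\<^sub>v u3 \<in> carrier_vec (n - p i)" using append_carrier_vec[OF uc] dims(2)[OF i] by simp
  have 2: "gP (obs i) *\<^sub>v (gN (obs i) *\<^sub>v z + gL (obs i) *\<^sub>v (C i *\<^sub>v x)) + gQ (obs i) *\<^sub>v (C i *\<^sub>v (A *\<^sub>v x)) - A *\<^sub>v x
      = Ts i *\<^sub>v (gN (obs i) *\<^sub>v \<omega>)"
    unfolding gP_eq drift gQAx Ts_mult_vec[OF i u23] N\<omega> unfolding Ax
    by (rule combine[OF uc ac(1) hk(2) ac(2,3)])
  show ?thesis by (rule that[OF \<omega> 1 2])
qed

text \<open>Row \<open>i\<close> of -R L applied to the errors. The coupling is formed from
  differences of estimates, in which the plant state cancels; this is why \<open>f\<close> is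
  related to \<open>e\<close> only through differences.\<close>

lemma coupling_eq_mix:
  assumes e: "\<And>j. j < N \<Longrightarrow> e j \<in> carrier_vec n" and i: "i < N"
    and diff: "\<And>j k. j < N \<Longrightarrow> k < n \<Longrightarrow> f j k - f i k = e j $ k - e i $ k"
  shows "r $ i \<cdot>\<^sub>v vec n (\<lambda>k. \<Sum>j<N. a $$ (i, j) * (f j k - f i k)) = - mix n N (weight_mat N r * laplacian N a) e i"
proof (rule eq_vecI)
  fix k assume "k < dim_vec (- mix n N (weight_mat N r * laplacian N a) e i)"
  then have k: "k < n" by simp
  have "(\<Sum>j<N. (weight_mat N r * laplacian N a) $$ (i, j) * e j $ k)
      = (\<Sum>j<N. (if i = j then r $ i * (\<Sum>k<N. a $$ (i, k)) * e j $ k else 0) - r $ i * (a $$ (i, j) * e j $ k))"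
    using i by (intro sum.cong) (auto simp: weight_laplacian_entry(1)[OF a] laplacian_entry[OF a] algebra_simps simp del: index_mult_mat(1))
  also have "\<dots> = r $ i * (\<Sum>j<N. a $$ (i, j)) * e i $ k - r $ i * (\<Sum>j<N. a $$ (i, j) * e j $ k)"
    using i by (simp add: sum_subtractf sum_distrib_left[symmetric])
  also have "\<dots> = - (r $ i * (\<Sum>j<N. a $$ (i, j) * (e j $ k - e i $ k)))"
    by (simp add: right_diff_distrib sum_subtractf sum_distrib_right mult.assoc)
  finally show "(r $ i \<cdot>\<^sub>v vec n (\<lambda>k. \<Sum>j<N. a $$ (i, j) * (f j k - f i k))) $ k
      = (- mix n N (weight_mat N r * laplacian N a) e i) $ k"
    using k diff by (simp add: mix_def)
qed simp

text \<open>By \<open>node_error\<close> the error of each node is in the range of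
  \<open>Ts i\<close> at all times, which at time 0 is the initial condition built into
  \<open>error_system_solutions\<close>. The drift is given by the same lemma and the coupling by
  \<open>coupling_eq_mix\<close>.\<close>

lemma observer_errors_solve_error_system:
  assumes po: "plant_observer n N A C a r \<gamma> obs x z"
  shows "est_error n N C obs x z \<in> error_system_solutions n N a r \<gamma> Ts obs"
    and "i < N \<Longrightarrow> 0 \<le> t \<Longrightarrow> estimate C obs x z i t - x t \<in> carrier_vec n"
proof -
  define e where "e i t = estimate C obs x z i t - x t" for i t
  define s where "s i t = vec n (\<lambda>k. \<Sum>j<N. a $$ (i, j) * (estimate C obs x z j t $ k - estimate C obs x z i t $ k))" for i t
  let ?RL = "weight_mat N r * laplacian N a"
  have dx: "has_vec_deriv n x (\<lambda>t. A *\<^sub>v x t)" using po unfolding plant_observer_def by blast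
  have dz: "has_vec_deriv (n - p i) (z i) (\<lambda>t. gN (obs i) *\<^sub>v z i t + gL (obs i) *\<^sub>v (C i *\<^sub>v x t)
      + (\<gamma> * r $ i) \<cdot>\<^sub>v (gM (obs i) *\<^sub>v s i t))" if i: "i < N" for i
  proof -
    have "dim_row (gN (obs i)) = n - p i" using gN_carrier[OF i] by simp
    moreover have "has_vec_deriv (dim_row (gN (obs i))) (z i) (\<lambda>t. gN (obs i) *\<^sub>v z i t + gL (obs i) *\<^sub>v (C i *\<^sub>v x t)
        + (\<gamma> * r $ i) \<cdot>\<^sub>v (gM (obs i) *\<^sub>v s i t))"
      using po i unfolding plant_observer_def s_def by blast
    ultimately show ?thesis by metis
  qed
  have xc: "x t \<in> carrier_vec n" if "0 \<le> t" for t by (rule has_vec_derivD(1)[OF dx that])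
  have zc: "z i t \<in> carrier_vec (n - p i)" if "i < N" "0 \<le> t" for i t by (rule has_vec_derivD(1)[OF dz[OF that(1)] that(2)])
  have gPc: "gP (obs i) \<in> carrier_mat n (n - p i)" if "i < N" for i unfolding gP_eq by (rule Ts_carrier[OF that])
  have estc: "estimate C obs x z i t \<in> carrier_vec n" if "i < N" "0 \<le> t" for i t
    unfolding estimate_def
    using mult_mat_vec_carrier[OF gPc zc] mult_mat_vec_carrier[OF gQ_carrier mult_mat_vec_carrier[OF fac_props(4) xc]] that
    by (intro add_carrier_vec) auto
  then have ec: "e i t \<in> carrier_vec n" if "i < N" "0 \<le> t" for i t unfolding e_def using xc that by (intro minus_carrier_vec) auto
  show "i < N \<Longrightarrow> 0 \<le> t \<Longrightarrow> estimate C obs x z i t - x t \<in> carrier_vec n" for i t using ec unfolding e_def by blast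
  have de: "has_vec_deriv n (e i) (\<lambda>t. gP (obs i) *\<^sub>v (gN (obs i) *\<^sub>v z i t + gL (obs i) *\<^sub>v (C i *\<^sub>v x t)
      + (\<gamma> * r $ i) \<cdot>\<^sub>v (gM (obs i) *\<^sub>v s i t)) + gQ (obs i) *\<^sub>v (C i *\<^sub>v (A *\<^sub>v x t)) - A *\<^sub>v x t)" if i: "i < N" for i
    unfolding e_def estimate_def
    by (intro has_vec_deriv_diff has_vec_deriv_add has_vec_deriv_mult_mat[OF dz[OF i] gPc[OF i]]
      has_vec_deriv_mult_mat[OF has_vec_deriv_mult_mat[OF dx fac_props(4)[OF i]] gQ_carrier[OF i]] dx)
  have key: "\<exists>\<omega> \<in> carrier_vec (n - p i). e i t = Ts i *\<^sub>v \<omega> \<and>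
      gP (obs i) *\<^sub>v (gN (obs i) *\<^sub>v z i t + gL (obs i) *\<^sub>v (C i *\<^sub>v x t)
      + (\<gamma> * r $ i) \<cdot>\<^sub>v (gM (obs i) *\<^sub>v s i t)) + gQ (obs i) *\<^sub>v (C i *\<^sub>v (A *\<^sub>v x t)) - A *\<^sub>v x t
      = Ts i *\<^sub>v (gN (obs i) *\<^sub>v ((Ts i)\<^sup>T *\<^sub>v e i t) - \<gamma> \<cdot>\<^sub>v (gM (obs i) *\<^sub>v mix n N ?RL (\<lambda>i. e i t) i))"
    if i: "i < N" and t: "0 \<le> t" for i t
  proof -
    obtain \<omega> where \<omega>: "\<omega> \<in> carrier_vec (n - p i)"
      and e\<omega>: "gP (obs i) *\<^sub>v z i t + gQ (obs i) *\<^sub>v (C i *\<^sub>v x t) - x t = Ts i *\<^sub>v \<omega>"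
      and drift: "gP (obs i) *\<^sub>v (gN (obs i) *\<^sub>v z i t + gL (obs i) *\<^sub>v (C i *\<^sub>v x t)) + gQ (obs i) *\<^sub>v (C i *\<^sub>v (A *\<^sub>v x t)) - A *\<^sub>v x t
        = Ts i *\<^sub>v (gN (obs i) *\<^sub>v \<omega>)"
      by (rule node_error[OF i xc[OF t] zc[OF i t]])
    have e1: "e i t = Ts i *\<^sub>v \<omega>" unfolding e_def estimate_def by (rule e\<omega>)
    have "estimate C obs x z j t $ k - estimate C obs x z i t $ k = e j t $ k - e i t $ k" if "j < N" "k < n" for j k
      unfolding e_def using that estc[OF _ t] xc[OF t] i by simp
    from coupling_eq_mix[of "\<lambda>i. e i t" i "\<lambda>j k. estimate C obs x z j t $ k", OF ec[OF _ t] i this]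
    have sm: "r $ i \<cdot>\<^sub>v s i t = - mix n N ?RL (\<lambda>i. e i t) i" unfolding s_def by simp
    let ?mx = "mix n N ?RL (\<lambda>i. e i t) i"
    note gMc = gM_carrier[OF i] and Tsc = Ts_carrier[OF i]
    have sc: "s i t \<in> carrier_vec n" unfolding s_def by simp
    define q where "q = gM (obs i) *\<^sub>v ?mx"
    have q: "q \<in> carrier_vec (n - p i)" unfolding q_def by (rule mult_mat_vec_carrier[OF gMc mix_carrier(1)])
    have "(\<gamma> * r $ i) \<cdot>\<^sub>v (gM (obs i) *\<^sub>v s i t) = \<gamma> \<cdot>\<^sub>v (gM (obs i) *\<^sub>v (r $ i \<cdot>\<^sub>v s i t))"
      using mult_mat_vec[OF gMc sc] by (simp add: smult_smult_assoc)
    also have "gM (obs i) *\<^sub>v (r $ i \<cdot>\<^sub>v s i t) = gM (obs i) *\<^sub>v ((- 1) \<cdot>\<^sub>v ?mx)"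
      unfolding sm by (rule arg_cong[where f = "\<lambda>u. gM (obs i) *\<^sub>v u"]) (auto intro!: eq_vecI)
    also have "\<dots> = (- 1) \<cdot>\<^sub>v q" unfolding q_def by (rule mult_mat_vec[OF gMc mix_carrier(1)])
    finally have cpl: "(\<gamma> * r $ i) \<cdot>\<^sub>v (gM (obs i) *\<^sub>v s i t) = (- \<gamma>) \<cdot>\<^sub>v q" by (simp add: smult_smult_assoc)
    define b where "b = gN (obs i) *\<^sub>v z i t + gL (obs i) *\<^sub>v (C i *\<^sub>v x t)"
    have b: "b \<in> carrier_vec (n - p i)" unfolding b_def
      using mult_mat_vec_carrier[OF gN_carrier[OF i] zc[OF i t]]
        mult_mat_vec_carrier[OF gL_carrier[OF i] mult_mat_vec_carrier[OF fac_props(4)[OF i] xc[OF t]]] by simp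
    define l' where "l' = A *\<^sub>v x t"
    define l where "l = gQ (obs i) *\<^sub>v (C i *\<^sub>v l')"
    have l': "l' \<in> carrier_vec n" unfolding l'_def using A xc[OF t] by simp
    have l: "l \<in> carrier_vec n" unfolding l_def
      by (rule mult_mat_vec_carrier[OF gQ_carrier[OF i] mult_mat_vec_carrier[OF fac_props(4)[OF i] l']])
    have N\<omega>: "gN (obs i) *\<^sub>v \<omega> \<in> carrier_vec (n - p i)" using gN_carrier[OF i] \<omega> by simp
    have dr: "Ts i *\<^sub>v b + l - l' = Ts i *\<^sub>v (gN (obs i) *\<^sub>v \<omega>)" using drift unfolding gP_eq b_def l_def l'_def .
    define Tb Tq where "Tb = Ts i *\<^sub>v b" and "Tq = Ts i *\<^sub>v q"
    have Tbq: "Tb \<in> carrier_vec n" "Tq \<in> carrier_vec n" unfolding Tb_def Tq_def using Tsc b q by auto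
    have "Ts i *\<^sub>v (b + (- \<gamma>) \<cdot>\<^sub>v q) + l - l' = (Tb + (- \<gamma>) \<cdot>\<^sub>v Tq) + l - l'"
      using mult_add_distrib_mat_vec[OF Tsc b, of "(- \<gamma>) \<cdot>\<^sub>v q"] mult_mat_vec[OF Tsc q] q unfolding Tb_def Tq_def by simp
    also have "\<dots> = (Tb + l - l') - \<gamma> \<cdot>\<^sub>v Tq" using Tbq l l' by (intro eq_vecI) auto
    also have "\<dots> = Ts i *\<^sub>v (gN (obs i) *\<^sub>v \<omega>) - Ts i *\<^sub>v (\<gamma> \<cdot>\<^sub>v q)"
      using dr mult_mat_vec[OF Tsc q] unfolding Tb_def Tq_def by simp
    also have "\<dots> = Ts i *\<^sub>v (gN (obs i) *\<^sub>v \<omega> - \<gamma> \<cdot>\<^sub>v q)"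
      using mult_minus_distrib_mat_vec[OF Tsc N\<omega>, of "\<gamma> \<cdot>\<^sub>v q"] q by simp
    finally have "Ts i *\<^sub>v (b + (- \<gamma>) \<cdot>\<^sub>v q) + l - l' = Ts i *\<^sub>v (gN (obs i) *\<^sub>v \<omega> - \<gamma> \<cdot>\<^sub>v q)" .
    then show ?thesis
      unfolding gP_eq cpl b_def[symmetric] l'_def[symmetric] unfolding l_def[symmetric] q_def[symmetric]
      using \<omega> e1 Ts_transpose_Ts[OF i \<omega>] by (intro bexI[of _ \<omega>]) auto
  qed
  have e_stack: "est_error n N C obs x z t = stack_vec n N (\<lambda>i. e i t)" for t unfolding est_error_def e_def ..
  have dE: "has_vec_deriv (N * n) (\<lambda>t. stack_vec n N (\<lambda>i. e i t)) (\<lambda>t. error_mat n N a r \<gamma> Ts obs *\<^sub>v stack_vec n N (\<lambda>i. e i t))"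
  proof (rule has_vec_deriv_cong[OF has_vec_deriv_stack[OF de]])
    fix t :: real assume t: "0 \<le> t"
    have "error_mat n N a r \<gamma> Ts obs *\<^sub>v stack_vec n N (\<lambda>i. e i t) = stack_vec n N (\<lambda>i. Ts i *\<^sub>v
      (gN (obs i) *\<^sub>v ((Ts i)\<^sup>T *\<^sub>v e i t) - \<gamma> \<cdot>\<^sub>v (gM (obs i) *\<^sub>v mix n N ?RL (\<lambda>i. e i t) i)))"
      by (rule error_mat_mult_stack_vec[OF a Ts_carrier gN_carrier gM_carrier]) (use ec t in auto)
    also have "\<dots> = stack_vec n N (\<lambda>i. gP (obs i) *\<^sub>v (gN (obs i) *\<^sub>v z i t + gL (obs i) *\<^sub>v (C i *\<^sub>v x t)
      + (\<gamma> * r $ i) \<cdot>\<^sub>v (gM (obs i) *\<^sub>v s i t)) + gQ (obs i) *\<^sub>v (C i *\<^sub>v (A *\<^sub>v x t)) - A *\<^sub>v x t)"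
      using key[OF _ t] by (intro stack_vec_cong) metis
    finally show "error_mat n N a r \<gamma> Ts obs *\<^sub>v stack_vec n N (\<lambda>i. e i t) =
      stack_vec n N (\<lambda>i. gP (obs i) *\<^sub>v (gN (obs i) *\<^sub>v z i t + gL (obs i) *\<^sub>v (C i *\<^sub>v x t)
      + (\<gamma> * r $ i) \<cdot>\<^sub>v (gM (obs i) *\<^sub>v s i t)) + gQ (obs i) *\<^sub>v (C i *\<^sub>v (A *\<^sub>v x t)) - A *\<^sub>v x t)" .
  qed auto
  obtain \<omega> where \<omega>: "\<And>i. i < N \<Longrightarrow> \<omega> i \<in> carrier_vec (n - p i)" "\<And>i. i < N \<Longrightarrow> e i 0 = Ts i *\<^sub>v \<omega> i"
    using key[OF _ order_refl] by metis
  have "block_diag N Ts \<in> carrier_mat (\<Sum>i<N. n) (\<Sum>i<N. n - p i)" by (rule block_diag_carrier) (rule Ts_carrier)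
  moreover have "block_diag N Ts *\<^sub>v cat_vec N \<omega> = cat_vec N (\<lambda>i. Ts i *\<^sub>v \<omega> i)"
    by (rule block_diag_mult_cat_vec[of N Ts "\<lambda>_. n" "\<lambda>i. n - p i"]) (use Ts_carrier \<omega> in auto)
  moreover have "cat_vec N (\<lambda>i. Ts i *\<^sub>v \<omega> i) = stack_vec n N (\<lambda>i. e i 0)"
  proof -
    have "stack_vec n N (\<lambda>i. e i 0) = cat_vec N (\<lambda>i. e i 0)" by (rule stack_vec_eq_cat_vec) (use ec in auto)
    also have "\<dots> = cat_vec N (\<lambda>i. Ts i *\<^sub>v \<omega> i)" by (rule cat_vec_cong) (use \<omega> in auto)
    finally show ?thesis by simp
  qed
  moreover have "cat_vec N \<omega> \<in> carrier_vec (\<Sum>i<N. n - p i)" by (rule cat_vec_carrier) (rule \<omega>(1))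
  ultimately have "stack_vec n N (\<lambda>i. e i 0) \<in> (*\<^sub>v) (block_diag N Ts) ` carrier_vec (dim_col (block_diag N Ts))"
    by (intro image_eqI[of _ _ "cat_vec N \<omega>"]) auto
  with dE show "est_error n N C obs x z \<in> error_system_solutions n N a r \<gamma> Ts obs"
    unfolding error_system_solutions_def e_stack[abs_def] by simp
qed

lemma design_correct:
  "observer_form n N m p obs" "omniscient n N A C a r \<gamma> obs"
  "observer_errors n N A C a r \<gamma> obs \<subseteq> error_system_solutions n N a r \<gamma> Ts obs"
  "converge_with_rate \<alpha> (error_system_solutions n N a r \<gamma> Ts obs)"
  "state_dim N obs = N * n - (\<Sum>i<N. p i)"
proof -
  show "observer_form n N m p obs"
    unfolding observer_form_def using gN_carrier gL_carrier gM_carrier gQ_carrier Ts_carrier gP_eq by simp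
  show sub: "observer_errors n N A C a r \<gamma> obs \<subseteq> error_system_solutions n N a r \<gamma> Ts obs"
    unfolding observer_errors_def using observer_errors_solve_error_system(1) by blast
  obtain \<mu> where \<mu>: "0 < \<mu>" "converge_with_rate (\<alpha> + \<mu>) (error_system_solutions n N a r \<gamma> Ts obs)"
    using error_system_decay by blast
  show "converge_with_rate \<alpha> (error_system_solutions n N a r \<gamma> Ts obs)"
    by (rule converge_with_rate_antimono[OF \<mu>(2)]) (use \<mu> in auto)
  show "omniscient n N A C a r \<gamma> obs"
    by (rule omniscient_if_errors_decay[OF converge_with_rate_antimono[OF \<mu>(2) order_refl sub]])
      (use \<mu>(1) \<alpha> observer_errors_solve_error_system(2) in auto)
  have "state_dim N obs = (\<Sum>i<N. n - p i)"
    unfolding state_dim_def by (rule sum.cong[OF refl]) (use gN_carrier in auto)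
  also have "\<dots> = (\<Sum>i<N. n) - (\<Sum>i<N. p i)" by (rule sum_subtractf_nat) (use dims(1) in auto)
  finally show "state_dim N obs = N * n - (\<Sum>i<N. p i)" by simp
qed

end

text \<open>A vector that \<open>F i\<close> never sees is never seen by
  \<open>C i = D i * F i\<close> either; if this holds at all nodes, the stacked output is
  0.\<close>

lemma jointly_observable:
  assumes A: "A \<in> carrier_mat n n" and C: "\<And>i. i < N \<Longrightarrow> C i \<in> carrier_mat (m i) n"
    and obs: "observable (col_blocks n N C) A"
    and fac: "\<And>i. i < N \<Longrightarrow> full_rank_factorization (m i) n (p i) (C i) (D i) (F i)"
    and w: "w \<in> carrier_vec n" and un: "\<And>i. i < N \<Longrightarrow> w \<in> unobs_space (F i) A"
  shows "w = 0\<^sub>v n"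
proof -
  note cb = col_blocks_carrier[of N C m n, OF C]
  have "col_blocks n N C *\<^sub>v (A ^\<^sub>m k *\<^sub>v w) = 0\<^sub>v (\<Sum>i<N. m i)" for k
  proof -
    have Aw: "A ^\<^sub>m k *\<^sub>v w \<in> carrier_vec n" by (rule pow_mat_mult_vec_carrier[OF A w])
    have "C i *\<^sub>v (A ^\<^sub>m k *\<^sub>v w) = 0\<^sub>v (m i)" if i: "i < N" for i
    proof -
      have f: "D i \<in> carrier_mat (m i) (p i)" "F i \<in> carrier_mat (p i) n" "C i = D i * F i"
        using fac[OF i] unfolding full_rank_factorization_def by auto
      have "F i *\<^sub>v (A ^\<^sub>m k *\<^sub>v w) = 0\<^sub>v (p i)" using un[OF i] unfolding unobs_space_iff[OF A f(2)] by blast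
      then show ?thesis unfolding f(3) assoc_mult_mat_vec[OF f(1,2) Aw] using f(1) by simp
    qed
    then show ?thesis using cb Aw by blast
  qed
  then show ?thesis using obs observable_iff[OF A, of "col_blocks n N C" "\<Sum>i<N. m i"] cb w by blast
qed

text \<open>The quantifiers follow the procedure: every step is solvable for every admissible
  outcome of the earlier ones, and every completed run is correct. The bare existence of an observer
  results from one such run.\<close>

theorem theorem7:
  fixes A a :: "real mat" and C :: "nat \<Rightarrow> real mat"
    and n N :: nat and m p :: "nat \<Rightarrow> nat" and \<alpha> :: real
  assumes "A \<in> carrier_mat n n"
    and "\<And>i. i < N \<Longrightarrow> C i \<in> carrier_mat (m i) n"
    and "observable (col_blocks n N C) A"
    and "weighted_digraph N a"
    and "strongly_connected N a"
    and "0 \<le> \<alpha>"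
    and "\<And>i. i < N \<Longrightarrow> p i = vec_space.rank (m i) (C i)"
  shows
    "(\<exists>!r. laplacian_weights N a r) \<and>
     (\<forall>r. laplacian_weights N a r \<longrightarrow>
       (\<exists>\<gamma> obs. observer_form n N m p obs \<and>
          omniscient n N A C a r \<gamma> obs \<and>
          converge_with_rate \<alpha> (observer_errors n N A C a r \<gamma> obs) \<and>
          state_dim N obs = N * n - (\<Sum>i < N. p i)) \<and>
       (\<forall>i < N. \<exists>D F. full_rank_factorization (m i) n (p i) (C i) D F) \<and>
       (\<forall>D F v.
         (\<forall>i < N. full_rank_factorization (m i) n (p i) (C i) (D i) (F i) \<and>
                  v i = n - subspace_dim n (unobs_space (F i) A)) \<longrightarrow>
         (\<forall>i < N. \<exists>d. obs_decomposition n (p i) (v i) A (F i) d) \<and>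
         (\<forall>d. (\<forall>i < N. obs_decomposition n (p i) (v i) A (F i) (d i)) \<longrightarrow>
           (\<forall>i < N. observable (oE (d i) * o12 (d i)) (o22 (d i))) \<and>
           (\<exists>\<epsilon>. admissible_eps n N v a r (\<lambda>i. 1) d \<epsilon>) \<and>
           (\<forall>\<epsilon>. admissible_eps n N v a r (\<lambda>i. 1) d \<epsilon> \<longrightarrow>
             (\<exists>\<gamma>\<^sub>0. \<forall>\<gamma> \<ge> \<gamma>\<^sub>0. admissible_gamma n N v \<alpha> \<epsilon> d \<gamma>) \<and>
             (\<forall>\<gamma>. admissible_gamma n N v \<alpha> \<epsilon> d \<gamma> \<longrightarrow>
               (\<forall>i < N. \<exists>H. admissible_H (p i) (v i) \<alpha> (d i) H) \<and>
               (\<forall>H. (\<forall>i < N. admissible_H (p i) (v i) \<alpha> (d i) (H i)) \<longrightarrow>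
                 (\<forall>i < N. (\<exists>X. lyapunov_solution (p i) (v i) \<alpha> \<gamma> (d i) (H i) X) \<and>
                    (\<forall>X. lyapunov_solution (p i) (v i) \<alpha> \<gamma> (d i) (H i) X \<longrightarrow> pos_def X)) \<and>
                 (\<forall>X. (\<forall>i < N. lyapunov_solution (p i) (v i) \<alpha> \<gamma> (d i) (H i) (X i)) \<longrightarrow>
                   (let Ts = (\<lambda>i. Ts_mat n (p i) (d i));
                        obs = (\<lambda>i. designed_gains n (p i) (v i) (D i) (d i) (H i) (X i))
                    in observer_form n N m p obs \<and>
                       omniscient n N A C a r \<gamma> obs \<and>
                       observer_errors n N A C a r \<gamma> obs
                         \<subseteq> error_system_solutions n N a r \<gamma> Ts obs \<and>
                       converge_with_rate \<alpha> (error_system_solutions n N a r \<gamma> Ts obs) \<and>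
                       state_dim N obs = N * n - (\<Sum>i < N. p i)))))))))"
proof -
  note A = assms(1) and C = assms(2) and obs = assms(3) and g = assms(4) and sc = assms(5) and \<alpha> = assms(6) and p = assms(7)
  have fac_ex: "\<forall>i < N. \<exists>D F. full_rank_factorization (m i) n (p i) (C i) D F"
    using full_rank_factorization_exists[OF C p] by blast
  have dec_ex: "p i \<le> v i" "v i \<le> n" "\<exists>d. obs_decomposition n (p i) (v i) A (F i) d" "F i \<in> carrier_mat (p i) n"
    if "\<forall>i < N. full_rank_factorization (m i) n (p i) (C i) (D i) (F i) \<and> v i = n - subspace_dim n (unobs_space (F i) A)"
      and i: "i < N" for D F v i
  proof -
    have F: "F i \<in> carrier_mat (p i) n" "vec_space.rank (p i) (F i) = p i" "v i = n - subspace_dim n (unobs_space (F i) A)"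
      using that unfolding full_rank_factorization_def by auto
    show "p i \<le> v i" "v i \<le> n" "\<exists>d. obs_decomposition n (p i) (v i) A (F i) d" "F i \<in> carrier_mat (p i) n"
      using obs_decomposition_exists[OF A F] F(1) by auto
  qed
  have design: "observer_design n N A a r p v F d"
    if r: "laplacian_weights N a r"
      and fv: "\<forall>i < N. full_rank_factorization (m i) n (p i) (C i) (D i) (F i) \<and> v i = n - subspace_dim n (unobs_space (F i) A)"
      and d: "\<forall>i < N. obs_decomposition n (p i) (v i) A (F i) (d i)" for r D F v d
  proof
    fix w assume "w \<in> carrier_vec n" "\<And>i. i < N \<Longrightarrow> w \<in> unobs_space (F i) A"
    then show "w = 0\<^sub>v n" using jointly_observable[OF A C obs, of p D F] fv by blast
  qed (use A g sc r dec_ex[OF fv] d in auto)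
  have gains: "gain_design n N A a r p v F d m C D H X \<alpha> \<gamma> \<epsilon>"
    if r: "laplacian_weights N a r"
      and fv: "\<forall>i < N. full_rank_factorization (m i) n (p i) (C i) (D i) (F i) \<and> v i = n - subspace_dim n (unobs_space (F i) A)"
      and d: "\<forall>i < N. obs_decomposition n (p i) (v i) A (F i) (d i)"
      and e: "admissible_eps n N v a r (\<lambda>i. 1) d \<epsilon>" and ga: "admissible_gamma n N v \<alpha> \<epsilon> d \<gamma>"
      and H: "\<forall>i < N. admissible_H (p i) (v i) \<alpha> (d i) (H i)"
      and X: "\<forall>i < N. lyapunov_solution (p i) (v i) \<alpha> \<gamma> (d i) (H i) (X i)" for r D F v d \<epsilon> \<gamma> H X
    using design[OF r fv d] \<alpha> fv e ga H X by (intro gain_design.intro gain_design_axioms.intro) auto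
  have lyap: "(\<exists>X. lyapunov_solution (p i) (v i) \<alpha> \<gamma> (d i) (H i) X) \<and>
      (\<forall>X. lyapunov_solution (p i) (v i) \<alpha> \<gamma> (d i) (H i) X \<longrightarrow> pos_def X)"
    if od: "observer_design n N A a r p v F d"
      and e: "admissible_eps n N v a r (\<lambda>i. 1) d \<epsilon>" and ga: "admissible_gamma n N v \<alpha> \<epsilon> d \<gamma>"
      and H: "\<forall>i < N. admissible_H (p i) (v i) \<alpha> (d i) (H i)" and i: "i < N" for r v F d \<epsilon> \<gamma> H i
  proof -
    interpret observer_design n N A a r p v F d by (rule od)
    have Hi: "admissible_H (p i) (v i) \<alpha> (d i) (H i)" using H i by blast
    then have "H i \<in> carrier_mat (v i - p i) (p i)" unfolding admissible_H_def by blast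
    then have M: "closed_loop (d i) (H i) \<in> carrier_mat (v i - p i) (v i - p i)"
      by (rule closed_loop_carrier[OF shapes(6,4,1)[OF i]])
    show ?thesis using lyapunov_solution_exists_pos_def[OF M Hi gamma_bound[OF e ga i]] by blast
  qed
  \<comment> \<open>One run of the procedure, with arbitrary choices made at each step.\<close>
  have existence: "\<exists>\<gamma> obs. observer_form n N m p obs \<and> omniscient n N A C a r \<gamma> obs \<and>
      converge_with_rate \<alpha> (observer_errors n N A C a r \<gamma> obs) \<and> state_dim N obs = N * n - (\<Sum>i < N. p i)"
    if r: "laplacian_weights N a r" for r
  proof -
    obtain D F where fac: "\<forall>i < N. full_rank_factorization (m i) n (p i) (C i) (D i) (F i)" using fac_ex by metis
    define v where "v i = n - subspace_dim n (unobs_space (F i) A)" for i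
    have fv: "\<forall>i < N. full_rank_factorization (m i) n (p i) (C i) (D i) (F i) \<and> v i = n - subspace_dim n (unobs_space (F i) A)"
      using fac v_def by simp
    have "\<forall>i < N. \<exists>d. obs_decomposition n (p i) (v i) A (F i) d" using dec_ex(3)[OF fv] by blast
    then obtain d where d: "\<forall>i < N. obs_decomposition n (p i) (v i) A (F i) (d i)" by metis
    interpret observer_design n N A a r p v F d by (rule design[OF r fv d])
    obtain \<epsilon> where e: "admissible_eps n N v a r (\<lambda>i. 1) d \<epsilon>" using admissible_eps_exists by blast
    then have "0 < \<epsilon>" unfolding admissible_eps_def by blast
    then obtain \<gamma> where ga: "admissible_gamma n N v \<alpha> \<epsilon> d \<gamma>" using admissible_gamma_exists[OF _ \<alpha>] by blast
    have "\<forall>i < N. \<exists>H. admissible_H (p i) (v i) \<alpha> (d i) H" using observer_gains_exist(2) by blast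
    then obtain H where H: "\<forall>i < N. admissible_H (p i) (v i) \<alpha> (d i) (H i)" by metis
    have "\<forall>i < N. \<exists>X. lyapunov_solution (p i) (v i) \<alpha> \<gamma> (d i) (H i) X"
      using lyap[OF observer_design_axioms e ga H] by blast
    then obtain X where X: "\<forall>i < N. lyapunov_solution (p i) (v i) \<alpha> \<gamma> (d i) (H i) (X i)" by metis
    interpret gain_design n N A a r p v F d m C D H X \<alpha> \<gamma> \<epsilon> by (rule gains[OF r fv d e ga H X])
    show ?thesis
      using design_correct(1,2,5) converge_with_rate_antimono[OF design_correct(4) order_refl design_correct(3)] by blast
  qed
  show ?thesis
  proof (intro conjI allI impI)
    show "\<exists>!r. laplacian_weights N a r" by (rule laplacian_weights_unique_exists[OF g sc])
  next
    fix r assume "laplacian_weights N a r"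
    then show "\<exists>\<gamma> obs. observer_form n N m p obs \<and> omniscient n N A C a r \<gamma> obs \<and>
      converge_with_rate \<alpha> (observer_errors n N A C a r \<gamma> obs) \<and> state_dim N obs = N * n - (\<Sum>i < N. p i)"
      by (rule existence)
  next
    fix i assume "i < N"
    then show "\<exists>D F. full_rank_factorization (m i) n (p i) (C i) D F" using fac_ex by blast
  next
    fix r D F v i
    assume "\<forall>i < N. full_rank_factorization (m i) n (p i) (C i) (D i) (F i) \<and> v i = n - subspace_dim n (unobs_space (F i) A)"
      and "i < N"
    then show "\<exists>d. obs_decomposition n (p i) (v i) A (F i) d" by (rule dec_ex(3))
  next
    fix r D F v d i
    assume r: "laplacian_weights N a r"
      and fv: "\<forall>i < N. full_rank_factorization (m i) n (p i) (C i) (D i) (F i) \<and> v i = n - subspace_dim n (unobs_space (F i) A)"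
      and d: "\<forall>i < N. obs_decomposition n (p i) (v i) A (F i) (d i)" and i: "i < N"
    show "observable (oE (d i) * o12 (d i)) (o22 (d i))"
      by (rule observer_design.observer_gains_exist(1)[OF design[OF r fv d] i])
  next
    fix r D F v d
    assume r: "laplacian_weights N a r"
      and fv: "\<forall>i < N. full_rank_factorization (m i) n (p i) (C i) (D i) (F i) \<and> v i = n - subspace_dim n (unobs_space (F i) A)"
      and d: "\<forall>i < N. obs_decomposition n (p i) (v i) A (F i) (d i)"
    show "\<exists>\<epsilon>. admissible_eps n N v a r (\<lambda>i. 1) d \<epsilon>"
      by (rule observer_design.admissible_eps_exists[OF design[OF r fv d]])
  next
    fix r D F v d \<epsilon>
    assume r: "laplacian_weights N a r"
      and fv: "\<forall>i < N. full_rank_factorization (m i) n (p i) (C i) (D i) (F i) \<and> v i = n - subspace_dim n (unobs_space (F i) A)"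
      and d: "\<forall>i < N. obs_decomposition n (p i) (v i) A (F i) (d i)" and e: "admissible_eps n N v a r (\<lambda>i. 1) d \<epsilon>"
    have "0 < \<epsilon>" using e unfolding admissible_eps_def by blast
    then show "\<exists>\<gamma>\<^sub>0. \<forall>\<gamma> \<ge> \<gamma>\<^sub>0. admissible_gamma n N v \<alpha> \<epsilon> d \<gamma>"
      by (rule observer_design.admissible_gamma_exists[OF design[OF r fv d] _ \<alpha>])
  next
    fix r D F v d i
    assume r: "laplacian_weights N a r"
      and fv: "\<forall>i < N. full_rank_factorization (m i) n (p i) (C i) (D i) (F i) \<and> v i = n - subspace_dim n (unobs_space (F i) A)"
      and d: "\<forall>i < N. obs_decomposition n (p i) (v i) A (F i) (d i)" and i: "i < N"
    show "\<exists>H. admissible_H (p i) (v i) \<alpha> (d i) H"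
      by (rule observer_design.observer_gains_exist(2)[OF design[OF r fv d] i])
  next
    fix r D F v d \<epsilon> \<gamma> H i
    assume r: "laplacian_weights N a r"
      and fv: "\<forall>i < N. full_rank_factorization (m i) n (p i) (C i) (D i) (F i) \<and> v i = n - subspace_dim n (unobs_space (F i) A)"
      and d: "\<forall>i < N. obs_decomposition n (p i) (v i) A (F i) (d i)" and e: "admissible_eps n N v a r (\<lambda>i. 1) d \<epsilon>"
      and ga: "admissible_gamma n N v \<alpha> \<epsilon> d \<gamma>" and H: "\<forall>i < N. admissible_H (p i) (v i) \<alpha> (d i) (H i)" and i: "i < N"
    show "\<exists>X. lyapunov_solution (p i) (v i) \<alpha> \<gamma> (d i) (H i) X"
      using lyap[OF design[OF r fv d] e ga H i] by blast
  next
    fix r D F v d \<epsilon> \<gamma> H i X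
    assume r: "laplacian_weights N a r"
      and fv: "\<forall>i < N. full_rank_factorization (m i) n (p i) (C i) (D i) (F i) \<and> v i = n - subspace_dim n (unobs_space (F i) A)"
      and d: "\<forall>i < N. obs_decomposition n (p i) (v i) A (F i) (d i)" and e: "admissible_eps n N v a r (\<lambda>i. 1) d \<epsilon>"
      and ga: "admissible_gamma n N v \<alpha> \<epsilon> d \<gamma>" and H: "\<forall>i < N. admissible_H (p i) (v i) \<alpha> (d i) (H i)" and i: "i < N"
      and X: "lyapunov_solution (p i) (v i) \<alpha> \<gamma> (d i) (H i) X"
    show "pos_def X" using lyap[OF design[OF r fv d] e ga H i] X by blast
  next
    fix r D F v d \<epsilon> \<gamma> H X
    assume r: "laplacian_weights N a r"
      and fv: "\<forall>i < N. full_rank_factorization (m i) n (p i) (C i) (D i) (F i) \<and> v i = n - subspace_dim n (unobs_space (F i) A)"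
      and d: "\<forall>i < N. obs_decomposition n (p i) (v i) A (F i) (d i)" and e: "admissible_eps n N v a r (\<lambda>i. 1) d \<epsilon>"
      and ga: "admissible_gamma n N v \<alpha> \<epsilon> d \<gamma>" and H: "\<forall>i < N. admissible_H (p i) (v i) \<alpha> (d i) (H i)"
      and X: "\<forall>i < N. lyapunov_solution (p i) (v i) \<alpha> \<gamma> (d i) (H i) (X i)"
    interpret gain_design n N A a r p v F d m C D H X \<alpha> \<gamma> \<epsilon> by (rule gains[OF r fv d e ga H X])
    show "let Ts = (\<lambda>i. Ts_mat n (p i) (d i));
              obs = (\<lambda>i. designed_gains n (p i) (v i) (D i) (d i) (H i) (X i))
          in observer_form n N m p obs \<and>
             omniscient n N A C a r \<gamma> obs \<and>
             observer_errors n N A C a r \<gamma> obs \<subseteq> error_system_solutions n N a r \<gamma> Ts obs \<and>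
             converge_with_rate \<alpha> (error_system_solutions n N a r \<gamma> Ts obs) \<and>
             state_dim N obs = N * n - (\<Sum>i < N. p i)"
      unfolding Let_def using design_correct by blast
  qed
qed

end
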